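(* There is an algorithm which, given a $\{P_7,C_3\}$-free graph $G$, decides in $O(|V(G)|^5(|V(G)|+|E(G)|))$ time whether $G$ admits a 3-coloring. If a 3-coloring exists, it can be computed in the same time.
   Context: All graphs are finite, simple, loopless and undirected. $P_t$ denotes the path on $t$ vertices and $C_\ell$ the cycle on $\ell$ vertices. For a set $\mathcal H$ of graphs, a graph $G$ is $\mathcal H$-free if no member of $\mathcal H$ is (isomorphic to) an induced subgraph of $G$. A coloring of $G$ is a function $f:V(G)\to\mathbb N$ (colors being positive integers) with $f(v)\neq f(w)$ for every edge $vw$; a 3-coloring is a coloring with values in $\{1,2,3\}$. *)

theory Defs
  imports Main
begin

subsection \<open>Graphs\<close>

record 'a graph =
  verts :: "'a set"
  edges :: "'a set set"

definition simple_graph :: "'a graph \<Rightarrow> bool" where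
  "simple_graph G \<longleftrightarrow> finite (verts G) \<and> (\<forall>e\<in>edges G. e \<subseteq> verts G \<and> card e = 2)"

definition path_graph :: "nat \<Rightarrow> nat graph" where
  "path_graph t = \<lparr>verts = {..<t}, edges = {{i, Suc i} | i. Suc i < t}\<rparr>"

text \<open>Only meaningful for \<open>l \<ge> 3\<close>.\<close>

definition cycle_graph :: "nat \<Rightarrow> nat graph" where
  "cycle_graph l = \<lparr>verts = {..<l}, edges = {{i, Suc i mod l} | i. i < l}\<rparr>"

definition induced_subgraph :: "'a graph \<Rightarrow> 'a set \<Rightarrow> 'a graph" where
  "induced_subgraph G W = \<lparr>verts = W, edges = {e \<in> edges G. e \<subseteq> W}\<rparr>"

definition isomorphic :: "'a graph \<Rightarrow> 'b graph \<Rightarrow> bool" where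
  "isomorphic G H \<longleftrightarrow> (\<exists>f. bij_betw f (verts G) (verts H) \<and>
     (\<forall>u\<in>verts G. \<forall>v\<in>verts G. {u, v} \<in> edges G \<longleftrightarrow> {f u, f v} \<in> edges H))"

definition H_free :: "'b graph set \<Rightarrow> 'a graph \<Rightarrow> bool" where
  "H_free \<H> G \<longleftrightarrow>
     (\<forall>H\<in>\<H>. \<not> (\<exists>W\<subseteq>verts G. isomorphic H (induced_subgraph G W)))"

definition coloring :: "'a graph \<Rightarrow> ('a \<Rightarrow> nat) \<Rightarrow> bool" where
  "coloring G f \<longleftrightarrow> (\<forall>v\<in>verts G. f v > 0) \<and>
     (\<forall>v\<in>verts G. \<forall>w\<in>verts G. {v, w} \<in> edges G \<longrightarrow> f v \<noteq> f w)"

definition three_coloring :: "'a graph \<Rightarrow> ('a \<Rightarrow> nat) \<Rightarrow> bool" where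
  "three_coloring G f \<longleftrightarrow> coloring G f \<and> f ` verts G \<subseteq> {1, 2, 3}"


subsection \<open>Algorithms: a random access machine with bounded words\<close>

text \<open>
  An algorithm is a (finite, input-independent) program for a word RAM. The machine has registers
  and an indirectly addressable memory, both indexed by and containing natural numbers. Every
  instruction and every evaluation of a test takes one unit of time.
\<close>

datatype operand = Const nat | Reg nat

datatype binop = Plus | Minus | Times | Div

datatype test = Less operand operand | Equal operand operand

datatype program =
    Skip
  | Move nat operand
  | Arith nat binop operand operand
  | Load nat operand
  | Store operand operand
  | Seq program program
  | Cond test program program
  | While test program

record state =
  reg :: "nat \<Rightarrow> nat"
  mem :: "nat \<Rightarrow> nat"

fun val :: "state \<Rightarrow> operand \<Rightarrow> nat" where
  "val s (Const k) = k"
| "val s (Reg r) = reg s r"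

text \<open>Subtraction is truncated at 0, and division by 0 yields 0.\<close>

fun arith :: "binop \<Rightarrow> nat \<Rightarrow> nat \<Rightarrow> nat" where
  "arith Plus a b = a + b"
| "arith Minus a b = a - b"
| "arith Times a b = a * b"
| "arith Div a b = a div b"

fun holds :: "state \<Rightarrow> test \<Rightarrow> bool" where
  "holds s (Less a b) \<longleftrightarrow> val s a < val s b"
| "holds s (Equal a b) \<longleftrightarrow> val s a = val s b"

text \<open>
  \<open>exec M p s t s'\<close>: with words ranging over \<open>{..<M}\<close>, program \<open>p\<close> started in \<open>s\<close> halts in \<open>s'\<close>
  after exactly \<open>t\<close> steps. An attempt to write a value, or to access an address, that does not
  fit into a word gets stuck: such a computation has no result.
\<close>

inductive exec :: "nat \<Rightarrow> program \<Rightarrow> state \<Rightarrow> nat \<Rightarrow> state \<Rightarrow> bool" for M :: nat where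
  Skip: "exec M Skip s 1 s"
| Move: "val s a < M \<Longrightarrow> exec M (Move r a) s 1 (s\<lparr>reg := (reg s)(r := val s a)\<rparr>)"
| Arith: "arith f (val s a) (val s b) < M \<Longrightarrow>
    exec M (Arith r f a b) s 1 (s\<lparr>reg := (reg s)(r := arith f (val s a) (val s b))\<rparr>)"
| Load: "val s a < M \<Longrightarrow> mem s (val s a) < M \<Longrightarrow>
    exec M (Load r a) s 1 (s\<lparr>reg := (reg s)(r := mem s (val s a))\<rparr>)"
| Store: "val s a < M \<Longrightarrow> val s b < M \<Longrightarrow>
    exec M (Store a b) s 1 (s\<lparr>mem := (mem s)(val s a := val s b)\<rparr>)"
| Seq: "exec M p s t s' \<Longrightarrow> exec M q s' t' s'' \<Longrightarrow> exec M (Seq p q) s (t + t') s''"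
| CondTrue: "holds s b \<Longrightarrow> exec M p s t s' \<Longrightarrow> exec M (Cond b p q) s (1 + t) s'"
| CondFalse: "\<not> holds s b \<Longrightarrow> exec M q s t s' \<Longrightarrow> exec M (Cond b p q) s (1 + t) s'"
| WhileFalse: "\<not> holds s b \<Longrightarrow> exec M (While b p) s 1 s"
| WhileTrue: "holds s b \<Longrightarrow> exec M p s t s' \<Longrightarrow> exec M (While b p) s' t' s'' \<Longrightarrow>
    exec M (While b p) s (1 + t + t') s''"

inductive_cases exec_SkipE: "exec M Skip s t s'"
inductive_cases exec_MoveE: "exec M (Move r a) s t s'"
inductive_cases exec_ArithE: "exec M (Arith r f a b) s t s'"
inductive_cases exec_LoadE: "exec M (Load r a) s t s'"
inductive_cases exec_StoreE: "exec M (Store a b) s t s'"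
inductive_cases exec_SeqE: "exec M (Seq p q) s t s'"
inductive_cases exec_CondE: "exec M (Cond b p q) s t s'"
inductive_cases exec_WhileE: "exec M (While b p) s t s'"

lemma exec_deterministic:
  "exec M p s t s' \<Longrightarrow> exec M p s u s'' \<Longrightarrow> t = u \<and> s' = s''"
proof (induction arbitrary: u s'' rule: exec.induct)
  case (Seq p s t s1 q t' s2)
  from Seq.prems obtain a b s3 where "u = a + b" "exec M p s a s3" "exec M q s3 b s''"
    by (rule exec_SeqE)
  with Seq.IH show ?case by metis
next
  case (CondTrue s b p t s1 q)
  from CondTrue.prems CondTrue.hyps obtain a where "u = 1 + a" "exec M p s a s''"
    by (auto elim: exec_CondE)
  with CondTrue.IH show ?case by metis
next
  case (CondFalse s b q t s1 p)
  from CondFalse.prems CondFalse.hyps obtain a where "u = 1 + a" "exec M q s a s''"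
    by (auto elim: exec_CondE)
  with CondFalse.IH show ?case by metis
next
  case (WhileFalse s b p)
  from WhileFalse.prems show ?case
    by (rule exec_WhileE) (use WhileFalse.hyps in simp_all)
next
  case (WhileTrue s b p t s1 t' s2)
  from WhileTrue.prems obtain a c s3
    where "u = 1 + a + c" "exec M p s a s3" "exec M (While b p) s3 c s''"
    by (rule exec_WhileE) (use WhileTrue.hyps in simp_all)
  with WhileTrue.IH show ?case by metis
qed (erule exec_SkipE exec_MoveE exec_ArithE exec_LoadE exec_StoreE; simp)+

text \<open>The input is placed at the addresses \<open>0, 1, 2, \<dots>\<close>; everything else is zero.\<close>

definition initial_state :: "nat list \<Rightarrow> state" where
  "initial_state xs =
     \<lparr>reg = (\<lambda>_. 0), mem = (\<lambda>i. if i < length xs then xs ! i else 0)\<rparr>"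

text \<open>
  A graph with vertex set \<open>{0, \<dots>, n - 1}\<close> and \<open>m\<close> edges is presented as the word
  \<open>n, m, u\<^sub>1, v\<^sub>1, \<dots>, u\<^sub>m, v\<^sub>m\<close>, where the edges \<open>u\<^sub>iv\<^sub>i\<close> are listed without repetition, in any
  order and with their ends in any order.
\<close>

definition encodes :: "nat list \<Rightarrow> nat graph \<Rightarrow> bool" where
  "encodes xs G \<longleftrightarrow> (\<exists>n es.
     verts G = {..<n} \<and>
     edges G = set (map (\<lambda>(u, v). {u, v}) es) \<and>
     distinct (map (\<lambda>(u, v). {u, v}) es) \<and>
     xs = n # length es # concat (map (\<lambda>(u, v). [u, v]) es))"

end

theory Submission
  imports Defs
begin

text \<open>
  Colours are 0, 1, 2; only the output shifts them to 1, 2, 3. The components of the graph are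
  coloured one after the other, so let the graph be connected.

  If it has no five-cycle, it is 3-colourable outright: fix a vertex r, give its neighbours colour 2
  and use 0 and 1 elsewhere. Otherwise the vertices outside N(r) would span an odd cycle. A shortest
  one has length seven, because longer ones contain an induced path on seven vertices, and a
  seven-cycle dominates the graph (\<open>seven_cycle_dominates\<close>), so r would have a neighbour on it
  (\<open>no_five_cycle_colouring\<close>).

  If it has a five-cycle, it has one whose non-neighbours are pairwise non-adjacent
  (\<open>ex_good_cycle\<close>): while two non-neighbours are adjacent, some vertex b next to such an edge has two
  neighbours at distance two on the cycle, and exchanging the vertex between them for b destroys
  edges of this kind and creates none. Up to rotation and renaming of colours, a 3-colouring uses
  0, 1, 2, 1, 2 along the cycle. Four further vertices are guessed together with their colours, and
  the consequences of the guess are propagated through lists of admissible colours. A vertex that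
  keeps all three colours is not adjacent to the cycle, and its neighbours have two colours left; a
  local rule (\<open>trim\<close>) then takes a colour away from it. If the guess is extremal in the right sense,
  this does not destroy colourability (\<open>trim_guess\<close>). The reason is that the full-list vertices are
  pairwise non-adjacent, so that each of them can be recoloured alone, and that a vertex at which the
  rule is wrong would yield an induced path on seven vertices or contradict extremality. What remains
  is a problem with lists of size at most two, solved by fixing one vertex after the other and keeping
  the first colour whose propagation meets no conflict; there is no need to revise earlier choices
  (\<open>two_list_step\<close>).

  Finding the cycle takes n^5 tuples with one pass over the edges each; there are 10 n^4 guesses, each
  evaluated in time n (n + m). Fifth powers are superadditive, so the bound survives the sum over the
  components.

  The algorithm is a program of a small language with variables and arrays that is compiled to the
  machine. Its specification is a weakest precondition that carries the elapsed time; the lemma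
  on a part of the program bounds its time, describes its result, and says by \<open>keep\<close> what it
  leaves unchanged.
  Soundness of the calculus (\<open>wp_sound\<close>) transfers the bound to the machine.
\<close>

section \<open>Triangle-free graphs without induced paths on seven vertices\<close>

text \<open>
  The edge relation instead of a set of edges makes seven-vertex paths a matter of 21 adjacency
  facts. Distinctness of the seven vertices follows from the non-adjacencies.
\<close>

locale p7_graph =
  fixes E :: "'a \<Rightarrow> 'a \<Rightarrow> bool" and V :: "'a set"
  assumes fin: "finite V"
    and dom: "E u v \<Longrightarrow> u \<in> V"
    and sym: "E u v \<Longrightarrow> E v u"
    and tri: "E u v \<Longrightarrow> E v w \<Longrightarrow> E u w \<Longrightarrow> False"
    and p7: "E a b \<Longrightarrow> E b c \<Longrightarrow> E c d \<Longrightarrow> E d e \<Longrightarrow> E e f \<Longrightarrow> E f g \<Longrightarrow>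
      \<not> E a c \<Longrightarrow> \<not> E a d \<Longrightarrow> \<not> E a e \<Longrightarrow> \<not> E a f \<Longrightarrow> \<not> E a g \<Longrightarrow>
      \<not> E b d \<Longrightarrow> \<not> E b e \<Longrightarrow> \<not> E b f \<Longrightarrow> \<not> E b g \<Longrightarrow>
      \<not> E c e \<Longrightarrow> \<not> E c f \<Longrightarrow> \<not> E c g \<Longrightarrow> \<not> E d f \<Longrightarrow> \<not> E d g \<Longrightarrow> \<not> E e g \<Longrightarrow> False"
begin

lemma sym_iff: "E u v \<longleftrightarrow> E v u"
  using sym by blast

lemma irrefl: "\<not> E u u"
  using tri by blast

definition proper :: "('a \<Rightarrow> nat) \<Rightarrow> bool" where
  "proper f \<longleftrightarrow> (\<forall>v\<in>V. f v < 3) \<and> (\<forall>u v. E u v \<longrightarrow> f u \<noteq> f v)"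

text \<open>
  The lists are stable under propagation: a vertex whose colour is decided excludes it at its
  neighbours.
\<close>

definition closed_lists :: "('a \<Rightarrow> nat set) \<Rightarrow> bool" where
  "closed_lists L \<longleftrightarrow> (\<forall>u v. E u v \<longrightarrow> card (L u) = 1 \<longrightarrow> L u \<inter> L v = {})"

definition misses :: "('a \<Rightarrow> nat set) \<Rightarrow> 'a \<Rightarrow> nat \<Rightarrow> bool" where
  "misses L v c \<longleftrightarrow> (\<exists>w. E v w \<and> c \<notin> L w)"

text \<open>
  If all neighbours lack the same colour, that colour is free, and the rule keeps it. Otherwise one
  colour is given up, and which one depends on whether 0 is missing at some neighbour. The asymmetry
  comes from the five-cycle, on which 0 is the colour that occurs once.
\<close>

definition trim :: "('a \<Rightarrow> nat set) \<Rightarrow> 'a \<Rightarrow> nat set" where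
  "trim L v = (if card (L v) = 3 then
     (if misses L v 0 then (if misses L v 1 \<or> misses L v 2 then {1, 2} else {0})
      else (if misses L v 2 then {0, 2} else {1})) else L v)"

end

locale five_cycle = p7_graph +
  fixes c0 c1 c2 c3 c4 :: 'a
  assumes cyc: "E c0 c1" "E c1 c2" "E c2 c3" "E c3 c4" "E c4 c0"
begin

lemma cyc': "E c1 c0" "E c2 c1" "E c3 c2" "E c4 c3" "E c0 c4"
  using cyc sym by blast+

lemma chords: "\<not> E c0 c2" "\<not> E c1 c3" "\<not> E c2 c4" "\<not> E c3 c0" "\<not> E c4 c1"
    "\<not> E c2 c0" "\<not> E c3 c1" "\<not> E c4 c2" "\<not> E c0 c3" "\<not> E c1 c4"
  using cyc cyc' tri by blast+

definition near :: "'a \<Rightarrow> bool" where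
  "near u \<longleftrightarrow> E c0 u \<or> E c1 u \<or> E c2 u \<or> E c3 u \<or> E c4 u"

lemma far: assumes "\<not> near x"
  shows "\<not> E c0 x" "\<not> E c1 x" "\<not> E c2 x" "\<not> E c3 x" "\<not> E c4 x"
    "\<not> E x c0" "\<not> E x c1" "\<not> E x c2" "\<not> E x c3" "\<not> E x c4"
  using assms unfolding near_def by (auto simp: sym_iff)

lemma near_cyc: "near c0" "near c1" "near c2" "near c3" "near c4"
  using cyc cyc' unfolding near_def by auto

end

text \<open>
  The vertices without a neighbour on the cycle form an independent set.
\<close>

locale good_cycle = five_cycle +
  assumes stable: "E u v \<Longrightarrow> near u \<or> near v"
begin

text \<open>
  Once the cycle is coloured 0, 1, 2, 1, 2, a vertex with a neighbour on it that still has two colours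
  is of one of these three kinds: it misses 0 in the first, 1 in the second and 2 in the third.
\<close>

definition clsA :: "'a \<Rightarrow> bool" where
  "clsA v \<longleftrightarrow> E c0 v \<and> \<not> E c1 v \<and> \<not> E c2 v \<and> \<not> E c3 v \<and> \<not> E c4 v"
definition clsU :: "'a \<Rightarrow> bool" where
  "clsU v \<longleftrightarrow> (E c1 v \<or> E c3 v) \<and> \<not> E c0 v \<and> \<not> E c2 v \<and> \<not> E c4 v"
definition clsW :: "'a \<Rightarrow> bool" where
  "clsW v \<longleftrightarrow> (E c2 v \<or> E c4 v) \<and> \<not> E c0 v \<and> \<not> E c1 v \<and> \<not> E c3 v"

text \<open>
  The two stars at \<open>x\<close> and \<open>x'\<close> would be joined through the cycle to an induced path on seven
  vertices, or the path \<open>v x a0\<close> would be extended by four vertices of the cycle.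
\<close>

lemma path_A_UW:
  assumes x: "\<not> near x" "E x v" "E x a0" "clsA a0" "clsU v \<or> clsW v"
    and x': "\<not> near x'" "E x' a" "clsA a"
    and n: "\<not> E x a" "\<not> E x' v" "\<not> E v a"
  shows False
proof -
  note F = far[OF x(1)] far[OF x'(1)]
  have xx: "\<not> E x x'" using stable x x' by blast
  have va0: "\<not> E v a0" using x tri sym by blast
  consider "E c3 v" "\<not> E c4 v" "\<not> E c0 v" | "E c2 v" "\<not> E c1 v" "\<not> E c0 v"
    | "E c1 v" "\<not> E c0 v" "\<not> E c2 v" "\<not> E c3 v" "\<not> E c4 v"
    | "E c4 v" "\<not> E c0 v" "\<not> E c2 v" "\<not> E c3 v" "\<not> E c1 v"
    using x(5) unfolding clsU_def clsW_def by blast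
  then show False
  proof cases
    case 1
    show False
      by (rule p7[of x v c3 c4 c0 a x'])
        (use 1 x x' n F xx chords cyc cyc' in \<open>auto simp: clsA_def sym_iff\<close>)
  next
    case 2
    show False
      by (rule p7[of x v c2 c1 c0 a x'])
        (use 2 x x' n F xx chords cyc cyc' in \<open>auto simp: clsA_def sym_iff\<close>)
  next
    case 3
    show False
      by (rule p7[of v x a0 c0 c4 c3 c2])
        (use 3 x x' n F xx va0 chords cyc cyc' in \<open>auto simp: clsA_def sym_iff\<close>)
  next
    case 4
    show False
      by (rule p7[of v x a0 c0 c1 c2 c3])
        (use 4 x x' n F xx va0 chords cyc cyc' in \<open>auto simp: clsA_def sym_iff\<close>)
  qed
qed

text \<open>
  An exchange between neighbourhoods in the second and third class: if \<open>x\<close> and \<open>x'\<close> each see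
  one of the two neighbours of \<open>y\<close>, then a path through the cycle or through \<open>y\<close> has seven vertices.
\<close>

lemma nested_U_W:
  assumes y: "\<not> near y" "E y u" "E y w" and cl: "clsU u" "clsW w"
    and x: "\<not> near x" "E x w" "\<not> E x u" and x': "\<not> near x'" "E x' u" "\<not> E x' w"
  shows False
proof -
  note F = far[OF x(1)] far[OF x'(1)] far[OF y(1)]
  have s: "\<not> E x x'" "\<not> E x y" "\<not> E x' y" using stable x x' y by blast+
  have uw: "\<not> E u w" using y tri sym by blast
  show False
  proof (cases "E c1 u"; cases "E c4 w")
    assume "E c1 u" "E c4 w"
    then show False
      by (intro p7[of x' u c1 c0 c4 w x])
        (use x x' y F s uw chords cyc cyc' cl in \<open>auto simp: clsU_def clsW_def sym_iff\<close>)
  next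
    assume "E c1 u" "\<not> E c4 w"
    then show False
      by (intro p7[of x w y u c1 c0 c4])
        (use x x' y F s uw chords cyc cyc' cl in \<open>auto simp: clsU_def clsW_def sym_iff\<close>)
  next
    assume "\<not> E c1 u" "E c4 w"
    then show False
      by (intro p7[of x' u y w c4 c0 c1])
        (use x x' y F s uw chords cyc cyc' cl in \<open>auto simp: clsU_def clsW_def sym_iff\<close>)
  next
    assume "\<not> E c1 u" "\<not> E c4 w"
    then show False
      by (intro p7[of w y u c3 c4 c0 c1])
        (use x x' y F s uw chords cyc cyc' cl in \<open>auto simp: clsU_def clsW_def sym_iff\<close>)
  qed
qed

text \<open>
  Two far vertices with private neighbours in the second and in the third class are linked by
  the cycle to an induced path on seven vertices.
\<close>

lemma path_UW_WU:
  assumes x: "\<not> near x" "E x u" "E x w" "clsU u" "clsW w"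
    and x': "\<not> near x'" "E x' u'" "E x' w'" "clsU u'" "clsW w'"
    and n: "\<not> E x u'" "\<not> E x w'" "\<not> E x' u" "\<not> E x' w" "\<not> E u u'" "\<not> E w w'"
      "\<not> E u w'" "\<not> E u' w"
  shows False
proof -
  note F = far[OF x(1)] far[OF x'(1)]
  have s: "\<not> E x x'" using stable x x' by blast
  have uw: "\<not> E u w" "\<not> E u' w'" using x x' tri sym by blast+
  consider "E c2 w" "E c2 w'" | "E c4 w" "E c4 w'"
    | "E c2 w" "E c4 w'" "\<not> E c4 w" "\<not> E c2 w'" | "E c4 w" "E c2 w'" "\<not> E c2 w" "\<not> E c4 w'"
    using x x' unfolding clsW_def by blast
  then show False
  proof cases
    case 1
    show False
      by (rule p7[of u x w c2 w' x' u'])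
        (use 1 x x' n F s uw chords cyc cyc' in \<open>auto simp: clsU_def clsW_def sym_iff\<close>)
  next
    case 2
    show False
      by (rule p7[of u x w c4 w' x' u'])
        (use 2 x x' n F s uw chords cyc cyc' in \<open>auto simp: clsU_def clsW_def sym_iff\<close>)
  next
    case 3
    show False
      by (rule p7[of x w c2 c3 c4 w' x'])
        (use 3 x x' n F s uw chords cyc cyc' in \<open>auto simp: clsU_def clsW_def sym_iff\<close>)
  next
    case 4
    show False
      by (rule p7[of x w c4 c3 c2 w' x'])
        (use 4 x x' n F s uw chords cyc cyc' in \<open>auto simp: clsU_def clsW_def sym_iff\<close>)
  qed
qed

end

section \<open>An extremal guess leaves two colours at every vertex\<close>

lemma two_colours:
  fixes X :: "nat set"
  assumes "X \<subseteq> {0, 1, 2}" "X \<noteq> {}" "\<And>d. X \<noteq> {d}" "0 \<notin> X \<or> 1 \<notin> X \<or> 2 \<notin> X"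
  shows "X = {1, 2} \<or> X = {0, 2} \<or> X = {0, 1}"
proof -
  have n: "\<not> X \<subseteq> {d}" for d using assms(2,3) subset_singletonD by metis
  consider "0 \<notin> X" | "1 \<notin> X" | "2 \<notin> X" using assms(4) by blast
  then show ?thesis
  proof cases
    case 1
    then have "1 \<in> X" "2 \<in> X" using n[of 1] n[of 2] assms(1) by auto
    then have "X = {1, 2}" using 1 assms(1) by auto
    then show ?thesis by simp
  next
    case 2
    then have "0 \<in> X" "2 \<in> X" using n[of 0] n[of 2] assms(1) by auto
    then have "X = {0, 2}" using 2 assms(1) by auto
    then show ?thesis by simp
  next
    case 3
    then have "0 \<in> X" "1 \<in> X" using n[of 0] n[of 1] assms(1) by auto
    then have "X = {0, 1}" using 3 assms(1) by auto
    then show ?thesis by simp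
  qed
qed

text \<open>
  The hypotheses tie the class of a vertex to its list of two colours.
\<close>

lemma class_of_list:
  assumes "(A w \<and> L w = {1, 2}) \<or> (U w \<and> L w = {0, 2}) \<or> (W w \<and> L w = {0, 1::nat})"
    and "\<not> (A w \<and> U w)" "\<not> (A w \<and> W w)" "\<not> (U w \<and> W w)"
  shows "0 \<notin> L w \<longleftrightarrow> A w" "1 \<notin> L w \<longleftrightarrow> U w" "2 \<notin> L w \<longleftrightarrow> W w"
  using assms by (elim disjE; simp; fail)+

lemma ex_card_min:
  fixes g :: "'b \<Rightarrow> nat"
  assumes "x \<in> S"
  shows "\<exists>y\<in>S. \<forall>z\<in>S. g y \<le> g z"
  using assms ex_has_least_nat[of "\<lambda>x. x \<in> S" x g] by auto

lemma ex_card_max: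
  fixes g :: "'b \<Rightarrow> nat"
  assumes "x \<in> S" "finite S"
  shows "\<exists>y\<in>S. \<forall>z\<in>S. g z \<le> g y"
proof -
  have "Max (g ` S) \<in> g ` S" using assms by (intro Max_in) auto
  then obtain y where y: "y \<in> S" "g y = Max (g ` S)" by auto
  have "g z \<le> g y" if "z \<in> S" for z
    using that y assms(2) by (metis Max_ge finite_imageI imageI)
  then show ?thesis using y by blast
qed

text \<open>
  The lists that arise from guessing the colours of \<open>S\<close> along \<open>f\<close>: nothing that \<open>f\<close> uses has been
  discarded.
\<close>

definition (in p7_graph) seeded :: "('a \<Rightarrow> nat) \<Rightarrow> ('a \<Rightarrow> nat set) \<Rightarrow> 'a set \<Rightarrow> bool" where
  "seeded f L S \<longleftrightarrow> (\<forall>v\<in>V. f v \<in> L v \<and> L v \<subseteq> {0, 1, 2}) \<and> (\<forall>v\<in>S. L v = {f v})"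

context good_cycle begin

lemma cls_disjoint: "clsA v \<Longrightarrow> \<not> clsU v" "clsA v \<Longrightarrow> \<not> clsW v" "clsU v \<Longrightarrow> \<not> clsW v"
  unfolding clsA_def clsU_def clsW_def by blast+

lemma finite_nbrs: "finite {u. E x u \<and> P u}"
  by (rule finite_subset[OF _ fin]) (use dom sym in blast)

text \<open>
  A vertex \<open>x0\<close> with the fewest neighbours in class A, and any such neighbour \<open>a0\<close>. If another
  \<open>x\<close> were related to the guess in none of the ways listed, \<open>path_A_UW\<close> would put all its neighbours in
  class A below those of \<open>x0\<close>, hence \<open>a0\<close> among them by minimality.
\<close>

lemma ex_A_guess:
  assumes x: "x1 \<in> X"
    and X: "\<And>x. x \<in> X \<Longrightarrow> \<not> near x \<and> (\<exists>a. E x a \<and> clsA a) \<and> (\<exists>v. E x v \<and> (clsU v \<or> clsW v))"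
  shows "\<exists>x0\<in>X. \<exists>a0. E x0 a0 \<and> clsA a0 \<and> (\<forall>x\<in>X. E x a0 \<or>
    (\<exists>v. E x0 v \<and> (clsU v \<or> clsW v) \<and> (E x v \<or> (\<exists>a. E x a \<and> clsA a \<and> E v a))))"
proof -
  let ?N = "\<lambda>x. {a. E x a \<and> clsA a}"
  obtain x0 where x0: "x0 \<in> X" "\<And>x. x \<in> X \<Longrightarrow> card (?N x0) \<le> card (?N x)"
    using ex_card_min[OF x, of "\<lambda>x. card (?N x)"] by blast
  obtain a0 v where a0: "E x0 a0" "clsA a0" and v: "E x0 v" "clsU v \<or> clsW v" "\<not> near x0"
    using X[OF x0(1)] by blast
  have "E x a0 \<or> (\<exists>v. E x0 v \<and> (clsU v \<or> clsW v) \<and> (E x v \<or> (\<exists>a. E x a \<and> clsA a \<and> E v a)))"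
    if xX: "x \<in> X" for x
  proof (rule ccontr)
    assume no: "\<not> ?thesis"
    have "?N x \<subseteq> ?N x0"
    proof
      fix a assume a: "a \<in> ?N x"
      show "a \<in> ?N x0"
      proof (rule ccontr)
        assume "a \<notin> ?N x0"
        then show False
          using path_A_UW[of x0 v a0 x a] v a0 a no X[OF xX] by blast
      qed
    qed
    then have "?N x = ?N x0"
      using x0(2)[OF xX] finite_nbrs[of x0 clsA] by (metis card_subset_eq card_mono le_antisym)
    then show False using a0 no by blast
  qed
  then show ?thesis using x0 a0 by blast
qed

text \<open>
  The analogue for the second and third class. Minimality of the set N of neighbours of
  colour 2 alone does not suffice; among the minimal vertices the one that forces most vertices through
  its neighbours in the third class is taken.
\<close>

lemma ex_UW_guess:
  assumes x: "x1 \<in> X"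
    and X: "\<And>x. x \<in> X \<Longrightarrow> \<not> near x \<and> f x = 1 \<and> (\<exists>u. E x u \<and> clsU u \<and> f u = 2) \<and> (\<exists>w. E x w \<and> clsW w)"
    and f: "\<And>u v. E u v \<Longrightarrow> f u \<noteq> f v"
    and fU: "\<And>u. clsU u \<Longrightarrow> f u = 0 \<or> f u = 2" and fW: "\<And>w. clsW w \<Longrightarrow> f w = 0 \<or> f w = (1::nat)"
  shows "\<exists>x0\<in>X. \<exists>u0. E x0 u0 \<and> clsU u0 \<and> f u0 = 2 \<and> (\<forall>x\<in>X. E x u0 \<or>
    (\<exists>w. E x0 w \<and> clsW w \<and> (E x w \<or> (\<exists>u. E x u \<and> clsU u \<and> E w u))))"
proof -
  define N where "N x = {u. E x u \<and> clsU u \<and> f u = 2}" for x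
  define H where "H x = {v. clsU v \<and> (\<exists>w. E x w \<and> clsW w \<and> E w v)}" for x
  define arrow where "arrow x x' \<longleftrightarrow>
    (\<exists>w. E x w \<and> clsW w \<and> (E x' w \<or> (\<exists>u. E x' u \<and> clsU u \<and> E w u)))" for x x'
  \<comment> \<open>Y holds the vertices with inclusion-minimal N; x0 is one of them with H as large as possible.\<close>
  define Y where "Y = {x \<in> X. \<forall>y\<in>X. N y \<subseteq> N x \<longrightarrow> N y = N x}"
  have finN: "finite (N x)" for x
    unfolding N_def by (rule finite_nbrs)
  have finH: "finite (H x)" for x
    by (rule finite_subset[OF _ fin]) (use dom sym in \<open>auto simp: H_def\<close>)
  have below: "\<exists>y\<in>Y. N y \<subseteq> N x" if "x \<in> X" for x
  proof -
    obtain y where y: "y \<in> X" "N y \<subseteq> N x" "\<And>z. z \<in> X \<Longrightarrow> N z \<subseteq> N x \<Longrightarrow> card (N y) \<le> card (N z)"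
      using ex_card_min[of x "{y \<in> X. N y \<subseteq> N x}" "\<lambda>y. card (N y)"] \<open>x \<in> X\<close> by blast
    have "N z = N y" if "z \<in> X" "N z \<subseteq> N y" for z
      using y(3)[OF that(1)] that(2) y(2) finN by (meson card_seteq order_trans)
    then show ?thesis using y unfolding Y_def by blast
  qed
  have finX: "finite X"
    by (rule finite_subset[OF _ fin]) (use X dom in blast)
  obtain x0 where x0: "x0 \<in> Y" and mx: "\<And>y. y \<in> Y \<Longrightarrow> card (H y) \<le> card (H x0)"
  proof -
    obtain y where "y \<in> Y" using below[OF x] by blast
    moreover have "finite Y" using finX by (simp add: Y_def)
    ultimately show ?thesis using ex_card_max[of y Y "\<lambda>y. card (H y)"] that by blast
  qed
  have Wcol: "f w = 0" if "E y w" "clsW w" "y \<in> X" for y w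
    using f[OF that(1)] fW[OF that(2)] X[OF that(3)] by auto
  have Hcol: "f v = 2" if vH: "v \<in> H y" and yX: "y \<in> X" for v y
  proof -
    obtain w where w: "E y w" "clsW w" "E w v" "clsU v" using vH unfolding H_def by blast
    show ?thesis using f[OF w(3)] fU[OF w(4)] Wcol[OF w(1,2) yX] by auto
  qed
  have YX: "y \<in> X" if "y \<in> Y" for y using that by (simp add: Y_def)
  have Ymin: "N z = N y" if "y \<in> Y" "z \<in> X" "N z \<subseteq> N y" for y z
    using that by (simp add: Y_def)
  have ssx: "\<not> E y z" if "y \<in> X" "z \<in> X" for y z
    using stable[of y z] X that by blast
  have core: "arrow x0 y \<or> N y = N x0" if y: "y \<in> Y" for y
  proof (rule ccontr)
    assume no: "\<not> ?thesis"
    have "N y \<noteq> N x0" using no by blast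
    then have "\<not> N y \<subseteq> N x0" "\<not> N x0 \<subseteq> N y"
      using Ymin[OF x0 YX[OF y]] Ymin[OF y YX[OF x0]] by auto
    then obtain u u' where u: "u \<in> N x0" "u \<notin> N y" and u': "u' \<in> N y" "u' \<notin> N x0" by blast
    obtain w w' where w: "E x0 w" "clsW w" and w': "E y w'" "clsW w'"
      using X[OF YX[OF x0]] X[OF YX[OF y]] by blast
    have nar: "\<not> E y w" "\<not> E w z" if "E x0 w" "clsW w" "z \<in> N y" for w z
      using no that unfolding arrow_def N_def by blast+
    have nar': "\<not> E x0 w'" if "E y w'" "clsW w'" for w'
      using no that unfolding arrow_def by blast
    have near: "\<not> near x0" "\<not> near y" using X YX x0 y by blast+
    have ne: "\<not> E a b" if "f a = f b" for a b using f that by blast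
    have "\<exists>w'. E y w' \<and> clsW w' \<and> E u w'"
    proof (rule ccontr)
      assume "\<not> ?thesis"
      then have "\<not> E u w'" using w' by blast
      moreover have "\<not> E u u'" "\<not> E w w'" using ne u u' Wcol[OF w YX[OF x0]] Wcol[OF w' YX[OF y]]
        unfolding N_def by simp_all
      moreover have "\<not> E u' w" using nar(2)[OF w u'(1)] sym by blast
      ultimately show False
        using path_UW_WU[of x0 u w y u' w'] near u u' w w' nar(1)[OF w u'(1)] nar'[OF w']
        unfolding N_def by blast
    qed
    then obtain w' where w': "E y w'" "clsW w'" "E u w'" by blast
    have "u \<in> H y" using w' u sym unfolding H_def N_def by blast
    moreover have "u \<notin> H x0" using u tri sym unfolding H_def N_def by blast
    ultimately have "\<not> H x0 \<subseteq> H y"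
      using mx[OF y] psubset_card_mono[OF finH, of "H x0" y] by auto
    then obtain v w where v: "v \<in> H x0" "v \<notin> H y" and w: "E x0 w" "clsW w" "E w v" "clsU v"
      unfolding H_def by blast
    have e: "E v w" "E w x0" "E x0 u" "E u w'" "E w' y" "E y u'"
      using w w' u u' sym unfolding N_def by blast+
    have cols: "f v = 2" "f u = 2" "f u' = 2" "f w = 0" "f w' = 0"
      using Hcol[OF v(1) YX[OF x0]] u u' Wcol[OF w(1,2) YX[OF x0]] Wcol[OF w'(1,2) YX[OF y]]
      unfolding N_def by auto
    show False
    proof (rule p7[OF e])
      show "\<not> E v u" "\<not> E v u'" "\<not> E w w'" "\<not> E u u'" using cols ne by auto
      show "\<not> E v x0" "\<not> E w u" "\<not> E u y" "\<not> E w' u'" using e tri sym by blast+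
      show "\<not> E v w'" using v w w' sym unfolding H_def by blast
      show "\<not> E v y" using nar[OF w(1,2)] no w sym unfolding arrow_def by blast
      show "\<not> E w y" using nar[OF w(1,2) u'(1)] sym by blast
      show "\<not> E w u'" using nar[OF w(1,2) u'(1)] by blast
      show "\<not> E x0 w'" using nar'[OF w'(1,2)] .
      show "\<not> E x0 y" using ssx YX x0 y by blast
      show "\<not> E x0 u'" using u' unfolding N_def by blast
    qed
  qed
  obtain u0 where u0: "u0 \<in> N x0" using X[OF YX[OF x0]] unfolding N_def by blast
  have "E x u0 \<or> arrow x0 x" if xX: "x \<in> X" for x
  proof (rule ccontr)
    assume no: "\<not> ?thesis"
    obtain y where y: "y \<in> Y" "N y \<subseteq> N x" using below[OF xX] by blast
    have nsub: "\<not> N x0 \<subseteq> N x" using no u0 unfolding N_def by blast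
    then have "N y \<noteq> N x0" using y by blast
    then have ny: "\<not> N y \<subseteq> N x0" and ar: "arrow x0 y"
      using core[OF y(1)] Ymin[OF x0 YX[OF y(1)]] by auto
    obtain w where w: "E x0 w" "clsW w" and c: "E y w \<or> (\<exists>u. E y u \<and> clsU u \<and> E w u)"
      using ar unfolding arrow_def by blast
    have nxw: "\<not> E x w" using no w unfolding arrow_def by blast
    from c show False
    proof
      assume yw: "E y w"
      obtain u where u: "u \<in> N y" "u \<notin> N x0" using ny by blast
      then have xu: "E x u" using y(2) unfolding N_def by blast
      show False
        using nested_U_W[of y u w x0 x] X[OF YX[OF y(1)]] X[OF YX[OF x0]] X[OF xX] u xu nxw w yw
        unfolding N_def by blast
    next
      assume "\<exists>u. E y u \<and> clsU u \<and> E w u"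
      then obtain u where u: "E y u" "clsU u" "E w u" by blast
      have "f u = 2" using Hcol[of u x0] w u YX[OF x0] unfolding H_def by blast
      then have "E x u" using y(2) u unfolding N_def by blast
      then show False using no w u unfolding arrow_def by blast
    qed
  qed
  then show ?thesis using YX[OF x0] u0 unfolding N_def arrow_def by blast
qed

text \<open>
  A far vertex of colour 1 without a neighbour of colour 2 may be recoloured by 2, since far
  vertices are pairwise non-adjacent.
\<close>

lemma normalize:
  assumes f: "proper f"
  obtains g where "proper g" "\<And>v. near v \<Longrightarrow> g v = f v"
    "\<And>x. \<lbrakk>\<not> near x; \<And>u. E x u \<Longrightarrow> clsU u \<or> clsW u; g x = 1\<rbrakk> \<Longrightarrow> \<exists>u. E x u \<and> g u = 2"
proof -
  define Z where "Z x \<longleftrightarrow> \<not> near x \<and> (\<forall>u. E x u \<longrightarrow> f u \<noteq> 2)" for x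
  define g where "g x = (if Z x \<and> f x = 1 then 2 else f x)" for x
  have nb: "near u" if "E x u" "\<not> near x" for x u using stable that by blast
  have "g u \<noteq> g v" if "E u v" for u v
    using that f nb[of u v] nb[of v u] sym[OF that] unfolding g_def Z_def proper_def by auto
  then have "proper g" using f unfolding proper_def g_def by auto
  moreover have "g v = f v" if "near v" for v using that unfolding g_def Z_def by auto
  moreover have "\<exists>u. E x u \<and> g u = 2" if x: "\<not> near x" "g x = 1" for x
  proof -
    have "f x = 1" "\<not> Z x" using x(2) unfolding g_def by (auto split: if_splits)
    then obtain u where "E x u" "f u = 2" using x(1) unfolding Z_def by blast
    then show ?thesis using nb[of x u] x(1) unfolding g_def Z_def by auto
  qed
  ultimately show ?thesis using that by blast
qed

text \<open>
  The vertices \<open>x0\<close>, \<open>a0\<close> come from \<open>ex_A_guess\<close> applied to the far vertices of colour 0 that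
  the rule would deprive of 0, and \<open>y0\<close>, \<open>u0\<close> from \<open>ex_UW_guess\<close> applied to those of colour 1 that it
  would deprive of 1. The alternatives offered by these lemmas all shorten the list of the vertex in
  question by propagation, so the rule never meets it. Where \<open>f\<close> violates the rule for another reason,
  the rule leaves a single colour that is missing at all neighbours.
\<close>

lemma trim_guess:
  assumes f: "proper f" and fC: "f c0 = 0" "f c1 = 1" "f c2 = 2" "f c3 = 1" "f c4 = 2"
    and norm: "\<And>x. \<lbrakk>\<not> near x; \<And>u. E x u \<Longrightarrow> clsU u \<or> clsW u; f x = 1\<rbrakk> \<Longrightarrow> \<exists>u. E x u \<and> f u = 2"
  shows "\<exists>x0\<in>V. \<exists>a0\<in>V. \<exists>y0\<in>V. \<exists>u0\<in>V. f x0 = 0 \<and> f a0 \<in> {1, 2} \<and> f y0 = 1 \<and> f u0 = 2 \<and>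
    (\<forall>L. seeded f L {c0, c1, c2, c3, c4, x0, a0, y0, u0} \<longrightarrow> closed_lists L \<longrightarrow>
      (\<exists>g. proper g \<and> (\<forall>v\<in>V. g v \<in> trim L v)))"
proof -
  have fE: "f u \<noteq> f v" if "E u v" for u v using f that unfolding proper_def by blast
  have f3: "f v < 3" if "v \<in> V" for v using f that unfolding proper_def by blast
  have inV: "u \<in> V" "v \<in> V" if "E u v" for u v using dom[OF that] dom[OF sym[OF that]] .
  have cV: "c0 \<in> V" "c1 \<in> V" "c2 \<in> V" using cyc inV by blast+
  have fU: "f u = 0 \<or> f u = 2" if "clsU u" for u
  proof -
    from that obtain c where "E c u" "f c = 1" unfolding clsU_def using fC by blast
    then show ?thesis using fE[of c u] f3[of u] inV[of c u] by auto
  qed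
  have fW: "f u = 0 \<or> f u = 1" if "clsW u" for u
  proof -
    from that obtain c where "E c u" "f c = 2" unfolding clsW_def using fC by blast
    then show ?thesis using fE[of c u] f3[of u] inV[of c u] by auto
  qed
  have fA: "f u \<in> {1, 2}" if "clsA u" for u
  proof -
    from that have "E c0 u" unfolding clsA_def by blast
    then show ?thesis using fE[of c0 u] f3[of u] inV[of c0 u] fC by auto
  qed
  \<comment> \<open>The far vertices that the rule would deprive of the colour used by f.\<close>
  define X1 where "X1 = {x. \<not> near x \<and> f x = 0 \<and> (\<exists>a. E x a \<and> clsA a) \<and> (\<exists>v. E x v \<and> (clsU v \<or> clsW v))}"
  define X2 where "X2 = {x. \<not> near x \<and> f x = 1 \<and> (\<exists>u. E x u \<and> clsU u \<and> f u = 2) \<and> (\<exists>w. E x w \<and> clsW w)}"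
  obtain x0 a0 where xa: "x0 \<in> V" "a0 \<in> V" "f x0 = 0" "f a0 \<in> {1, 2}"
    and r1: "\<And>x. x \<in> X1 \<Longrightarrow> E x a0 \<or>
      (\<exists>v. E x0 v \<and> (clsU v \<or> clsW v) \<and> (E x v \<or> (\<exists>a. E x a \<and> clsA a \<and> E v a)))"
  proof (cases "X1 = {}")
    case True
    \<comment> \<open>Without critical vertices, vertices of the cycle serve as a guess of the right colours.\<close>
    then show ?thesis using that[of c0 c1] cV fC by auto
  next
    case False
    then obtain x1 where "x1 \<in> X1" by blast
    have p: "\<not> near x \<and> (\<exists>a. E x a \<and> clsA a) \<and> (\<exists>v. E x v \<and> (clsU v \<or> clsW v))"
      if "x \<in> X1" for x using that unfolding X1_def by simp
    from ex_A_guess[OF \<open>x1 \<in> X1\<close> p] obtain x0 a0 where x0: "x0 \<in> X1" "E x0 a0" "clsA a0"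
      and "\<forall>x\<in>X1. E x a0 \<or>
        (\<exists>v. E x0 v \<and> (clsU v \<or> clsW v) \<and> (E x v \<or> (\<exists>a. E x a \<and> clsA a \<and> E v a)))"
      by blast
    moreover have "f x0 = 0" using x0(1) unfolding X1_def by simp
    ultimately show ?thesis using that[of x0 a0] inV[OF x0(2)] fA[OF x0(3)] by blast
  qed
  obtain y0 u0 where yu: "y0 \<in> V" "u0 \<in> V" "f y0 = 1" "f u0 = 2"
    and r2: "\<And>x. x \<in> X2 \<Longrightarrow> E x u0 \<or>
      (\<exists>w. E y0 w \<and> clsW w \<and> (E x w \<or> (\<exists>u. E x u \<and> clsU u \<and> E w u)))"
  proof (cases "X2 = {}")
    case True
    then show ?thesis using that[of c1 c2] cV fC by auto
  next
    case False
    then obtain x1 where "x1 \<in> X2" by blast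
    have p: "\<not> near x \<and> f x = 1 \<and> (\<exists>u. E x u \<and> clsU u \<and> f u = 2) \<and> (\<exists>w. E x w \<and> clsW w)"
      if "x \<in> X2" for x using that unfolding X2_def by simp
    from ex_UW_guess[OF \<open>x1 \<in> X2\<close> p fE fU fW] obtain y0 u0 where y0: "y0 \<in> X2" "E y0 u0" "f u0 = 2"
      and "\<forall>x\<in>X2. E x u0 \<or>
        (\<exists>w. E y0 w \<and> clsW w \<and> (E x w \<or> (\<exists>u. E x u \<and> clsU u \<and> E w u)))"
      by blast
    then show ?thesis using that[of y0 u0] inV[OF y0(2)] p[OF y0(1)] y0(3) by blast
  qed
  have "\<exists>g. proper g \<and> (\<forall>v\<in>V. g v \<in> trim L v)"
    if sd: "seeded f L {c0, c1, c2, c3, c4, x0, a0, y0, u0}" and cl: "closed_lists L" for L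
  proof -
    have fL: "f v \<in> L v" "L v \<subseteq> {0, 1, 2}" if "v \<in> V" for v
      using sd that unfolding seeded_def by blast+
    have LS: "L c0 = {0}" "L c1 = {1}" "L c2 = {2}" "L c3 = {1}" "L c4 = {2}"
      "L x0 = {0}" "L y0 = {1}" "L u0 = {2}" "L a0 = {f a0}"
      using sd fC xa yu unfolding seeded_def by auto
    have prp: "d \<notin> L v" if "L u = {d}" "E u v" for u v d
      using cl that unfolding closed_lists_def by fastforce
    have full: "L x = {0, 1, 2}" if "x \<in> V" "card (L x) = 3" for x
      using card_subset_eq[of "{0, 1, 2}" "L x"] fL(2)[OF that(1)] that(2) by simp
    have excl: "E c0 w \<Longrightarrow> 0 \<notin> L w" "E c1 w \<Longrightarrow> 1 \<notin> L w" "E c2 w \<Longrightarrow> 2 \<notin> L w"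
      "E c3 w \<Longrightarrow> 1 \<notin> L w" "E c4 w \<Longrightarrow> 2 \<notin> L w" for w
      using prp LS by blast+
    have notnear: "\<not> near x" if "x \<in> V" "card (L x) = 3" for x
      using excl[of x] full[OF that] unfolding near_def by auto
    have nbr: "(clsA w \<and> L w = {1, 2}) \<or> (clsU w \<and> L w = {0, 2}) \<or> (clsW w \<and> L w = {0, 1})"
      if x: "x \<in> V" "card (L x) = 3" "E x w" for x w
    proof -
      have nw: "near w" using stable[OF x(3)] notnear[OF x(1,2)] by blast
      have wV: "w \<in> V" using inV x(3) by blast
      have ns: "L w \<noteq> {d}" for d
        using prp[of w d x] sym[OF x(3)] full[OF x(1,2)] fL(2)[OF wV] by auto
      have "L w = {1, 2} \<or> L w = {0, 2} \<or> L w = {0, 1}"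
      proof (rule two_colours[OF fL(2)[OF wV]])
        show "L w \<noteq> {}" using fL(1)[OF wV] by blast
        show "0 \<notin> L w \<or> 1 \<notin> L w \<or> 2 \<notin> L w" using nw excl[of w] unfolding near_def by blast
      qed (rule ns)
      then show ?thesis
      proof (elim disjE)
        assume l: "L w = {1, 2}"
        then have "\<not> E c1 w" "\<not> E c2 w" "\<not> E c3 w" "\<not> E c4 w" using excl[of w] by auto
        then show ?thesis using l nw unfolding near_def clsA_def by simp
      next
        assume l: "L w = {0, 2}"
        then have "\<not> E c0 w" "\<not> E c2 w" "\<not> E c4 w" using excl[of w] by auto
        then show ?thesis using l nw unfolding near_def clsU_def by simp
      next
        assume l: "L w = {0, 1}"
        then have "\<not> E c0 w" "\<not> E c1 w" "\<not> E c3 w" using excl[of w] by auto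
        then show ?thesis using l nw unfolding near_def clsW_def by simp
      qed
    qed
    have ok: "f x \<in> trim L x \<or> (\<exists>c. trim L x = {c} \<and> (\<forall>w. E x w \<longrightarrow> c \<notin> L w))" if x: "x \<in> V" for x
    proof (cases "card (L x) = 3")
      case False
      then show ?thesis using fL[OF x] unfolding trim_def by simp
    next
      case True
      note nb = nbr[OF x True]
      have iffs: "0 \<notin> L w \<longleftrightarrow> clsA w" "1 \<notin> L w \<longleftrightarrow> clsU w" "2 \<notin> L w \<longleftrightarrow> clsW w" if "E x w" for w
        using class_of_list[of clsA w L clsU clsW] nb[OF that] cls_disjoint[of w] by blast+
      have m: "misses L x 0 \<longleftrightarrow> (\<exists>a. E x a \<and> clsA a)" "misses L x 1 \<longleftrightarrow> (\<exists>a. E x a \<and> clsU a)"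
        "misses L x 2 \<longleftrightarrow> (\<exists>a. E x a \<and> clsW a)"
        unfolding misses_def using iffs by blast+
      have nosing: "False" if "E x v" "L v = {d}" for v d
      proof -
        have "card (L v) = 2" using nb[OF that(1)] by (elim disjE conjE) simp_all
        then show False using that(2) by simp
      qed
      have tr: "trim L x = (if misses L x 0 then (if misses L x 1 \<or> misses L x 2 then {1, 2} else {0})
        else (if misses L x 2 then {0, 2} else {1}))" using True unfolding trim_def by simp
      consider (a) "misses L x 0" "misses L x 1 \<or> misses L x 2"
        | (b) "misses L x 0" "\<not> misses L x 1" "\<not> misses L x 2"
        | (c) "\<not> misses L x 0" "misses L x 2" | (d) "\<not> misses L x 0" "\<not> misses L x 2" by blast
      then show ?thesis
      proof cases
        case a
        have "f x \<noteq> 0"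
        proof
          assume "f x = 0"
          then have "x \<in> X1" using a m notnear[OF x True] unfolding X1_def by blast
          from r1[OF this] consider "E x a0"
            | v where "E x0 v" "clsU v \<or> clsW v" "E x v \<or> (\<exists>a. E x a \<and> clsA a \<and> E v a)" by blast
          then show False
          proof cases
            case 1 then show False using nosing LS by blast
          next
            case v: (2 v)
            have "0 \<notin> L v" using prp LS v by blast
            moreover have "1 \<notin> L v \<or> 2 \<notin> L v" using v(2) excl unfolding clsU_def clsW_def by blast
            moreover have "f v \<in> L v" "L v \<subseteq> {0, 1, 2}" using fL inV[OF v(1)] by blast+
            ultimately have "f v = 1 \<and> L v = {1} \<or> f v = 2 \<and> L v = {2}" by auto
            then obtain d where d: "L v = {d}" "d = 1 \<or> d = 2" by blast
            from v(3) show False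
            proof (elim disjE exE conjE)
              assume "E x v" then show False using nosing d by blast
            next
              fix a assume "E x a" "clsA a" "E v a"
              then have "d \<notin> L a" "L a = {1, 2}"
                using prp d nb[of a] unfolding clsA_def clsU_def clsW_def by blast+
              then show False using d by auto
            qed
          qed
        qed
        then show ?thesis using f3[OF x] a unfolding tr by auto
      next
        case b
        then have "trim L x = {0}" unfolding tr by simp
        moreover have "0 \<notin> L w" if "E x w" for w using nb[OF that] b m that by auto
        ultimately show ?thesis by blast
      next
        case c
        have "f x \<noteq> 1"
        proof
          assume fx: "f x = 1"
          have UW: "clsU u \<or> clsW u" if "E x u" for u using nb[OF that] c m that by blast
          obtain u where u: "E x u" "f u = 2"
            using norm[OF notnear[OF x True] UW fx] by blast
          then have "clsU u" using UW[of u] fW[of u] by auto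
          then have "x \<in> X2" using c m u fx notnear[OF x True] unfolding X2_def by blast
          from r2[OF this] consider "E x u0"
            | v where "E y0 v" "clsW v" "E x v \<or> (\<exists>u. E x u \<and> clsU u \<and> E v u)" by blast
          then show False
          proof cases
            case 1 then show False using nosing LS by blast
          next
            case v: (2 v)
            have "1 \<notin> L v" using prp LS v by blast
            moreover have "2 \<notin> L v" using v(2) excl unfolding clsW_def by blast
            moreover have "f v \<in> L v" "L v \<subseteq> {0, 1, 2}" using fL inV[OF v(1)] by blast+
            ultimately have d: "L v = {0}" by auto
            from v(3) show False
            proof (elim disjE exE conjE)
              assume "E x v" then show False using nosing d by blast
            next
              fix a assume "E x a" "clsU a" "E v a"
              then have "0 \<notin> L a" "L a = {0, 2}"
                using prp d nb[of a] unfolding clsA_def clsU_def clsW_def by blast+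
              then show False by auto
            qed
          qed
        qed
        then show ?thesis using f3[OF x] c unfolding tr by auto
      next
        case d
        then have "trim L x = {1}" unfolding tr by simp
        moreover have "1 \<notin> L w" if "E x w" for w using nb[OF that] d m that by auto
        ultimately show ?thesis by blast
      qed
    qed
    \<comment> \<open>Recolour the vertices at which f violates the rule; all of them are far from the cycle.\<close>
    define g where "g v = (if f v \<in> trim L v then f v else (SOME c. c \<in> trim L v))" for v
    have gin: "g v \<in> trim L v" if "v \<in> V" for v
      using ok[OF that] unfolding g_def by (auto intro: someI)
    have tsub: "trim L v \<subseteq> {0, 1, 2}" if "v \<in> V" for v
      using fL(2)[OF that] unfolding trim_def by auto
    have gf: "g v = f v" if "v \<in> V" "card (L v) \<noteq> 3" for v
      using fL[OF that(1)] that(2) unfolding g_def trim_def by simp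
    have gE: "g u \<noteq> f w" if uw: "E u w" for u w
    proof (cases "f u \<in> trim L u")
      case True
      then show ?thesis using fE[OF uw] unfolding g_def by simp
    next
      case False
      then obtain c where c: "trim L u = {c}" "c \<notin> L w" using ok[of u] inV[OF uw] uw by blast
      then have "g u = c" using gin[of u] inV[OF uw] by auto
      then show ?thesis using fL(1)[of w] inV[OF uw] c by auto
    qed
    have "g u \<noteq> g w" if "E u w" for u w
    proof (cases "card (L w) = 3")
      case False
      then show ?thesis using gE[OF that] gf[of w] inV[OF that] by simp
    next
      case True
      then have "card (L u) \<noteq> 3" using stable[OF that] notnear inV[OF that] by blast
      then show ?thesis using gE[OF sym[OF that]] gf[of u] inV[OF that] by simp
    qed
    moreover have "g v < 3" if "v \<in> V" for v using gin[OF that] tsub[OF that] by auto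
    ultimately have "proper g" unfolding proper_def by blast
    then show ?thesis using gin by blast
  qed
  then show ?thesis using xa yu by blast
qed

end

section \<open>Five-cycles with independent non-neighbourhood\<close>

lemma pattern_of_five_cycle:
  fixes a b c d e :: nat
  assumes "a < 3" "b < 3" "c < 3" "d < 3" "e < 3" "a \<noteq> b" "b \<noteq> c" "c \<noteq> d" "d \<noteq> e" "e \<noteq> a"
  shows "b = d \<and> c = e \<and> a \<noteq> c \<or> c = e \<and> d = a \<and> b \<noteq> d \<or> d = a \<and> e = b \<and> c \<noteq> e \<or>
    e = b \<and> a = c \<and> d \<noteq> a \<or> a = c \<and> b = d \<and> e \<noteq> b"
proof -
  have c: "\<And>x::nat. x < 3 \<Longrightarrow> x = 0 \<or> x = 1 \<or> x = 2" by linarith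
  show ?thesis
    using c[OF assms(1)] c[OF assms(2)] c[OF assms(3)] c[OF assms(4)] c[OF assms(5)] assms(6-10)
    by (elim disjE) simp_all
qed

lemma permute_three:
  fixes a b c :: nat
  assumes "a < 3" "b < 3" "c < 3" "a \<noteq> b" "b \<noteq> c" "a \<noteq> c"
  obtains p :: "nat \<Rightarrow> nat" where "p a = 0" "p b = 1" "p c = 2" "inj_on p {..<3}" "\<And>x. x < 3 \<Longrightarrow> p x < 3"
proof
  let ?p = "\<lambda>x. if x = a then 0 else if x = b then 1 else (2::nat)"
  show "?p a = 0" "?p b = 1" "?p c = 2" using assms by auto
  show "inj_on ?p {..<3}"
    using assms by (auto simp: inj_on_def split: if_splits)
  show "?p x < 3" for x by auto
qed

lemma (in five_cycle) rotate: "five_cycle E V c1 c2 c3 c4 c0"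
  by unfold_locales (use cyc in auto)

lemma (in good_cycle) rotate_good: "good_cycle E V c1 c2 c3 c4 c0"
proof -
  interpret R: five_cycle E V c1 c2 c3 c4 c0 by (rule rotate)
  have "R.near u = near u" for u unfolding R.near_def near_def by blast
  then show ?thesis by unfold_locales (use stable in blast)
qed

lemma (in good_cycle) trim_guess_any:
  assumes f: "proper f" and pat: "f c1 = f c3" "f c2 = f c4" "f c0 \<noteq> f c2"
  shows "\<exists>f. proper f \<and> f c0 = 0 \<and> f c1 = 1 \<and> f c2 = 2 \<and> f c3 = 1 \<and> f c4 = 2 \<and>
    (\<exists>x0\<in>V. \<exists>a0\<in>V. \<exists>y0\<in>V. \<exists>u0\<in>V. f x0 = 0 \<and> f a0 \<in> {1, 2} \<and> f y0 = 1 \<and> f u0 = 2 \<and>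
    (\<forall>L. seeded f L {c0, c1, c2, c3, c4, x0, a0, y0, u0} \<longrightarrow> closed_lists L \<longrightarrow>
      (\<exists>g. proper g \<and> (\<forall>v\<in>V. g v \<in> trim L v))))"
proof -
  have cV: "c0 \<in> V" "c1 \<in> V" "c2 \<in> V" using cyc dom sym by blast+
  have "f c0 < 3" "f c1 < 3" "f c2 < 3" "f c0 \<noteq> f c1" "f c1 \<noteq> f c2"
    using f cyc cV unfolding proper_def by blast+
  then obtain p :: "nat \<Rightarrow> nat" where p: "p (f c0) = 0" "p (f c1) = 1" "p (f c2) = 2"
    "inj_on p {..<3}" "\<And>x. x < 3 \<Longrightarrow> p x < 3"
    using permute_three[of "f c0" "f c1" "f c2"] pat(3) by blast
  have "proper (\<lambda>v. p (f v))"
    unfolding proper_def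
  proof (intro conjI allI impI ballI)
    show "p (f v) < 3" if "v \<in> V" for v using f p(5) that unfolding proper_def by blast
    show "p (f u) \<noteq> p (f v)" if "E u v" for u v
    proof -
      have "f u < 3" "f v < 3" "f u \<noteq> f v"
        using f that dom[OF that] dom[OF sym[OF that]] unfolding proper_def by blast+
      then show ?thesis using inj_onD[OF p(4), of "f u" "f v"] by auto
    qed
  qed
  from normalize[OF this] obtain g where g: "proper g" "\<And>v. near v \<Longrightarrow> g v = p (f v)"
    "\<And>x. \<lbrakk>\<not> near x; \<And>u. E x u \<Longrightarrow> clsU u \<or> clsW u; g x = 1\<rbrakk> \<Longrightarrow> \<exists>u. E x u \<and> g u = 2"
    by metis
  have gc: "g c0 = 0" "g c1 = 1" "g c2 = 2" "g c3 = 1" "g c4 = 2"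
    using g(2) near_cyc p pat by simp_all
  from trim_guess[OF g(1) gc g(3)] show ?thesis using g(1) gc by blast
qed

text \<open>
  The cycle is listed almost twice, as \<open>c 0, \<dots>, c 8\<close>, so that every rotation is a window of
  length five.
\<close>

lemma (in p7_graph) good_guess:
  assumes good: "good_cycle E V (c 0) (c 1) (c 2) (c 3) (c 4)"
    and c: "c (5::nat) = c 0" "c 6 = c 1" "c 7 = c 2" "c 8 = c 3"
    and f: "proper f"
  shows "\<exists>k<5. \<exists>f. proper f \<and> f (c k) = 0 \<and> f (c (k + 1)) = 1 \<and> f (c (k + 2)) = 2 \<and>
      f (c (k + 3)) = 1 \<and> f (c (k + 4)) = 2 \<and>
    (\<exists>x0\<in>V. \<exists>a0\<in>V. \<exists>y0\<in>V. \<exists>u0\<in>V. f x0 = 0 \<and> f a0 \<in> {1, 2} \<and> f y0 = 1 \<and> f u0 = 2 \<and>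
    (\<forall>L. seeded f L {c k, c (k + 1), c (k + 2), c (k + 3), c (k + 4), x0, a0, y0, u0} \<longrightarrow>
      closed_lists L \<longrightarrow> (\<exists>g. proper g \<and> (\<forall>v\<in>V. g v \<in> trim L v))))"
proof -
  interpret G0: good_cycle E V "c 0" "c 1" "c 2" "c 3" "c 4" by (rule good)
  interpret G1: good_cycle E V "c 1" "c 2" "c 3" "c 4" "c 0" by (rule G0.rotate_good)
  interpret G2: good_cycle E V "c 2" "c 3" "c 4" "c 0" "c 1" by (rule G1.rotate_good)
  interpret G3: good_cycle E V "c 3" "c 4" "c 0" "c 1" "c 2" by (rule G2.rotate_good)
  interpret G4: good_cycle E V "c 4" "c 0" "c 1" "c 2" "c 3" by (rule G3.rotate_good)
  have cV: "c 0 \<in> V" "c 1 \<in> V" "c 2 \<in> V" "c 3 \<in> V" "c 4 \<in> V" using G0.cyc dom by blast+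
  have ne: "f u \<noteq> f v" if "E u v" for u v using f that unfolding proper_def by blast
  have l: "f (c 0) < 3" "f (c 1) < 3" "f (c 2) < 3" "f (c 3) < 3" "f (c 4) < 3"
    using f cV unfolding proper_def by blast+
  consider "f (c 1) = f (c 3)" "f (c 2) = f (c 4)" "f (c 0) \<noteq> f (c 2)"
    | "f (c 2) = f (c 4)" "f (c 3) = f (c 0)" "f (c 1) \<noteq> f (c 3)"
    | "f (c 3) = f (c 0)" "f (c 4) = f (c 1)" "f (c 2) \<noteq> f (c 4)"
    | "f (c 4) = f (c 1)" "f (c 0) = f (c 2)" "f (c 3) \<noteq> f (c 0)"
    | "f (c 0) = f (c 2)" "f (c 1) = f (c 3)" "f (c 4) \<noteq> f (c 1)"
    using pattern_of_five_cycle[OF l G0.cyc[THEN ne]] by blast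
  then show ?thesis
  proof cases
    case 1
    from G0.trim_guess_any[OF f 1] show ?thesis
      by (intro exI[of _ 0] conjI) (simp_all del: One_nat_def add_2_eq_Suc add_2_eq_Suc')
  next
    case 2
    from G1.trim_guess_any[OF f 2] show ?thesis
      by (intro exI[of _ 1] conjI) (simp_all add: c del: One_nat_def add_2_eq_Suc add_2_eq_Suc')
  next
    case 3
    from G2.trim_guess_any[OF f 3] show ?thesis
      by (intro exI[of _ 2] conjI) (simp_all add: c del: One_nat_def add_2_eq_Suc add_2_eq_Suc')
  next
    case 4
    from G3.trim_guess_any[OF f 4] show ?thesis
      by (intro exI[of _ 3] conjI) (simp_all add: c del: One_nat_def add_2_eq_Suc add_2_eq_Suc')
  next
    case 5
    from G4.trim_guess_any[OF f 5] show ?thesis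
      by (intro exI[of _ 4] conjI) (simp_all add: c del: One_nat_def add_2_eq_Suc add_2_eq_Suc')
  qed
qed

text \<open>
  Connectivity is stated as an induction principle: a set that contains the root and is closed under
  adjacency is everything.
\<close>

locale conn_graph = p7_graph +
  fixes r :: 'a
  assumes root: "r \<in> V"
    and conn: "r \<in> S \<Longrightarrow> (\<And>u v. u \<in> S \<Longrightarrow> E u v \<Longrightarrow> v \<in> S) \<Longrightarrow> V \<subseteq> S"
begin

lemma conn_any:
  assumes "x \<in> S" "x \<in> V" and cl: "\<And>u v. u \<in> S \<Longrightarrow> E u v \<Longrightarrow> v \<in> S"
  shows "V \<subseteq> S"
proof (cases "r \<in> S")
  case False
  then have "V \<subseteq> - S" using conn[of "- S"] cl sym by blast
  then show ?thesis using assms by blast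
qed (use conn cl in blast)

end

text \<open>
  The ordered pairs of adjacent vertices without a neighbour on the cycle; they measure how far the
  cycle is from being good.
\<close>

definition far_edges :: "('a \<Rightarrow> 'a \<Rightarrow> bool) \<Rightarrow> 'a \<Rightarrow> 'a \<Rightarrow> 'a \<Rightarrow> 'a \<Rightarrow> 'a \<Rightarrow> ('a \<times> 'a) set" where
  "far_edges E c0 c1 c2 c3 c4 = {(u, v). E u v \<and>
    \<not> (E c0 u \<or> E c1 u \<or> E c2 u \<or> E c3 u \<or> E c4 u) \<and> \<not> (E c0 v \<or> E c1 v \<or> E c2 v \<or> E c3 v \<or> E c4 v)}"

context five_cycle begin

lemma far_edges_near: "far_edges E c0 c1 c2 c3 c4 = {(u, v). E u v \<and> \<not> near u \<and> \<not> near v}"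
  unfolding far_edges_def near_def by blast

text \<open>
  The far edge, \<open>a\<close>, and four vertices of the cycle form an induced path.
\<close>

lemma A_nbr_no_far_edge:
  assumes "\<not> near u" "\<not> near v" "E u v" "E v a" "E c0 a" "\<not> E c1 a" "\<not> E c2 a" "\<not> E c3 a"
  shows False
proof -
  have "\<not> E u a" using assms tri by blast
  then show False
    by (intro p7[of u v a c0 c1 c2 c3])
      (use assms far[OF assms(1)] far[OF assms(2)] cyc cyc' chords in \<open>auto simp: sym_iff\<close>)
qed

text \<open>
  Exchanging \<open>c0\<close> for \<open>b\<close> cannot create a far edge: an edge between \<open>u\<close> and \<open>v\<close> that only \<open>c0\<close> dominated
  would be the end of an induced path that starts with \<open>q\<close>, \<open>x\<close>, \<open>b\<close> and passes through \<open>c1\<close> and \<open>c0\<close>. The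
  edge between \<open>x\<close> and \<open>q\<close> disappears because \<open>b\<close> is adjacent to \<open>x\<close>.
\<close>

lemma swap:
  assumes b: "E b c4" "E b c1" and x: "E b x" "E x q" "\<not> near x" "\<not> near q"
  shows "five_cycle E V b c1 c2 c3 c4"
    and "far_edges E b c1 c2 c3 c4 \<subset> far_edges E c0 c1 c2 c3 c4"
proof -
  show "five_cycle E V b c1 c2 c3 c4"
    by unfold_locales (use cyc b sym in blast)+
  then interpret S: five_cycle E V b c1 c2 c3 c4 .
  have bn: "\<not> E b c0" "\<not> E b c2" "\<not> E b c3" "\<not> E b q" using b cyc cyc' x tri sym by blast+
  have key: False if e: "E u v" "\<not> S.near u" "\<not> S.near v" "near u" for u v
  proof -
    have u: "E c0 u" "\<not> E c1 u" "\<not> E c2 u" "\<not> E c3 u" "\<not> E c4 u" "\<not> E b u"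
      using e unfolding near_def S.near_def by blast+
    have v0: "\<not> E c0 v" using u e tri sym by blast
    have v: "\<not> near v" "\<not> E b v" using v0 e(3) unfolding near_def S.near_def by blast+
    have qu: "\<not> E q u" using A_nbr_no_far_edge[of x q u] x u by blast
    have xu: "\<not> E x u" using A_nbr_no_far_edge[of q x u] x u sym by blast
    have xv: "\<not> E x v" using A_nbr_no_far_edge[of x v u] x u v e sym by blast
    have qv: "\<not> E q v" using A_nbr_no_far_edge[of q v u] x u v e sym by blast
    show False
    proof (rule p7[of q x b c1 c0 u v])
      show "E q x" "E x b" "E b c1" "E c1 c0" "E c0 u" "E u v" using x b cyc' u e sym by blast+
      show "\<not> E q b" "\<not> E b c0" "\<not> E b u" "\<not> E b v" using bn u v sym by blast+
      show "\<not> E q c1" "\<not> E q c0" "\<not> E x c1" "\<not> E x c0" using far[OF x(3)] far[OF x(4)] by blast+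
      show "\<not> E q u" "\<not> E q v" "\<not> E x u" "\<not> E x v" using qu qv xu xv .
      show "\<not> E c1 u" "\<not> E c1 v" "\<not> E c0 v" using u v0 far[OF v(1)] by blast+
    qed
  qed
  have "far_edges E b c1 c2 c3 c4 \<subseteq> far_edges E c0 c1 c2 c3 c4"
    unfolding far_edges_near S.far_edges_near using key sym by blast
  moreover have "(x, q) \<in> far_edges E c0 c1 c2 c3 c4" "(x, q) \<notin> far_edges E b c1 c2 c3 c4"
    unfolding far_edges_near S.far_edges_near using x unfolding S.near_def by blast+
  ultimately show "far_edges E b c1 c2 c3 c4 \<subset> far_edges E c0 c1 c2 c3 c4" by blast
qed

text \<open>
  If \<open>b\<close> saw only one vertex of the cycle, then \<open>q\<close>, \<open>x\<close> and \<open>b\<close> followed by four vertices of the cycle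
  would be an induced path. Two neighbours of \<open>b\<close> are at distance two because there is no triangle.
\<close>

lemma two_nbrs:
  assumes b: "near b" and x: "E b x" "E x q" "\<not> near x" "\<not> near q"
  shows "E b c4 \<and> E b c1 \<or> E b c0 \<and> E b c2 \<or> E b c1 \<and> E b c3 \<or> E b c2 \<and> E b c4 \<or> E b c3 \<and> E b c0"
proof (rule ccontr)
  assume no: "\<not> ?thesis"
  have one: False if "five_cycle E V d0 d1 d2 d3 d4" "E b d0" "\<not> E b d2" "\<not> E b d3"
    "\<And>u. five_cycle.near E d0 d1 d2 d3 d4 u = near u" for d0 d1 d2 d3 d4
  proof -
    interpret D: five_cycle E V d0 d1 d2 d3 d4 by fact
    show False
      using D.A_nbr_no_far_edge[of q x b] x that D.cyc tri sym by blast
  qed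
  interpret R1: five_cycle E V c1 c2 c3 c4 c0 by (rule rotate)
  interpret R2: five_cycle E V c2 c3 c4 c0 c1 by (rule R1.rotate)
  interpret R3: five_cycle E V c3 c4 c0 c1 c2 by (rule R2.rotate)
  interpret R4: five_cycle E V c4 c0 c1 c2 c3 by (rule R3.rotate)
  have n: "R1.near u = near u" "R2.near u = near u" "R3.near u = near u" "R4.near u = near u" for u
    unfolding near_def R1.near_def R2.near_def R3.near_def R4.near_def by blast+
  from b consider "E b c0" | "E b c1" | "E b c2" | "E b c3" | "E b c4" unfolding near_def using sym by blast
  then show False
  proof cases
    case 1 then show ?thesis using one[OF five_cycle_axioms] no sym by blast
  next
    case 2 then show ?thesis using one[OF R1.five_cycle_axioms] no n sym by blast
  next
    case 3 then show ?thesis using one[OF R2.five_cycle_axioms] no n sym by blast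
  next
    case 4 then show ?thesis using one[OF R3.five_cycle_axioms] no n sym by blast
  next
    case 5 then show ?thesis using one[OF R4.five_cycle_axioms] no n sym by blast
  qed
qed

lemma improve:
  assumes b: "near b" and x: "E b x" "E x q" "\<not> near x" "\<not> near q"
  shows "\<exists>d0 d1 d2 d3 d4. five_cycle E V d0 d1 d2 d3 d4 \<and>
    far_edges E d0 d1 d2 d3 d4 \<subset> far_edges E c0 c1 c2 c3 c4"
proof -
  interpret R1: five_cycle E V c1 c2 c3 c4 c0 by (rule rotate)
  interpret R2: five_cycle E V c2 c3 c4 c0 c1 by (rule R1.rotate)
  interpret R3: five_cycle E V c3 c4 c0 c1 c2 by (rule R2.rotate)
  interpret R4: five_cycle E V c4 c0 c1 c2 c3 by (rule R3.rotate)
  have n: "R1.near u = near u" "R2.near u = near u" "R3.near u = near u" "R4.near u = near u" for u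
    unfolding near_def R1.near_def R2.near_def R3.near_def R4.near_def by blast+
  have fr: "far_edges E c1 c2 c3 c4 c0 = far_edges E c0 c1 c2 c3 c4"
    "far_edges E c2 c3 c4 c0 c1 = far_edges E c0 c1 c2 c3 c4"
    "far_edges E c3 c4 c0 c1 c2 = far_edges E c0 c1 c2 c3 c4"
    "far_edges E c4 c0 c1 c2 c3 = far_edges E c0 c1 c2 c3 c4"
    unfolding far_edges_def by blast+
  from two_nbrs[OF assms] consider "E b c4" "E b c1" | "E b c0" "E b c2" | "E b c1" "E b c3"
    | "E b c2" "E b c4" | "E b c3" "E b c0" by blast
  then show ?thesis
  proof cases
    case 1 then show ?thesis using swap[OF 1 x] by blast
  next
    case 2 then show ?thesis using R1.swap[OF 2 x(1,2)] x(3,4) n unfolding fr by blast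
  next
    case 3 then show ?thesis using R2.swap[OF 3 x(1,2)] x(3,4) n unfolding fr by blast
  next
    case 4 then show ?thesis using R3.swap[OF 4 x(1,2)] x(3,4) n unfolding fr by blast
  next
    case 5 then show ?thesis using R4.swap[OF 5 x(1,2)] x(3,4) n unfolding fr by blast
  qed
qed

end

text \<open>
  A five-cycle with the fewest far edges. A far edge would be connected to the cycle, which by
  \<open>improve\<close> contradicts minimality.
\<close>

lemma (in conn_graph) ex_good_cycle:
  assumes "five_cycle E V c0 c1 c2 c3 c4"
  shows "\<exists>d0 d1 d2 d3 d4. good_cycle E V d0 d1 d2 d3 d4"
  using assms
proof (induction "card (far_edges E c0 c1 c2 c3 c4)" arbitrary: c0 c1 c2 c3 c4 rule: less_induct)
  case less
  interpret F: five_cycle E V c0 c1 c2 c3 c4 by (rule less.prems)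
  show ?case
  proof (cases "\<exists>u v. E u v \<and> \<not> F.near u \<and> \<not> F.near v")
    case False
    then have "good_cycle E V c0 c1 c2 c3 c4" by unfold_locales blast
    then show ?thesis by blast
  next
    case True
    have "\<exists>x q b. E x q \<and> \<not> F.near x \<and> \<not> F.near q \<and> E b x \<and> F.near b"
    proof (rule ccontr)
      assume no: "\<not> ?thesis"
      let ?S = "{x. \<exists>q. E x q \<and> \<not> F.near x \<and> \<not> F.near q}"
      have cl: "v \<in> ?S" if "u \<in> ?S" "E u v" for u v using that no sym by blast
      obtain x where "x \<in> ?S" "x \<in> V" using True dom by blast
      then have "V \<subseteq> ?S" using conn_any[of x ?S] cl by blast
      then show False using F.near_cyc(1) dom[OF F.cyc(1)] by blast
    qed
    then obtain x q b where "F.near b" "E b x" "E x q" "\<not> F.near x" "\<not> F.near q" by blast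
    from F.improve[OF this] obtain d0 d1 d2 d3 d4 where d: "five_cycle E V d0 d1 d2 d3 d4"
      "far_edges E d0 d1 d2 d3 d4 \<subset> far_edges E c0 c1 c2 c3 c4" by blast
    have "finite (far_edges E c0 c1 c2 c3 c4)"
      by (rule finite_subset[of _ "V \<times> V"]) (use fin dom sym in \<open>auto simp: far_edges_def\<close>)
    then show ?thesis using less.hyps[OF psubset_card_mono[OF _ d(2)] d(1)] by blast
  qed
qed

section \<open>Components without five-cycles and lists of size two\<close>

lemma sym_relpow:
  assumes "sym R" "(x, y) \<in> R ^^ k"
  shows "(y, x) \<in> R ^^ k"
  using assms(2)
proof (induction k arbitrary: y)
  case (Suc k)
  then obtain z where "(x, z) \<in> R ^^ k" "(z, y) \<in> R" by auto
  then have "(y, z) \<in> R" "(z, x) \<in> R ^^ k" using Suc.IH assms(1) by (auto dest: symD)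
  then show ?case using relpow_Suc_I2 by fastforce
qed simp

text \<open>
  Colour a vertex by the parity of the walks from a representative of its class; two walks
  of different parity would close to an odd one.
\<close>

lemma two_colouring_of_no_odd_walk:
  assumes sym: "sym R" and no: "\<And>u k. odd k \<Longrightarrow> (u, u) \<notin> R ^^ k"
  shows "\<exists>p :: 'b \<Rightarrow> bool. \<forall>u v. (u, v) \<in> R \<longrightarrow> p u \<noteq> p v"
proof -
  define rt where "rt v = (SOME u. (u, v) \<in> R\<^sup>*)" for v
  define d where "d v = (SOME k. (rt v, v) \<in> R ^^ k)" for v
  have rt: "(rt v, v) \<in> R\<^sup>*" for v unfolding rt_def by (rule someI[of _ v]) simp
  have d: "(rt v, v) \<in> R ^^ d v" for v
    unfolding d_def by (rule someI_ex) (use rt rtrancl_imp_relpow in blast)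
  have same: "rt u = rt v" if "(u, v) \<in> R" for u v
  proof -
    have "(x, u) \<in> R\<^sup>* \<longleftrightarrow> (x, v) \<in> R\<^sup>*" for x
      using that symD[OF sym that] by (meson rtrancl.rtrancl_into_rtrancl)
    then show ?thesis unfolding rt_def by simp
  qed
  have "odd (d u) \<noteq> odd (d v)" if uv: "(u, v) \<in> R" for u v
  proof
    assume "odd (d u) = odd (d v)"
    then have "odd (d u + (1 + d v))" by auto
    moreover have "(rt u, rt u) \<in> R ^^ (d u + (1 + d v))"
      unfolding relpow_add using d[of u] uv sym_relpow[OF sym d[of v]] same[OF uv] by auto
    ultimately show False using no by blast
  qed
  then show ?thesis by (intro exI[of _ "\<lambda>v. odd (d v)"]) blast
qed

context p7_graph begin

text \<open>
  The seven-cycle is induced, because a chord would cut off a triangle or a five-cycle. If \<open>z0\<close> is the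
  only neighbour of \<open>b\<close> on it, then \<open>b\<close> and six vertices of the cycle form an induced path; otherwise
  there is a second neighbour at distance two, and \<open>x\<close>, \<open>b\<close> and five vertices of the cycle do.
\<close>

lemma seven_cycle_dominates:
  assumes no5: "\<And>c0 c1 c2 c3 c4. \<not> five_cycle E V c0 c1 c2 c3 c4"
    and z: "E z0 z1" "E z1 z2" "E z2 z3" "E z3 z4" "E z4 z5" "E z5 z6" "E z6 z0"
    and b: "E z0 b" "E b x"
  shows "\<exists>z\<in>{z0, z1, z2, z3, z4, z5, z6}. E z x"
proof (rule ccontr)
  assume "\<not> ?thesis"
  then have x: "\<not> E z0 x" "\<not> E z1 x" "\<not> E z2 x" "\<not> E z3 x" "\<not> E z4 x" "\<not> E z5 x" "\<not> E z6 x"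
    by auto
  have z': "E z1 z0" "E z2 z1" "E z3 z2" "E z4 z3" "E z5 z4" "E z6 z5" "E z0 z6" using z sym by blast+
  have n5: False if "E c0 c1" "E c1 c2" "E c2 c3" "E c3 c4" "E c4 c0" for c0 c1 c2 c3 c4
  proof -
    have "five_cycle E V c0 c1 c2 c3 c4" by unfold_locales (use that in blast)+
    then show False using no5 by blast
  qed
  have t: "\<not> E z0 z2" "\<not> E z1 z3" "\<not> E z2 z4" "\<not> E z3 z5" "\<not> E z4 z6" "\<not> E z5 z0" "\<not> E z6 z1"
    using z tri sym by blast+
  have f: "\<not> E z0 z3" "\<not> E z1 z4" "\<not> E z2 z5" "\<not> E z3 z6" "\<not> E z4 z0" "\<not> E z5 z1" "\<not> E z6 z2"
    using n5[OF z(4-7)] n5[OF z(5-7) z(1)] n5[OF z(6-7) z(1,2)] n5[OF z(7) z(1-3)]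
      n5[OF z(1-4)] n5[OF z(2-5)] n5[OF z(3-6)] by blast+
  have bt: "\<not> E b z1" "\<not> E b z6" using b z tri sym by blast+
  have bf: "\<not> E b z3" "\<not> E b z4"
    using n5[of b z0 z1 z2 z3] n5[of b z4 z5 z6 z0] z b sym by blast+
  have bb: "\<not> (E b z2 \<and> E b z5)" using n5[of b z2 z3 z4 z5] z sym by blast
  note N = t f bt bf x z z' b
  have N': "\<not> E u v \<Longrightarrow> \<not> E v u" for u v using sym by blast
  consider "E b z2" "\<not> E b z5" | "E b z5" "\<not> E b z2" | "\<not> E b z2" "\<not> E b z5" using bb by blast
  then show False
  proof cases
    case 1
    show False
      by (rule p7[of x b z2 z3 z4 z5 z6]) (use N 1 sym in \<open>blast intro: N'\<close>)+
  next
    case 2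
    show False
      by (rule p7[of x b z5 z4 z3 z2 z1]) (use N 2 sym in \<open>blast intro: N'\<close>)+
  next
    case 3
    show False
      by (rule p7[of b z0 z1 z2 z3 z4 z5]) (use N 3 sym in \<open>blast intro: N'\<close>)+
  qed
qed

text \<open>
  Restricting lists of size two and propagating without conflict never harms: a vertex whose list
  was left alone keeps the colour that \<open>f\<close> gives it, and a vertex whose list shrank has one colour left,
  which closedness removed from the lists of its neighbours.
\<close>

lemma two_list_step:
  assumes f: "proper f" "\<And>v. v \<in> V \<Longrightarrow> f v \<in> L v" and L: "\<And>v. v \<in> V \<Longrightarrow> L v \<subseteq> {0, 1, 2} \<and> card (L v) \<le> 2"
    and L': "closed_lists L'" "\<And>v. v \<in> V \<Longrightarrow> L' v \<subseteq> L v \<and> L' v \<noteq> {}"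
  obtains g where "proper g" "\<And>v. v \<in> V \<Longrightarrow> g v \<in> L' v"
proof
  define g where "g v = (if L' v = L v then f v else (SOME c. c \<in> L' v))" for v
  show gin: "g v \<in> L' v" if "v \<in> V" for v
    using f(2)[OF that] L'(2)[OF that] unfolding g_def by (auto intro: someI)
  have single: "L' v = {g v}" if "v \<in> V" "L' v \<noteq> L v" for v
  proof -
    have fin: "finite (L v)" using L[OF that(1)] finite_subset by blast
    have "L' v \<subset> L v" using L'(2)[OF that(1)] that(2) by blast
    then have "card (L' v) < card (L v)" by (rule psubset_card_mono[OF fin])
    then have "card (L' v) < 2" using L[OF that(1)] by simp
    moreover have "card (L' v) \<noteq> 0"
      using fin L'(2)[OF that(1)] finite_subset[of "L' v" "L v"] by auto
    ultimately have "card (L' v) = 1" by simp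
    then obtain d where "L' v = {d}" using card_1_singletonE by blast
    then show ?thesis using gin[OF that(1)] by simp
  qed
  have V: "u \<in> V" "v \<in> V" if "E u v" for u v using dom that sym by blast+
  have half: "g u \<noteq> g v" if e: "E u v" and ch: "L' u \<noteq> L u" for u v
  proof -
    have "L' u = {g u}" using single[OF V(1)[OF e] ch] .
    then have "L' u \<inter> L' v = {}" using L'(1) e unfolding closed_lists_def by fastforce
    then show ?thesis using gin[OF V(1)[OF e]] gin[OF V(2)[OF e]] by auto
  qed
  have "g u \<noteq> g v" if "E u v" for u v
  proof (cases "L' u = L u \<and> L' v = L v")
    case True
    then show ?thesis using f(1) that unfolding g_def proper_def by simp
  next
    case False
    then show ?thesis using half[OF that] half[OF sym[OF that]] by metis
  qed
  moreover have "g v < 3" if "v \<in> V" for v using gin[OF that] L'(2)[OF that] L[OF that] by auto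
  ultimately show "proper g" unfolding proper_def by blast
qed

end

text \<open>
  A shortest closed odd walk outside the neighbourhood of \<open>r\<close> is an induced cycle. It has length
  seven, since the graph has neither triangles nor five-cycles, and cycles of length nine or more
  contain a path on seven vertices. By \<open>seven_cycle_dominates\<close> and connectivity it dominates \<open>r\<close>.
\<close>

lemma (in conn_graph) no_five_cycle_colouring:
  assumes no5: "\<And>c0 c1 c2 c3 c4. \<not> five_cycle E V c0 c1 c2 c3 c4"
  shows "\<exists>f. proper f \<and> (\<forall>v\<in>V. f v \<in> (if E r v then {2} else {0, 1}))"
proof -
  define R where "R = {(u, v). E u v \<and> \<not> E r u \<and> \<not> E r v}"
  have symR: "sym R" unfolding R_def sym_def using sym by blast
  have noodd: "(u, u) \<notin> R ^^ k" if "odd k" for u k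
  proof
    assume "(u, u) \<in> R ^^ k"
    with \<open>odd k\<close> have "\<exists>k. odd k \<and> (\<exists>u. (u, u) \<in> R ^^ k)" by blast
    then obtain n where n: "odd n" "\<exists>u. (u, u) \<in> R ^^ n"
      and least: "\<And>m. m < n \<Longrightarrow> odd m \<Longrightarrow> (u, u) \<notin> R ^^ m" for u
      using exists_least_iff[of "\<lambda>k. odd k \<and> (\<exists>u. (u, u) \<in> R ^^ k)"] by auto
    then obtain w where w0: "w 0 = w n" and w: "\<And>i. i < n \<Longrightarrow> (w i, w (Suc i)) \<in> R"
      unfolding relpow_fun_conv by metis
    have seg: "(w i, w (i + j)) \<in> R ^^ j" if "i + j \<le> n" for i j
      using that
    proof (induction j)
      case (Suc j)
      then show ?case using w[of "i + j"] by auto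
    qed simp
    have wE: "E (w i) (w (Suc i))" if "i < n" for i using w[OF that] by (simp add: R_def)
    have chord: "\<not> E (w i) (w j)" if ij: "i + 2 \<le> j" "j < n" "\<not> (i = 0 \<and> j = n - 1)" for i j
    proof
      assume "E (w i) (w j)"
      then have e: "(w i, w j) \<in> R" "(w j, w i) \<in> R"
        using w[of i] w[of j] ij sym[of "w i" "w j"] unfolding R_def by simp_all
      have s1: "(w i, w j) \<in> R ^^ (j - i)" using seg[of i "j - i"] ij by simp
      have s2: "(w j, w i) \<in> R ^^ (n - j + i)"
      proof -
        have "(w j, w n) \<in> R ^^ (n - j)" using seg[of j "n - j"] ij by simp
        moreover have "(w n, w i) \<in> R ^^ i" using seg[of 0 i] ij w0 by simp
        ultimately show ?thesis unfolding relpow_add by blast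
      qed
      have c1: "(w i, w i) \<in> R ^^ (j - i + 1)" using relpow_Suc_I[OF s1 e(2)] by simp
      have c2: "(w j, w j) \<in> R ^^ (n - j + i + 1)" using relpow_Suc_I[OF s2 e(1)] by simp
      have "(j - i + 1) + (n - j + i + 1) = n + 2" using ij by simp
      then have "odd (j - i + 1) \<or> odd (n - j + i + 1)" using n(1) by (metis even_add even_numeral)
      moreover have "j - i + 1 < n" "n - j + i + 1 < n" using ij by auto
      ultimately show False using least c1 c2 by blast
    qed
    have "n = 1 \<or> n = 3 \<or> n = 5 \<or> n = 7 \<or> n \<ge> 8" using n(1) by presburger
    then consider "n = 1" | "n = 3" | "n = 5" | "n = 7" | "n \<ge> 8" by blast
    then show False
    proof cases
      case 1
      then show False using wE[of 0] w0 irrefl by auto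
    next
      case 2
      then have "E (w 0) (w 1)" "E (w 1) (w 2)" "E (w 2) (w 0)"
        using wE[of 0] wE[of 1] wE[of 2] w0 by (simp_all add: numeral_eq_Suc)
      then show False using tri sym by blast
    next
      case 3
      have "five_cycle E V (w 0) (w 1) (w 2) (w 3) (w 4)"
        by unfold_locales (use wE[of 0] wE[of 1] wE[of 2] wE[of 3] wE[of 4] w0 3 in \<open>simp_all add: numeral_eq_Suc\<close>)
      then show False using no5 by blast
    next
      case 4
      have z: "E (w 0) (w 1)" "E (w 1) (w 2)" "E (w 2) (w 3)" "E (w 3) (w 4)" "E (w 4) (w 5)"
        "E (w 5) (w 6)" "E (w 6) (w 0)"
        using wE[of 0] wE[of 1] wE[of 2] wE[of 3] wE[of 4] wE[of 5] wE[of 6] w0 4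
        by (simp_all add: numeral_eq_Suc)
      define S where "S = {v. \<exists>z\<in>{w 0, w 1, w 2, w 3, w 4, w 5, w 6}. E z v}"
      have "v \<in> S" if "u \<in> S" "E u v" for u v
      proof -
        from that(1) consider "E (w 0) u" | "E (w 1) u" | "E (w 2) u" | "E (w 3) u" | "E (w 4) u"
          | "E (w 5) u" | "E (w 6) u" unfolding S_def by auto
        then show ?thesis
        proof cases
          case 1 then show ?thesis using seven_cycle_dominates[OF no5 z 1 that(2)] unfolding S_def by blast
        next
          case 2 then show ?thesis
            using seven_cycle_dominates[OF no5 z(2-7) z(1) 2 that(2)] unfolding S_def by blast
        next
          case 3 then show ?thesis
            using seven_cycle_dominates[OF no5 z(3-7) z(1-2) 3 that(2)] unfolding S_def by blast
        next
          case 4 then show ?thesis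
            using seven_cycle_dominates[OF no5 z(4-7) z(1-3) 4 that(2)] unfolding S_def by blast
        next
          case 5 then show ?thesis
            using seven_cycle_dominates[OF no5 z(5-7) z(1-4) 5 that(2)] unfolding S_def by blast
        next
          case 6 then show ?thesis
            using seven_cycle_dominates[OF no5 z(6-7) z(1-5) 6 that(2)] unfolding S_def by blast
        next
          case 7 then show ?thesis
            using seven_cycle_dominates[OF no5 z(7) z(1-6) 7 that(2)] unfolding S_def by blast
        qed
      qed
      moreover have "w 1 \<in> S" "w 1 \<in> V" using z dom unfolding S_def by blast+
      ultimately have "r \<in> S" using conn_any[of "w 1" S] root by blast
      then have "\<exists>i\<in>{0, 1, 2, 3, 4, 5, 6}. E (w i) r" unfolding S_def by simp
      then obtain i where "i \<in> {0, 1, 2, 3, 4, 5, 6}" "E (w i) r" by blast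
      then have "i < n" "E (w i) r" using 4 by auto
      then show False using w[of i] sym unfolding R_def by blast
    next
      case 5
      show False
      proof (rule p7[of "w 0" "w 1" "w 2" "w 3" "w 4" "w 5" "w 6"])
        show "E (w 0) (w 1)" "E (w 1) (w 2)" "E (w 2) (w 3)" "E (w 3) (w 4)" "E (w 4) (w 5)" "E (w 5) (w 6)"
          using wE[of 0] wE[of 1] wE[of 2] wE[of 3] wE[of 4] wE[of 5] 5 by (simp_all add: numeral_eq_Suc)
      qed (rule chord; use 5 in simp)+
    qed
  qed
  obtain p :: "'a \<Rightarrow> bool" where "\<forall>u v. (u, v) \<in> R \<longrightarrow> p u \<noteq> p v"
    using two_colouring_of_no_odd_walk[OF symR noodd] ..
  then have p: "p u \<noteq> p v" if "(u, v) \<in> R" for u v using that by simp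
  define f where "f v = (if E r v then 2 else if p v then 1 else (0::nat))" for v
  have "f u \<noteq> f v" if "E u v" for u v
  proof -
    have "\<not> (E r u \<and> E r v)" using that tri by blast
    moreover have "p u \<noteq> p v" if "\<not> E r u" "\<not> E r v"
      using p[of u v] that \<open>E u v\<close> unfolding R_def by blast
    ultimately show ?thesis unfolding f_def by simp
  qed
  then have "proper f" unfolding proper_def by (auto simp: f_def)
  moreover have "f v \<in> (if E r v then {2} else {0, 1})" for v unfolding f_def by simp
  ultimately show ?thesis by blast
qed

section \<open>A language with variables and arrays, and its compilation\<close>

text \<open>
  A value \<open>Rd x y\<close> is entry \<open>y\<close> of array \<open>x\<close>; arrays are addressed by numbers, so a
  program can compute which row of a matrix it reads.
\<close>

datatype exp = N nat | X nat | Bin binop exp exp | Rd exp exp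
datatype bexp = Lt exp exp | Eq exp exp
datatype cmd = SKIP | Asg nat exp | Wr exp exp exp | SEQ cmd cmd | IF bexp cmd cmd | WHILE bexp cmd

type_synonym env = "nat \<Rightarrow> nat"
type_synonym arrays = "nat \<Rightarrow> nat \<Rightarrow> nat"

fun xval :: "env \<Rightarrow> arrays \<Rightarrow> exp \<Rightarrow> nat" where
  "xval e A (N k) = k"
| "xval e A (X v) = e v"
| "xval e A (Bin f x y) = arith f (xval e A x) (xval e A y)"
| "xval e A (Rd x y) = A (xval e A x) (xval e A y)"

fun xcost :: "exp \<Rightarrow> nat" where
  "xcost (N k) = 1"
| "xcost (X v) = 1"
| "xcost (Bin f x y) = xcost x + xcost y + 1"
| "xcost (Rd x y) = xcost x + xcost y + 3"

fun bval :: "env \<Rightarrow> arrays \<Rightarrow> bexp \<Rightarrow> bool" where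
  "bval e A (Lt x y) \<longleftrightarrow> xval e A x < xval e A y"
| "bval e A (Eq x y) \<longleftrightarrow> xval e A x = xval e A y"

fun bcost :: "bexp \<Rightarrow> nat" where
  "bcost (Lt x y) = xcost x + xcost y + 1"
| "bcost (Eq x y) = xcost x + xcost y + 1"

text \<open>
  Expressions are evaluated on a stack of odd registers. The even registers hold the variables, and
  register 1 the length \<open>K\<close> of an array.
\<close>

definition T :: "nat \<Rightarrow> nat" where
  "T d = 2 * d + 3"

fun cx :: "nat \<Rightarrow> exp \<Rightarrow> program" where
  "cx d (N k) = Move (T d) (Const k)"
| "cx d (X v) = Move (T d) (Reg (2 * v))"
| "cx d (Bin f x y) = Seq (cx d x) (Seq (cx (Suc d) y) (Arith (T d) f (Reg (T d)) (Reg (T (Suc d)))))"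
| "cx d (Rd x y) = Seq (cx d x) (Seq (cx (Suc d) y)
     (Seq (Arith (T d) Times (Reg (T d)) (Reg 1))
     (Seq (Arith (T d) Plus (Reg (T d)) (Reg (T (Suc d)))) (Load (T d) (Reg (T d))))))"

fun cb :: "bexp \<Rightarrow> program" where
  "cb (Lt x y) = Seq (cx 0 x) (cx 1 y)"
| "cb (Eq x y) = Seq (cx 0 x) (cx 1 y)"

fun ct :: "bexp \<Rightarrow> test" where
  "ct (Lt x y) = Less (Reg (T 0)) (Reg (T 1))"
| "ct (Eq x y) = Equal (Reg (T 0)) (Reg (T 1))"

fun cc :: "cmd \<Rightarrow> program" where
  "cc SKIP = Skip"
| "cc (Asg v x) = Seq (cx 0 x) (Move (2 * v) (Reg (T 0)))"
| "cc (Wr j i x) = Seq (cx 0 j) (Seq (cx 1 i) (Seq (cx 2 x)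
     (Seq (Arith (T 0) Times (Reg (T 0)) (Reg 1))
     (Seq (Arith (T 0) Plus (Reg (T 0)) (Reg (T 1))) (Store (Reg (T 0)) (Reg (T 2)))))))"
| "cc (SEQ c d) = Seq (cc c) (cc d)"
| "cc (IF b c d) = Seq (cb b) (Cond (ct b) (cc c) (cc d))"
| "cc (WHILE b c) = Seq (cb b) (While (ct b) (Seq (cc c) (cb b)))"

definition FOR :: "nat \<Rightarrow> exp \<Rightarrow> cmd \<Rightarrow> cmd" where
  "FOR v x c = SEQ (Asg v (N 0)) (WHILE (Lt (X v) x) (SEQ c (Asg v (Bin Plus (X v) (N 1)))))"

text \<open>
  There are \<open>J\<close> arrays of length \<open>K\<close>, stored one after the other, and every address must fit into a
  word.
\<close>

locale machine =
  fixes M K J :: nat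
  assumes K: "0 < K" and M: "1 < M" and KJ: "K * J \<le> M"
begin

text \<open>
  Evaluation does not get stuck: every intermediate value is a word, and every array access is within
  bounds.
\<close>

fun xok :: "env \<Rightarrow> arrays \<Rightarrow> exp \<Rightarrow> bool" where
  "xok e A (N k) \<longleftrightarrow> k < M"
| "xok e A (X v) \<longleftrightarrow> True"
| "xok e A (Bin f x y) \<longleftrightarrow> xok e A x \<and> xok e A y \<and> arith f (xval e A x) (xval e A y) < M"
| "xok e A (Rd x y) \<longleftrightarrow> xok e A x \<and> xok e A y \<and> xval e A x < J \<and> xval e A y < K"

fun bok :: "env \<Rightarrow> arrays \<Rightarrow> bexp \<Rightarrow> bool" where
  "bok e A (Lt x y) \<longleftrightarrow> xok e A x \<and> xok e A y"
| "bok e A (Eq x y) \<longleftrightarrow> xok e A x \<and> xok e A y"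

text \<open>
  The postcondition depends on the elapsed time. A loop needs an invariant and a bound on the time
  at which the invariant can hold; as every iteration takes time, the bound also proves termination.
\<close>

primrec wp :: "cmd \<Rightarrow> (nat \<Rightarrow> env \<Rightarrow> arrays \<Rightarrow> bool) \<Rightarrow> nat \<Rightarrow> env \<Rightarrow> arrays \<Rightarrow> bool" where
  "wp SKIP Q = (\<lambda>\<tau> e A. Q (\<tau> + 1) e A)"
| "wp (Asg v x) Q = (\<lambda>\<tau> e A. xok e A x \<and> Q (\<tau> + (xcost x + 1)) (e(v := xval e A x)) A)"
| "wp (Wr j i x) Q = (\<lambda>\<tau> e A. xok e A j \<and> xok e A i \<and> xok e A x \<and> xval e A j < J \<and> xval e A i < K \<and>
     Q (\<tau> + (xcost j + xcost i + xcost x + 3)) e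
       (A(xval e A j := (A (xval e A j))(xval e A i := xval e A x))))"
| "wp (SEQ c d) Q = wp c (wp d Q)"
| "wp (IF b c d) Q = (\<lambda>\<tau> e A. bok e A b \<and>
     (if bval e A b then wp c Q (\<tau> + bcost b) e A else wp d Q (\<tau> + bcost b) e A))"
| "wp (WHILE b c) Q = (\<lambda>\<tau> e A. \<exists>I B. I \<tau> e A \<and> (\<forall>\<tau> e A. I \<tau> e A \<longrightarrow> \<tau> \<le> (B::nat) \<and> bok e A b \<and>
     (if bval e A b then wp c I (\<tau> + bcost b) e A else Q (\<tau> + bcost b) e A)))"

lemma wp_mono:
  assumes "wp c Q \<tau> e A" "\<And>\<tau> e A. Q \<tau> e A \<Longrightarrow> R \<tau> e A"
  shows "wp c R \<tau> e A"
  using assms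
proof (induction c arbitrary: Q R \<tau> e A)
  case (SEQ c d)
  from SEQ.prems(1) have "wp c (wp d Q) \<tau> e A" by simp
  then have "wp c (wp d R) \<tau> e A" by (rule SEQ.IH(1)) (rule SEQ.IH(2), assumption, rule SEQ.prems(2))
  then show ?case by simp
next
  case (IF b c d)
  then show ?case by (auto split: if_splits)
next
  case (WHILE b c)
  from WHILE.prems(1) obtain I B where "I \<tau> e A" "\<forall>\<tau> e A. I \<tau> e A \<longrightarrow> \<tau> \<le> (B::nat) \<and> bok e A b \<and>
     (if bval e A b then wp c I (\<tau> + bcost b) e A else Q (\<tau> + bcost b) e A)" by auto
  then show ?case using WHILE.prems(2)
    by (auto intro!: exI[of _ I] exI[of _ B])
qed auto

text \<open>
  The boundedness clauses spare the program logic from tracking the size of values that are merely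
  copied.
\<close>

definition rep :: "state \<Rightarrow> env \<Rightarrow> arrays \<Rightarrow> bool" where
  "rep s e A \<longleftrightarrow> (\<forall>v. reg s (2 * v) = e v) \<and> reg s 1 = K \<and>
     (\<forall>j i. i < K \<longrightarrow> mem s (K * j + i) = A j i) \<and> (\<forall>r. reg s r < M) \<and> (\<forall>a. mem s a < M)"

lemma rep_temp:
  assumes "rep s e A" "x < M"
  shows "rep (s\<lparr>reg := (reg s)(T d := x)\<rparr>) e A"
proof -
  have "2 * v \<noteq> T d" "T d \<noteq> Suc 0" for v unfolding T_def by presburger+
  then show ?thesis using assms unfolding rep_def by (auto simp: eq_commute)
qed

lemma addr: assumes "j < J" "i < K" shows "j * K + i < M"
proof -
  have "j * K + i < (j + 1) * K" using assms by simp
  also have "\<dots> \<le> J * K" using assms by (intro mult_right_mono) auto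
  finally show ?thesis using KJ by (simp add: mult.commute)
qed

lemma T_eq [simp]: "T a = T b \<longleftrightarrow> a = b" unfolding T_def by simp

lemma T_ne [simp]: "T a \<noteq> 1" "T a \<noteq> Suc 0" "1 \<noteq> T a" "Suc 0 \<noteq> T a" "T a \<noteq> 2 * v" "2 * v \<noteq> T a"
  unfolding T_def by presburger+

lemma cx_correct:
  assumes "rep s e A" "xok e A x"
  shows "\<exists>s'. exec M (cx d x) s (xcost x) s' \<and> rep s' e A \<and> reg s' (T d) = xval e A x \<and>
    (\<forall>k<d. reg s' (T k) = reg s (T k))"
  using assms
proof (induction x arbitrary: s d)
  case (N k)
  then show ?case
    using exec.Move[of s "Const k" M "T d"] rep_temp[OF N(1), of k d] by (intro exI[of _ "s\<lparr>reg := (reg s)(T d := k)\<rparr>"]) auto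
next
  case (X v)
  have v: "reg s (2 * v) = e v" "reg s (2 * v) < M" using X(1) unfolding rep_def by blast+
  then show ?case
    using exec.Move[of s "Reg (2 * v)" M "T d"] rep_temp[OF X(1), of "e v" d]
    by (intro exI[of _ "s\<lparr>reg := (reg s)(T d := e v)\<rparr>"]) auto
next
  case (Bin f x y)
  from Bin.prems obtain s1 where s1: "exec M (cx d x) s (xcost x) s1" "rep s1 e A"
    "reg s1 (T d) = xval e A x" "\<forall>k<d. reg s1 (T k) = reg s (T k)" using Bin.IH(1)[of s d] by auto
  from Bin.prems obtain s2 where s2: "exec M (cx (Suc d) y) s1 (xcost y) s2" "rep s2 e A"
    "reg s2 (T (Suc d)) = xval e A y" "\<forall>k<Suc d. reg s2 (T k) = reg s1 (T k)"
    using Bin.IH(2)[of s1 "Suc d"] s1 by auto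
  let ?z = "arith f (xval e A x) (xval e A y)"
  have z: "?z < M" using Bin.prems by simp
  have "exec M (Arith (T d) f (Reg (T d)) (Reg (T (Suc d)))) s2 1 (s2\<lparr>reg := (reg s2)(T d := ?z)\<rparr>)"
    using exec.Arith[of f s2 "Reg (T d)" "Reg (T (Suc d))" M "T d"] z s1(3) s2(3,4) by simp
  from exec.Seq[OF s1(1) exec.Seq[OF s2(1) this]]
  have "exec M (cx d (Bin f x y)) s (xcost (Bin f x y)) (s2\<lparr>reg := (reg s2)(T d := ?z)\<rparr>)"
    by (simp add: add.assoc)
  then show ?case using rep_temp[OF s2(2) z, of d] s1(4) s2(4)
    by (intro exI[of _ "s2\<lparr>reg := (reg s2)(T d := ?z)\<rparr>"]) auto
next
  case (Rd x y)
  from Rd.prems obtain s1 where s1: "exec M (cx d x) s (xcost x) s1" "rep s1 e A"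
    "reg s1 (T d) = xval e A x" "\<forall>k<d. reg s1 (T k) = reg s (T k)" using Rd.IH(1)[of s d] by auto
  from Rd.prems obtain s2 where s2: "exec M (cx (Suc d) y) s1 (xcost y) s2" "rep s2 e A"
    "reg s2 (T (Suc d)) = xval e A y" "\<forall>k<Suc d. reg s2 (T k) = reg s1 (T k)"
    using Rd.IH(2)[of s1 "Suc d"] s1 by auto
  have ji: "xval e A x < J" "xval e A y < K" using Rd.prems by auto
  let ?j = "xval e A x" and ?i = "xval e A y"
  have a: "?j * K + ?i < M" "?j * K < M" using addr[OF ji] by auto
  define s3 where "s3 = s2\<lparr>reg := (reg s2)(T d := ?j * K)\<rparr>"
  define s4 where "s4 = s3\<lparr>reg := (reg s3)(T d := ?j * K + ?i)\<rparr>"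
  define s5 where "s5 = s4\<lparr>reg := (reg s4)(T d := A ?j ?i)\<rparr>"
  have r3: "rep s3 e A" unfolding s3_def by (rule rep_temp[OF s2(2) a(2)])
  have r4: "rep s4 e A" unfolding s4_def by (rule rep_temp[OF r3 a(1)])
  have "mem s4 (K * ?j + ?i) = A ?j ?i" using r4 ji unfolding rep_def by blast
  then have m: "mem s4 (?j * K + ?i) = A ?j ?i" by (simp add: mult.commute)
  have ml: "A ?j ?i < M" using r4 m unfolding rep_def by metis
  have r5: "rep s5 e A" unfolding s5_def by (rule rep_temp[OF r4 ml])
  have K1: "reg s2 1 = K" using s2(2) unfolding rep_def by blast
  have e3: "exec M (Arith (T d) Times (Reg (T d)) (Reg 1)) s2 1 s3"
    using exec.Arith[of Times s2 "Reg (T d)" "Reg 1" M "T d"] a s1(3) s2(4) K1 unfolding s3_def by simp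
  have e4: "exec M (Arith (T d) Plus (Reg (T d)) (Reg (T (Suc d)))) s3 1 s4"
    using exec.Arith[of Plus s3 "Reg (T d)" "Reg (T (Suc d))" M "T d"] a s2(3) unfolding s4_def s3_def by simp
  have e5: "exec M (Load (T d) (Reg (T d))) s4 1 s5"
    using exec.Load[of s4 "Reg (T d)" M "T d"] a m ml unfolding s5_def s4_def by simp
  from exec.Seq[OF s1(1) exec.Seq[OF s2(1) exec.Seq[OF e3 exec.Seq[OF e4 e5]]]]
  have "exec M (cx d (Rd x y)) s (xcost (Rd x y)) s5"
    by (simp add: add.assoc numeral_eq_Suc)
  moreover have "reg s5 (T d) = A ?j ?i" "\<forall>k<d. reg s5 (T k) = reg s (T k)"
    using s1(4) s2(4) unfolding s5_def s4_def s3_def by auto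
  ultimately show ?case using r5 by auto
qed

lemma cb_correct:
  assumes "rep s e A" "bok e A b"
  shows "\<exists>s'. exec M (cb b) s (bcost b - 1) s' \<and> rep s' e A \<and> (holds s' (ct b) \<longleftrightarrow> bval e A b) \<and> bcost b \<ge> 1"
proof -
  obtain x y where b: "b = Lt x y \<or> b = Eq x y" by (cases b) auto
  then have ok: "xok e A x" "xok e A y" using assms(2) by auto
  obtain s1 where s1: "exec M (cx 0 x) s (xcost x) s1" "rep s1 e A" "reg s1 (T 0) = xval e A x"
    using cx_correct[OF assms(1) ok(1), of 0] by auto
  obtain s2 where s2: "exec M (cx 1 y) s1 (xcost y) s2" "rep s2 e A" "reg s2 (T 1) = xval e A y"
    "reg s2 (T 0) = reg s1 (T 0)" using cx_correct[OF s1(2) ok(2), of 1] by auto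
  from exec.Seq[OF s1(1) s2(1)] show ?thesis using b s1(3) s2 by (intro exI[of _ s2]) auto
qed

lemma rep_var:
  assumes "rep s e A" "x < M"
  shows "rep (s\<lparr>reg := (reg s)(2 * v := x)\<rparr>) (e(v := x)) A"
proof -
  have "2 * v \<noteq> Suc 0" by presburger
  then show ?thesis using assms unfolding rep_def by auto
qed

lemma rep_mem:
  assumes r: "rep s e A" and x: "x < M" and i: "i < K"
  shows "rep (s\<lparr>mem := (mem s)(j * K + i := x)\<rparr>) e (A(j := (A j)(i := x)))"
proof -
  have "j = j' \<and> i = i'" if "K * j' + i' = j * K + i" "i' < K" for j' i'
  proof -
    have "(K * j' + i') div K = j'" "(K * j' + i') mod K = i'" using that(2) by auto
    moreover have "(K * j + i) div K = j" "(K * j + i) mod K = i" using i by auto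
    ultimately show ?thesis using that(1) by (simp add: mult.commute)
  qed
  then show ?thesis using r x i unfolding rep_def by (auto simp: mult.commute)
qed

text \<open>
  Induction on the program; for a loop, a second induction on the time left until the bound.
\<close>

theorem wp_sound:
  assumes "wp c Q \<tau> e A" "rep s e A"
  shows "\<exists>t s' e' A'. exec M (cc c) s t s' \<and> rep s' e' A' \<and> Q (\<tau> + t) e' A'"
  using assms
proof (induction c arbitrary: Q \<tau> e A s)
  case SKIP
  then show ?case using exec.Skip[of M s] by fastforce
next
  case (Asg v x)
  then obtain s1 where s1: "exec M (cx 0 x) s (xcost x) s1" "rep s1 e A" "reg s1 (T 0) = xval e A x"
    using cx_correct[of s e A x 0] by auto
  have l: "xval e A x < M" using s1(2,3) unfolding rep_def by metis
  have "exec M (Move (2 * v) (Reg (T 0))) s1 1 (s1\<lparr>reg := (reg s1)(2 * v := xval e A x)\<rparr>)"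
    using exec.Move[of s1 "Reg (T 0)" M "2 * v"] s1(3) l by simp
  from exec.Seq[OF s1(1) this] rep_var[OF s1(2) l] Asg.prems(1) show ?case by fastforce
next
  case (Wr j i x)
  then have ok: "xok e A j" "xok e A i" "xok e A x" "xval e A j < J" "xval e A i < K" by auto
  obtain s1 where s1: "exec M (cx 0 j) s (xcost j) s1" "rep s1 e A" "reg s1 (T 0) = xval e A j"
    using cx_correct[OF Wr.prems(2) ok(1), of 0] by auto
  obtain s2 where s2: "exec M (cx 1 i) s1 (xcost i) s2" "rep s2 e A" "reg s2 (T 1) = xval e A i"
    "reg s2 (T 0) = reg s1 (T 0)" using cx_correct[OF s1(2) ok(2), of 1] by auto
  obtain s3 where s3: "exec M (cx 2 x) s2 (xcost x) s3" "rep s3 e A" "reg s3 (T 2) = xval e A x"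
    "reg s3 (T 0) = reg s2 (T 0)" "reg s3 (T 1) = reg s2 (T 1)"
    using cx_correct[OF s2(2) ok(3), of 2] by auto
  let ?j = "xval e A j" and ?i = "xval e A i" and ?x = "xval e A x"
  have a: "?j * K + ?i < M" "?j * K < M" using addr[OF ok(4,5)] by auto
  have l: "?x < M" using s3(2,3) unfolding rep_def by metis
  define s4 where "s4 = s3\<lparr>reg := (reg s3)(T 0 := ?j * K)\<rparr>"
  define s5 where "s5 = s4\<lparr>reg := (reg s4)(T 0 := ?j * K + ?i)\<rparr>"
  define s6 where "s6 = s5\<lparr>mem := (mem s5)(?j * K + ?i := ?x)\<rparr>"
  have r4: "rep s4 e A" unfolding s4_def by (rule rep_temp[OF s3(2) a(2)])
  have r5: "rep s5 e A" unfolding s5_def by (rule rep_temp[OF r4 a(1)])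
  have r6: "rep s6 e (A(?j := (A ?j)(?i := ?x)))" unfolding s6_def by (rule rep_mem[OF r5 l ok(5)])
  have K1: "reg s3 1 = K" using s3(2) unfolding rep_def by blast
  have e4: "exec M (Arith (T 0) Times (Reg (T 0)) (Reg 1)) s3 1 s4"
    using exec.Arith[of Times s3 "Reg (T 0)" "Reg 1" M "T 0"] a s1(3) s2(4) s3(4) K1 unfolding s4_def by simp
  have e5: "exec M (Arith (T 0) Plus (Reg (T 0)) (Reg (T 1))) s4 1 s5"
    using exec.Arith[of Plus s4 "Reg (T 0)" "Reg (T 1)" M "T 0"] a s2(3) s3(5) unfolding s5_def s4_def by simp
  have e6: "exec M (Store (Reg (T 0)) (Reg (T 2))) s5 1 s6"
    using exec.Store[of s5 "Reg (T 0)" M "Reg (T 2)"] a l s3(3) unfolding s6_def s5_def s4_def by simp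
  from exec.Seq[OF s1(1) exec.Seq[OF s2(1) exec.Seq[OF s3(1) exec.Seq[OF e4 exec.Seq[OF e5 e6]]]]]
  have "exec M (cc (Wr j i x)) s (xcost j + xcost i + xcost x + 3) s6"
    by (simp add: add.assoc numeral_eq_Suc)
  then show ?case using r6 Wr.prems(1) by auto
next
  case (SEQ c d)
  from SEQ.prems have "wp c (wp d Q) \<tau> e A" by simp
  from SEQ.IH(1)[OF this SEQ.prems(2)] obtain t1 s1 e1 A1 where
    1: "exec M (cc c) s t1 s1" "rep s1 e1 A1" "wp d Q (\<tau> + t1) e1 A1" by blast
  from SEQ.IH(2)[OF 1(3,2)] obtain t2 s2 e2 A2 where
    2: "exec M (cc d) s1 t2 s2" "rep s2 e2 A2" "Q (\<tau> + t1 + t2) e2 A2" by blast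
  show ?case using exec.Seq[OF 1(1) 2(1)] 2 by (auto simp: add.assoc)
next
  case (IF b c d)
  then have "bok e A b" by simp
  from cb_correct[OF IF.prems(2) this] obtain s1 where
    1: "exec M (cb b) s (bcost b - 1) s1" "rep s1 e A" "holds s1 (ct b) \<longleftrightarrow> bval e A b" "bcost b \<ge> 1"
    by blast
  show ?case
  proof (cases "bval e A b")
    case True
    then obtain t s2 e2 A2 where 2: "exec M (cc c) s1 t s2" "rep s2 e2 A2" "Q (\<tau> + bcost b + t) e2 A2"
      using IF.prems(1) IF.IH(1)[OF _ 1(2), of Q "\<tau> + bcost b"] by auto
    have "exec M (cc (IF b c d)) s (bcost b - 1 + (1 + t)) s2"
      using exec.Seq[OF 1(1) exec.CondTrue[OF _ 2(1)]] 1(3) True by simp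
    moreover have "bcost b - 1 + (1 + t) = bcost b + t" using 1(4) by simp
    ultimately show ?thesis using 2 by (auto simp: add.assoc)
  next
    case False
    then obtain t s2 e2 A2 where 2: "exec M (cc d) s1 t s2" "rep s2 e2 A2" "Q (\<tau> + bcost b + t) e2 A2"
      using IF.prems(1) IF.IH(2)[OF _ 1(2), of Q "\<tau> + bcost b"] by auto
    have "exec M (cc (IF b c d)) s (bcost b - 1 + (1 + t)) s2"
      using exec.Seq[OF 1(1) exec.CondFalse[OF _ 2(1)]] 1(3) False by simp
    moreover have "bcost b - 1 + (1 + t) = bcost b + t" using 1(4) by simp
    ultimately show ?thesis using 2 by (auto simp: add.assoc)
  qed
next
  case (WHILE b c)
  from WHILE.prems(1) obtain I B where I: "I \<tau> e A"
    and step: "\<And>\<tau> e A. I \<tau> e A \<Longrightarrow> \<tau> \<le> (B::nat) \<and> bok e A b \<and>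
      (if bval e A b then wp c I (\<tau> + bcost b) e A else Q (\<tau> + bcost b) e A)" by auto
  have "\<exists>t s' e' A'. exec M (While (ct b) (Seq (cc c) (cb b))) s1 t s' \<and> rep s' e' A' \<and>
      Q (\<tau> + (bcost b - 1) + t) e' A'"
    if "I \<tau> e A" "rep s1 e A" "holds s1 (ct b) \<longleftrightarrow> bval e A b" "bcost b \<ge> 1" for \<tau> e A s1
    using that
  proof (induction "B - \<tau>" arbitrary: \<tau> e A s1 rule: less_induct)
    case less
    note st = step[OF less.prems(1)]
    show ?case
    proof (cases "bval e A b")
      case False
      then show ?thesis
        using exec.WhileFalse[of s1 "ct b" M "Seq (cc c) (cb b)"] less.prems st
        by (intro exI[of _ 1] exI[of _ s1] exI[of _ e] exI[of _ A]) auto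
    next
      case True
      then have "wp c I (\<tau> + bcost b) e A" using st by simp
      from WHILE.IH[OF this less.prems(2)] obtain t2 s2 e2 A2 where
        2: "exec M (cc c) s1 t2 s2" "rep s2 e2 A2" "I (\<tau> + bcost b + t2) e2 A2" by blast
      from step[OF 2(3)] have st2: "\<tau> + bcost b + t2 \<le> B" "bok e2 A2 b" by auto
      from cb_correct[OF 2(2) st2(2)] obtain s3 where
        3: "exec M (cb b) s2 (bcost b - 1) s3" "rep s3 e2 A2" "holds s3 (ct b) \<longleftrightarrow> bval e2 A2 b" by blast
      have "B - (\<tau> + bcost b + t2) < B - \<tau>" using st2(1) less.prems(4) by simp
      from less.hyps[OF this 2(3) 3(2,3) less.prems(4)] obtain t4 s4 e4 A4 where
        4: "exec M (While (ct b) (Seq (cc c) (cb b))) s3 t4 s4" "rep s4 e4 A4"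
          "Q (\<tau> + bcost b + t2 + (bcost b - 1) + t4) e4 A4" by blast
      have "exec M (While (ct b) (Seq (cc c) (cb b))) s1 (1 + (t2 + (bcost b - 1)) + t4) s4"
        using exec.WhileTrue[OF _ exec.Seq[OF 2(1) 3(1)] 4(1)] True less.prems(3) by simp
      moreover have "\<tau> + (bcost b - 1) + (1 + (t2 + (bcost b - 1)) + t4) =
          \<tau> + bcost b + t2 + (bcost b - 1) + t4" using less.prems(4) by simp
      ultimately show ?thesis using 4 by metis
    qed
  qed
  moreover from cb_correct[OF WHILE.prems(2)] step[OF I] obtain s1 where
    1: "exec M (cb b) s (bcost b - 1) s1" "rep s1 e A" "holds s1 (ct b) \<longleftrightarrow> bval e A b" "bcost b \<ge> 1"
    by blast
  ultimately obtain t s' e' A' where 2: "exec M (While (ct b) (Seq (cc c) (cb b))) s1 t s'" "rep s' e' A'"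
    "Q (\<tau> + (bcost b - 1) + t) e' A'" using I by blast
  have "exec M (cc (WHILE b c)) s (bcost b - 1 + t) s'" using exec.Seq[OF 1(1) 2(1)] by simp
  then show ?case using 2(2,3) by (metis add.assoc)
qed

lemma wp_FOR:
  assumes n: "n < M"
    and init: "I 0 (\<tau> + 2) (e(v := 0)) A"
    and inv: "\<And>k \<tau> e A. I k \<tau> e A \<Longrightarrow> k \<le> n \<and> e v = k \<and> xok e A x \<and> xval e A x = n \<and> \<tau> \<le> B"
    and body: "\<And>k \<tau> e A. I k \<tau> e A \<Longrightarrow> k < n \<Longrightarrow>
      wp c (\<lambda>\<tau>' e' A'. e' v = k \<and> I (Suc k) (\<tau>' + 4) (e'(v := Suc k)) A') (\<tau> + (xcost x + 2)) e A"
    and fin: "\<And>\<tau> e A. I n \<tau> e A \<Longrightarrow> Q (\<tau> + (xcost x + 2)) e A"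
  shows "wp (FOR v x c) Q \<tau> e A"
proof -
  let ?I = "\<lambda>\<tau> e A. \<exists>k. I k \<tau> e A"
  let ?c = "SEQ c (Asg v (Bin Plus (X v) (N 1)))"
  have step: "\<tau> \<le> B \<and> bok e A (Lt (X v) x) \<and> (if bval e A (Lt (X v) x)
      then wp ?c ?I (\<tau> + bcost (Lt (X v) x)) e A else Q (\<tau> + bcost (Lt (X v) x)) e A)"
    if k: "I k \<tau> e A" for k \<tau> e A
  proof (cases "k < n")
    case True
    have "wp c (\<lambda>\<tau> e A. xok e A (Bin Plus (X v) (N 1)) \<and>
        ?I (\<tau> + (xcost (Bin Plus (X v) (N 1)) + 1)) (e(v := xval e A (Bin Plus (X v) (N 1)))) A)
      (\<tau> + (xcost x + 2)) e A"
      by (rule wp_mono[OF body[OF k True]])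
        (use True n M in \<open>auto intro!: exI[of _ "Suc k"] simp: eval_nat_numeral\<close>)
    then show ?thesis using True inv[OF k] by simp
  next
    case False
    then have "k = n" using inv[OF k] by simp
    then show ?thesis using fin[of \<tau> e A] k inv[OF k] by simp
  qed
  have "wp (WHILE (Lt (X v) x) ?c) Q (\<tau> + 2) (e(v := 0)) A"
    unfolding wp.simps(6)
    by (intro exI[of _ ?I] exI[of _ B]) (use init step in blast)
  then show ?thesis using M unfolding FOR_def by simp
qed

text \<open>
  The form used for almost all loops: the body takes time at most \<open>D\<close> in every round, and the
  invariant does not mention time.
\<close>

lemma wp_FOR_const:
  assumes n: "n < M"
    and init: "P 0 (e(v := 0)) A"
    and x: "\<And>k e A. P k e A \<Longrightarrow> k \<le> n \<Longrightarrow> xok e A x \<and> xval e A x = n"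
    and body: "\<And>k \<tau> e A. k < n \<Longrightarrow> P k e A \<Longrightarrow> e v = k \<Longrightarrow>
      wp c (\<lambda>\<tau>' e' A'. \<tau>' \<le> \<tau> + D \<and> e' v = k \<and> P (Suc k) (e'(v := Suc k)) A') \<tau> e A"
    and fin: "\<And>\<tau>' e' A'. \<tau>' \<le> \<tau> + n * (D + xcost x + 6) + xcost x + 4 \<Longrightarrow> e' v = n \<Longrightarrow> P n e' A' \<Longrightarrow> Q \<tau>' e' A'"
  shows "wp (FOR v x c) Q \<tau> e A"
proof (rule wp_FOR[where I = "\<lambda>k \<tau>' e A. k \<le> n \<and> e v = k \<and> P k e A \<and> \<tau>' \<le> \<tau> + 2 + k * (D + xcost x + 6)"
      and B = "\<tau> + 2 + n * (D + xcost x + 6)" and n = n])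
  fix k \<tau>' e A assume k: "k \<le> n \<and> e v = k \<and> P k e A \<and> \<tau>' \<le> \<tau> + 2 + k * (D + xcost x + 6)"
  have "k * (D + xcost x + 6) \<le> n * (D + xcost x + 6)" using k by (intro mult_right_mono) auto
  then show "k \<le> n \<and> e v = k \<and> xok e A x \<and> xval e A x = n \<and> \<tau>' \<le> \<tau> + 2 + n * (D + xcost x + 6)"
    using k x[of k e A] by (meson add_le_cancel_left le_trans)
  assume "k < n"
  show "wp c (\<lambda>\<tau>'' e' A'. e' v = k \<and> Suc k \<le> n \<and> (e'(v := Suc k)) v = Suc k \<and>
      P (Suc k) (e'(v := Suc k)) A' \<and> \<tau>'' + 4 \<le> \<tau> + 2 + Suc k * (D + xcost x + 6)) (\<tau>' + (xcost x + 2)) e A"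
    by (rule wp_mono[OF body[OF \<open>k < n\<close>]]) (use k \<open>k < n\<close> in auto)
qed (use n init fin in auto)

end

section \<open>Colour lists in memory\<close>

abbreviation plus_exp (infixl "\<oplus>" 65) where "x \<oplus> y \<equiv> Bin Plus x y"
abbreviation minus_exp (infixl "\<ominus>" 65) where "x \<ominus> y \<equiv> Bin Minus x y"
abbreviation times_exp (infixl "\<otimes>" 70) where "x \<otimes> y \<equiv> Bin Times x y"
abbreviation div_exp (infixl "\<oslash>" 70) where "x \<oslash> y \<equiv> Bin Div x y"

abbreviation seq_cmd (infixr ";;" 55) where "c ;; d \<equiv> SEQ c d"

text \<open>
  The layout common to all parts of the program follows. Variables: 0 and 1 hold the numbers of
  vertices and edges, 2 the size of the current component, 3 whether all components so far were coloured,
  4 the root of the component, 5 and 6 the ends of the queue, 7 whether a list has become empty, 8 and up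
  are temporary. Arrays: 0 is input and output, 1 holds the degrees, 2 the component marks (the root plus
  one), 3 the colours found, 4 the vertices of the current component, 5 the queue, 6 the five-cycle, 10 to
  12 the lists (row \<open>10 + c\<close> tells who may have colour c), 13 to 15 a copy of them, \<open>20 + v\<close> the row of v
  in the adjacency matrix and \<open>20 + n + v\<close> the list of its neighbours.

  This program removes colour (variable 9) from the list of a vertex (variable 8). A vertex enters the
  queue at the moment when one colour remains.
\<close>

definition REM :: cmd where
  "REM = IF (Eq (Rd (N 10 \<oplus> X 9) (X 8)) (N 1))
     (Wr (N 10 \<oplus> X 9) (X 8) (N 0) ;;
      Asg 13 (Rd (N 10) (X 8) \<oplus> Rd (N 11) (X 8) \<oplus> Rd (N 12) (X 8)) ;;
      IF (Eq (X 13) (N 1)) (Wr (N 5) (X 6) (X 8) ;; Asg 6 (X 6 \<oplus> N 1))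
        (IF (Eq (X 13) (N 0)) (Asg 7 (N 1)) SKIP))
     SKIP"

definition RESTRICT :: cmd where
  "RESTRICT =
     IF (Eq (X 10) (N 0)) SKIP (Asg 9 (N 0) ;; REM) ;;
     IF (Eq (X 10) (N 1)) SKIP (Asg 9 (N 1) ;; REM) ;;
     IF (Eq (X 10) (N 2)) SKIP (Asg 9 (N 2) ;; REM)"

text \<open>
  For a list with a single element, row 11 plus twice row 12 is that element. After a failure the queue
  is emptied to end the propagation.
\<close>

definition VISIT :: cmd where
  "VISIT =
     Asg 11 (Rd (N 5) (X 5)) ;;
     Asg 5 (X 5 \<oplus> N 1) ;;
     Asg 9 (Rd (N 11) (X 11) \<oplus> N 2 \<otimes> Rd (N 12) (X 11)) ;;
     FOR 12 (Rd (N 1) (X 11)) (Asg 8 (Rd (N 20 \<oplus> X 0 \<oplus> X 11) (X 12)) ;; REM) ;;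
     IF (Eq (X 7) (N 0)) SKIP (Asg 5 (X 6))"

definition PROPAGATE :: cmd where
  "PROPAGATE = IF (Eq (X 7) (N 0)) (WHILE (Lt (X 5) (X 6)) VISIT) (Asg 5 (X 6))"

text \<open>
  The frame of a program: everything outside \<open>S\<close> is unchanged.
\<close>

definition keep :: "nat set \<Rightarrow> (nat \<Rightarrow> 'b) \<Rightarrow> (nat \<Rightarrow> 'b) \<Rightarrow> bool" where
  "keep S e e' \<longleftrightarrow> (\<forall>r. r \<notin> S \<longrightarrow> e' r = e r)"

lemma keep_refl: "keep S e e" unfolding keep_def by simp
lemma keep_trans: "keep S e e' \<Longrightarrow> keep S e' e'' \<Longrightarrow> keep S e e''" unfolding keep_def by simp
lemma keep_mono: "keep S e e' \<Longrightarrow> S \<subseteq> S' \<Longrightarrow> keep S' e e'" unfolding keep_def by blast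
lemma keepD: "keep S e e' \<Longrightarrow> r \<notin> S \<Longrightarrow> e' r = e r" unfolding keep_def by blast

lemma card_colours:
  assumes "S \<subseteq> {0, 1, 2::nat}"
  shows "card S = of_bool (0 \<in> S) + of_bool (1 \<in> S) + of_bool (2 \<in> S)"
proof -
  have "card S = (\<Sum>x\<in>{0, 1, 2}. of_bool (x \<in> S))"
    using assms by (simp add: sum.If_cases of_bool_def Int_absorb1 Int_absorb2 Collect_conj_eq inf_absorb2)
  then show ?thesis by simp
qed

text \<open>
  One component \<open>V\<close> inside a graph with \<open>n\<close> vertices and \<open>m\<close> edges, with an enumeration of its
  vertices and of the neighbours of each of them.
\<close>

locale comp_machine = machine M K J + p7_graph E V
  for M K J :: nat and E :: "nat \<Rightarrow> nat \<Rightarrow> bool" and V :: "nat set" +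
  fixes n m nc :: nat and vc deg :: "nat \<Rightarrow> nat" and nb :: "nat \<Rightarrow> nat \<Rightarrow> nat"
  assumes Vn: "V \<subseteq> {..<n}" and vc: "vc ` {..<nc} = V" and nc: "nc = card V"
    and nb: "v \<in> V \<Longrightarrow> nb v ` {..<deg v} = {w. E v w}"
    and degsum: "sum deg V \<le> 2 * m"
    and Kn: "n + 2 * m + 10 \<le> K" and Jn: "20 + 2 * n < J"
begin

text \<open>
  What the colouring of a component reads but never writes.
\<close>

definition static :: "env \<Rightarrow> arrays \<Rightarrow> bool" where
  "static e A \<longleftrightarrow> e 0 = n \<and> e 2 = nc \<and> (\<forall>i<nc. A 4 i = vc i) \<and>
     (\<forall>v\<in>V. A 1 v = deg v \<and> (\<forall>i<deg v. A (20 + n + v) i = nb v i) \<and>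
       (\<forall>w\<in>V. A (20 + v) w = of_bool (E v w)))"

lemma static_keep:
  assumes "static e A" "keep S e e'" "keep S' A A'" "0 \<notin> S" "2 \<notin> S" "S' \<subseteq> {5..15}"
  shows "static e' A'"
proof -
  have "e' 0 = e 0" "e' 2 = e 2" using assms keepD by metis+
  moreover have "A' 1 = A 1" "A' 4 = A 4" "\<And>v. A' (20 + v) = A (20 + v)" "\<And>v. A' (20 + n + v) = A (20 + n + v)"
    using assms(6) by (intro keepD[OF assms(3)]; force)+
  ultimately show ?thesis using assms(1) unfolding static_def by simp
qed

lemma small: "x \<le> 2 * K \<Longrightarrow> x < M" "x \<le> J \<Longrightarrow> x < M"
proof -
  have "2 * K < K * 21" "K * 21 \<le> K * J" using Kn Jn by simp_all
  then show "x \<le> 2 * K \<Longrightarrow> x < M" using KJ by linarith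
  have "J < 10 * J" "10 * J \<le> K * J" using Kn Jn by simp_all
  then show "x \<le> J \<Longrightarrow> x < M" using KJ by linarith
qed

lemma nc_le: "nc \<le> n" using card_mono[OF _ Vn] nc by simp

lemma V_less: "v \<in> V \<Longrightarrow> v < n" using Vn by auto

lemma deg_le: "v \<in> V \<Longrightarrow> deg v \<le> 2 * m"
  using member_le_sum[of v V deg] fin degsum by fastforce

lemma bounds:
  "v \<in> V \<Longrightarrow> v < K" "v \<in> V \<Longrightarrow> deg v < K" "nc < K" "n < K" "v \<in> V \<Longrightarrow> 20 + n + v < J" "v \<in> V \<Longrightarrow> 20 + v < J"
  using V_less[of v] deg_le[of v] Kn nc_le Jn by auto

text \<open>
  The lists \<open>L\<close> are stored in memory, and every vertex whose list has one element waits in the queue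
  unless its colour has been removed from its neighbours already. The set \<open>Y\<close> holds the vertex that is being
  processed, which is in neither state. The bound on variable 6 says that the queue has room for all
  vertices whose colour is still undecided.
\<close>

definition lstate :: "nat set \<Rightarrow> (nat \<Rightarrow> nat set) \<Rightarrow> env \<Rightarrow> arrays \<Rightarrow> bool" where
  "lstate Y L e A \<longleftrightarrow> static e A \<and> (\<forall>v\<in>V. L v \<subseteq> {0, 1, 2}) \<and>
     (\<forall>v\<in>V. \<forall>c<3. A (10 + c) v = of_bool (c \<in> L v)) \<and>
     e 5 \<le> e 6 \<and> e 6 + card {v \<in> V. 2 \<le> card (L v)} \<le> nc \<and>
     (\<forall>i. e 5 \<le> i \<and> i < e 6 \<longrightarrow> A 5 i \<in> V \<and> (e 7 = 0 \<longrightarrow> card (L (A 5 i)) = 1)) \<and>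
     (e 7 = 0 \<longleftrightarrow> (\<forall>v\<in>V. L v \<noteq> {})) \<and>
     (e 7 = 0 \<longrightarrow> (\<forall>v\<in>V. v \<notin> Y \<longrightarrow> card (L v) = 1 \<longrightarrow>
        (\<exists>i. e 5 \<le> i \<and> i < e 6 \<and> A 5 i = v) \<or> (\<forall>w. E v w \<longrightarrow> L v \<inter> L w = {})))"

text \<open>
  The potential for amortised analysis: each vertex is charged \<open>wt\<close> once, when it leaves the queue.
\<close>

definition pot :: "(nat \<Rightarrow> nat) \<Rightarrow> (nat \<Rightarrow> nat set) \<Rightarrow> env \<Rightarrow> arrays \<Rightarrow> nat" where
  "pot wt L e A = (\<Sum>v | v \<in> V \<and> 2 \<le> card (L v). wt v) + (\<Sum>i = e 5..<e 6. wt (A 5 i))"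

lemma lstate_rep: "lstate Y L e A \<Longrightarrow> v \<in> V \<Longrightarrow> c < 3 \<Longrightarrow> A (10 + c) v = of_bool (c \<in> L v)"
  unfolding lstate_def by blast

lemma lstateD:
  assumes "lstate Y L e A"
  shows lstate_static: "static e A"
    and lstate_sub: "v \<in> V \<Longrightarrow> L v \<subseteq> {0, 1, 2}"
    and lstate_len: "e 5 \<le> e 6" "e 6 + card {v \<in> V. 2 \<le> card (L v)} \<le> nc"
    and lstate_queue: "e 5 \<le> i \<Longrightarrow> i < e 6 \<Longrightarrow> A 5 i \<in> V"
      "e 5 \<le> i \<Longrightarrow> i < e 6 \<Longrightarrow> e 7 = 0 \<Longrightarrow> card (L (A 5 i)) = 1"
    and lstate_fail: "e 7 = 0 \<longleftrightarrow> (\<forall>v\<in>V. L v \<noteq> {})"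
    and lstate_closed: "e 7 = 0 \<Longrightarrow> v \<in> V \<Longrightarrow> v \<notin> Y \<Longrightarrow> card (L v) = 1 \<Longrightarrow>
        (\<exists>i. e 5 \<le> i \<and> i < e 6 \<and> A 5 i = v) \<or> (\<forall>w. E v w \<longrightarrow> L v \<inter> L w = {})"
proof -
  note d = assms[unfolded lstate_def]
  note d1 = d[THEN conjunct1] and d2 = d[THEN conjunct2, THEN conjunct1]
  note r3 = d[THEN conjunct2, THEN conjunct2, THEN conjunct2]
  note r5 = r3[THEN conjunct2, THEN conjunct2]
  note r7 = r5[THEN conjunct2, THEN conjunct2]
  show "static e A" by (rule d1)
  show "v \<in> V \<Longrightarrow> L v \<subseteq> {0, 1, 2}" using d2 by blast
  show "e 5 \<le> e 6" by (rule r3[THEN conjunct1])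
  show "e 6 + card {v \<in> V. 2 \<le> card (L v)} \<le> nc" by (rule r3[THEN conjunct2, THEN conjunct1])
  show "e 5 \<le> i \<Longrightarrow> i < e 6 \<Longrightarrow> A 5 i \<in> V" using r5[THEN conjunct1] by blast
  show "e 5 \<le> i \<Longrightarrow> i < e 6 \<Longrightarrow> e 7 = 0 \<Longrightarrow> card (L (A 5 i)) = 1" using r5[THEN conjunct1] by blast
  show "e 7 = 0 \<longleftrightarrow> (\<forall>v\<in>V. L v \<noteq> {})" by (rule r5[THEN conjunct2, THEN conjunct1])
  show "e 7 = 0 \<Longrightarrow> v \<in> V \<Longrightarrow> v \<notin> Y \<Longrightarrow> card (L v) = 1 \<Longrightarrow>
        (\<exists>i. e 5 \<le> i \<and> i < e 6 \<and> A 5 i = v) \<or> (\<forall>w. E v w \<longrightarrow> L v \<inter> L w = {})"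
    using r7[THEN mp, THEN bspec, of v] by simp
qed

lemma lstate_fin: "lstate Y L e A \<Longrightarrow> v \<in> V \<Longrightarrow> finite (L v)"
  by (rule finite_subset[OF lstate_sub]) auto

lemma lstate_card:
  assumes "lstate Y L e A" "v \<in> V"
  shows "A 10 v + A 11 v + A 12 v = card (L v)"
  using lstate_rep[OF assms, of 0] lstate_rep[OF assms, of 1] lstate_rep[OF assms, of 2]
    card_colours[OF lstate_sub[OF assms]] by simp

text \<open>
  The potential cannot grow because a vertex enters the queue only when its list drops from two
  colours to one.
\<close>

lemma wp_REM:
  assumes l: "lstate Y L e A" and v: "e 8 = v" "v \<in> V" and c: "e 9 = c" "c < 3"
  shows "wp REM (\<lambda>\<tau>' e' A'. \<tau>' \<le> \<tau> + 80 \<and> lstate Y (L(v := L v - {c})) e' A' \<and>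
    keep {6, 7, 13} e e' \<and> keep {5, 10, 11, 12} A A' \<and>
    (\<forall>wt. pot wt (L(v := L v - {c})) e' A' \<le> pot wt L e A)) \<tau> e A"
proof (cases "c \<in> L v")
  case False
  have "A (10 + c) v = 0" using lstate_rep[OF l v(2) c(2)] False by simp
  then show ?thesis
    using False l v c bounds(1)[OF v(2)] Jn by (simp add: REM_def keep_refl fun_upd_idem small)
next
  case True
  define L' where "L' = L(v := L v - {c})"
  define A1 where "A1 = A(10 + c := (A (10 + c))(v := 0))"
  have Lsub: "L v \<subseteq> {0, 1, 2}" and finL: "finite (L v)"
    using lstate_sub[OF l v(2)] lstate_fin[OF l v(2)] .
  have cardL': "card (L' v) = card (L v) - 1" "card (L v) > 0"
    using True finL unfolding L'_def by (auto simp: card_gt_0_iff)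
  have rep: "A1 (10 + d) u = of_bool (d \<in> L' u)" if "u \<in> V" "d < 3" for u d
    using lstate_rep[OF l that] unfolding A1_def L'_def by auto
  have sub: "L' u \<subseteq> {0, 1, 2}" if "u \<in> V" for u
    using lstate_sub[OF l that] unfolding L'_def by auto
  have sum1: "A1 10 v + A1 11 v + A1 12 v = card (L' v)"
    using rep[OF v(2), of 0] rep[OF v(2), of 1] rep[OF v(2), of 2] card_colours[OF sub[OF v(2)]] by simp
  have static: "static e A" by (rule lstate_static[OF l])
  have len: "e 5 \<le> e 6" "e 6 + card {v \<in> V. 2 \<le> card (L v)} \<le> nc" by (rule lstate_len[OF l])+
  have Ac: "A (10 + c) v = 1" using lstate_rep[OF l v(2) c(2)] True by simp
  have small': "card (L' v) \<le> 3" using card_mono[OF _ sub[OF v(2)]] by simp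
  have A1_5: "A1 5 = A 5" unfolding A1_def by simp
  have k1: "keep {5, 10, 11, 12} A A1" unfolding A1_def keep_def using c(2) by auto
  have others: "L' u = L u" if "u \<noteq> v" for u using that unfolding L'_def by simp
  have finV: "finite {u \<in> V. 2 \<le> card (L u)}" using fin by simp
  have clos: "L' u \<inter> L' w = {}" if "L u \<inter> L w = {}" for u w
    using that unfolding L'_def by auto
  consider "card (L v) = 1" | "card (L v) = 2" | "card (L v) \<ge> 3" using cardL' by linarith
  then have "\<exists>e' A'. (\<forall>Q. (\<forall>\<tau>'. \<tau>' \<le> \<tau> + 80 \<longrightarrow> Q \<tau>' e' A') \<longrightarrow> wp REM Q \<tau> e A) \<and>
    lstate Y L' e' A' \<and> keep {6, 7, 13} e e' \<and> keep {5, 10, 11, 12} A A' \<and>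
    (\<forall>wt. pot wt L' e' A' \<le> pot wt L e A)"
  proof cases
    case 1
    then have e0: "L' v = {}" using cardL' finL unfolding L'_def by (metis card_0_eq diff_self_eq_0 finite_Diff fun_upd_same)
    let ?e = "e(13 := card (L' v), 7 := 1)"
    have set2: "{u \<in> V. 2 \<le> card (L' u)} = {u \<in> V. 2 \<le> card (L u)}"
    proof -
      have "2 \<le> card (L' u) \<longleftrightarrow> 2 \<le> card (L u)" for u
      proof (cases "u = v")
        case False
        show ?thesis unfolding others[OF False] by simp
      qed (use 1 e0 in simp)
      then show ?thesis by simp
    qed
    have "wp REM Q \<tau> e A" if "\<forall>\<tau>'. \<tau>' \<le> \<tau> + 80 \<longrightarrow> Q \<tau>' ?e A1" for Q
      using that v c Ac sum1 e0 small bounds(1)[OF v(2)] Jn A1_5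
      by (simp add: REM_def small A1_def[symmetric] fun_upd_same fun_upd_other del: fun_upd_apply)
    moreover have "lstate Y L' ?e A1"
      unfolding lstate_def
    proof (intro conjI)
      show "static ?e A1" by (rule static_keep[OF static _ k1, of "{7, 13}"]) (auto simp: keep_def)
      show "\<forall>v\<in>V. L' v \<subseteq> {0, 1, 2}" using sub by blast
      show "\<forall>v\<in>V. \<forall>c<3. A1 (10 + c) v = of_bool (c \<in> L' v)" using rep by simp
      show "?e 5 \<le> ?e 6" "?e 6 + card {v \<in> V. 2 \<le> card (L' v)} \<le> nc" using len set2 by simp_all
      show "\<forall>i. ?e 5 \<le> i \<and> i < ?e 6 \<longrightarrow> A1 5 i \<in> V \<and> (?e 7 = 0 \<longrightarrow> card (L' (A1 5 i)) = 1)"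
        using lstate_queue(1)[OF l] A1_5 by simp
      show "?e 7 = 0 \<longleftrightarrow> (\<forall>v\<in>V. L' v \<noteq> {})" using e0 v(2) by auto
    qed simp
    moreover have "pot wt L' ?e A1 \<le> pot wt L e A" for wt
      unfolding pot_def using set2 A1_5 by simp
    moreover have "keep {6, 7, 13} e ?e" by (simp add: keep_def)
    ultimately show ?thesis using k1 by blast
  next
    case 2
    let ?e = "e(13 := 1, 6 := Suc (e 6))"
    let ?A = "A1(5 := (A 5)(e 6 := v))"
    have c1: "card (L' v) = 1" using 2 cardL' by simp
    have set2: "{u \<in> V. 2 \<le> card (L u)} = insert v {u \<in> V. 2 \<le> card (L' u)}"
    proof -
      have "2 \<le> card (L u) \<longleftrightarrow> u = v \<or> 2 \<le> card (L' u)" for u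
      proof (cases "u = v")
        case False
        show ?thesis unfolding others[OF False] using False by simp
      qed (use 2 in simp)
      then show ?thesis using v(2) by (intro set_eqI) (simp only: mem_Collect_eq insert_iff, blast)
    qed
    have vn: "v \<notin> {u \<in> V. 2 \<le> card (L' u)}" using c1 by simp
    have cset: "card {u \<in> V. 2 \<le> card (L u)} = Suc (card {u \<in> V. 2 \<le> card (L' u)})"
      unfolding set2 using vn fin by simp
    have e6: "e 6 < nc" using len(2) cset by simp
    have "wp REM Q \<tau> e A" if "\<forall>\<tau>'. \<tau>' \<le> \<tau> + 80 \<longrightarrow> Q \<tau>' ?e ?A" for Q
      using that v c Ac sum1 c1 small bounds(1)[OF v(2)] bounds(3) Jn A1_5 e6
      by (simp add: REM_def small A1_def[symmetric] fun_upd_same fun_upd_other del: fun_upd_apply)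
    moreover have "lstate Y L' ?e ?A"
      unfolding lstate_def
    proof (intro conjI)
      have "keep {5, 10, 11, 12} A ?A" using k1 unfolding keep_def by auto
      then show "static ?e ?A" using static_keep[OF static, of "{6, 13}" ?e "{5, 10, 11, 12}" ?A]
        by (simp add: keep_def)
      show "\<forall>v\<in>V. L' v \<subseteq> {0, 1, 2}" using sub by blast
      show "\<forall>v\<in>V. \<forall>c<3. ?A (10 + c) v = of_bool (c \<in> L' v)" using rep by simp
      show "?e 5 \<le> ?e 6" using len by simp
      show "?e 6 + card {v \<in> V. 2 \<le> card (L' v)} \<le> nc" using len cset by simp
      show "\<forall>i. ?e 5 \<le> i \<and> i < ?e 6 \<longrightarrow> ?A 5 i \<in> V \<and> (?e 7 = 0 \<longrightarrow> card (L' (?A 5 i)) = 1)"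
      proof (intro allI impI)
        fix i assume i: "?e 5 \<le> i \<and> i < ?e 6"
        show "?A 5 i \<in> V \<and> (?e 7 = 0 \<longrightarrow> card (L' (?A 5 i)) = 1)"
        proof (cases "i = e 6")
          case True
          then show ?thesis using v(2) c1 by simp
        next
          case False
          then have i': "e 5 \<le> i" "i < e 6" using i by auto
          then have p: "A 5 i \<in> V" "e 7 = 0 \<longrightarrow> card (L (A 5 i)) = 1" using lstate_queue[OF l i'] by blast+
          then have "e 7 = 0 \<longrightarrow> A 5 i \<noteq> v" using 2 by auto
          then show ?thesis using p False others by auto
        qed
      qed
      have "L' v \<noteq> {}" using c1 by auto
      moreover have "L v \<noteq> {}" using 2 by auto
      ultimately have "L' u = {} \<longleftrightarrow> L u = {}" for u using others by (cases "u = v") auto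
      then show "?e 7 = 0 \<longleftrightarrow> (\<forall>v\<in>V. L' v \<noteq> {})" using lstate_fail[OF l] by simp
      show "?e 7 = 0 \<longrightarrow> (\<forall>u\<in>V. u \<notin> Y \<longrightarrow> card (L' u) = 1 \<longrightarrow>
        (\<exists>i. ?e 5 \<le> i \<and> i < ?e 6 \<and> ?A 5 i = u) \<or> (\<forall>w. E u w \<longrightarrow> L' u \<inter> L' w = {}))"
      proof (intro impI ballI)
        fix u assume u: "?e 7 = 0" "u \<in> V" "u \<notin> Y" "card (L' u) = 1"
        show "(\<exists>i. ?e 5 \<le> i \<and> i < ?e 6 \<and> ?A 5 i = u) \<or> (\<forall>w. E u w \<longrightarrow> L' u \<inter> L' w = {})"
        proof (cases "u = v")
          case True
          then show ?thesis using len by (intro disjI1 exI[of _ "e 6"]) simp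
        next
          case False
          then have "(\<exists>i. e 5 \<le> i \<and> i < e 6 \<and> A 5 i = u) \<or> (\<forall>w. E u w \<longrightarrow> L u \<inter> L w = {})"
            using lstate_closed[OF l, of u] u others by simp
          then show ?thesis
          proof
            assume "\<exists>i. e 5 \<le> i \<and> i < e 6 \<and> A 5 i = u"
            then obtain i where "e 5 \<le> i" "i < e 6" "A 5 i = u" by blast
            then show ?thesis by (intro disjI1 exI[of _ i]) simp
          qed (use clos in blast)
        qed
      qed
    qed
    moreover have "pot wt L' ?e ?A \<le> pot wt L e A" for wt
    proof -
      have "(\<Sum>u | u \<in> V \<and> 2 \<le> card (L u). wt u) = wt v + (\<Sum>u | u \<in> V \<and> 2 \<le> card (L' u). wt u)"
        unfolding set2 using vn fin by simp
      moreover have "(\<Sum>i = ?e 5..<?e 6. wt (?A 5 i)) = (\<Sum>i = e 5..<e 6. wt (A 5 i)) + wt v"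
        using len by simp
      ultimately show ?thesis unfolding pot_def by simp
    qed
    moreover have "keep {6, 7, 13} e ?e" "keep {5, 10, 11, 12} A ?A" using k1 by (auto simp: keep_def)
    ultimately show ?thesis by blast
  next
    case 3
    let ?e = "e(13 := card (L' v))"
    have c2: "card (L' v) \<ge> 2" using 3 cardL' by simp
    have set2: "{u \<in> V. 2 \<le> card (L' u)} = {u \<in> V. 2 \<le> card (L u)}"
    proof -
      have "2 \<le> card (L' u) \<longleftrightarrow> 2 \<le> card (L u)" for u
      proof (cases "u = v")
        case False
        show ?thesis unfolding others[OF False] by simp
      qed (use 3 c2 in simp)
      then show ?thesis by simp
    qed
    have "wp REM Q \<tau> e A" if "\<forall>\<tau>'. \<tau>' \<le> \<tau> + 80 \<longrightarrow> Q \<tau>' ?e A1" for Q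
      using that v c Ac sum1 c2 small bounds(1)[OF v(2)] bounds(3) Jn A1_5 small'
      by (simp add: REM_def small A1_def[symmetric] fun_upd_same fun_upd_other del: fun_upd_apply)
    moreover have "lstate Y L' ?e A1"
      unfolding lstate_def
    proof (intro conjI)
      show "static ?e A1" by (rule static_keep[OF static _ k1, of "{13}"]) (auto simp: keep_def)
      show "\<forall>v\<in>V. L' v \<subseteq> {0, 1, 2}" using sub by blast
      show "\<forall>v\<in>V. \<forall>c<3. A1 (10 + c) v = of_bool (c \<in> L' v)" using rep by simp
      show "?e 5 \<le> ?e 6" "?e 6 + card {v \<in> V. 2 \<le> card (L' v)} \<le> nc" using len set2 by simp_all
      have q: "A 5 i \<in> V \<and> (e 7 = 0 \<longrightarrow> card (L (A 5 i)) = 1)" if "e 5 \<le> i" "i < e 6" for i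
        using lstate_queue[OF l that] by blast
      then have "e 7 = 0 \<longrightarrow> A 5 i \<noteq> v" if "e 5 \<le> i" "i < e 6" for i using that 3 by fastforce
      then show "\<forall>i. ?e 5 \<le> i \<and> i < ?e 6 \<longrightarrow> A1 5 i \<in> V \<and> (?e 7 = 0 \<longrightarrow> card (L' (A1 5 i)) = 1)"
        using q others by (auto simp: A1_5)
      have "L' v \<noteq> {}" "L v \<noteq> {}" using c2 3 by auto
      then have "L' u = {} \<longleftrightarrow> L u = {}" for u using others by (cases "u = v") auto
      then show "?e 7 = 0 \<longleftrightarrow> (\<forall>v\<in>V. L' v \<noteq> {})" using lstate_fail[OF l] by simp
      have "e 7 = 0 \<Longrightarrow> u \<in> V \<Longrightarrow> u \<notin> Y \<Longrightarrow> card (L u) = 1 \<Longrightarrow>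
        (\<exists>i. e 5 \<le> i \<and> i < e 6 \<and> A 5 i = u) \<or> (\<forall>w. E u w \<longrightarrow> L u \<inter> L w = {})" for u
        by (rule lstate_closed[OF l])
      moreover have "card (L' u) = 1 \<Longrightarrow> card (L u) = 1" for u using c2 others by (cases "u = v") auto
      moreover have n1: "5 \<noteq> (13::nat)" and n2: "6 \<noteq> (13::nat)" and n3: "7 \<noteq> (13::nat)" by simp_all
      ultimately show "?e 7 = 0 \<longrightarrow> (\<forall>u\<in>V. u \<notin> Y \<longrightarrow> card (L' u) = 1 \<longrightarrow>
        (\<exists>i. ?e 5 \<le> i \<and> i < ?e 6 \<and> A1 5 i = u) \<or> (\<forall>w. E u w \<longrightarrow> L' u \<inter> L' w = {}))"
        using clos unfolding A1_5 fun_upd_other[OF n1] fun_upd_other[OF n2] fun_upd_other[OF n3] by blast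
    qed
    moreover have "pot wt L' ?e A1 \<le> pot wt L e A" for wt
      unfolding pot_def using set2 A1_5 by simp
    moreover have "keep {6, 7, 13} e ?e" by (simp add: keep_def)
    ultimately show ?thesis using k1 by blast
  qed
  then obtain e' A' where *: "\<And>Q. (\<forall>\<tau>'. \<tau>' \<le> \<tau> + 80 \<longrightarrow> Q \<tau>' e' A') \<Longrightarrow> wp REM Q \<tau> e A"
    "lstate Y L' e' A'" "keep {6, 7, 13} e e'" "keep {5, 10, 11, 12} A A'"
    "\<forall>wt. pot wt L' e' A' \<le> pot wt L e A" by blast
  show ?thesis by (rule *(1)) (use *(2-5) in \<open>simp add: L'_def\<close>)
qed

end

section \<open>Propagation\<close>

definition COPY_LISTS :: "nat \<Rightarrow> nat \<Rightarrow> cmd" where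
  "COPY_LISTS a b = FOR 14 (X 2)
     (Asg 8 (Rd (N 4) (X 14)) ;;
      Wr (N a) (X 8) (Rd (N b) (X 8)) ;;
      Wr (N (a + 1)) (X 8) (Rd (N (b + 1)) (X 8)) ;;
      Wr (N (a + 2)) (X 8) (Rd (N (b + 2)) (X 8)))"

definition INIT_LISTS :: cmd where
  "INIT_LISTS = Asg 5 (N 0) ;; Asg 6 (N 0) ;; Asg 7 (N 0) ;;
     FOR 14 (X 2)
       (Asg 8 (Rd (N 4) (X 14)) ;;
        Wr (N 10) (X 8) (N 1) ;; Wr (N 11) (X 8) (N 1) ;; Wr (N 12) (X 8) (N 1))"

context machine begin

lemma wp_seqI:
  assumes "wp c P \<tau> e A" "\<And>\<tau>' e' A'. P \<tau>' e' A' \<Longrightarrow> wp d Q \<tau>' e' A'"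
  shows "wp (c ;; d) Q \<tau> e A"
  using wp_mono[OF assms] by simp

end

context comp_machine begin

lemma lstate_cong:
  assumes "keep S e e'" "0 \<notin> S" "2 \<notin> S" "5 \<notin> S" "6 \<notin> S" "7 \<notin> S"
  shows "lstate Y L e' A = lstate Y L e A"
proof -
  have e: "e' 0 = e 0" "e' 2 = e 2" "e' 5 = e 5" "e' 6 = e 6" "e' 7 = e 7"
    using assms keepD by metis+
  have "static e' A = static e A" unfolding static_def e ..
  then show ?thesis unfolding lstate_def e by simp
qed

lemma pot_cong:
  assumes "keep S e e'" "5 \<notin> S" "6 \<notin> S"
  shows "pot wt L e' A = pot wt L e A"
  using keepD[OF assms(1,2)] keepD[OF assms(1,3)] unfolding pot_def by simp

text \<open>
  Shrinking of lists that keeps every colouring, as opposed to the choices made later.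
\<close>

definition refines :: "(nat \<Rightarrow> nat set) \<Rightarrow> (nat \<Rightarrow> nat set) \<Rightarrow> bool" where
  "refines L L' \<longleftrightarrow> (\<forall>u\<in>V. L' u \<subseteq> L u) \<and>
     (\<forall>f. proper f \<longrightarrow> (\<forall>u\<in>V. f u \<in> L u) \<longrightarrow> (\<forall>u\<in>V. f u \<in> L' u))"

lemma refines_refl: "refines L L" unfolding refines_def by simp

lemma refines_trans: "refines L L' \<Longrightarrow> refines L' L'' \<Longrightarrow> refines L L''"
  unfolding refines_def by (meson order_trans)

lemma refines_sub: "refines L L' \<Longrightarrow> u \<in> V \<Longrightarrow> L' u \<subseteq> L u"
  unfolding refines_def by simp

lemma wp_restrict_step:
  assumes l: "lstate Y L e A" and v: "e 8 = v" "v \<in> V" and d: "e 10 = d" and k: "k < 3"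
  shows "wp (IF (Eq (X 10) (N k)) SKIP (Asg 9 (N k) ;; REM)) (\<lambda>\<tau>' e' A'. \<tau>' \<le> \<tau> + 90 \<and>
    lstate Y (L(v := if d = k then L v else L v - {k})) e' A' \<and>
    keep {6, 7, 9, 13} e e' \<and> keep {5, 10, 11, 12} A A' \<and>
    (\<forall>wt. pot wt (L(v := if d = k then L v else L v - {k})) e' A' \<le> pot wt L e A)) \<tau> e A"
proof (cases "d = k")
  case True
  then show ?thesis using d l small Jn k by (simp add: keep_refl small)
next
  case False
  let ?e = "e(9 := k)"
  have ke: "keep {9} e ?e" by (simp add: keep_def)
  have "wp REM (\<lambda>\<tau>' e' A'. \<tau>' \<le> \<tau> + 90 \<and>
    lstate Y (L(v := if d = k then L v else L v - {k})) e' A' \<and>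
    keep {6, 7, 9, 13} e e' \<and> keep {5, 10, 11, 12} A A' \<and>
    (\<forall>wt. pot wt (L(v := if d = k then L v else L v - {k})) e' A' \<le> pot wt L e A)) \<tau>' ?e A"
    if t: "\<tau>' \<le> \<tau> + 10" for \<tau>'
  proof -
    have "wp REM (\<lambda>\<tau>'' e' A'. \<tau>'' \<le> \<tau>' + 80 \<and> lstate Y (L(v := L v - {k})) e' A' \<and>
      keep {6, 7, 13} ?e e' \<and> keep {5, 10, 11, 12} A A' \<and>
      (\<forall>wt. pot wt (L(v := L v - {k})) e' A' \<le> pot wt L ?e A)) \<tau>' ?e A"
      using l lstate_cong[OF ke] v k by (intro wp_REM) simp_all
    then show ?thesis
      by (rule wp_mono) (use t False pot_cong[OF ke] in \<open>simp add: keep_def\<close>)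
  qed
  then show ?thesis using d False k Jn by (simp add: small)
qed

lemma wp_RESTRICT:
  assumes l: "lstate Y L e A" and v: "e 8 = v" "v \<in> V" and d: "e 10 = d" "d < 3"
  shows "wp RESTRICT (\<lambda>\<tau>' e' A'. \<tau>' \<le> \<tau> + 270 \<and> lstate Y (L(v := L v \<inter> {d})) e' A' \<and>
    keep {6, 7, 9, 13} e e' \<and> keep {5, 10, 11, 12} A A' \<and>
    (\<forall>wt. pot wt (L(v := L v \<inter> {d})) e' A' \<le> pot wt L e A)) \<tau> e A"
  unfolding RESTRICT_def
proof (rule wp_seqI[OF wp_restrict_step[OF l v d(1)]], simp, elim conjE)
  fix \<tau>1 e1 A1
  let ?L1 = "L(v := if d = 0 then L v else L v - {0})"
  assume 1: "\<tau>1 \<le> \<tau> + 90" "lstate Y ?L1 e1 A1" "keep {6, 7, 9, 13} e e1"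
    "keep {5, 10, 11, 12} A A1" "\<forall>wt. pot wt ?L1 e1 A1 \<le> pot wt L e A"
  have v1: "e1 8 = v" "e1 10 = d" using keepD[OF 1(3)] v d by simp_all
  show "wp (IF (Eq (X 10) (N 1)) SKIP (Asg 9 (N 1) ;; REM) ;;
      IF (Eq (X 10) (N 2)) SKIP (Asg 9 (N 2) ;; REM))
     (\<lambda>\<tau>' e' A'. \<tau>' \<le> \<tau> + 270 \<and> lstate Y (L(v := L v \<inter> {d})) e' A' \<and>
        keep {6, 7, 9, 13} e e' \<and> keep {5, 10, 11, 12} A A' \<and>
        (\<forall>wt. pot wt (L(v := L v \<inter> {d})) e' A' \<le> pot wt L e A)) \<tau>1 e1 A1"
  proof (rule wp_seqI[OF wp_restrict_step[OF 1(2) v1(1) v(2) v1(2)]], simp, elim conjE)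
    fix \<tau>2 e2 A2
    let ?L2 = "?L1(v := if d = 1 then ?L1 v else ?L1 v - {1})"
    assume 2: "\<tau>2 \<le> \<tau>1 + 90" "lstate Y ?L2 e2 A2" "keep {6, 7, 9, 13} e1 e2"
      "keep {5, 10, 11, 12} A1 A2" "\<forall>wt. pot wt ?L2 e2 A2 \<le> pot wt ?L1 e1 A1"
    have v2: "e2 8 = v" "e2 10 = d" using keepD[OF 2(3)] v1 by simp_all
    have L3: "?L2(v := if d = 2 then ?L2 v else ?L2 v - {2}) = L(v := L v \<inter> {d})"
    proof -
      have "d = 0 \<or> d = 1 \<or> d = 2" using d by auto
      then show ?thesis using lstate_sub[OF l v(2)] by (elim disjE) (auto simp: fun_eq_iff)
    qed
    show "wp (IF (Eq (X 10) (N 2)) SKIP (Asg 9 (N 2) ;; REM))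
     (\<lambda>\<tau>' e' A'. \<tau>' \<le> \<tau> + 270 \<and> lstate Y (L(v := L v \<inter> {d})) e' A' \<and>
        keep {6, 7, 9, 13} e e' \<and> keep {5, 10, 11, 12} A A' \<and>
        (\<forall>wt. pot wt (L(v := L v \<inter> {d})) e' A' \<le> pot wt L e A)) \<tau>2 e2 A2"
    proof (rule wp_mono[OF wp_restrict_step[OF 2(2) v2(1) v(2) v2(2)]], simp, unfold L3, elim conjE, intro conjI allI)
      fix \<tau>3 e3 A3 and wt :: "nat \<Rightarrow> nat"
      assume 3: "\<tau>3 \<le> \<tau>2 + 90" "lstate Y (L(v := L v \<inter> {d})) e3 A3" "keep {6, 7, 9, 13} e2 e3"
        "keep {5, 10, 11, 12} A2 A3" "\<forall>wt. pot wt (L(v := L v \<inter> {d})) e3 A3 \<le> pot wt ?L2 e2 A2"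
      show "\<tau>3 \<le> \<tau> + 270" using 1 2 3 by simp
      show "lstate Y (L(v := L v \<inter> {d})) e3 A3" by fact
      show "keep {6, 7, 9, 13} e e3" using keep_trans[OF 1(3) keep_trans[OF 2(3) 3(3)]] .
      show "keep {5, 10, 11, 12} A A3" using keep_trans[OF 1(4) keep_trans[OF 2(4) 3(4)]] .
      show "pot wt (L(v := L v \<inter> {d})) e3 A3 \<le> pot wt L e A"
        using 1(5)[rule_format, of wt] 2(5)[rule_format, of wt] 3(5)[rule_format, of wt] by linarith
    qed
  qed
qed

lemma lstate_discharge:
  assumes l: "lstate {v} L e A" and v: "\<And>w. E v w \<Longrightarrow> L v \<inter> L w = {}"
  shows "lstate {} L e A"
proof -
  have "(\<exists>i. e 5 \<le> i \<and> i < e 6 \<and> A 5 i = u) \<or> (\<forall>w. E u w \<longrightarrow> L u \<inter> L w = {})"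
    if "e 7 = 0" "u \<in> V" "card (L u) = 1" for u
  proof (cases "u = v")
    case True
    then show ?thesis using v by blast
  next
    case False
    then have "u \<notin> {v}" by simp
    then show ?thesis using lstate_closed[OF l that(1,2) _ that(3)] by simp
  qed
  then show ?thesis using l unfolding lstate_def by simp
qed

text \<open>
  After a failure the lists need no longer be closed, so the queue may be dropped.
\<close>

lemma lstate_flush:
  assumes "lstate Y L e A" "e 7 \<noteq> 0"
  shows "lstate Z L (e(5 := e 6)) A"
proof -
  have "static (e(5 := e 6)) A"
    using lstate_static[OF assms(1)] unfolding static_def by simp
  then show ?thesis using assms unfolding lstate_def by simp
qed

lemma pot_flush: "pot wt L (e(5 := e 6)) A \<le> pot wt L e A"
  unfolding pot_def by simp

lemma wp_VISIT:
  assumes l: "lstate {} L e A" and q: "e 7 = 0" "e 5 < e 6" and v: "v = A 5 (e 5)"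
  shows "wp VISIT (\<lambda>\<tau>' e' A'. \<tau>' \<le> \<tau> + 60 + deg v * 110 \<and> (\<exists>L'. lstate {} L' e' A' \<and> refines L L' \<and>
    (e' 7 \<noteq> 0 \<longrightarrow> e' 5 = e' 6) \<and> (\<forall>wt. pot wt L' e' A' + wt v \<le> pot wt L e A)) \<and>
    keep {5, 6, 7, 8, 9, 11, 12, 13} e e' \<and> keep {5, 10, 11, 12} A A') \<tau> e A"
proof -
  have vV: "v \<in> V" and card1: "card (L v) = 1"
    using lstate_queue(1)[OF l order_refl q(2)] lstate_queue(2)[OF l order_refl q(2) q(1)] v by blast+
  from card1 obtain c where c: "L v = {c}" by (rule card_1_singletonE)
  have c012: "c = 0 \<or> c = 1 \<or> c = 2" using lstate_sub[OF l vV] unfolding c by simp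
  then have c3: "c < 3" by auto
  have "A 11 v = of_bool (1 = c)" "A 12 v = of_bool (2 = c)"
    using lstate_rep[OF l vV, of 1] lstate_rep[OF l vV, of 2] unfolding c by simp_all
  then have col: "A 11 v + 2 * A 12 v = c" using c012 by auto
  have small5: "e 5 < K" using q lstate_len[OF l] bounds(3) by simp
  define e1 where "e1 = e(11 := v, 5 := Suc (e 5), 9 := c)"
  have e1: "e1 0 = n" "e1 11 = v" "e1 9 = c" "e1 7 = 0"
    using lstate_static[OF l] q unfolding e1_def static_def by simp_all
  have l1: "lstate {v} L e1 A"
  proof -
    have st: "static e1 A" using lstate_static[OF l] unfolding static_def e1_def by simp
    have "(\<exists>i\<ge>Suc (e 5). i < e 6 \<and> A 5 i = u) \<or> (\<forall>w. E u w \<longrightarrow> L u \<inter> L w = {})"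
      if u: "u \<in> V" "u \<noteq> v" "card (L u) = 1" for u
    proof -
      have "(\<exists>i. e 5 \<le> i \<and> i < e 6 \<and> A 5 i = u) \<or> (\<forall>w. E u w \<longrightarrow> L u \<inter> L w = {})"
        using lstate_closed[OF l q(1) u(1) _ u(3)] by simp
      then show ?thesis
      proof
        assume "\<exists>i. e 5 \<le> i \<and> i < e 6 \<and> A 5 i = u"
        then obtain i where i: "e 5 \<le> i" "i < e 6" "A 5 i = u" by blast
        then have "i \<noteq> e 5" using v u by auto
        then show ?thesis using i by (intro disjI1 exI[of _ i]) simp
      qed simp
    qed
    moreover have "\<forall>i. Suc (e 5) \<le> i \<and> i < e 6 \<longrightarrow> A 5 i \<in> V \<and> (e 7 = 0 \<longrightarrow> card (L (A 5 i)) = 1)"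
      using lstate_queue[OF l] by simp
    moreover have "\<forall>v\<in>V. \<forall>c<3. A (10 + c) v = of_bool (c \<in> L v)" using lstate_rep[OF l] by simp
    moreover have "\<forall>v\<in>V. L v \<subseteq> {0, 1, 2}" using lstate_sub[OF l] by simp
    moreover have "e1 5 = Suc (e 5)" "e1 6 = e 6" "e1 7 = e 7" unfolding e1_def by simp_all
    ultimately show ?thesis using st lstate_len[OF l] lstate_fail[OF l] q
      unfolding lstate_def by simp
  qed
  have p1: "pot wt L e1 A + wt v = pot wt L e A" for wt
    using q(2) v unfolding pot_def e1_def by (simp add: sum.atLeast_Suc_lessThan)
  let ?P = "\<lambda>i e' A'. \<exists>L'. lstate {v} L' e' A' \<and> L' v = {c} \<and> refines L L' \<and>
      (\<forall>j<i. c \<notin> L' (nb v j)) \<and> e' 11 = v \<and> e' 9 = c \<and> keep {6, 7, 8, 12, 13} e1 e' \<and>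
      keep {5, 10, 11, 12} A A' \<and> (\<forall>wt. pot wt L' e' A' \<le> pot wt L e1 A)"
  have loop: "wp (FOR 12 (Rd (N 1) (X 11)) (Asg 8 (Rd (N 20 \<oplus> X 0 \<oplus> X 11) (X 12)) ;; REM))
     (\<lambda>\<tau>' e' A'. \<tau>' \<le> \<tau>0 + deg v * (90 + 5 + 6) + 5 + 4 \<and> ?P (deg v) e' A') \<tau>0 e1 A"
    if t0: "\<tau>0 \<le> \<tau> + 30" for \<tau>0
  proof (rule wp_FOR_const[where P = ?P and D = 90 and n = "deg v"])
    show "deg v < M" using bounds(2)[OF vV] small(1)[of "deg v"] by simp
    show "?P 0 (e1(12 := 0)) A"
    proof (intro exI[of _ L] conjI)
      have k: "keep {12} e1 (e1(12 := 0))" by (simp add: keep_def)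
      show "lstate {v} L (e1(12 := 0)) A" using lstate_cong[OF k] l1 by simp
      show "\<forall>wt. pot wt L (e1(12 := 0)) A \<le> pot wt L e1 A" using pot_cong[OF k] by simp
    qed (use c e1 refines_refl in \<open>simp_all add: keep_def\<close>)
  next
    fix k e' A' assume P: "?P k e' A'"
    then obtain L' where L': "lstate {v} L' e' A'" "e' 11 = v" by blast
    have "A' 1 v = deg v" using lstate_static[OF L'(1)] vV unfolding static_def by simp
    then show "xok e' A' (Rd (N 1) (X 11)) \<and> xval e' A' (Rd (N 1) (X 11)) = deg v"
      using L'(2) bounds(1)[OF vV] Jn M by simp
  next
    fix i \<tau>' e' A' assume i: "i < deg v" and P: "?P i e' A'" and ei: "e' 12 = i"
    then obtain L' where L': "lstate {v} L' e' A'" "L' v = {c}" "refines L L'"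
      "\<forall>j<i. c \<notin> L' (nb v j)" "e' 11 = v" "e' 9 = c" "keep {6, 7, 8, 12, 13} e1 e'"
      "keep {5, 10, 11, 12} A A'" "\<forall>wt. pot wt L' e' A' \<le> pot wt L e1 A" by blast
    let ?w = "nb v i"
    have Ew: "E v ?w" using nb[OF vV] i by blast
    have wV: "?w \<in> V" using dom sym Ew by blast
    have wv: "?w \<noteq> v" using Ew irrefl by auto
    have st: "static e' A'" by (rule lstate_static[OF L'(1)])
    have e0: "e' 0 = n" and row: "A' (20 + n + v) i = ?w"
      using st vV i unfolding static_def by simp_all
    let ?e = "e'(8 := ?w)"
    have ke: "keep {8} e' ?e" by (simp add: keep_def)
    let ?L = "L'(?w := L' ?w - {c})"
    have ref: "refines L ?L"
      unfolding refines_def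
    proof (intro conjI ballI allI impI)
      show "?L u \<subseteq> L u" if "u \<in> V" for u using refines_sub[OF L'(3) that] by auto
      fix f u assume f: "proper f" "\<forall>u\<in>V. f u \<in> L u" "u \<in> V"
      then have "\<forall>u\<in>V. f u \<in> L' u" using L'(3) unfolding refines_def by blast
      moreover have "f v \<noteq> f ?w" using f(1) Ew unfolding proper_def by blast
      moreover have "f v = c" using bspec[OF f(2) vV] unfolding c by simp
      ultimately show "f u \<in> ?L u" using f(3) by (cases "u = ?w") simp_all
    qed
    have "wp REM (\<lambda>\<tau>'' e'' A''. \<tau>'' \<le> (\<tau>' + 10) + 80 \<and> lstate {v} ?L e'' A'' \<and>
      keep {6, 7, 13} ?e e'' \<and> keep {5, 10, 11, 12} A' A'' \<and>
      (\<forall>wt. pot wt ?L e'' A'' \<le> pot wt L' ?e A')) (\<tau>' + 10) ?e A'"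
      using L'(1,6) lstate_cong[OF ke] wV c3 by (intro wp_REM) simp_all
    then have "wp REM (\<lambda>\<tau>'' e'' A''. \<tau>'' \<le> \<tau>' + 90 \<and> e'' 12 = i \<and> ?P (Suc i) (e''(12 := Suc i)) A'')
      (\<tau>' + 10) ?e A'"
    proof (rule wp_mono, elim conjE, intro conjI)
      fix \<tau>'' e'' A''
      assume 2: "\<tau>'' \<le> (\<tau>' + 10) + 80" "lstate {v} ?L e'' A''" "keep {6, 7, 13} ?e e''"
        "keep {5, 10, 11, 12} A' A''" "\<forall>wt. pot wt ?L e'' A'' \<le> pot wt L' ?e A'"
      show "\<tau>'' \<le> \<tau>' + 90" using 2 by simp
      show "e'' 12 = i" using keepD[OF 2(3)] ei by simp
      have k: "keep {12} e'' (e''(12 := Suc i))" by (simp add: keep_def)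
      show "?P (Suc i) (e''(12 := Suc i)) A''"
      proof (intro exI[of _ ?L] conjI)
        show "lstate {v} ?L (e''(12 := Suc i)) A''" using 2(2) lstate_cong[OF k] by simp
        show "?L v = {c}" using wv L'(2) by simp
        show "\<forall>j<Suc i. c \<notin> ?L (nb v j)"
        proof (intro allI impI)
          fix j assume "j < Suc i"
          then show "c \<notin> ?L (nb v j)" using L'(4) by (cases "j = i") simp_all
        qed
        show "(e''(12 := Suc i)) 11 = v" "(e''(12 := Suc i)) 9 = c" using keepD[OF 2(3)] L' by simp_all
        show "keep {6, 7, 8, 12, 13} e1 (e''(12 := Suc i))" using L'(7) 2(3) unfolding keep_def by auto
        show "keep {5, 10, 11, 12} A A''" by (rule keep_trans[OF L'(8) 2(4)])
        have "pot wt ?L e'' A'' \<le> pot wt L e1 A" for wt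
          using 2(5)[rule_format, of wt] L'(9)[rule_format, of wt] pot_cong[OF ke, of wt L' A'] by simp
        then show "\<forall>wt. pot wt ?L (e''(12 := Suc i)) A'' \<le> pot wt L e1 A"
          using pot_cong[OF k] by simp
      qed (rule ref)
    qed
    then show "wp (Asg 8 (Rd (N 20 \<oplus> X 0 \<oplus> X 11) (X 12)) ;; REM)
      (\<lambda>\<tau>'' e'' A''. \<tau>'' \<le> \<tau>' + 90 \<and> e'' 12 = i \<and> ?P (Suc i) (e''(12 := Suc i)) A'') \<tau>' e' A'"
      using e0 L'(5) ei row bounds(5)[OF vV] bounds(2)[OF vV] i Jn
      by (simp add: small eval_nat_numeral)
  qed simp
  have rest: "wp (IF (Eq (X 7) (N 0)) SKIP (Asg 5 (X 6)))
    (\<lambda>\<tau>' e' A'. \<tau>' \<le> \<tau> + 60 + deg v * 110 \<and> (\<exists>L'. lstate {} L' e' A' \<and> refines L L' \<and>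
    (e' 7 \<noteq> 0 \<longrightarrow> e' 5 = e' 6) \<and> (\<forall>wt. pot wt L' e' A' + wt v \<le> pot wt L e A)) \<and>
    keep {5, 6, 7, 8, 9, 11, 12, 13} e e' \<and> keep {5, 10, 11, 12} A A') \<tau>' e' A'"
    if t0: "\<tau>0 \<le> \<tau> + 30" and t: "\<tau>' \<le> \<tau>0 + deg v * (90 + 5 + 6) + 5 + 4" and P: "?P (deg v) e' A'" for \<tau>0 \<tau>' e' A'
  proof -
    from P obtain L' where L': "lstate {v} L' e' A'" "L' v = {c}" "refines L L'"
      "\<forall>j<deg v. c \<notin> L' (nb v j)" "keep {6, 7, 8, 12, 13} e1 e'"
      "keep {5, 10, 11, 12} A A'" "\<forall>wt. pot wt L' e' A' \<le> pot wt L e1 A" by blast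
    have "L' v \<inter> L' w = {}" if "E v w" for w
    proof -
      from that nb[OF vV] obtain j where "j < deg v" "w = nb v j" by blast
      then show ?thesis using L'(2,4) by simp
    qed
    from lstate_discharge[OF L'(1) this] have l2: "lstate {} L' e' A'" .
    have k: "keep {5, 6, 7, 8, 9, 11, 12, 13} e e'" using L'(5) unfolding keep_def e1_def by auto
    have p: "pot wt L' e' A' + wt v \<le> pot wt L e A" for wt
      using L'(7)[rule_format, of wt] p1[of wt] by simp
    show ?thesis
    proof (cases "e' 7 = 0")
      case True
      then show ?thesis using t t0 l2 L'(3) k p L'(6) M by auto
    next
      case False
      have "lstate {} L' (e'(5 := e' 6)) A'" by (rule lstate_flush[OF l2 False])
      moreover have "pot wt L' (e'(5 := e' 6)) A' + wt v \<le> pot wt L e A" for wt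
        using p[of wt] pot_flush[of wt L' e' A'] by simp
      moreover have "keep {5, 6, 7, 8, 9, 11, 12, 13} e (e'(5 := e' 6))" using k unfolding keep_def by auto
      ultimately show ?thesis using False t t0 L'(3,6) M by auto
    qed
  qed
  have "wp (FOR 12 (Rd (N 1) (X 11)) (Asg 8 (Rd (N 20 \<oplus> X 0 \<oplus> X 11) (X 12)) ;; REM) ;;
      IF (Eq (X 7) (N 0)) SKIP (Asg 5 (X 6)))
    (\<lambda>\<tau>' e' A'. \<tau>' \<le> \<tau> + 60 + deg v * 110 \<and> (\<exists>L'. lstate {} L' e' A' \<and> refines L L' \<and>
    (e' 7 \<noteq> 0 \<longrightarrow> e' 5 = e' 6) \<and> (\<forall>wt. pot wt L' e' A' + wt v \<le> pot wt L e A)) \<and>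
    keep {5, 6, 7, 8, 9, 11, 12, 13} e e' \<and> keep {5, 10, 11, 12} A A') \<tau>0 e1 A"
    if "\<tau>0 \<le> \<tau> + 30" for \<tau>0
    by (rule wp_seqI[OF loop[OF that]], elim conjE, rule rest[OF that])
  moreover have "c < M" "2 * A 12 v < M" using small(1)[of c] c3 Kn col by simp_all
  ultimately show ?thesis
    unfolding VISIT_def using small5 Jn bounds(1)[OF vV] col c012
    by (simp add: small v[symmetric] e1_def)
qed

text \<open>
  The time that a visit of the vertex takes.
\<close>

definition W :: "nat \<Rightarrow> nat" where
  "W v = 110 * deg v + 70"

text \<open>
  The potential with weights \<open>W\<close> pays for the visits, so the time is linear in the size of the
  component however the queue evolves.
\<close>

lemma wp_PROPAGATE:
  assumes l: "lstate {} L e A"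
  shows "wp PROPAGATE (\<lambda>\<tau>' e' A'. \<tau>' \<le> \<tau> + pot W L e A + 20 \<and> (\<exists>L'. lstate {} L' e' A' \<and> refines L L' \<and>
    e' 5 = e' 6 \<and> (\<forall>wt. pot wt L' e' A' \<le> pot wt L e A)) \<and>
    keep {5, 6, 7, 8, 9, 11, 12, 13} e e' \<and> keep {5, 10, 11, 12} A A') \<tau> e A"
    (is "wp _ ?Q _ _ _")
proof (cases "e 7 = 0")
  case False
  have "lstate {} L (e(5 := e 6)) A" by (rule lstate_flush[OF l False])
  then show ?thesis
    unfolding PROPAGATE_def using False M pot_flush[of _ L e A]
    by (simp add: refines_refl keep_def exI[of _ L])
next
  case True
  let ?I = "\<lambda>\<tau>' e' A'. \<exists>L'. lstate {} L' e' A' \<and> refines L L' \<and> (e' 7 \<noteq> 0 \<longrightarrow> e' 5 = e' 6) \<and>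
    (\<forall>wt. pot wt L' e' A' \<le> pot wt L e A) \<and> keep {5, 6, 7, 8, 9, 11, 12, 13} e e' \<and> keep {5, 10, 11, 12} A A' \<and>
    \<tau>' + pot W L' e' A' \<le> \<tau> + 3 + pot W L e A"
  have step: "\<tau>' \<le> \<tau> + 3 + pot W L e A \<and> bok e' A' (Lt (X 5) (X 6)) \<and>
     (if bval e' A' (Lt (X 5) (X 6)) then wp VISIT ?I (\<tau>' + bcost (Lt (X 5) (X 6))) e' A'
      else ?Q (\<tau>' + bcost (Lt (X 5) (X 6))) e' A')" if I: "?I \<tau>' e' A'" for \<tau>' e' A'
  proof -
    from I obtain L' where L': "lstate {} L' e' A'" "refines L L'" "e' 7 \<noteq> 0 \<longrightarrow> e' 5 = e' 6"
      "\<forall>wt. pot wt L' e' A' \<le> pot wt L e A" "keep {5, 6, 7, 8, 9, 11, 12, 13} e e'"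
      "keep {5, 10, 11, 12} A A'" "\<tau>' + pot W L' e' A' \<le> \<tau> + 3 + pot W L e A" by blast
    show ?thesis
    proof (cases "e' 5 < e' 6")
      case False
      then have "e' 5 = e' 6" using lstate_len(1)[OF L'(1)] by simp
      then show ?thesis using L' False by auto
    next
      case lt: True
      then have e7: "e' 7 = 0" using L'(3) by simp
      have "wp VISIT ?I (\<tau>' + 3) e' A'"
      proof (rule wp_mono[OF wp_VISIT[OF L'(1) e7 lt refl]], elim conjE exE)
        fix \<tau>'' e'' A'' L''
        assume 2: "\<tau>'' \<le> \<tau>' + 3 + 60 + deg (A' 5 (e' 5)) * 110" "lstate {} L'' e'' A''" "refines L' L''"
          "e'' 7 \<noteq> 0 \<longrightarrow> e'' 5 = e'' 6" "\<forall>wt. pot wt L'' e'' A'' + wt (A' 5 (e' 5)) \<le> pot wt L' e' A'"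
          "keep {5, 6, 7, 8, 9, 11, 12, 13} e' e''" "keep {5, 10, 11, 12} A' A''"
        show "?I \<tau>'' e'' A''"
        proof (intro exI[of _ L''] conjI)
          show "lstate {} L'' e'' A''" "e'' 7 \<noteq> 0 \<longrightarrow> e'' 5 = e'' 6" by fact+
          show "refines L L''" by (rule refines_trans[OF L'(2) 2(3)])
          show "keep {5, 6, 7, 8, 9, 11, 12, 13} e e''" by (rule keep_trans[OF L'(5) 2(6)])
          show "keep {5, 10, 11, 12} A A''" by (rule keep_trans[OF L'(6) 2(7)])
          show "\<forall>wt. pot wt L'' e'' A'' \<le> pot wt L e A"
            using 2(5) L'(4) by (meson add_leD1 le_trans)
          have "pot W L'' e'' A'' + W (A' 5 (e' 5)) \<le> pot W L' e' A'" using 2(5) by blast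
          then show "\<tau>'' + pot W L'' e'' A'' \<le> \<tau> + 3 + pot W L e A"
            using 2(1) L'(7) unfolding W_def by simp
        qed
      qed
      then show ?thesis using lt L'(7) by (simp add: add.commute numeral_3_eq_3)
    qed
  qed
  have "wp (WHILE (Lt (X 5) (X 6)) VISIT) ?Q (\<tau> + 3) e A"
    unfolding wp.simps(6)
  proof (intro exI[of _ ?I] exI[of _ "\<tau> + 3 + pot W L e A"] conjI allI impI)
    show "?I (\<tau> + 3) e A" using l True by (intro exI[of _ L]) (simp add: refines_refl keep_refl)
  qed (use step in blast)+
  then show ?thesis
    unfolding PROPAGATE_def using True M by (simp add: numeral_3_eq_3)
qed

lemma vc_ex: "v \<in> V \<Longrightarrow> \<exists>j<nc. v = vc j"
  using vc by blast

lemma list_row: "static e A \<Longrightarrow> i < nc \<Longrightarrow> A 4 i = vc i \<and> vc i \<in> V"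
  using vc unfolding static_def by blast

lemma wp_COPY_LISTS:
  assumes st: "static e A" and ab: "5 < a" "a + 2 < 20" "b + 2 < 20" "a + 2 < b \<or> b + 2 < a" "a + 2 \<le> 15"
  shows "wp (COPY_LISTS a b) (\<lambda>\<tau>' e' A'. \<tau>' \<le> \<tau> + nc * 60 + 5 \<and> keep {8, 14} e e' \<and>
    keep {a, a + 1, a + 2} A A' \<and> (\<forall>v\<in>V. \<forall>c<3. A' (a + c) v = A (b + c) v)) \<tau> e A"
proof -
  define P where "P i e' A' \<longleftrightarrow> keep {8, 14} e e' \<and> keep {a, a + 1, a + 2} A A' \<and>
    (\<forall>j<i. \<forall>c<3. A' (a + c) (vc j) = A (b + c) (vc j))" for i :: nat and e' :: env and A' :: arrays
  show ?thesis
    unfolding COPY_LISTS_def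
  proof (rule wp_FOR_const[where D = 50 and n = nc and P = P])
    show "nc < M" using bounds(3) small(1)[of nc] by simp
    show "P 0 (e(14 := 0)) A" by (simp add: keep_def P_def)
  next
    fix k e' A' assume "P k e' A'"
    then have "e' 2 = nc" using st keepD[of "{8, 14}" e e' 2] unfolding static_def P_def by simp
    then show "xok e' A' (X 2) \<and> xval e' A' (X 2) = nc" by simp
  next
    fix i \<tau>' e' A' assume i: "i < nc" and P: "P i e' A'" and ei: "e' 14 = i"
    then have k: "keep {8, 14} e e'" "keep {a, a + 1, a + 2} A A'"
      and old: "\<And>j c. j < i \<Longrightarrow> c < 3 \<Longrightarrow> A' (a + c) (vc j) = A (b + c) (vc j)" unfolding P_def by blast+
    have v: "A' 4 i = vc i" "vc i \<in> V" using list_row[OF st i] keepD[OF k(2), of 4] ab by auto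
    have b: "A' (b + c) = A (b + c)" if "c < 3" for c
      using keepD[OF k(2), of "b + c"] ab that by auto
    let ?v = "vc i"
    let ?A3 = "A'(a := (A' a)(?v := A' b ?v), a + 1 := (A' (a + 1))(?v := A' (b + 1) ?v),
      a + 2 := (A' (a + 2))(?v := A' (b + 2) ?v))"
    have new: "?A3 (a + c) (vc j) = A (b + c) (vc j)" if "j < Suc i" "c < 3" for j c
    proof -
      have c: "c = 0 \<or> c = 1 \<or> c = 2" using that by auto
      have o: "j \<noteq> i \<Longrightarrow> A' (a + c) (vc j) = A (b + c) (vc j)" using old[of j c] that by simp
      show ?thesis
        using c b[of 0] b[of 1] b[of 2] o by (cases "j = i"; elim disjE) auto
    qed
    have kA: "keep {a, a + 1, a + 2} A ?A3" using k(2) unfolding keep_def by simp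
    have ke: "keep {8, 14} e (e'(8 := ?v, 14 := Suc i))" using k(1) unfolding keep_def by simp
    have P': "P (Suc i) (e'(8 := ?v, 14 := Suc i)) ?A3" unfolding P_def using new kA ke by blast
    have ne: "b \<noteq> a" "b + 1 \<noteq> a" "b \<noteq> a + 1" "b + 2 \<noteq> a" "b + 2 \<noteq> a + 1" using ab by auto
    show "wp (Asg 8 (Rd (N 4) (X 14)) ;; Wr (N a) (X 8) (Rd (N b) (X 8)) ;;
        Wr (N (a + 1)) (X 8) (Rd (N (b + 1)) (X 8)) ;; Wr (N (a + 2)) (X 8) (Rd (N (b + 2)) (X 8)))
      (\<lambda>\<tau>'' e'' A''. \<tau>'' \<le> \<tau>' + 50 \<and> e'' 14 = i \<and> P (Suc i) (e''(14 := Suc i)) A'') \<tau>' e' A'"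
      using v P' ne ab ei bounds(1)[OF v(2)] Jn bounds(3) i by (simp add: small)
  next
    fix \<tau>' e' A' assume t: "\<tau>' \<le> \<tau> + nc * (50 + xcost (X 2) + 6) + xcost (X 2) + 4" and P: "P nc e' A'"
    have "A' (a + c) v = A (b + c) v" if "v \<in> V" "c < 3" for v c
    proof -
      from vc_ex[OF that(1)] obtain j where "j < nc" "v = vc j" by blast
      then show ?thesis using P that(2) unfolding P_def by blast
    qed
    then show "\<tau>' \<le> \<tau> + nc * 60 + 5 \<and> keep {8, 14} e e' \<and>
      keep {a, a + 1, a + 2} A A' \<and> (\<forall>v\<in>V. \<forall>c<3. A' (a + c) v = A (b + c) v)"
      using t P unfolding P_def by simp
  qed
qed

lemma init_lstate:
  assumes st: "static e A" and one: "\<And>v c. v \<in> V \<Longrightarrow> c < 3 \<Longrightarrow> A (10 + c) v = 1"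
    and e: "e 5 = 0" "e 6 = 0" "e 7 = 0"
  shows "lstate {} (\<lambda>_. {0, 1, 2}) e A"
proof -
  have "A (10 + c) v = of_bool (c \<in> {0, 1, 2})" if "v \<in> V" "c < 3" for v c
    using one[OF that] that(2) by auto
  moreover have "card {v \<in> V. 2 \<le> card {0, 1, 2::nat}} = nc" using nc by simp
  ultimately show ?thesis unfolding lstate_def using st e by simp
qed

lemma wp_INIT_LISTS:
  assumes st: "static e A"
  shows "wp INIT_LISTS (\<lambda>\<tau>' e' A'. \<tau>' \<le> \<tau> + nc * 60 + 20 \<and> keep {5, 6, 7, 8, 14} e e' \<and>
    keep {10, 11, 12} A A' \<and> lstate {} (\<lambda>_. {0, 1, 2}) e' A' \<and> e' 5 = e' 6 \<and> e' 7 = 0) \<tau> e A"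
    (is "wp _ ?Q _ _ _")
proof -
  define P where "P i e' A' \<longleftrightarrow> keep {5, 6, 7, 8, 14} e e' \<and> keep {10, 11, 12} A A' \<and>
    e' 5 = 0 \<and> e' 6 = 0 \<and> e' 7 = 0 \<and>
    (\<forall>j<i. A' 10 (vc j) = 1 \<and> A' 11 (vc j) = 1 \<and> A' 12 (vc j) = 1)" for i :: nat and e' :: env and A' :: arrays
  have "wp (FOR 14 (X 2) (Asg 8 (Rd (N 4) (X 14)) ;;
        Wr (N 10) (X 8) (N 1) ;; Wr (N 11) (X 8) (N 1) ;; Wr (N 12) (X 8) (N 1))) ?Q \<tau>0
      (e(5 := 0, 6 := 0, 7 := 0)) A" if t0: "\<tau>0 \<le> \<tau> + 10" for \<tau>0
  proof (rule wp_FOR_const[where D = 50 and n = nc and P = P])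
    show "nc < M" using bounds(3) small(1)[of nc] by simp
    show "P 0 (e(5 := 0, 6 := 0, 7 := 0, 14 := 0)) A" by (simp add: keep_def P_def)
  next
    fix k e' A' assume "P k e' A'"
    then have "e' 2 = nc" using st keepD[of "{5, 6, 7, 8, 14}" e e' 2] unfolding static_def P_def by simp
    then show "xok e' A' (X 2) \<and> xval e' A' (X 2) = nc" by simp
  next
    fix i \<tau>' e' A' assume i: "i < nc" and P: "P i e' A'" and ei: "e' 14 = i"
    then have k: "keep {5, 6, 7, 8, 14} e e'" "keep {10, 11, 12} A A'" "e' 5 = 0" "e' 6 = 0" "e' 7 = 0"
      and old: "\<And>j. j < i \<Longrightarrow> A' 10 (vc j) = 1 \<and> A' 11 (vc j) = 1 \<and> A' 12 (vc j) = 1"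
      unfolding P_def by blast+
    have v: "A' 4 i = vc i" "vc i \<in> V" using list_row[OF st i] keepD[OF k(2), of 4] by auto
    let ?v = "vc i"
    let ?A3 = "A'(10 := (A' 10)(?v := 1), 11 := (A' 11)(?v := 1), 12 := (A' 12)(?v := 1))"
    have new: "?A3 10 (vc j) = 1 \<and> ?A3 11 (vc j) = 1 \<and> ?A3 12 (vc j) = 1" if "j < Suc i" for j
      using old[of j] that by (cases "j = i") auto
    have kA: "keep {10, 11, 12} A ?A3" using k(2) unfolding keep_def by simp
    have ke: "keep {5, 6, 7, 8, 14} e (e'(8 := ?v, 14 := Suc i))" using k(1) unfolding keep_def by simp
    have P': "P (Suc i) (e'(8 := ?v, 14 := Suc i)) ?A3" unfolding P_def using new kA ke k(3-5) by simp
    show "wp (Asg 8 (Rd (N 4) (X 14)) ;;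
        Wr (N 10) (X 8) (N 1) ;; Wr (N 11) (X 8) (N 1) ;; Wr (N 12) (X 8) (N 1))
      (\<lambda>\<tau>'' e'' A''. \<tau>'' \<le> \<tau>' + 50 \<and> e'' 14 = i \<and> P (Suc i) (e''(14 := Suc i)) A'') \<tau>' e' A'"
      using v P' ei bounds(1)[OF v(2)] Jn bounds(3) i by (simp add: small)
  next
    fix \<tau>' e' A' assume t: "\<tau>' \<le> \<tau>0 + nc * (50 + xcost (X 2) + 6) + xcost (X 2) + 4" and P: "P nc e' A'"
    have one: "A' (10 + c) v = 1" if "v \<in> V" "c < 3" for v c
    proof -
      from vc_ex[OF that(1)] obtain j where j: "j < nc" "v = vc j" by blast
      have "c = 0 \<or> c = 1 \<or> c = 2" using that(2) by auto
      then show ?thesis using P j unfolding P_def by auto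
    qed
    have k: "keep {5, 6, 7, 8, 14} e e'" "keep {10, 11, 12} A A'" "e' 5 = 0" "e' 6 = 0" "e' 7 = 0"
      using P unfolding P_def by blast+
    have "static e' A'" by (rule static_keep[OF st k(1,2)]) auto
    from init_lstate[OF this one k(3-5)] show "?Q \<tau>' e' A'" using t t0 k by simp
  qed
  then show ?thesis unfolding INIT_LISTS_def using M by simp
qed

end

section \<open>Shortening the full lists\<close>

definition FLAGS :: cmd where
  "FLAGS = Asg 16 (N 0) ;; Asg 17 (N 0) ;; Asg 18 (N 0) ;;
     FOR 19 (Rd (N 1) (X 8))
       (Asg 11 (Rd (N 20 \<oplus> X 0 \<oplus> X 8) (X 19)) ;;
        IF (Eq (Rd (N 13) (X 11)) (N 0)) (Asg 16 (N 1)) SKIP ;;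
        IF (Eq (Rd (N 14) (X 11)) (N 0)) (Asg 17 (N 1)) SKIP ;;
        IF (Eq (Rd (N 15) (X 11)) (N 0)) (Asg 18 (N 1)) SKIP)"

text \<open>
  The branches remove the complement of the list that \<open>trim\<close> prescribes. The rule refers to the lists
  before any of them is shortened, hence the copy made by the caller.
\<close>

definition TRIM_VERTEX :: cmd where
  "TRIM_VERTEX =
     IF (Eq (Rd (N 13) (X 8) \<oplus> Rd (N 14) (X 8) \<oplus> Rd (N 15) (X 8)) (N 3))
       (FLAGS ;;
        IF (Eq (X 16) (N 0))
          (IF (Eq (X 18) (N 0)) (Asg 10 (N 1) ;; RESTRICT) (Asg 9 (N 1) ;; REM))
          (IF (Eq (X 17 \<oplus> X 18) (N 0)) (Asg 10 (N 0) ;; RESTRICT) (Asg 9 (N 0) ;; REM)))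
       SKIP"

definition TRIM :: cmd where
  "TRIM = COPY_LISTS 13 10 ;; FOR 15 (X 2) (Asg 8 (Rd (N 4) (X 15)) ;; TRIM_VERTEX)"

text \<open>
  The second attempt, after the first colour of the vertex has led to a conflict: the lists are
  restored and that colour is removed.
\<close>

definition RETRY :: cmd where
  "RETRY = COPY_LISTS 10 13 ;; Asg 5 (N 0) ;; Asg 6 (N 0) ;; Asg 7 (N 0) ;;
     Asg 8 (X 17) ;; Asg 9 (X 16) ;; REM ;; PROPAGATE"

definition TRY_COLOUR :: cmd where
  "TRY_COLOUR = Asg 5 (N 0) ;; Asg 6 (N 0) ;; COPY_LISTS 13 10 ;;
     Asg 8 (X 17) ;; Asg 10 (X 16) ;; RESTRICT ;; PROPAGATE ;; IF (Eq (X 7) (N 0)) SKIP RETRY"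

definition SOLVE :: cmd where
  "SOLVE = FOR 15 (X 2)
     (IF (Eq (X 7) (N 0))
       (Asg 17 (Rd (N 4) (X 15)) ;;
        IF (Eq (Rd (N 10) (X 17) \<oplus> Rd (N 11) (X 17) \<oplus> Rd (N 12) (X 17)) (N 2))
          (IF (Eq (Rd (N 10) (X 17)) (N 1)) (Asg 16 (N 0)) (Asg 16 (N 1)) ;; TRY_COLOUR)
          SKIP)
       SKIP)"

lemma keep_trans': "keep S e e' \<Longrightarrow> keep S' e' e'' \<Longrightarrow> S' \<subseteq> S \<Longrightarrow> keep S e e''"
  by (rule keep_trans[OF _ keep_mono])

context comp_machine begin

lemma lstate_acong:
  assumes "keep S A A'" "S \<subseteq> {13..15}"
  shows "lstate Y L e A' = lstate Y L e A" "pot wt L e A' = pot wt L e A"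
proof -
  have a: "A' j = A j" if "j \<notin> {13..15}" for j
    by (rule keepD[OF assms(1)]) (use that assms(2) in blast)
  have s: "A' 1 = A 1" "A' 4 = A 4" "A' 5 = A 5" "\<And>v. A' (20 + v) = A (20 + v)" "\<And>v. A' (20 + n + v) = A (20 + n + v)"
    by (intro a; simp)+
  have r: "c < 3 \<Longrightarrow> A' (10 + c) = A (10 + c)" for c by (intro a) simp
  show "lstate Y L e A' = lstate Y L e A"
    unfolding lstate_def static_def s using r by simp
  show "pot wt L e A' = pot wt L e A" unfolding pot_def s ..
qed

lemma wp_flag:
  assumes "a < 20" "e 11 = w" "w < K" "\<And>\<tau>'. \<tau>' \<le> \<tau> + 12 \<Longrightarrow> Q \<tau>' (e(r := if A a w = 0 then 1 else e r)) A"
  shows "wp (IF (Eq (Rd (N a) (X 11)) (N 0)) (Asg r (N 1)) SKIP) Q \<tau> e A"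
proof -
  have "A a w \<noteq> 0 \<Longrightarrow> e(r := if A a w = 0 then 1 else e r) = e" by simp
  then show ?thesis using assms Jn M small(2)[of a] by (cases "A a w = 0") simp_all
qed

lemma wp_FLAGS:
  assumes st: "static e A" and v: "e 8 = v" "v \<in> V"
    and B: "\<And>u c. u \<in> V \<Longrightarrow> c < 3 \<Longrightarrow> A (13 + c) u = of_bool (c \<in> L u)"
  shows "wp FLAGS (\<lambda>\<tau>' e' A'. \<tau>' \<le> \<tau> + deg v * 80 + 30 \<and> A' = A \<and> keep {11, 16, 17, 18, 19} e e' \<and>
    e' 16 = of_bool (misses L v 0) \<and> e' 17 = of_bool (misses L v 1) \<and> e' 18 = of_bool (misses L v 2)) \<tau> e A"
    (is "wp _ ?Q _ _ _")
proof -
  define F where "F i c = (of_bool (\<exists>j<i. c \<notin> L (nb v j)) :: nat)" for i c :: nat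
  have F0: "F 0 c = 0" for c unfolding F_def by simp
  have FS: "F (Suc i) c = (if c \<notin> L (nb v i) then 1 else F i c)" for i c
    unfolding F_def by (auto simp: less_Suc_eq)
  have Fdeg: "F (deg v) c = of_bool (misses L v c)" for c
  proof -
    have "(\<exists>j<deg v. c \<notin> L (nb v j)) \<longleftrightarrow> (\<exists>w\<in>nb v ` {..<deg v}. c \<notin> L w)" by blast
    then show ?thesis unfolding F_def misses_def nb[OF v(2)] by simp
  qed
  define P where "P i e' A' \<longleftrightarrow> A' = A \<and> keep {11, 16, 17, 18, 19} e e' \<and>
    e' 16 = F i 0 \<and> e' 17 = F i 1 \<and> e' 18 = F i 2" for i :: nat and e' :: env and A' :: arrays
  have e0: "e 0 = n" and row: "\<And>i. i < deg v \<Longrightarrow> A (20 + n + v) i = nb v i" and dg: "A 1 v = deg v"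
    using st v(2) unfolding static_def by blast+
  have "wp (FOR 19 (Rd (N 1) (X 8))
       (Asg 11 (Rd (N 20 \<oplus> X 0 \<oplus> X 8) (X 19)) ;;
        IF (Eq (Rd (N 13) (X 11)) (N 0)) (Asg 16 (N 1)) SKIP ;;
        IF (Eq (Rd (N 14) (X 11)) (N 0)) (Asg 17 (N 1)) SKIP ;;
        IF (Eq (Rd (N 15) (X 11)) (N 0)) (Asg 18 (N 1)) SKIP)) ?Q \<tau>0 (e(16 := 0, 17 := 0, 18 := 0)) A"
    if t0: "\<tau>0 \<le> \<tau> + 10" for \<tau>0
  proof (rule wp_FOR_const[where D = 60 and n = "deg v" and P = P])
    show "deg v < M" using bounds(2)[OF v(2)] small(1)[of "deg v"] by simp
    show "P 0 (e(16 := 0, 17 := 0, 18 := 0, 19 := 0)) A" by (simp add: P_def F0 keep_def)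
  next
    fix k e' A' assume P: "P k e' A'"
    then have "A' = A" "e' 8 = v" using v keepD[of "{11, 16, 17, 18, 19}" e e' 8] unfolding P_def by simp_all
    then show "xok e' A' (Rd (N 1) (X 8)) \<and> xval e' A' (Rd (N 1) (X 8)) = deg v"
      using dg bounds(1)[OF v(2)] Jn M by simp
  next
    fix i \<tau>' e' A' assume i: "i < deg v" and P: "P i e' A'" and ei: "e' 19 = i"
    have A': "A' = A" and k: "keep {11, 16, 17, 18, 19} e e'"
      and f: "e' 16 = F i 0" "e' 17 = F i 1" "e' 18 = F i 2" using P unfolding P_def by blast+
    have e8: "e' 8 = v" "e' 0 = n" using keepD[OF k] v e0 by simp_all
    let ?w = "nb v i"
    have wV: "?w \<in> V" using nb[OF v(2)] i dom sym by blast
    have b: "A 13 ?w = of_bool (0 \<in> L ?w)" "A 14 ?w = of_bool (1 \<in> L ?w)" "A 15 ?w = of_bool (2 \<in> L ?w)"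
      using B[OF wV, of 0] B[OF wV, of 1] B[OF wV, of 2] by simp_all
    have g: "(if A 13 ?w = 0 then 1 else F i 0) = F (Suc i) 0"
      "(if A 14 ?w = 0 then 1 else F i 1) = F (Suc i) 1" "(if A 15 ?w = 0 then 1 else F i 2) = F (Suc i) 2"
      unfolding FS b by simp_all
    let ?e = "e'(11 := ?w, 16 := F (Suc i) 0, 17 := F (Suc i) 1, 18 := F (Suc i) 2)"
    have P': "P (Suc i) (?e(19 := Suc i)) A" unfolding P_def using k by (simp add: keep_def)
    have "wp (IF (Eq (Rd (N 13) (X 11)) (N 0)) (Asg 16 (N 1)) SKIP ;;
        IF (Eq (Rd (N 14) (X 11)) (N 0)) (Asg 17 (N 1)) SKIP ;;
        IF (Eq (Rd (N 15) (X 11)) (N 0)) (Asg 18 (N 1)) SKIP)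
      (\<lambda>\<tau>'' e'' A''. \<tau>'' \<le> \<tau>' + 60 \<and> e'' 19 = i \<and> P (Suc i) (e''(19 := Suc i)) A'') \<tau>1 (e'(11 := ?w)) A"
      if t1: "\<tau>1 \<le> \<tau>' + 15" for \<tau>1
    proof (rule wp_seqI[where P = "\<lambda>\<tau>'' e'' A''. \<tau>'' \<le> \<tau>1 + 12 \<and> A'' = A \<and> e'' = e'(11 := ?w, 16 := F (Suc i) 0)"])
      show "wp (IF (Eq (Rd (N 13) (X 11)) (N 0)) (Asg 16 (N 1)) SKIP)
        (\<lambda>\<tau>'' e'' A''. \<tau>'' \<le> \<tau>1 + 12 \<and> A'' = A \<and> e'' = e'(11 := ?w, 16 := F (Suc i) 0)) \<tau>1 (e'(11 := ?w)) A"
        by (rule wp_flag[of _ _ ?w]) (use bounds(1)[OF wV] g f in \<open>simp_all del: One_nat_def cong: if_cong\<close>)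
    next
      fix \<tau>2 e2 A2 assume 2: "\<tau>2 \<le> \<tau>1 + 12 \<and> A2 = A \<and> e2 = e'(11 := ?w, 16 := F (Suc i) 0)"
      show "wp (IF (Eq (Rd (N 14) (X 11)) (N 0)) (Asg 17 (N 1)) SKIP ;;
        IF (Eq (Rd (N 15) (X 11)) (N 0)) (Asg 18 (N 1)) SKIP)
      (\<lambda>\<tau>'' e'' A''. \<tau>'' \<le> \<tau>' + 60 \<and> e'' 19 = i \<and> P (Suc i) (e''(19 := Suc i)) A'') \<tau>2 e2 A2"
      proof (rule wp_seqI[where P = "\<lambda>\<tau>'' e'' A''. \<tau>'' \<le> \<tau>2 + 12 \<and> A'' = A \<and>
          e'' = e'(11 := ?w, 16 := F (Suc i) 0, 17 := F (Suc i) 1)"])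
        show "wp (IF (Eq (Rd (N 14) (X 11)) (N 0)) (Asg 17 (N 1)) SKIP)
          (\<lambda>\<tau>'' e'' A''. \<tau>'' \<le> \<tau>2 + 12 \<and> A'' = A \<and>
          e'' = e'(11 := ?w, 16 := F (Suc i) 0, 17 := F (Suc i) 1)) \<tau>2 e2 A2"
          by (rule wp_flag[of _ _ ?w]) (use bounds(1)[OF wV] g f 2 in \<open>simp_all del: One_nat_def cong: if_cong\<close>)
      next
        fix \<tau>3 e3 A3 assume 3: "\<tau>3 \<le> \<tau>2 + 12 \<and> A3 = A \<and> e3 = e'(11 := ?w, 16 := F (Suc i) 0, 17 := F (Suc i) 1)"
        show "wp (IF (Eq (Rd (N 15) (X 11)) (N 0)) (Asg 18 (N 1)) SKIP)
          (\<lambda>\<tau>'' e'' A''. \<tau>'' \<le> \<tau>' + 60 \<and> e'' 19 = i \<and> P (Suc i) (e''(19 := Suc i)) A'') \<tau>3 e3 A3"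
          by (rule wp_flag[of _ _ ?w]) (use bounds(1)[OF wV] g f 2 3 t1 ei P' in \<open>simp_all del: One_nat_def cong: if_cong\<close>)
      qed
    qed
    then show "wp (Asg 11 (Rd (N 20 \<oplus> X 0 \<oplus> X 8) (X 19)) ;;
        IF (Eq (Rd (N 13) (X 11)) (N 0)) (Asg 16 (N 1)) SKIP ;;
        IF (Eq (Rd (N 14) (X 11)) (N 0)) (Asg 17 (N 1)) SKIP ;;
        IF (Eq (Rd (N 15) (X 11)) (N 0)) (Asg 18 (N 1)) SKIP)
      (\<lambda>\<tau>'' e'' A''. \<tau>'' \<le> \<tau>' + 60 \<and> e'' 19 = i \<and> P (Suc i) (e''(19 := Suc i)) A'') \<tau>' e' A'"
      unfolding wp.simps(4) wp.simps(2)
      using A' e8 ei row[OF i] bounds(5)[OF v(2)] bounds(2)[OF v(2)] i Jn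
      by (simp add: small del: wp.simps)
  next
    fix \<tau>' e' A' assume "\<tau>' \<le> \<tau>0 + deg v * (60 + xcost (Rd (N 1) (X 8)) + 6) + xcost (Rd (N 1) (X 8)) + 4" "P (deg v) e' A'"
    then show "?Q \<tau>' e' A'" using t0 unfolding P_def Fdeg by simp
  qed
  then show ?thesis unfolding FLAGS_def using M by simp
qed

lemma wp_TRIM_VERTEX:
  assumes l: "lstate {} Lc e A" and v: "e 8 = v" "v \<in> V"
    and B: "\<And>u c. u \<in> V \<Longrightarrow> c < 3 \<Longrightarrow> A (13 + c) u = of_bool (c \<in> L u)"
    and L: "\<And>u. u \<in> V \<Longrightarrow> L u \<subseteq> {0, 1, 2}" and Lc: "Lc v = L v \<or> Lc v = trim L v"
  shows "wp TRIM_VERTEX (\<lambda>\<tau>' e' A'. \<tau>' \<le> \<tau> + deg v * 80 + 400 \<and> lstate {} (Lc(v := trim L v)) e' A' \<and>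
    keep {6, 7, 9, 10, 11, 13, 16, 17, 18, 19} e e' \<and> keep {5, 10, 11, 12} A A' \<and>
    (\<forall>wt. pot wt (Lc(v := trim L v)) e' A' \<le> pot wt Lc e A)) \<tau> e A"
    (is "wp _ ?Q _ _ _")
proof -
  have st: "static e A" by (rule lstate_static[OF l])
  have sum: "A 13 v + A 14 v + A 15 v = card (L v)"
    using B[OF v(2), of 0] B[OF v(2), of 1] B[OF v(2), of 2] card_colours[OF L[OF v(2)]] by simp
  have le3: "card (L v) \<le> 3" using card_mono[OF _ L[OF v(2)]] by simp
  have c3: "A 13 v < M" "A 13 v + A 14 v < M" "A 13 v + A 14 v + A 15 v < M"
    using sum le3 small(1)[of "A 13 v + A 14 v + A 15 v"] small(1)[of "A 13 v + A 14 v"] small(1)[of "A 13 v"] Kn by linarith+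
  show ?thesis
  proof (cases "card (L v) = 3")
    case False
    then have t: "trim L v = L v" unfolding trim_def by simp
    then have "Lc(v := trim L v) = Lc" using Lc by (simp add: fun_upd_idem)
    then show ?thesis unfolding TRIM_VERTEX_def
      using False l v c3 bounds(1)[OF v(2)] Jn sum by (simp add: keep_refl small)
  next
    case True
    have full: "L v = {0, 1, 2}" using card_subset_eq[OF _ L[OF v(2)]] True by simp
    have tr: "trim L v = (if misses L v 0 then (if misses L v 1 \<or> misses L v 2 then {1, 2} else {0})
       else (if misses L v 2 then {0, 2} else {1}))" using True unfolding trim_def by simp
    have REM': "wp REM ?Q \<tau>1 (e1(9 := c)) A"
      if e1: "keep {11, 16, 17, 18, 19} e e1" and t1: "\<tau>1 \<le> \<tau> + deg v * 80 + 100"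
        and c: "c < 3" "Lc v - {c} = trim L v" for \<tau>1 e1 c
    proof -
      have k: "keep {9, 11, 16, 17, 18, 19} e (e1(9 := c))" using e1 unfolding keep_def by simp
      have l1: "lstate {} Lc (e1(9 := c)) A" using lstate_cong[OF k] l by simp
      have v1: "(e1(9 := c)) 8 = v" using keepD[OF k] v by simp
      have 9: "(e1(9 := c)) 9 = c" by simp
      from wp_REM[OF l1 v1 v(2) 9 c(1)] show ?thesis
      proof (rule wp_mono)
        fix \<tau>2 e2 A2
        assume 2: "\<tau>2 \<le> \<tau>1 + 80 \<and> lstate {} (Lc(v := Lc v - {c})) e2 A2 \<and> keep {6, 7, 13} (e1(9 := c)) e2 \<and>
          keep {5, 10, 11, 12} A A2 \<and> (\<forall>wt. pot wt (Lc(v := Lc v - {c})) e2 A2 \<le> pot wt Lc (e1(9 := c)) A)"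
        have "keep {6, 7, 9, 10, 11, 13, 16, 17, 18, 19} e e2" using 2 k unfolding keep_def by simp
        then show "?Q \<tau>2 e2 A2" using 2 t1 pot_cong[OF k] unfolding c(2) by simp
      qed
    qed
    have RES': "wp RESTRICT ?Q \<tau>1 (e1(10 := c)) A"
      if e1: "keep {11, 16, 17, 18, 19} e e1" and t1: "\<tau>1 \<le> \<tau> + deg v * 80 + 100"
        and c: "c < 3" "Lc v \<inter> {c} = trim L v" for \<tau>1 e1 c
    proof -
      have k: "keep {10, 11, 16, 17, 18, 19} e (e1(10 := c))" using e1 unfolding keep_def by simp
      have l1: "lstate {} Lc (e1(10 := c)) A" using lstate_cong[OF k] l by simp
      have v1: "(e1(10 := c)) 8 = v" using keepD[OF k] v by simp
      have 9: "(e1(10 := c)) 10 = c" by simp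
      from wp_RESTRICT[OF l1 v1 v(2) 9 c(1)] show ?thesis
      proof (rule wp_mono)
        fix \<tau>2 e2 A2
        assume 2: "\<tau>2 \<le> \<tau>1 + 270 \<and> lstate {} (Lc(v := Lc v \<inter> {c})) e2 A2 \<and> keep {6, 7, 9, 13} (e1(10 := c)) e2 \<and>
          keep {5, 10, 11, 12} A A2 \<and> (\<forall>wt. pot wt (Lc(v := Lc v \<inter> {c})) e2 A2 \<le> pot wt Lc (e1(10 := c)) A)"
        have "keep {6, 7, 9, 10, 11, 13, 16, 17, 18, 19} e e2" using 2 k unfolding keep_def by simp
        then show "?Q \<tau>2 e2 A2" using 2 t1 pot_cong[OF k] unfolding c(2) by simp
      qed
    qed
    have "wp (FLAGS ;;
        IF (Eq (X 16) (N 0))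
          (IF (Eq (X 18) (N 0)) (Asg 10 (N 1) ;; RESTRICT) (Asg 9 (N 1) ;; REM))
          (IF (Eq (X 17 \<oplus> X 18) (N 0)) (Asg 10 (N 0) ;; RESTRICT) (Asg 9 (N 0) ;; REM))) ?Q \<tau>0 e A"
      if t0: "\<tau>0 \<le> \<tau> + 30" for \<tau>0
    proof (rule wp_seqI[OF wp_FLAGS[OF st v B]], assumption, assumption, elim conjE)
      fix \<tau>1 e1 A1
      assume 1: "\<tau>1 \<le> \<tau>0 + deg v * 80 + 30" "A1 = A" "keep {11, 16, 17, 18, 19} e e1"
        "e1 16 = of_bool (misses L v 0)" "e1 17 = of_bool (misses L v 1)" "e1 18 = of_bool (misses L v 2)"
      consider (a) "\<not> misses L v 0" "\<not> misses L v 2" | (b) "\<not> misses L v 0" "misses L v 2"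
        | (c) "misses L v 0" "\<not> misses L v 1" "\<not> misses L v 2" | (d) "misses L v 0" "misses L v 1 \<or> misses L v 2" by blast
      then show "wp (IF (Eq (X 16) (N 0))
          (IF (Eq (X 18) (N 0)) (Asg 10 (N 1) ;; RESTRICT) (Asg 9 (N 1) ;; REM))
          (IF (Eq (X 17 \<oplus> X 18) (N 0)) (Asg 10 (N 0) ;; RESTRICT) (Asg 9 (N 0) ;; REM))) ?Q \<tau>1 e1 A1"
      proof cases
        case a
        then have "trim L v = {1}" using tr by simp
        then have "Lc v \<inter> {1} = trim L v" using Lc full by (elim disjE) simp_all
        then have "wp RESTRICT ?Q \<tau>2 (e1(10 := 1)) A" if "\<tau>2 \<le> \<tau>1 + 30" for \<tau>2
          using RES'[OF 1(3)] that 1(1) t0 by simp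
        then show ?thesis using 1(2-) a M by simp
      next
        case b
        then have "trim L v = {0, 2}" using tr by simp
        then have "Lc v - {1} = trim L v" using Lc full by (elim disjE) (simp_all add: insert_Diff_if)
        then have "wp REM ?Q \<tau>2 (e1(9 := 1)) A" if "\<tau>2 \<le> \<tau>1 + 30" for \<tau>2
          using REM'[OF 1(3)] that 1(1) t0 by simp
        then show ?thesis using 1(2-) b M by simp
      next
        case c
        then have "trim L v = {0}" using tr by simp
        then have "Lc v \<inter> {0} = trim L v" using Lc full by (elim disjE) simp_all
        then have "wp RESTRICT ?Q \<tau>2 (e1(10 := 0)) A" if "\<tau>2 \<le> \<tau>1 + 30" for \<tau>2
          using RES'[OF 1(3)] that 1(1) t0 by simp
        then show ?thesis using 1(2-) c M by simp
      next
        case d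
        then have "trim L v = {1, 2}" using tr by simp
        then have "Lc v - {0} = trim L v" using Lc full by (elim disjE) (simp_all add: insert_Diff_if)
        then have "wp REM ?Q \<tau>2 (e1(9 := 0)) A" if "\<tau>2 \<le> \<tau>1 + 30" for \<tau>2
          using REM'[OF 1(3)] that 1(1) t0 by simp
        moreover have "\<not> (e1 17 = 0 \<and> e1 18 = 0)" "e1 17 + e1 18 < M" using 1(5,6) d small(1)[of "e1 17 + e1 18"] Kn by auto
        ultimately show ?thesis using 1(2-4) d M by (cases "e1 17 = 0") simp_all
      qed
    qed
    then show ?thesis unfolding TRIM_VERTEX_def
      using True v c3 bounds(1)[OF v(2)] Jn sum by (simp add: small del: wp.simps(4))
  qed
qed

lemma deg_K: "v \<in> V \<Longrightarrow> deg v * 80 \<le> 80 * K" using bounds(2)[of v] by simp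

lemma wp_TRIM:
  assumes l: "lstate {} L e A"
  shows "wp TRIM (\<lambda>\<tau>' e' A'. \<tau>' \<le> \<tau> + nc * (150 * K) + 20 \<and>
    (\<exists>L'. lstate {} L' e' A' \<and> (\<forall>v\<in>V. L' v = trim L v) \<and> (\<forall>wt. pot wt L' e' A' \<le> pot wt L e A)) \<and>
    keep ({6..11} \<union> {13..19}) e e' \<and> keep ({5} \<union> {10..15}) A A') \<tau> e A"
    (is "wp _ ?Q _ _ _")
proof -
  have st: "static e A" by (rule lstate_static[OF l])
  have "wp (FOR 15 (X 2) (Asg 8 (Rd (N 4) (X 15)) ;; TRIM_VERTEX)) ?Q \<tau>0 e0 A0"
    if 0: "\<tau>0 \<le> \<tau> + nc * 60 + 5" "keep {8, 14} e e0" "keep {13, 13 + 1, 13 + 2} A A0"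
      "\<forall>v\<in>V. \<forall>c<3. A0 (13 + c) v = A (10 + c) v" for \<tau>0 e0 A0
  proof -
    have l0: "lstate {} L e0 A0" and p0: "pot wt L e0 A0 = pot wt L e A" for wt
      using lstate_cong[OF 0(2), of "{}" L A0] lstate_acong(1)[OF 0(3), of "{}" L e] l
        lstate_acong(2)[OF 0(3), of wt L e] pot_cong[OF 0(2), of wt L A0] by simp_all
    have B: "A0 (13 + c) v = of_bool (c \<in> L v)" if "v \<in> V" "c < 3" for v c
      using 0(4) lstate_rep[OF l that] that by simp
    define P where "P i e' A' \<longleftrightarrow> (\<exists>L'. lstate {} L' e' A' \<and> (\<forall>v\<in>V. L' v = L v \<or> L' v = trim L v) \<and>
      (\<forall>j<i. L' (vc j) = trim L (vc j)) \<and> (\<forall>wt. pot wt L' e' A' \<le> pot wt L e A)) \<and>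
      keep ({6..11} \<union> {13..19}) e0 e' \<and> keep {5, 10, 11, 12} A0 A'" for i :: nat and e' :: env and A' :: arrays
    show ?thesis
    proof (rule wp_FOR_const[where D = "80 * K + 420" and n = nc and P = P])
      show "nc < M" using bounds(3) small(1)[of nc] by simp
      have k: "keep {15} e0 (e0(15 := 0))" by (simp add: keep_def)
      show "P 0 (e0(15 := 0)) A0"
        unfolding P_def using lstate_cong[OF k] l0 pot_cong[OF k] p0
        by (intro conjI exI[of _ L]) (simp_all add: keep_def)
    next
      fix k e' A' assume "P k e' A'"
      then have "\<exists>L'. lstate {} L' e' A'" unfolding P_def by blast
      then have "e' 2 = nc" using lstate_static unfolding static_def by blast
      then show "xok e' A' (X 2) \<and> xval e' A' (X 2) = nc" by simp
    next
      fix i \<tau>' e' A' assume i: "i < nc" and P: "P i e' A'" and ei: "e' 15 = i"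
      then obtain L' where L': "lstate {} L' e' A'" "\<forall>v\<in>V. L' v = L v \<or> L' v = trim L v"
        "\<forall>j<i. L' (vc j) = trim L (vc j)" "\<forall>wt. pot wt L' e' A' \<le> pot wt L e A"
        and k: "keep ({6..11} \<union> {13..19}) e0 e'" "keep {5, 10, 11, 12} A0 A'" unfolding P_def by blast
      have v: "A' 4 i = vc i" "vc i \<in> V" using list_row[OF lstate_static[OF L'(1)] i] by auto
      let ?v = "vc i" let ?e = "e'(8 := ?v)"
      have k8: "keep {8} e' ?e" by (simp add: keep_def)
      have l1: "lstate {} L' ?e A'" using lstate_cong[OF k8] L'(1) by simp
      have B': "A' (13 + c) u = of_bool (c \<in> L u)" if "u \<in> V" "c < 3" for u c
        using B[OF that] keepD[OF k(2), of "13 + c"] that by simp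
      have Lc: "L' ?v = L ?v \<or> L' ?v = trim L ?v" using L'(2) v(2) by blast
      have "wp TRIM_VERTEX (\<lambda>\<tau>'' e'' A''. \<tau>'' \<le> \<tau>' + (80 * K + 420) \<and> e'' 15 = i \<and> P (Suc i) (e''(15 := Suc i)) A'') \<tau>1 ?e A'"
        if t1: "\<tau>1 \<le> \<tau>' + 10" for \<tau>1
      proof (rule wp_mono[OF wp_TRIM_VERTEX[where L = L, OF l1 _ v(2) B' _ Lc]])
        show "?e 8 = ?v" by simp
        show "L u \<subseteq> {0, 1, 2}" if "u \<in> V" for u by (rule lstate_sub[OF l that])
      next
        fix \<tau>2 e2 A2
        let ?L = "L'(?v := trim L ?v)"
        assume 2: "\<tau>2 \<le> \<tau>1 + deg ?v * 80 + 400 \<and> lstate {} ?L e2 A2 \<and>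
          keep {6, 7, 9, 10, 11, 13, 16, 17, 18, 19} ?e e2 \<and> keep {5, 10, 11, 12} A' A2 \<and>
          (\<forall>wt. pot wt ?L e2 A2 \<le> pot wt L' ?e A')"
        then have k2: "keep {6, 7, 9, 10, 11, 13, 16, 17, 18, 19} ?e e2" by blast
        have k3: "keep {15} e2 (e2(15 := Suc i))" by (simp add: keep_def)
        have "lstate {} ?L (e2(15 := Suc i)) A2" using 2 lstate_cong[OF k3] by simp
        moreover have "\<forall>v\<in>V. ?L v = L v \<or> ?L v = trim L v" using L'(2) by simp
        moreover have "\<forall>j<Suc i. ?L (vc j) = trim L (vc j)" using L'(3) by (simp add: less_Suc_eq)
        moreover have "pot wt ?L (e2(15 := Suc i)) A2 \<le> pot wt L e A" for wt
        proof -
          have "pot wt ?L e2 A2 \<le> pot wt L' ?e A'" using 2 by blast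
          also have "\<dots> = pot wt L' e' A'" by (rule pot_cong[OF k8]) simp_all
          also have "\<dots> \<le> pot wt L e A" using L'(4) by blast
          finally show ?thesis using pot_cong[OF k3, of wt ?L A2] by simp
        qed
        moreover have "keep ({6..11} \<union> {13..19}) e0 (e2(15 := Suc i))"
          by (rule keep_trans'[OF keep_trans'[OF keep_trans'[OF k(1) k8] k2] k3]) simp_all
        moreover have "keep {5, 10, 11, 12} A0 A2" using keep_trans[OF k(2)] 2 by blast
        ultimately have "P (Suc i) (e2(15 := Suc i)) A2" unfolding P_def by blast
        moreover have "e2 15 = i" using keepD[OF k2, of 15] ei by simp
        ultimately show "\<tau>2 \<le> \<tau>' + (80 * K + 420) \<and> e2 15 = i \<and> P (Suc i) (e2(15 := Suc i)) A2"
          using 2 t1 deg_K[OF v(2)] by linarith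
      qed
      then show "wp (Asg 8 (Rd (N 4) (X 15)) ;; TRIM_VERTEX)
        (\<lambda>\<tau>'' e'' A''. \<tau>'' \<le> \<tau>' + (80 * K + 420) \<and> e'' 15 = i \<and> P (Suc i) (e''(15 := Suc i)) A'') \<tau>' e' A'"
        using v ei bounds(3) i Jn by (simp add: small)
    next
      fix \<tau>' e' A' assume t: "\<tau>' \<le> \<tau>0 + nc * (80 * K + 420 + xcost (X 2) + 6) + xcost (X 2) + 4" and P: "P nc e' A'"
      then obtain L' where L': "lstate {} L' e' A'" "\<forall>j<nc. L' (vc j) = trim L (vc j)"
        "\<forall>wt. pot wt L' e' A' \<le> pot wt L e A"
        and k: "keep ({6..11} \<union> {13..19}) e0 e'" "keep {5, 10, 11, 12} A0 A'" unfolding P_def by blast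
      have "\<forall>v\<in>V. L' v = trim L v" using L'(2) vc_ex by blast
      moreover have "keep ({6..11} \<union> {13..19}) e e'"
        by (rule keep_trans[OF keep_mono[OF 0(2)] k(1)]) simp
      moreover have "keep ({5} \<union> {10..15}) A A'"
        by (rule keep_trans[OF keep_mono[OF 0(3)] keep_mono[OF k(2)]]) simp_all
      moreover have "nc * (80 * K + 420 + xcost (X 2) + 6) + nc * 60 \<le> nc * (150 * K)"
      proof -
        have "80 * K + 420 + xcost (X 2) + 6 + 60 \<le> 150 * K" using Kn by simp
        then have "nc * (80 * K + 420 + xcost (X 2) + 6 + 60) \<le> nc * (150 * K)" by (rule mult_le_mono2)
        then show ?thesis by (simp add: add_mult_distrib2)
      qed
      ultimately show "?Q \<tau>' e' A'" using L' t 0(1) by auto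
    qed
  qed
  then show ?thesis
    unfolding TRIM_def by (intro wp_seqI[OF wp_COPY_LISTS[OF st]]) simp_all
qed

end

section \<open>Lists of size at most two\<close>

context comp_machine begin

definition colourable :: "(nat \<Rightarrow> nat set) \<Rightarrow> bool" where
  "colourable L \<longleftrightarrow> (\<exists>f. proper f \<and> (\<forall>u\<in>V. f u \<in> L u))"

lemma refines_colourable: "refines L L' \<Longrightarrow> colourable L \<Longrightarrow> colourable L'"
  unfolding refines_def colourable_def by meson

lemma lstate_intro:
  assumes "static e A" "\<And>v. v \<in> V \<Longrightarrow> L v \<subseteq> {0, 1, 2}"
    and "\<And>v c. v \<in> V \<Longrightarrow> c < 3 \<Longrightarrow> A (10 + c) v = of_bool (c \<in> L v)"
    and "e 5 = 0" "e 6 = 0" "e 7 = 0" "\<And>v. v \<in> V \<Longrightarrow> L v \<noteq> {}" "closed_lists L"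
  shows "lstate {} L e A"
proof -
  have "card {v \<in> V. 2 \<le> card (L v)} \<le> nc" unfolding nc by (rule card_mono[OF fin]) simp
  moreover have "\<forall>w. E v w \<longrightarrow> L v \<inter> L w = {}" if "card (L v) = 1" for v
    using assms(8) that unfolding closed_lists_def by blast
  ultimately show ?thesis using assms(1-7) unfolding lstate_def by simp
qed

lemma lstate_closed_lists:
  assumes "lstate {} L e A" "e 5 = e 6" "e 7 = 0"
  shows "closed_lists L"
  unfolding closed_lists_def
proof (intro allI impI)
  fix u v assume e: "E u v" and c: "card (L u) = 1"
  have "\<not> (\<exists>i. e 5 \<le> i \<and> i < e 6 \<and> A 5 i = u)" using assms(2) by auto
  moreover have "(\<exists>i. e 5 \<le> i \<and> i < e 6 \<and> A 5 i = u) \<or> (\<forall>w. E u w \<longrightarrow> L u \<inter> L w = {})"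
    by (rule lstate_closed[OF assms(1,3) dom[OF e] _ c]) simp
  ultimately have "\<forall>w. E u w \<longrightarrow> L u \<inter> L w = {}" by blast
  then show "L u \<inter> L v = {}" using e by blast
qed

lemma lstate_nonempty: "lstate Y L e A \<Longrightarrow> e 7 = 0 \<Longrightarrow> v \<in> V \<Longrightarrow> L v \<noteq> {}"
  using lstate_fail by blast

lemma colourable_no_fail: "lstate Y L e A \<Longrightarrow> colourable L \<Longrightarrow> e 7 = 0"
  using lstate_fail[of Y L e A] unfolding colourable_def by fastforce

lemma sum_W: "sum W V \<le> 110 * K"
proof -
  have "sum W V = 110 * sum deg V + 70 * card V"
    unfolding W_def by (simp add: sum.distrib sum_distrib_left)
  then show ?thesis using degsum nc nc_le Kn by simp
qed

lemma pot_empty: "e 5 = e 6 \<Longrightarrow> pot wt L e A \<le> sum wt V"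
  unfolding pot_def using fin by (simp add: sum_mono2)

lemma wp_RETRY:
  assumes st: "static e A" and v: "e 17 = v" "v \<in> V" and c: "e 16 = c" "c < 3"
    and B: "\<And>v c. v \<in> V \<Longrightarrow> c < 3 \<Longrightarrow> A (13 + c) v = of_bool (c \<in> L v)"
    and L: "\<And>v. v \<in> V \<Longrightarrow> L v \<subseteq> {0, 1, 2} \<and> L v \<noteq> {}" "closed_lists L"
  shows "wp RETRY (\<lambda>\<tau>' e' A'. \<tau>' \<le> \<tau> + 170 * K + 200 \<and>
    (\<exists>L'. lstate {} L' e' A' \<and> refines (L(v := L v - {c})) L' \<and> e' 5 = e' 6) \<and>
    keep {5, 6, 7, 8, 9, 11, 12, 13, 14} e e' \<and> keep {5, 10, 11, 12} A A') \<tau> e A"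
    (is "wp _ ?Q _ _ _")
  unfolding RETRY_def
proof (rule wp_seqI[OF wp_COPY_LISTS[OF st]])
  fix \<tau>1 e1 A1
  assume 1: "\<tau>1 \<le> \<tau> + nc * 60 + 5 \<and> keep {8, 14} e e1 \<and> keep {10, 10 + 1, 10 + 2} A A1 \<and>
    (\<forall>v\<in>V. \<forall>c<3. A1 (10 + c) v = A (13 + c) v)"
  have k1: "keep {8, 14} e e1" and a1: "keep {10, 10 + 1, 10 + 2} A A1" using 1 by blast+
  let ?e = "e1(5 := 0, 6 := 0, 7 := 0, 8 := v, 9 := c)"
  have e1: "e1 17 = v" "e1 16 = c" using keepD[OF k1] v c by simp_all
  have st1: "static ?e A1"
  proof -
    have "static e1 A1" by (rule static_keep[OF st k1 a1]) auto
    then show ?thesis unfolding static_def by simp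
  qed
  have l: "lstate {} L ?e A1"
    by (rule lstate_intro[OF st1]) (use L B 1 in auto)
  let ?L = "L(v := L v - {c})"
  have "wp (REM ;; PROPAGATE) ?Q \<tau>2 ?e A1" if t2: "\<tau>2 \<le> \<tau>1 + 20" for \<tau>2
  proof (rule wp_seqI[OF wp_REM[OF l _ v(2) _ c(2)]], simp, simp, elim conjE)
    fix \<tau>3 e3 A3
    assume 3: "\<tau>3 \<le> \<tau>2 + 80" "lstate {} ?L e3 A3" "keep {6, 7, 13} ?e e3" "keep {5, 10, 11, 12} A1 A3"
      "\<forall>wt. pot wt ?L e3 A3 \<le> pot wt L ?e A1"
    have "pot W ?L e3 A3 \<le> sum W V" by (rule le_trans[OF spec[OF 3(5)] pot_empty]) simp
    then have p: "pot W ?L e3 A3 \<le> 110 * K" using sum_W by simp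
    show "wp PROPAGATE ?Q \<tau>3 e3 A3"
    proof (rule wp_mono[OF wp_PROPAGATE[OF 3(2)]], elim conjE exE)
      fix \<tau>4 e4 A4 L'
      assume 4: "\<tau>4 \<le> \<tau>3 + pot W ?L e3 A3 + 20" "lstate {} L' e4 A4" "refines ?L L'" "e4 5 = e4 6"
        "keep {5, 6, 7, 8, 9, 11, 12, 13} e3 e4" "keep {5, 10, 11, 12} A3 A4"
      have ke: "keep {5, 6, 7, 8, 9} e1 ?e" by (simp add: keep_def)
      have "keep {5, 6, 7, 8, 9, 11, 12, 13, 14} e e4"
        by (rule keep_trans'[OF keep_trans'[OF keep_trans'[OF keep_mono[OF k1] ke] 3(3)] 4(5)]) simp_all
      moreover have "keep {5, 10, 11, 12} A A4"
        by (rule keep_trans'[OF keep_trans'[OF keep_mono[OF a1] 3(4)] 4(6)]) simp_all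
      moreover have "nc \<le> K" using bounds(3) by simp
      ultimately show "?Q \<tau>4 e4 A4" using 4(1-4) 3(1) t2 1 p by auto
    qed
  qed
  then show "wp (Asg 5 (N 0) ;; Asg 6 (N 0) ;; Asg 7 (N 0) ;; Asg 8 (X 17) ;; Asg 9 (X 16) ;;
      REM ;; PROPAGATE) ?Q \<tau>1 e1 A1"
    using e1 M by simp
qed simp_all

lemma card_le2_minus: "finite S \<Longrightarrow> card S \<le> 2 \<Longrightarrow> c \<in> S \<Longrightarrow> card (S - {c}) \<le> 1"
  by simp

text \<open>
  If the first colour propagates without conflict, colourability is kept by \<open>two_list_step\<close>. If not,
  no colouring uses it, and removing it loses nothing.
\<close>

lemma wp_TRY_COLOUR:
  assumes l: "lstate {} L e A" and q: "e 5 = e 6" "e 7 = 0" and v: "e 17 = v" "v \<in> V"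
    and c: "e 16 = c" "c \<in> L v" and two: "\<And>u. u \<in> V \<Longrightarrow> card (L u) \<le> 2"
  shows "wp TRY_COLOUR (\<lambda>\<tau>' e' A'. \<tau>' \<le> \<tau> + 350 * K + 700 \<and>
    (\<exists>L'. lstate {} L' e' A' \<and> e' 5 = e' 6 \<and> (\<forall>u\<in>V. L' u \<subseteq> L u) \<and> card (L' v) \<le> 1 \<and>
      (colourable L \<longrightarrow> colourable L')) \<and>
    keep {5..14} e e' \<and> keep ({5} \<union> {10..15}) A A') \<tau> e A"
    (is "wp _ ?Q _ _ _")
proof -
  have c3: "c < 3" using lstate_sub[OF l v(2)] c(2) by auto
  have Lne: "L u \<noteq> {}" if "u \<in> V" for u by (rule lstate_nonempty[OF l q(2) that])
  have cl: "closed_lists L" by (rule lstate_closed_lists[OF l q])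
  let ?e0 = "e(5 := 0, 6 := 0)"
  have st0: "static ?e0 A" using lstate_static[OF l] unfolding static_def by simp
  have l0: "lstate {} L ?e0 A"
    by (rule lstate_intro[OF st0]) (use lstate_sub[OF l] lstate_rep[OF l] q Lne cl in simp_all)
  let ?L = "L(v := L v \<inter> {c})"
  have Lv: "L v \<inter> {c} = {c}" using c(2) by simp
  have "wp (COPY_LISTS 13 10 ;; Asg 8 (X 17) ;; Asg 10 (X 16) ;; RESTRICT ;; PROPAGATE ;;
      IF (Eq (X 7) (N 0)) SKIP RETRY) ?Q \<tau>0 ?e0 A" if t0: "\<tau>0 \<le> \<tau> + 10" for \<tau>0
  proof (rule wp_seqI[OF wp_COPY_LISTS[OF st0]])
    fix \<tau>1 e1 A1
    assume 1: "\<tau>1 \<le> \<tau>0 + nc * 60 + 5 \<and> keep {8, 14} ?e0 e1 \<and> keep {13, 13 + 1, 13 + 2} A A1 \<and>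
      (\<forall>v\<in>V. \<forall>c<3. A1 (13 + c) v = A (10 + c) v)"
    then have k1: "keep {8, 14} ?e0 e1" and a1: "keep {13, 13 + 1, 13 + 2} A A1" by blast+
    have B: "A1 (13 + c) v = of_bool (c \<in> L v)" if "v \<in> V" "c < 3" for v c
      using 1 lstate_rep[OF l that] that by simp
    have e1: "e1 17 = v" "e1 16 = c" "e1 5 = 0" "e1 6 = 0" using keepD[OF k1] v c by simp_all
    let ?e = "e1(8 := v, 10 := c)"
    have kk: "keep {8, 10} e1 ?e" by (simp add: keep_def)
    have l1: "lstate {} L ?e A1"
      using lstate_cong[OF k1] lstate_cong[OF kk] lstate_acong(1)[OF a1] l0 by simp
    have "wp (RESTRICT ;; PROPAGATE ;; IF (Eq (X 7) (N 0)) SKIP RETRY) ?Q \<tau>2 ?e A1"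
      if t2: "\<tau>2 \<le> \<tau>1 + 10" for \<tau>2
    proof (rule wp_seqI[OF wp_RESTRICT[OF l1 _ v(2) _ c3]], simp, simp, elim conjE)
      fix \<tau>3 e3 A3
      assume 3: "\<tau>3 \<le> \<tau>2 + 270" "lstate {} ?L e3 A3" "keep {6, 7, 9, 13} ?e e3" "keep {5, 10, 11, 12} A1 A3"
        "\<forall>wt. pot wt ?L e3 A3 \<le> pot wt L ?e A1"
      have "pot W ?L e3 A3 \<le> sum W V" by (rule le_trans[OF spec[OF 3(5)] pot_empty]) (simp add: e1)
      then have p: "pot W ?L e3 A3 \<le> 110 * K" using sum_W by simp
      show "wp (PROPAGATE ;; IF (Eq (X 7) (N 0)) SKIP RETRY) ?Q \<tau>3 e3 A3"
      proof (rule wp_seqI[OF wp_PROPAGATE[OF 3(2)]], elim conjE exE)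
        fix \<tau>4 e4 A4 L'
        assume 4: "\<tau>4 \<le> \<tau>3 + pot W ?L e3 A3 + 20" "lstate {} L' e4 A4" "refines ?L L'" "e4 5 = e4 6"
          "keep {5, 6, 7, 8, 9, 11, 12, 13} e3 e4" "keep {5, 10, 11, 12} A3 A4"
        have ke0: "keep {5, 6} e (e(5 := 0, 6 := 0))" by (simp add: keep_def)
        have ke: "keep {5..14} e e4"
          by (rule keep_trans'[OF keep_trans'[OF keep_trans'[OF keep_trans'[OF keep_mono[OF ke0] k1] kk] 3(3)] 4(5)]) simp_all
        have ka: "keep ({5} \<union> {10..15}) A A4"
          by (rule keep_trans'[OF keep_trans'[OF keep_mono[OF a1] 3(4)] 4(6)]) simp_all
        have sub: "L' u \<subseteq> L u" if "u \<in> V" for u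
          using refines_sub[OF 4(3) that] by (cases "u = v") auto
        have tm: "\<tau>4 \<le> \<tau> + 170 * K + 320"
          using 4(1) 3(1) t2 1 t0 p bounds(3) by linarith
        show "wp (IF (Eq (X 7) (N 0)) SKIP RETRY) ?Q \<tau>4 e4 A4"
        proof (cases "e4 7 = 0")
          case True
          have "card (L' v) \<le> card {c}"
            using refines_sub[OF 4(3) v(2)] by (intro card_mono) (simp_all add: Lv)
          moreover have "colourable L'" if "colourable L"
          proof -
            from that obtain f where f: "proper f" "\<And>u. u \<in> V \<Longrightarrow> f u \<in> L u" unfolding colourable_def by blast
            have "L u \<subseteq> {0, 1, 2} \<and> card (L u) \<le> 2" if "u \<in> V" for u using lstate_sub[OF l that] two[OF that] by simp
            moreover have "closed_lists L'" by (rule lstate_closed_lists[OF 4(2,4) True])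
            moreover have "L' u \<subseteq> L u \<and> L' u \<noteq> {}" if "u \<in> V" for u
              using sub[OF that] lstate_nonempty[OF 4(2) True that] by simp
            ultimately show ?thesis
              using two_list_step[OF f, of L'] unfolding colourable_def by metis
          qed
          ultimately show ?thesis using True M 4(2,4) sub ke ka tm by auto
        next
          case False
          have "\<not> colourable L'" using colourable_no_fail[OF 4(2)] False by blast
          then have nc': "\<not> colourable ?L" using refines_colourable[OF 4(3)] by blast
          have st4: "static e4 A4" by (rule lstate_static[OF 4(2)])
          have e4: "e4 17 = v" "e4 16 = c" using keepD[OF ke] v c by simp_all
          have B4: "A4 (13 + d) u = of_bool (d \<in> L u)" if "u \<in> V" "d < 3" for u d
            using B[OF that] keepD[OF 3(4), of "13 + d"] keepD[OF 4(6), of "13 + d"] by simp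
          have "wp RETRY ?Q \<tau>5 e4 A4" if t5: "\<tau>5 \<le> \<tau>4 + 10" for \<tau>5
          proof (rule wp_mono[OF wp_RETRY[where L = L, OF st4 e4(1) v(2) e4(2) c3 B4]], assumption, assumption)
            show "L u \<subseteq> {0, 1, 2} \<and> L u \<noteq> {}" if "u \<in> V" for u using lstate_sub[OF l that] Lne[OF that] by simp
            show "closed_lists L" by (rule cl)
            fix \<tau>6 e6 A6
            let ?M = "L(v := L v - {c})"
            assume 6: "\<tau>6 \<le> \<tau>5 + 170 * K + 200 \<and>
              (\<exists>L'. lstate {} L' e6 A6 \<and> refines ?M L' \<and> e6 5 = e6 6) \<and>
              keep {5, 6, 7, 8, 9, 11, 12, 13, 14} e4 e6 \<and> keep {5, 10, 11, 12} A4 A6"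
            then obtain L6 where L6: "lstate {} L6 e6 A6" "refines ?M L6" "e6 5 = e6 6" by blast
            have "L6 u \<subseteq> L u" if "u \<in> V" for u
              using refines_sub[OF L6(2) that] by (cases "u = v") auto
            moreover have "card (L6 v) \<le> 1"
            proof -
              have "card (L6 v) \<le> card (L v - {c})"
                using refines_sub[OF L6(2) v(2)] lstate_fin[OF l v(2)] by (intro card_mono) simp_all
              then show ?thesis using card_le2_minus[OF lstate_fin[OF l v(2)] two[OF v(2)] c(2)] by simp
            qed
            moreover have "colourable L6" if "colourable L"
            proof -
              from that obtain f where f: "proper f" "\<forall>u\<in>V. f u \<in> L u" unfolding colourable_def by blast
              have "f v \<noteq> c"
              proof
                assume "f v = c"
                then have "\<forall>u\<in>V. f u \<in> ?L u" using f(2) c(2) by simp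
                then show False using nc' f(1) unfolding colourable_def by blast
              qed
              then have "\<forall>u\<in>V. f u \<in> ?M u" using f(2) by simp
              then have "colourable ?M" using f(1) unfolding colourable_def by blast
              then show ?thesis by (rule refines_colourable[OF L6(2)])
            qed
            moreover have "keep {5..14} e e6" by (rule keep_trans'[OF ke]) (use 6 in blast, simp)
            moreover have "keep ({5} \<union> {10..15}) A A6" by (rule keep_trans'[OF ka]) (use 6 in blast, simp)
            moreover have "\<tau>6 \<le> \<tau> + 350 * K + 700" using 6 t5 tm by linarith
            ultimately show "?Q \<tau>6 e6 A6" using L6(1,3) by blast
          qed
          then show ?thesis using False M by simp
        qed
      qed
    qed
    then show "wp (Asg 8 (X 17) ;; Asg 10 (X 16) ;; RESTRICT ;; PROPAGATE ;;
      IF (Eq (X 7) (N 0)) SKIP RETRY) ?Q \<tau>1 e1 A1" using e1 by simp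
  qed simp_all
  then show ?thesis unfolding TRY_COLOUR_def using M by simp
qed

text \<open>
  Each round decides a vertex and keeps colourability, so a colourable instance never fails.
\<close>

lemma wp_SOLVE:
  assumes l: "lstate {} L e A" and q: "e 5 = e 6" and two: "\<And>u. u \<in> V \<Longrightarrow> card (L u) \<le> 2"
  shows "wp SOLVE (\<lambda>\<tau>' e' A'. \<tau>' \<le> \<tau> + nc * (450 * K) + 10 \<and>
    (\<exists>L'. lstate {} L' e' A' \<and> e' 5 = e' 6 \<and> (e' 7 = 0 \<longrightarrow> (\<forall>v\<in>V. L' v \<subseteq> L v \<and> card (L' v) = 1)) \<and>
      (colourable L \<longrightarrow> e' 7 = 0)) \<and>
    keep {5..17} e e' \<and> keep ({5} \<union> {10..15}) A A') \<tau> e A"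
    (is "wp _ ?Q _ _ _")
proof -
  define P where "P i e' A' \<longleftrightarrow> (\<exists>L'. lstate {} L' e' A' \<and> e' 5 = e' 6 \<and> (\<forall>v\<in>V. L' v \<subseteq> L v) \<and>
      (\<forall>v\<in>V. card (L' v) \<le> 2) \<and>
      (e' 7 = 0 \<longrightarrow> (\<forall>j<i. card (L' (vc j)) \<le> 1)) \<and> (colourable L \<longrightarrow> colourable L')) \<and>
    keep {5..17} e e' \<and> keep ({5} \<union> {10..15}) A A'" for i :: nat and e' :: env and A' :: arrays
  show ?thesis
    unfolding SOLVE_def
  proof (rule wp_FOR_const[where D = "350 * K + 800" and n = nc and P = P])
    show "nc < M" using bounds(3) small(1)[of nc] by simp
    have k: "keep {15} e (e(15 := 0))" by (simp add: keep_def)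
    show "P 0 (e(15 := 0)) A"
      unfolding P_def using lstate_cong[OF k] l q two keep_mono[OF k]
      by (intro conjI exI[of _ L]) (simp_all add: keep_def)
  next
    fix k e' A' assume "P k e' A'"
    then have "\<exists>L'. lstate {} L' e' A'" unfolding P_def by blast
    then have "e' 2 = nc" using lstate_static unfolding static_def by blast
    then show "xok e' A' (X 2) \<and> xval e' A' (X 2) = nc" by simp
  next
    fix i \<tau>' e' A' assume i: "i < nc" and P: "P i e' A'" and ei: "e' 15 = i"
    note P' = P[unfolded P_def]
    from P'[THEN conjunct1] obtain L' where L': "lstate {} L' e' A'" "e' 5 = e' 6" "\<forall>v\<in>V. L' v \<subseteq> L v"
      "\<forall>v\<in>V. card (L' v) \<le> 2" "e' 7 = 0 \<longrightarrow> (\<forall>j<i. card (L' (vc j)) \<le> 1)" "colourable L \<longrightarrow> colourable L'"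
      by (elim exE conjE) (rule that)
    have k: "keep {5..17} e e'" "keep ({5} \<union> {10..15}) A A'"
      by (rule P'[THEN conjunct2, THEN conjunct1], rule P'[THEN conjunct2, THEN conjunct2])
    let ?v = "vc i"
    have v: "A' 4 i = ?v" "?v \<in> V" using list_row[OF lstate_static[OF L'(1)] i] by auto
    let ?Q' = "\<lambda>\<tau>'' e'' A''. \<tau>'' \<le> \<tau>' + (350 * K + 800) \<and> e'' 15 = i \<and> P (Suc i) (e''(15 := Suc i)) A''"
    have adv: "P (Suc i) (e''(15 := Suc i)) A''"
      if "lstate {} L'' e'' A''" "e'' 5 = e'' 6" "\<forall>v\<in>V. L'' v \<subseteq> L' v"
        "e'' 7 = 0 \<longrightarrow> e' 7 = 0 \<and> card (L'' ?v) \<le> 1" "colourable L' \<longrightarrow> colourable L''"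
        "keep {5..17} e' e''" "keep ({5} \<union> {10..15}) A' A''" for e'' A'' L''
    proof -
      have kk: "keep {15} e'' (e''(15 := Suc i))" by (simp add: keep_def)
      have mono: "card (L'' u) \<le> card (L' u)" if "u \<in> V" for u
        using \<open>\<forall>v\<in>V. L'' v \<subseteq> L' v\<close> that lstate_fin[OF L'(1) that] by (intro card_mono) simp_all
      have vcV: "vc j \<in> V" if "j < Suc i" for j using that i vc by auto
      have c1: "lstate {} L'' (e''(15 := Suc i)) A''" using that(1) lstate_cong[OF kk] by simp
      have c2: "\<forall>v\<in>V. L'' v \<subseteq> L v" using that(3) L'(3) by (meson order_trans)
      have c3: "\<forall>v\<in>V. card (L'' v) \<le> 2" using mono L'(4) by (meson le_trans)
      have c4: "card (L'' (vc j)) \<le> 1" if "e'' 7 = 0" "j < Suc i" for j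
      proof (cases "j = i")
        case False
        then have "card (L' (vc j)) \<le> 1" using L'(5) \<open>e'' 7 = 0 \<longrightarrow> e' 7 = 0 \<and> card (L'' ?v) \<le> 1\<close> that by simp
        then show ?thesis using mono[OF vcV[OF that(2)]] by simp
      qed (use \<open>e'' 7 = 0 \<longrightarrow> e' 7 = 0 \<and> card (L'' ?v) \<le> 1\<close> that in simp)
      have c5: "colourable L \<longrightarrow> colourable L''" using that(5) L'(6) by simp
      have "keep {5..17} e (e''(15 := Suc i))"
        by (rule keep_trans'[OF keep_trans[OF k(1) that(6)] kk]) simp
      moreover have "keep ({5} \<union> {10..15}) A A''" by (rule keep_trans[OF k(2) that(7)])
      ultimately show ?thesis unfolding P_def using c1 c2 c3 c4 c5 that(2)
        by (intro conjI exI[of _ L'']) simp_all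
    qed
    show "wp (IF (Eq (X 7) (N 0))
       (Asg 17 (Rd (N 4) (X 15)) ;;
        IF (Eq (Rd (N 10) (X 17) \<oplus> Rd (N 11) (X 17) \<oplus> Rd (N 12) (X 17)) (N 2))
          (IF (Eq (Rd (N 10) (X 17)) (N 1)) (Asg 16 (N 0)) (Asg 16 (N 1)) ;; TRY_COLOUR)
          SKIP) SKIP) ?Q' \<tau>' e' A'"
    proof (cases "e' 7 = 0")
      case False
      have "P (Suc i) (e'(15 := Suc i)) A'"
        by (rule adv[OF L'(1,2)]) (use False in \<open>simp_all add: keep_refl\<close>)
      then show ?thesis using False ei M by simp
    next
      case True
      have sum: "A' 10 ?v + A' 11 ?v + A' 12 ?v = card (L' ?v)" by (rule lstate_card[OF L'(1) v(2)])
      have le2: "card (L' ?v) \<le> 2" using L'(4) v(2) by blast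
      have sm: "A' 10 ?v < M" "A' 10 ?v + A' 11 ?v < M" "A' 10 ?v + A' 11 ?v + A' 12 ?v < M"
        using sum le2 small(1)[of "A' 10 ?v + A' 11 ?v + A' 12 ?v"] small(1)[of "A' 10 ?v + A' 11 ?v"]
          small(1)[of "A' 10 ?v"] Kn by linarith+
      have vb: "?v < K" "i < K" using bounds(1)[OF v(2)] bounds(3) i by simp_all
      have k17: "keep {17} e' (e'(17 := ?v))" by (simp add: keep_def)
      show ?thesis
      proof (cases "card (L' ?v) = 2")
        case False
        then have one: "card (L' ?v) \<le> 1" using le2 by simp
        have "P (Suc i) ((e'(17 := ?v))(15 := Suc i)) A'"
        proof (rule adv)
          show "lstate {} L' (e'(17 := ?v)) A'" using L'(1) lstate_cong[OF k17] by simp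
          show "keep {5..17} e' (e'(17 := ?v))" by (rule keep_mono[OF k17]) simp
        qed (use L'(2) one True in \<open>simp_all add: keep_refl\<close>)
        then show ?thesis using True False ei M v sum sm vb Jn by (simp add: small)
      next
        case c2: True
        define c :: nat where "c = (if 0 \<in> L' ?v then 0 else 1)"
        have "c \<in> L' ?v"
        proof (cases "0 \<in> L' ?v")
          case False
          then have "L' ?v \<subseteq> {1, 2}" using lstate_sub[OF L'(1) v(2)] by auto
          then have "L' ?v = {1, 2}" using card_subset_eq[of "{1, 2}" "L' ?v"] c2 by simp
          then show ?thesis unfolding c_def by simp
        qed (simp add: c_def)
        have a10: "A' 10 ?v = of_bool (0 \<in> L' ?v)" using lstate_rep[OF L'(1) v(2), of 0] by simp
        let ?e = "e'(17 := ?v, 16 := c)"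
        have ke: "keep {16, 17} e' ?e" by (simp add: keep_def)
        have l1: "lstate {} L' ?e A'" using lstate_cong[OF ke] L'(1) by simp
        have "wp TRY_COLOUR ?Q' \<tau>1 ?e A'" if t1: "\<tau>1 \<le> \<tau>' + 50" for \<tau>1
        proof (rule wp_mono[OF wp_TRY_COLOUR[OF l1 _ _ _ v(2) _ \<open>c \<in> L' ?v\<close>]])
          fix \<tau>2 e2 A2
          assume 2: "\<tau>2 \<le> \<tau>1 + 350 * K + 700 \<and>
            (\<exists>L''. lstate {} L'' e2 A2 \<and> e2 5 = e2 6 \<and> (\<forall>u\<in>V. L'' u \<subseteq> L' u) \<and> card (L'' ?v) \<le> 1 \<and>
            (colourable L' \<longrightarrow> colourable L'')) \<and> keep {5..14} ?e e2 \<and> keep ({5} \<union> {10..15}) A' A2"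
          then obtain L'' where L'': "lstate {} L'' e2 A2" "e2 5 = e2 6" "\<forall>u\<in>V. L'' u \<subseteq> L' u"
            "card (L'' ?v) \<le> 1" "colourable L' \<longrightarrow> colourable L''" by blast
          have k2: "keep {5..14} ?e e2" and a2: "keep ({5} \<union> {10..15}) A' A2" using 2 by blast+
          have "P (Suc i) (e2(15 := Suc i)) A2"
          proof (rule adv[OF L''(1,2,3) _ L''(5)])
            show "keep {5..17} e' e2" by (rule keep_trans'[OF keep_mono[OF ke] k2]) simp_all
          qed (use L''(4) True a2 in simp_all)
          moreover have "e2 15 = i" using keepD[OF k2, of 15] ei by simp
          ultimately show "?Q' \<tau>2 e2 A2" using 2 t1 by simp
        qed (use L' True in simp_all)
        then have w: "wp TRY_COLOUR ?Q' \<tau>1 (e'(17 := ?v, 16 := if A' 10 ?v = 1 then 0 else 1)) A'"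
          if "\<tau>1 \<le> \<tau>' + 50" for \<tau>1 using that a10 unfolding c_def by (cases "0 \<in> L' ?v") simp_all
        show ?thesis
          by (cases "A' 10 ?v = 1") (use w True c2 ei M v sum sm vb Jn in \<open>simp_all add: small\<close>)
      qed
    qed
  next
    fix \<tau>' e' A' assume t: "\<tau>' \<le> \<tau> + nc * (350 * K + 800 + xcost (X 2) + 6) + xcost (X 2) + 4" and P: "P nc e' A'"
    note P' = P[unfolded P_def]
    from P'[THEN conjunct1] obtain L' where L': "lstate {} L' e' A'" "e' 5 = e' 6" "\<forall>v\<in>V. L' v \<subseteq> L v"
      "e' 7 = 0 \<longrightarrow> (\<forall>j<nc. card (L' (vc j)) \<le> 1)" "colourable L \<longrightarrow> colourable L'"
      by (elim exE conjE) (rule that)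
    have k: "keep {5..17} e e'" "keep ({5} \<union> {10..15}) A A'"
      by (rule P'[THEN conjunct2, THEN conjunct1], rule P'[THEN conjunct2, THEN conjunct2])
    have one: "card (L' v) = 1" if "e' 7 = 0" "v \<in> V" for v
    proof -
      have "card (L' v) \<le> 1" using L'(4) vc_ex[OF that(2)] that(1) by blast
      moreover have "card (L' v) \<noteq> 0"
        using lstate_nonempty[OF L'(1) that] lstate_fin[OF L'(1) that(2)] by simp
      ultimately show ?thesis by simp
    qed
    have "nc * (350 * K + 800 + xcost (X 2) + 6) \<le> nc * (450 * K)"
      using Kn by (intro mult_le_mono2) simp
    then have "\<tau>' \<le> \<tau> + nc * (450 * K) + 10" using t unfolding xcost.simps by linarith
    moreover have "colourable L \<longrightarrow> e' 7 = 0" using colourable_no_fail[OF L'(1)] L'(5) by blast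
    ultimately show "?Q \<tau>' e' A'" using L'(1-3) one k by blast
  qed
qed

end

section \<open>Evaluating one guess\<close>

fun SEEDS :: "(nat \<times> exp) list \<Rightarrow> cmd" where
  "SEEDS [] = SKIP"
| "SEEDS ((i, k) # xs) = Asg 8 (X i) ;; Asg 10 k ;; RESTRICT ;; SEEDS xs"

text \<open>
  Variables 36 to 40 hold the cycle in the rotation that is guessed, 31 to 34 the four guessed
  vertices, and 35 the colour of the second of them.
\<close>

definition EVAL :: cmd where
  "EVAL = INIT_LISTS ;;
     SEEDS [(36, N 0), (37, N 1), (38, N 2), (39, N 1), (40, N 2),
       (31, N 0), (32, X 35), (33, N 1), (34, N 2)] ;;
     PROPAGATE ;; TRIM ;; PROPAGATE ;; SOLVE"

text \<open>
  The lists of \<open>no_five_cycle_colouring\<close>.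
\<close>

definition STAR :: cmd where
  "STAR = FOR 15 (X 2) (Asg 8 (Rd (N 4) (X 15)) ;;
     IF (Eq (Rd (N 20 \<oplus> X 4) (X 8)) (N 1)) (Asg 10 (N 2) ;; RESTRICT) (Asg 9 (N 2) ;; REM))"

definition BIP :: cmd where
  "BIP = INIT_LISTS ;; STAR ;; PROPAGATE ;; SOLVE"

context comp_machine begin

lemma wp_SEEDS:
  assumes "lstate {} L e A"
    and "\<And>i k. (i, k) \<in> set xs \<Longrightarrow> 20 \<le> i \<and> e i \<in> V \<and> (k = N 0 \<or> k = N 1 \<or> k = N 2 \<or> k = X 35 \<and> e 35 < 3)"
  shows "wp (SEEDS xs) (\<lambda>\<tau>' e' A'. \<tau>' \<le> \<tau> + length xs * 280 + 1 \<and> (\<exists>L'. lstate {} L' e' A' \<and>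
      (\<forall>u\<in>V. L' u \<subseteq> L u) \<and> (\<forall>(i, k)\<in>set xs. L' (e i) \<subseteq> {xval e A k}) \<and>
      (\<forall>f. (\<forall>u\<in>V. f u \<in> L u) \<longrightarrow> (\<forall>(i, k)\<in>set xs. f (e i) = xval e A k) \<longrightarrow> (\<forall>u\<in>V. f u \<in> L' u)) \<and>
      (\<forall>wt. pot wt L' e' A' \<le> pot wt L e A)) \<and>
    keep {6, 7, 8, 9, 10, 13} e e' \<and> keep {5, 10, 11, 12} A A') \<tau> e A"
  using assms
proof (induction xs arbitrary: L \<tau> e A)
  case Nil
  then show ?case by (auto simp: keep_refl intro!: exI[of _ L])
next
  case (Cons x xs)
  obtain i k where x: "x = (i, k)" by (cases x)
  have ik: "20 \<le> i" "e i \<in> V" "k = N 0 \<or> k = N 1 \<or> k = N 2 \<or> k = X 35 \<and> e 35 < 3"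
    using Cons.prems(2)[of i k] x by simp_all
  let ?c = "xval e A k" and ?v = "e i"
  have c3: "?c < 3" using ik(3) by auto
  let ?e = "e(8 := ?v, 10 := ?c)"
  have ke: "keep {8, 10} e ?e" by (simp add: keep_def)
  have l1: "lstate {} L ?e A" using lstate_cong[OF ke] Cons.prems(1) by simp
  let ?L = "L(?v := L ?v \<inter> {?c})"
  let ?Q = "\<lambda>\<tau>' e' A'. \<tau>' \<le> \<tau> + length (x # xs) * 280 + 1 \<and> (\<exists>L'. lstate {} L' e' A' \<and>
      (\<forall>u\<in>V. L' u \<subseteq> L u) \<and> (\<forall>(i, k)\<in>set (x # xs). L' (e i) \<subseteq> {xval e A k}) \<and>
      (\<forall>f. (\<forall>u\<in>V. f u \<in> L u) \<longrightarrow> (\<forall>(i, k)\<in>set (x # xs). f (e i) = xval e A k) \<longrightarrow> (\<forall>u\<in>V. f u \<in> L' u)) \<and>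
      (\<forall>wt. pot wt L' e' A' \<le> pot wt L e A)) \<and>
    keep {6, 7, 8, 9, 10, 13} e e' \<and> keep {5, 10, 11, 12} A A'"
  have "wp (RESTRICT ;; SEEDS xs) ?Q \<tau>1 ?e A" if t1: "\<tau>1 \<le> \<tau> + 10" for \<tau>1
  proof (rule wp_seqI[OF wp_RESTRICT[OF l1 _ ik(2) _ c3]], simp, simp, elim conjE)
    fix \<tau>2 e2 A2
    assume 2: "\<tau>2 \<le> \<tau>1 + 270" "lstate {} ?L e2 A2" "keep {6, 7, 9, 13} ?e e2" "keep {5, 10, 11, 12} A A2"
      "\<forall>wt. pot wt ?L e2 A2 \<le> pot wt L ?e A"
    have k2: "keep {6, 7, 8, 9, 10, 13} e e2" by (rule keep_trans'[OF keep_mono[OF ke] 2(3)]) simp_all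
    have same: "e2 j = e j" if "20 \<le> j" for j using keepD[OF k2, of j] that by simp
    have val: "xval e2 A2 k' = xval e A k'" if "(i', k') \<in> set xs" for i' k'
      using Cons.prems(2)[of i' k'] that same[of 35] by auto
    have pre: "20 \<le> i' \<and> e2 i' \<in> V \<and> (k' = N 0 \<or> k' = N 1 \<or> k' = N 2 \<or> k' = X 35 \<and> e2 35 < 3)"
      if "(i', k') \<in> set xs" for i' k'
      using Cons.prems(2)[of i' k'] that same[of i'] same[of 35] by simp
    show "wp (SEEDS xs) ?Q \<tau>2 e2 A2"
    proof (rule wp_mono[OF Cons.IH[OF 2(2) pre]], assumption, elim conjE exE)
      fix \<tau>3 e3 A3 L'
      assume 3: "\<tau>3 \<le> \<tau>2 + length xs * 280 + 1" "lstate {} L' e3 A3" "\<forall>u\<in>V. L' u \<subseteq> ?L u"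
        "\<forall>(i, k)\<in>set xs. L' (e2 i) \<subseteq> {xval e2 A2 k}"
        "\<forall>f. (\<forall>u\<in>V. f u \<in> ?L u) \<longrightarrow> (\<forall>(i, k)\<in>set xs. f (e2 i) = xval e2 A2 k) \<longrightarrow> (\<forall>u\<in>V. f u \<in> L' u)"
        "\<forall>wt. pot wt L' e3 A3 \<le> pot wt ?L e2 A2"
        "keep {6, 7, 8, 9, 10, 13} e2 e3" "keep {5, 10, 11, 12} A2 A3"
      have sub: "L' u \<subseteq> L u" if "u \<in> V" for u
        by (rule order_trans[OF bspec[OF 3(3) that]]) simp
      have tail: "L' (e j) \<subseteq> {xval e A k'}" "e2 j = e j" "xval e2 A2 k' = xval e A k'" if "(j, k') \<in> set xs" for j k'
      proof -
        show a: "e2 j = e j" "xval e2 A2 k' = xval e A k'" using same[of j] pre[OF that] val[OF that] by simp_all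
        show "L' (e j) \<subseteq> {xval e A k'}" using bspec[OF 3(4) that] a by simp
      qed
      have hd: "L' (e i) \<subseteq> {xval e A k}" using bspec[OF 3(3) ik(2)] by simp
      have sing: "\<forall>(i, k)\<in>set (x # xs). L' (e i) \<subseteq> {xval e A k}"
        unfolding x using hd tail(1) by (simp only: list.set ball_simps split_conv) blast
      have pres: "f u \<in> L' u" if f: "\<forall>u\<in>V. f u \<in> L u" "\<forall>(i, k)\<in>set (x # xs). f (e i) = xval e A k" "u \<in> V" for f u
      proof -
        have "f ?v = ?c" using f(2) x by simp
        moreover have "f ?v \<in> L ?v" using f(1) ik(2) by blast
        ultimately have "\<forall>u\<in>V. f u \<in> ?L u" using f(1) by simp
        moreover have "\<forall>(i, k)\<in>set xs. f (e2 i) = xval e2 A2 k" using f(2) tail(2,3) by fastforce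
        ultimately show ?thesis using 3(5) f(3) by blast
      qed
      have pt: "pot wt L' e3 A3 \<le> pot wt L e A" for wt
        using spec[OF 3(6), of wt] spec[OF 2(5), of wt] pot_cong[OF ke, of wt L A] by simp
      have "keep {6, 7, 8, 9, 10, 13} e e3" by (rule keep_trans[OF k2 3(7)])
      moreover have "keep {5, 10, 11, 12} A A3" by (rule keep_trans[OF 2(4) 3(8)])
      moreover have "\<tau>3 \<le> \<tau> + length (x # xs) * 280 + 1" using 3(1) 2(1) t1 by simp
      ultimately show "?Q \<tau>3 e3 A3" using 3(2) sub sing pres pt
        by (intro conjI exI[of _ L']) (blast+)
    qed
  qed
  moreover have "xok (e(8 := ?v)) A k" "xval (e(8 := ?v)) A k = xval e A k" "xcost k = 1"
    using ik(3) M small(1)[of 2] Kn by auto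
  ultimately show ?case unfolding x by simp
qed

lemma small_consts: "10 < M" "5 < M" "20 < M" using small(1)[of 10] small(1)[of 20] small(1)[of 5] Kn by simp_all

lemma singleton_colouring:
  assumes l: "lstate {} L e A" and q: "e 5 = e 6" "e 7 = 0" and one: "\<forall>v\<in>V. card (L v) = 1"
  obtains f where "proper f" "\<And>v c. v \<in> V \<Longrightarrow> c < 3 \<Longrightarrow> A (10 + c) v = of_bool (c = f v)"
proof
  define f where "f v = (THE c. L v = {c})" for v
  have f: "L v = {f v}" if v: "v \<in> V" for v
  proof -
    from one v have "card (L v) = 1" by blast
    then obtain c where "L v = {c}" by (rule card_1_singletonE)
    then show ?thesis unfolding f_def by simp
  qed
  have cl: "closed_lists L" by (rule lstate_closed_lists[OF l q])
  show "proper f"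
    unfolding proper_def
  proof (intro conjI ballI allI impI)
    show "f v < 3" if "v \<in> V" for v
    proof -
      have "{f v} \<subseteq> {0, 1, 2}" using lstate_sub[OF l that] unfolding f[OF that] .
      then show ?thesis by auto
    qed
    fix u v assume e: "E u v"
    have V: "u \<in> V" "v \<in> V" using dom[OF e] dom[OF sym[OF e]] .
    have "L u \<inter> L v = {}" using cl e one V unfolding closed_lists_def by blast
    then show "f u \<noteq> f v" unfolding f[OF V(1)] f[OF V(2)] by simp
  qed
  show "A (10 + c) v = of_bool (c = f v)" if "v \<in> V" "c < 3" for v c
    using lstate_rep[OF l that] unfolding f[OF that(1)] by simp
qed

text \<open>
  When every list is a singleton, the list rows are the colouring.
\<close>

definition solved :: "arrays \<Rightarrow> bool" where
  "solved A \<longleftrightarrow> (\<exists>f. proper f \<and> (\<forall>v\<in>V. \<forall>c<3. A (10 + c) v = of_bool (c = f v)))"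

lemma wp_finish:
  assumes l: "lstate {} L e A" and p: "pot W L e A \<le> 110 * K" and two: "\<And>u. u \<in> V \<Longrightarrow> card (L u) \<le> 2"
  shows "wp (PROPAGATE ;; SOLVE) (\<lambda>\<tau>' e' A'. \<tau>' \<le> \<tau> + nc * (450 * K) + 110 * K + 30 \<and>
    (e' 7 = 0 \<longrightarrow> solved A') \<and> (colourable L \<longrightarrow> e' 7 = 0) \<and>
    keep {5..17} e e' \<and> keep ({5} \<union> {10..15}) A A') \<tau> e A"
    (is "wp _ ?Q _ _ _")
proof (rule wp_seqI[OF wp_PROPAGATE[OF l]], elim conjE exE)
  fix \<tau>1 e1 A1 L1
  assume 1: "\<tau>1 \<le> \<tau> + pot W L e A + 20" "lstate {} L1 e1 A1" "refines L L1" "e1 5 = e1 6"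
    "keep {5, 6, 7, 8, 9, 11, 12, 13} e e1" "keep {5, 10, 11, 12} A A1"
  have two1: "card (L1 u) \<le> 2" if "u \<in> V" for u
    using card_mono[OF lstate_fin[OF l that] refines_sub[OF 1(3) that]] two[OF that] by simp
  show "wp SOLVE ?Q \<tau>1 e1 A1"
  proof (rule wp_mono[OF wp_SOLVE[OF 1(2,4) two1]], assumption, elim conjE exE)
    fix \<tau>2 e2 A2 L2
    assume 2: "\<tau>2 \<le> \<tau>1 + nc * (450 * K) + 10" "lstate {} L2 e2 A2" "e2 5 = e2 6"
      "e2 7 = 0 \<longrightarrow> (\<forall>v\<in>V. L2 v \<subseteq> L1 v \<and> card (L2 v) = 1)" "colourable L1 \<longrightarrow> e2 7 = 0"
      "keep {5..17} e1 e2" "keep ({5} \<union> {10..15}) A1 A2"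
    have "solved A2" if z: "e2 7 = 0"
    proof -
      have one: "\<forall>v\<in>V. card (L2 v) = 1" using 2(4) z by blast
      obtain f where "proper f" "\<And>v c. v \<in> V \<Longrightarrow> c < 3 \<Longrightarrow> A2 (10 + c) v = of_bool (c = f v)"
        using singleton_colouring[OF 2(2,3) z one] by metis
      then show ?thesis unfolding solved_def by blast
    qed
    moreover have "colourable L \<longrightarrow> e2 7 = 0" using 2(5) refines_colourable[OF 1(3)] by blast
    moreover have "keep {5..17} e e2" by (rule keep_trans[OF keep_mono[OF 1(5)] 2(6)]) simp
    moreover have "keep ({5} \<union> {10..15}) A A2" by (rule keep_trans[OF keep_mono[OF 1(6)] 2(7)]) simp
    moreover have "\<tau>2 \<le> \<tau> + nc * (450 * K) + 110 * K + 30" using 2(1) 1(1) p by linarith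
    ultimately show "?Q \<tau>2 e2 A2" by blast
  qed
qed

lemma card_trim: "L v \<subseteq> {0, 1, 2} \<Longrightarrow> card (trim L v) \<le> 2"
  using card_mono[of "{0, 1, 2}" "L v"] unfolding trim_def by auto

text \<open>
  The program may fail for a guess that is not extremal. It finds a colouring whenever some
  colouring agrees with the guess and survives the shortening of the full lists.
\<close>

lemma wp_EVAL:
  assumes st: "static e A" and V: "\<And>i. i \<in> {31, 32, 33, 34, 36, 37, 38, 39, 40} \<Longrightarrow> e i \<in> V" and b: "e 35 < 3"
  shows "wp EVAL (\<lambda>\<tau>' e' A'. \<tau>' \<le> \<tau> + nc * (600 * K) + 700 * K \<and> (e' 7 = 0 \<longrightarrow> solved A') \<and>
    (\<forall>f. proper f \<and> f (e 36) = 0 \<and> f (e 37) = 1 \<and> f (e 38) = 2 \<and> f (e 39) = 1 \<and> f (e 40) = 2 \<and>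
      f (e 31) = 0 \<and> f (e 32) = e 35 \<and> f (e 33) = 1 \<and> f (e 34) = 2 \<and>
      (\<forall>L. seeded f L {e 36, e 37, e 38, e 39, e 40, e 31, e 32, e 33, e 34} \<longrightarrow> closed_lists L \<longrightarrow>
        (\<exists>g. proper g \<and> (\<forall>v\<in>V. g v \<in> trim L v))) \<longrightarrow> e' 7 = 0) \<and>
    keep {5..19} e e' \<and> keep ({5} \<union> {10..15}) A A') \<tau> e A"
    (is "wp _ (\<lambda>\<tau>' e' A'. _ \<and> _ \<and> ?C e' \<and> _ \<and> _) _ _ _")
  unfolding EVAL_def
proof (rule wp_seqI[OF wp_INIT_LISTS[OF st]], elim conjE)
  let ?Q = "\<lambda>\<tau>' e' A'. \<tau>' \<le> \<tau> + nc * (600 * K) + 700 * K \<and> (e' 7 = 0 \<longrightarrow> solved A') \<and> ?C e' \<and>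
    keep {5..19} e e' \<and> keep ({5} \<union> {10..15}) A A'"
  let ?xs = "[(36 :: nat, N 0), (37, N 1), (38, N 2), (39, N 1), (40, N 2), (31, N 0), (32, X 35), (33, N 1), (34, N 2)]"
  fix \<tau>1 e1 A1
  assume 1: "\<tau>1 \<le> \<tau> + nc * 60 + 20" "keep {5, 6, 7, 8, 14} e e1" "keep {10, 11, 12} A A1"
    "lstate {} (\<lambda>_. {0, 1, 2}) e1 A1" "e1 5 = e1 6" "e1 7 = 0"
  have e1: "e1 i = e i" if "20 \<le> i" for i using keepD[OF 1(2), of i] that by simp
  have pre: "20 \<le> i \<and> e1 i \<in> V \<and> (k = N 0 \<or> k = N 1 \<or> k = N 2 \<or> k = X 35 \<and> e1 35 < 3)"
    if "(i, k) \<in> set ?xs" for i k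
  proof -
    have "i = 36 \<and> k = N 0 \<or> i = 37 \<and> k = N 1 \<or> i = 38 \<and> k = N 2 \<or> i = 39 \<and> k = N 1 \<or> i = 40 \<and> k = N 2 \<or>
      i = 31 \<and> k = N 0 \<or> i = 32 \<and> k = X 35 \<or> i = 33 \<and> k = N 1 \<or> i = 34 \<and> k = N 2"
      using that by simp
    then show ?thesis by (elim disjE) (simp_all add: e1 V b)
  qed
  show "wp (SEEDS ?xs ;; PROPAGATE ;; TRIM ;; PROPAGATE ;; SOLVE) ?Q \<tau>1 e1 A1"
  proof (rule wp_seqI[OF wp_SEEDS[OF 1(4) pre]], assumption, elim conjE exE)
    fix \<tau>2 e2 A2 L2
    assume 2: "\<tau>2 \<le> \<tau>1 + length ?xs * 280 + 1" "lstate {} L2 e2 A2"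
      "\<forall>(i, k)\<in>set ?xs. L2 (e1 i) \<subseteq> {xval e1 A1 k}"
      "\<forall>f. (\<forall>u\<in>V. f u \<in> {0, 1, 2}) \<longrightarrow> (\<forall>(i, k)\<in>set ?xs. f (e1 i) = xval e1 A1 k) \<longrightarrow> (\<forall>u\<in>V. f u \<in> L2 u)"
      "\<forall>wt. pot wt L2 e2 A2 \<le> pot wt (\<lambda>_. {0, 1, 2}) e1 A1"
      "keep {6, 7, 8, 9, 10, 13} e1 e2" "keep {5, 10, 11, 12} A1 A2"
    have p2: "pot W L2 e2 A2 \<le> 110 * K"
      using le_trans[OF spec[OF 2(5), of W] pot_empty[OF 1(5)]] sum_W by simp
    show "wp (PROPAGATE ;; TRIM ;; PROPAGATE ;; SOLVE) ?Q \<tau>2 e2 A2"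
    proof (rule wp_seqI[OF wp_PROPAGATE[OF 2(2)]], elim conjE exE)
      fix \<tau>3 e3 A3 L3
      assume 3: "\<tau>3 \<le> \<tau>2 + pot W L2 e2 A2 + 20" "lstate {} L3 e3 A3" "refines L2 L3" "e3 5 = e3 6"
        "\<forall>wt. pot wt L3 e3 A3 \<le> pot wt L2 e2 A2"
        "keep {5, 6, 7, 8, 9, 11, 12, 13} e2 e3" "keep {5, 10, 11, 12} A2 A3"
      show "wp (TRIM ;; PROPAGATE ;; SOLVE) ?Q \<tau>3 e3 A3"
      proof (rule wp_seqI[OF wp_TRIM[OF 3(2)]], elim conjE exE)
        fix \<tau>4 e4 A4 L4
        assume 4: "\<tau>4 \<le> \<tau>3 + nc * (150 * K) + 20" "lstate {} L4 e4 A4" "\<forall>v\<in>V. L4 v = trim L3 v"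
          "\<forall>wt. pot wt L4 e4 A4 \<le> pot wt L3 e3 A3"
          "keep ({6..11} \<union> {13..19}) e3 e4" "keep ({5} \<union> {10..15}) A3 A4"
        have p4: "pot W L4 e4 A4 \<le> 110 * K"
          using spec[OF 4(4), of W] spec[OF 3(5), of W] p2 by linarith
        have two: "card (L4 u) \<le> 2" if "u \<in> V" for u
          using bspec[OF 4(3) that] card_trim[of L3 u, OF lstate_sub[OF 3(2) that]] by simp
        show "wp (PROPAGATE ;; SOLVE) ?Q \<tau>4 e4 A4"
        proof (rule wp_mono[OF wp_finish[OF 4(2) p4 two]], assumption, elim conjE)
          fix \<tau>5 e5 A5
          assume 5: "\<tau>5 \<le> \<tau>4 + nc * (450 * K) + 110 * K + 30" "e5 7 = 0 \<longrightarrow> solved A5"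
            "colourable L4 \<longrightarrow> e5 7 = 0" "keep {5..17} e4 e5" "keep ({5} \<union> {10..15}) A4 A5"
          have "e5 7 = 0" if f: "proper f \<and> f (e 36) = 0 \<and> f (e 37) = 1 \<and> f (e 38) = 2 \<and> f (e 39) = 1 \<and>
            f (e 40) = 2 \<and> f (e 31) = 0 \<and> f (e 32) = e 35 \<and> f (e 33) = 1 \<and> f (e 34) = 2 \<and>
            (\<forall>L. seeded f L {e 36, e 37, e 38, e 39, e 40, e 31, e 32, e 33, e 34} \<longrightarrow> closed_lists L \<longrightarrow>
            (\<exists>g. proper g \<and> (\<forall>v\<in>V. g v \<in> trim L v)))" for f
          proof -
            have pf: "proper f" and fc: "f (e 36) = 0" "f (e 37) = 1" "f (e 38) = 2" "f (e 39) = 1"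
              "f (e 40) = 2" "f (e 31) = 0" "f (e 32) = e 35" "f (e 33) = 1" "f (e 34) = 2"
              and ext: "\<And>L. seeded f L {e 36, e 37, e 38, e 39, e 40, e 31, e 32, e 33, e 34} \<Longrightarrow> closed_lists L \<Longrightarrow>
                \<exists>g. proper g \<and> (\<forall>v\<in>V. g v \<in> trim L v)" using f by simp_all
            have f3: "f u \<in> {0, 1, 2}" if "u \<in> V" for u
            proof -
              have "f u < 3" using pf that unfolding proper_def by blast
              then show ?thesis by auto
            qed
            have "\<forall>(i, k)\<in>set ?xs. f (e1 i) = xval e1 A1 k" using fc by (simp add: e1)
            then have "\<forall>u\<in>V. f u \<in> L2 u" using spec[OF 2(4), of f] f3 by blast
            then have fL3: "\<forall>u\<in>V. f u \<in> L3 u" using 3(3) pf unfolding refines_def by blast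
            then have "colourable L3" using pf unfolding colourable_def by blast
            then have e37: "e3 7 = 0" by (rule colourable_no_fail[OF 3(2)])
            have eq: "L3 u = {f u}" if "L2 u \<subseteq> {f u}" "u \<in> V" for u
              using order_trans[OF refines_sub[OF 3(3) that(2)] that(1)] bspec[OF fL3 that(2)] by (simp add: subset_singleton_iff) fastforce
            have L2: "L2 (e 36) \<subseteq> {0}" "L2 (e 37) \<subseteq> {1}" "L2 (e 38) \<subseteq> {2}" "L2 (e 39) \<subseteq> {1}" "L2 (e 40) \<subseteq> {2}"
              "L2 (e 31) \<subseteq> {0}" "L2 (e 32) \<subseteq> {e 35}" "L2 (e 33) \<subseteq> {1}" "L2 (e 34) \<subseteq> {2}"
              using 2(3) by (simp_all add: e1)
            have "seeded f L3 {e 36, e 37, e 38, e 39, e 40, e 31, e 32, e 33, e 34}"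
              unfolding seeded_def
            proof (intro conjI ballI)
              fix v assume "v \<in> {e 36, e 37, e 38, e 39, e 40, e 31, e 32, e 33, e 34}"
              then have "L2 v \<subseteq> {f v} \<and> v \<in> V"
                using L2 V by (elim insertE) (simp_all add: fc)
              then show "L3 v = {f v}" using eq by simp
            qed (use fL3 lstate_sub[OF 3(2)] in simp_all)
            moreover have "closed_lists L3" by (rule lstate_closed_lists[OF 3(2,4) e37])
            ultimately obtain g where "proper g" "\<forall>v\<in>V. g v \<in> trim L3 v" using ext by blast
            then have "colourable L4" using 4(3) unfolding colourable_def by metis
            then show ?thesis using 5(3) by simp
          qed
          moreover have "keep {5..19} e e5"
            by (rule keep_trans'[OF keep_trans'[OF keep_trans'[OF keep_trans'[OF keep_mono[OF 1(2)] 2(6)] 3(6)] 4(5)] 5(4)]) simp_all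
          moreover have "keep ({5} \<union> {10..15}) A A5"
            by (rule keep_trans'[OF keep_trans'[OF keep_trans'[OF keep_trans'[OF keep_mono[OF 1(3)] 2(7)] 3(7)] 4(6)] 5(5)]) simp_all
          moreover have "\<tau>5 \<le> \<tau> + nc * (600 * K) + 700 * K"
          proof -
            have "length ?xs * 280 = 2520" by simp
            then have "\<tau>5 \<le> \<tau> + nc * 60 + nc * (150 * K) + nc * (450 * K) + 220 * K + 2661"
              using 1(1) 2(1) 3(1) 4(1) 5(1) p2 by linarith
            moreover have "nc * (150 * K) + nc * (450 * K) = nc * (600 * K)" by simp
            moreover have "nc \<le> K" "10 \<le> K" using bounds(3) Kn by simp_all
            ultimately show ?thesis by linarith
          qed
          ultimately show "?Q \<tau>5 e5 A5" using 5(2) by blast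
        qed
      qed
    qed
  qed
qed

lemma wp_BIP:
  assumes st: "static e A" and r: "e 4 = r" "r \<in> V"
  shows "wp BIP (\<lambda>\<tau>' e' A'. \<tau>' \<le> \<tau> + nc * (600 * K) + 700 * K \<and> (e' 7 = 0 \<longrightarrow> solved A') \<and>
    ((\<exists>f. proper f \<and> (\<forall>v\<in>V. f v \<in> (if E r v then {2} else {0, 1}))) \<longrightarrow> e' 7 = 0) \<and>
    keep {5..19} e e' \<and> keep ({5} \<union> {10..15}) A A') \<tau> e A"
    (is "wp _ ?Q _ _ _")
  unfolding BIP_def
proof (rule wp_seqI[OF wp_INIT_LISTS[OF st]], elim conjE)
  fix \<tau>1 e1 A1
  assume 1: "\<tau>1 \<le> \<tau> + nc * 60 + 20" "keep {5, 6, 7, 8, 14} e e1" "keep {10, 11, 12} A A1"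
    "lstate {} (\<lambda>_. {0, 1, 2}) e1 A1" "e1 5 = e1 6" "e1 7 = 0"
  define t where "t v = (if E r v then {2} else {0, 1 :: nat})" for v
  define P where "P i e' A' \<longleftrightarrow> (\<exists>L'. lstate {} L' e' A' \<and> (\<forall>v\<in>V. L' v = {0, 1, 2} \<or> L' v = t v) \<and>
      (\<forall>j<i. L' (vc j) = t (vc j)) \<and> (\<forall>wt. pot wt L' e' A' \<le> pot wt (\<lambda>_. {0, 1, 2}) e1 A1)) \<and>
      keep {6, 7, 8, 9, 10, 13, 15} e1 e' \<and> keep {5, 10, 11, 12} A1 A'" for i :: nat and e' :: env and A' :: arrays
  have "wp STAR (\<lambda>\<tau>' e' A'. \<tau>' \<le> \<tau>1 + nc * 400 + 10 \<and> P nc e' A') \<tau>1 e1 A1"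
    unfolding STAR_def
  proof (rule wp_FOR_const[where D = 320 and n = nc and P = P])
    show "nc < M" using bounds(3) small(1)[of nc] by simp
    have k: "keep {15} e1 (e1(15 := 0))" by (simp add: keep_def)
    show "P 0 (e1(15 := 0)) A1"
      unfolding P_def using lstate_cong[OF k] 1(4) pot_cong[OF k]
      by (intro conjI exI[of _ "\<lambda>_. {0, 1, 2}"]) (simp_all add: keep_def)
  next
    fix k e' A' assume "P k e' A'"
    then have "\<exists>L'. lstate {} L' e' A'" unfolding P_def by blast
    then have "e' 2 = nc" using lstate_static unfolding static_def by blast
    then show "xok e' A' (X 2) \<and> xval e' A' (X 2) = nc" by simp
  next
    fix i and \<tau>' :: nat and e' A' assume i: "i < nc" and P: "P i e' A'" and ei: "e' 15 = i"
    note P' = P[unfolded P_def]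
    from P'[THEN conjunct1] obtain L' where L': "lstate {} L' e' A'" "\<forall>v\<in>V. L' v = {0, 1, 2} \<or> L' v = t v"
      "\<forall>j<i. L' (vc j) = t (vc j)" "\<forall>wt. pot wt L' e' A' \<le> pot wt (\<lambda>_. {0, 1, 2}) e1 A1"
      by (elim exE conjE) (rule that)
    have k: "keep {6, 7, 8, 9, 10, 13, 15} e1 e'" "keep {5, 10, 11, 12} A1 A'"
      by (rule P'[THEN conjunct2, THEN conjunct1], rule P'[THEN conjunct2, THEN conjunct2])
    let ?v = "vc i"
    have v: "A' 4 i = ?v" "?v \<in> V" using list_row[OF lstate_static[OF L'(1)] i] by auto
    have e4: "e' 4 = r" using keepD[OF k(1), of 4] keepD[OF 1(2), of 4] r by simp
    have adj: "A' (20 + r) ?v = of_bool (E r ?v)" using lstate_static[OF L'(1)] r v(2) unfolding static_def by blast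
    let ?L = "L'(?v := t ?v)"
    let ?Q' = "\<lambda>\<tau>'' e'' A''. \<tau>'' \<le> \<tau>' + 320 \<and> e'' 15 = i \<and> P (Suc i) (e''(15 := Suc i)) A''"
    have fin': "?Q' \<tau>2 e2 A2" if 2: "\<tau>2 \<le> \<tau>' + 310" "lstate {} ?L e2 A2" "keep {6, 7, 8, 9, 10, 13} e' e2"
      "keep {5, 10, 11, 12} A' A2" "\<forall>wt. pot wt ?L e2 A2 \<le> pot wt L' e' A'" for \<tau>2 e2 A2
    proof -
      have kk: "keep {15} e2 (e2(15 := Suc i))" by (simp add: keep_def)
      have "lstate {} ?L (e2(15 := Suc i)) A2" using 2(2) lstate_cong[OF kk] by simp
      moreover have "\<forall>v\<in>V. ?L v = {0, 1, 2} \<or> ?L v = t v" using L'(2) by simp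
      moreover have "\<forall>j<Suc i. ?L (vc j) = t (vc j)" using L'(3) by (simp add: less_Suc_eq)
      moreover have "pot wt ?L (e2(15 := Suc i)) A2 \<le> pot wt (\<lambda>_. {0, 1, 2}) e1 A1" for wt
        using spec[OF 2(5), of wt] spec[OF L'(4), of wt] pot_cong[OF kk, of wt ?L A2] by simp
      moreover have "keep {6, 7, 8, 9, 10, 13, 15} e1 (e2(15 := Suc i))"
        by (rule keep_trans'[OF keep_trans'[OF k(1) 2(3)] kk]) simp_all
      moreover have "keep {5, 10, 11, 12} A1 A2" by (rule keep_trans[OF k(2) 2(4)])
      ultimately have "P (Suc i) (e2(15 := Suc i)) A2"
        unfolding P_def by (intro conjI exI[of _ ?L]) simp_all
      then show ?thesis using 2(1) keepD[OF 2(3), of 15] ei by simp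
    qed
    have Lv: "L' ?v = {0, 1, 2} \<or> L' ?v = t ?v" using L'(2) v(2) by blast
    have A1': "wp RESTRICT ?Q' \<tau>2 (e'(8 := ?v, 10 := 2)) A'" if t2: "\<tau>2 \<le> \<tau>' + 40" and Er: "E r ?v" for \<tau>2
    proof -
      have kk: "keep {8, 10} e' (e'(8 := ?v, 10 := 2))" by (simp add: keep_def)
      have l: "lstate {} L' (e'(8 := ?v, 10 := 2)) A'" using lstate_cong[OF kk] L'(1) by simp
      have tv: "L' ?v \<inter> {2} = t ?v" using Lv Er unfolding t_def by (elim disjE) simp_all
      show ?thesis
      proof (rule wp_mono[OF wp_RESTRICT[OF l _ v(2), of 2]], simp, simp, simp, unfold tv, elim conjE)
        fix \<tau>3 e3 A3
        assume 3: "\<tau>3 \<le> \<tau>2 + 270" "lstate {} ?L e3 A3" "keep {6, 7, 9, 13} (e'(8 := ?v, 10 := 2)) e3"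
          "keep {5, 10, 11, 12} A' A3" "\<forall>wt. pot wt ?L e3 A3 \<le> pot wt L' (e'(8 := ?v, 10 := 2)) A'"
        show "?Q' \<tau>3 e3 A3"
        proof (rule fin'[OF _ 3(2) _ 3(4)])
          show "keep {6, 7, 8, 9, 10, 13} e' e3" by (rule keep_trans'[OF keep_mono[OF kk] 3(3)]) simp_all
        qed (use 3(1,5) t2 pot_cong[OF kk] in simp_all)
      qed
    qed
    have A2': "wp REM ?Q' \<tau>2 (e'(8 := ?v, 9 := 2)) A'" if t2: "\<tau>2 \<le> \<tau>' + 40" and Er: "\<not> E r ?v" for \<tau>2
    proof -
      have kk: "keep {8, 9} e' (e'(8 := ?v, 9 := 2))" by (simp add: keep_def)
      have l: "lstate {} L' (e'(8 := ?v, 9 := 2)) A'" using lstate_cong[OF kk] L'(1) by simp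
      have tv: "L' ?v - {2} = t ?v" using Lv Er unfolding t_def by (elim disjE) (simp_all add: insert_Diff_if)
      show ?thesis
      proof (rule wp_mono[OF wp_REM[OF l _ v(2), of 2]], simp, simp, simp, unfold tv, elim conjE)
        fix \<tau>3 e3 A3
        assume 3: "\<tau>3 \<le> \<tau>2 + 80" "lstate {} ?L e3 A3" "keep {6, 7, 13} (e'(8 := ?v, 9 := 2)) e3"
          "keep {5, 10, 11, 12} A' A3" "\<forall>wt. pot wt ?L e3 A3 \<le> pot wt L' (e'(8 := ?v, 9 := 2)) A'"
        show "?Q' \<tau>3 e3 A3"
        proof (rule fin'[OF _ 3(2) _ 3(4)])
          show "keep {6, 7, 8, 9, 10, 13} e' e3" by (rule keep_trans'[OF keep_mono[OF kk] 3(3)]) simp_all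
        qed (use 3(1,5) t2 pot_cong[OF kk] in simp_all)
      qed
    qed
    have vb: "?v < K" "i < K" "20 + r < J" using bounds(1)[OF v(2)] bounds(3) i bounds(6)[OF r(2)] by simp_all
    show "wp (Asg 8 (Rd (N 4) (X 15)) ;;
      IF (Eq (Rd (N 20 \<oplus> X 4) (X 8)) (N 1)) (Asg 10 (N 2) ;; RESTRICT) (Asg 9 (N 2) ;; REM)) ?Q' \<tau>' e' A'"
      by (cases "E r ?v") (use A1' A2' v e4 ei adj vb Jn in \<open>simp_all add: small\<close>)
  next
    fix \<tau>' e' A' assume "\<tau>' \<le> \<tau>1 + nc * (320 + xcost (X 2) + 6) + xcost (X 2) + 4" "P nc e' A'"
    then show "\<tau>' \<le> \<tau>1 + nc * 400 + 10 \<and> P nc e' A'" by simp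
  qed
  then show "wp (STAR ;; PROPAGATE ;; SOLVE) ?Q \<tau>1 e1 A1"
  proof (rule wp_seqI)
    fix \<tau>2 e2 A2 assume 2: "\<tau>2 \<le> \<tau>1 + nc * 400 + 10 \<and> P nc e2 A2"
    note P' = 2[THEN conjunct2, unfolded P_def]
    from P'[THEN conjunct1] obtain L' where L': "lstate {} L' e2 A2"
      "\<forall>j<nc. L' (vc j) = t (vc j)" "\<forall>wt. pot wt L' e2 A2 \<le> pot wt (\<lambda>_. {0, 1, 2}) e1 A1"
      by (elim exE conjE) (rule that)
    have k: "keep {6, 7, 8, 9, 10, 13, 15} e1 e2" "keep {5, 10, 11, 12} A1 A2"
      by (rule P'[THEN conjunct2, THEN conjunct1], rule P'[THEN conjunct2, THEN conjunct2])
    have Lt: "L' v = t v" if "v \<in> V" for v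
    proof -
      from vc_ex[OF that] obtain j where "j < nc" "v = vc j" by blast
      then show ?thesis using L'(2) by simp
    qed
    have p: "pot W L' e2 A2 \<le> 110 * K"
      using le_trans[OF spec[OF L'(3), of W] pot_empty[OF 1(5)]] sum_W by simp
    have two: "card (L' u) \<le> 2" if "u \<in> V" for u unfolding Lt[OF that] t_def by simp
    show "wp (PROPAGATE ;; SOLVE) ?Q \<tau>2 e2 A2"
    proof (rule wp_mono[OF wp_finish[OF L'(1) p two]], assumption, elim conjE)
      fix \<tau>5 e5 A5
      assume 5: "\<tau>5 \<le> \<tau>2 + nc * (450 * K) + 110 * K + 30" "e5 7 = 0 \<longrightarrow> solved A5"
        "colourable L' \<longrightarrow> e5 7 = 0" "keep {5..17} e2 e5" "keep ({5} \<union> {10..15}) A2 A5"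
      have "colourable L'" if "\<exists>f. proper f \<and> (\<forall>v\<in>V. f v \<in> (if E r v then {2} else {0, 1}))"
        using that Lt unfolding colourable_def t_def by simp
      then have "(\<exists>f. proper f \<and> (\<forall>v\<in>V. f v \<in> (if E r v then {2} else {0, 1}))) \<longrightarrow> e5 7 = 0" using 5(3) by blast
      moreover have "keep {5..19} e e5"
        by (rule keep_trans'[OF keep_trans'[OF keep_mono[OF 1(2)] k(1)] 5(4)]) simp_all
      moreover have "keep ({5} \<union> {10..15}) A A5"
        by (rule keep_trans'[OF keep_trans'[OF keep_mono[OF 1(3)] k(2)] 5(5)]) simp_all
      moreover have "\<tau>5 \<le> \<tau> + nc * (600 * K) + 700 * K"
      proof -
        have "\<tau>5 \<le> \<tau> + nc * 460 + nc * (450 * K) + 110 * K + 60" using 1(1) 2 5(1) by linarith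
        moreover have "nc * (450 * K) + nc * (150 * K) = nc * (600 * K)" by simp
        moreover have "nc \<le> K" "10 \<le> K" using bounds(3) Kn by simp_all
        ultimately show ?thesis by linarith
      qed
      ultimately show "?Q \<tau>5 e5 A5" using 5(2) by blast
    qed
  qed
qed

end

section \<open>The search for a five-cycle\<close>

text \<open>
  Tuples of vertices are enumerated as numbers in base \<open>card V\<close>; this takes the last digit of
  variable 19.
\<close>

definition DIGIT :: "nat \<Rightarrow> cmd" where
  "DIGIT i = Asg i (Rd (N 4) (X 19 \<ominus> X 19 \<oslash> X 2 \<otimes> X 2)) ;; Asg 19 (X 19 \<oslash> X 2)"

definition NEAR :: "exp \<Rightarrow> exp" where
  "NEAR x = Rd (N 20 \<oplus> X 22) x \<oplus> Rd (N 20 \<oplus> X 23) x \<oplus> Rd (N 20 \<oplus> X 24) x \<oplus>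
     Rd (N 20 \<oplus> X 25) x \<oplus> Rd (N 20 \<oplus> X 26) x"

text \<open>
  Edges of other components are far from the cycle as well; the mark restricts the test to the current
  one.
\<close>

definition CHECK_EDGE :: cmd where
  "CHECK_EDGE =
     Asg 17 (Rd (N 0) (N 2 \<oplus> N 2 \<otimes> X 27)) ;;
     Asg 18 (Rd (N 0) (N 3 \<oplus> N 2 \<otimes> X 27)) ;;
     IF (Eq (Rd (N 2) (X 17)) (X 4 \<oplus> N 1))
       (IF (Eq (NEAR (X 17)) (N 0)) (IF (Eq (NEAR (X 18)) (N 0)) (Asg 28 (N 1)) SKIP) SKIP) SKIP"

definition TEST_CYCLE :: cmd where
  "TEST_CYCLE =
     Asg 19 (X 21) ;; DIGIT 22 ;; DIGIT 23 ;; DIGIT 24 ;; DIGIT 25 ;; DIGIT 26 ;;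
     IF (Eq (Rd (N 20 \<oplus> X 22) (X 23) \<oplus> Rd (N 20 \<oplus> X 23) (X 24) \<oplus> Rd (N 20 \<oplus> X 24) (X 25) \<oplus>
         Rd (N 20 \<oplus> X 25) (X 26) \<oplus> Rd (N 20 \<oplus> X 26) (X 22)) (N 5))
       (Asg 28 (N 0) ;; FOR 27 (X 1) CHECK_EDGE ;; IF (Eq (X 28) (N 0)) (Asg 29 (N 1)) SKIP)
       SKIP"

definition SEARCH :: cmd where
  "SEARCH = Asg 29 (N 0) ;; Asg 20 (X 2 \<otimes> X 2 \<otimes> X 2 \<otimes> X 2 \<otimes> X 2) ;;
     FOR 21 (X 20) (IF (Eq (X 29) (N 0)) TEST_CYCLE SKIP)"

lemma mixed_radix:
  fixes i x y b :: nat
  assumes "i < b"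
  shows "(i + b * x) mod b = i" "(i + b * x) div b = x" "x < y \<Longrightarrow> i + b * x < b * y"
proof -
  show "(i + b * x) mod b = i" "(i + b * x) div b = x" using assms by simp_all
  assume "x < y"
  then have "b * (x + 1) \<le> b * y" by (intro mult_le_mono2) simp
  then show "i + b * x < b * y" using assms by simp
qed

context machine begin

lemma wp_SKIP: "Q (\<tau> + 1) e A \<Longrightarrow> wp SKIP Q \<tau> e A" by simp
lemma wp_IF_T: "bok e A b \<Longrightarrow> bval e A b \<Longrightarrow> wp c Q (\<tau> + bcost b) e A \<Longrightarrow> wp (IF b c d) Q \<tau> e A" by simp
lemma wp_IF_F: "bok e A b \<Longrightarrow> \<not> bval e A b \<Longrightarrow> wp d Q (\<tau> + bcost b) e A \<Longrightarrow> wp (IF b c d) Q \<tau> e A" by simp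

lemma wp_Asg_seq:
  "xok e A x \<Longrightarrow> xval e A x = y \<Longrightarrow> xcost x + 1 = k \<Longrightarrow> wp d Q (\<tau> + k) (e(v := y)) A \<Longrightarrow> wp (Asg v x ;; d) Q \<tau> e A"
  by simp

end

text \<open>
  The bound on words makes room for the number of the last tuple or guess.
\<close>

locale comp_search = comp_machine M K J E V n m nc vc deg nb + conn_graph E V r
  for M K J :: nat and E :: "nat \<Rightarrow> nat \<Rightarrow> bool" and V :: "nat set" and n m nc :: nat
    and vc deg :: "nat \<Rightarrow> nat" and nb :: "nat \<Rightarrow> nat \<Rightarrow> nat" and r :: nat +
  fixes eu ev :: "nat \<Rightarrow> nat"
  assumes edges: "u \<in> V \<Longrightarrow> E u v \<longleftrightarrow> (\<exists>i<m. eu i = u \<and> ev i = v \<or> eu i = v \<and> ev i = u)"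
    and big: "10 * nc ^ 5 + 10 < M"
    and eun: "i < m \<Longrightarrow> eu i < n \<and> ev i < n"
begin

definition static2 :: "env \<Rightarrow> arrays \<Rightarrow> bool" where
  "static2 e A \<longleftrightarrow> static e A \<and> e 1 = m \<and> e 4 = r \<and>
     (\<forall>i<m. A 0 (2 + 2 * i) = eu i \<and> A 0 (3 + 2 * i) = ev i) \<and> (\<forall>v<n. A 2 v = Suc r \<longleftrightarrow> v \<in> V)"

lemma static2_keep:
  assumes "static2 e A" "keep S e e'" "keep S' A A'" "0 \<notin> S" "1 \<notin> S" "2 \<notin> S" "4 \<notin> S" "S' \<subseteq> {5..15}"
  shows "static2 e' A'"
proof -
  have "static e' A'" using static_keep[OF _ assms(2,3,4,6,8)] assms(1) unfolding static2_def by blast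
  moreover have "e' 1 = e 1" "e' 4 = e 4" using keepD[OF assms(2)] assms by blast+
  moreover have "A' 0 = A 0" "A' 2 = A 2"
    using assms(8) by (intro keepD[OF assms(3)]; force)+
  ultimately show ?thesis using assms(1) unfolding static2_def by simp
qed

lemma nc_pos: "0 < nc" using root fin nc card_gt_0_iff by auto

lemma wp_DIGIT:
  assumes st: "static e A" and q: "e 19 = q" and i: "i \<noteq> 2" "i \<noteq> 19"
    and Q: "\<And>\<tau>'. \<tau>' \<le> \<tau> + 30 \<Longrightarrow> wp d Q \<tau>' (e(i := vc (q mod nc), 19 := q div nc)) A"
    and qM: "q < M"
  shows "wp (DIGIT i ;; d) Q \<tau> e A"
proof -
  have md: "q - q div nc * nc = q mod nc" by (simp add: minus_div_mult_eq_mod)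
  have l: "q mod nc < nc" using nc_pos by simp
  have "A 4 (q mod nc) = vc (q mod nc)" using list_row[OF st l] by simp
  moreover have "e 2 = nc" using st unfolding static_def by simp
  moreover have "q div nc * nc < M" "q div nc < M" "q - q div nc * nc < M"
    using qM by (simp_all add: le_less_trans[OF div_times_less_eq_dividend] le_less_trans[OF div_le_dividend] less_imp_diff_less)
  moreover have "q mod nc < K" using l bounds(3) by simp
  ultimately show ?thesis unfolding DIGIT_def using q i Jn Q md by (simp add: small)
qed

definition c5 :: "nat \<Rightarrow> nat \<Rightarrow> nat \<Rightarrow> nat \<Rightarrow> nat \<Rightarrow> bool" where
  "c5 a b c d f \<longleftrightarrow> E a b \<and> E b c \<and> E c d \<and> E d f \<and> E f a"

lemma good_iff:
  "good_cycle E V a b c d f \<longleftrightarrow> c5 a b c d f \<and> far_edges E a b c d f = {}"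
proof
  assume "good_cycle E V a b c d f"
  then interpret G: good_cycle E V a b c d f .
  show "c5 a b c d f \<and> far_edges E a b c d f = {}"
    using G.cyc G.stable unfolding c5_def G.far_edges_near by blast
next
  assume a: "c5 a b c d f \<and> far_edges E a b c d f = {}"
  then interpret F: five_cycle E V a b c d f
    by unfold_locales (simp_all add: c5_def)
  show "good_cycle E V a b c d f"
    using a by unfold_locales (auto simp: F.far_edges_near)
qed

lemma wp_CHECK:
  assumes st: "static2 e A" and c: "e 22 \<in> V" "e 23 \<in> V" "e 24 \<in> V" "e 25 \<in> V" "e 26 \<in> V"
  shows "wp (FOR 27 (X 1) CHECK_EDGE) (\<lambda>\<tau>' e' A'. \<tau>' \<le> \<tau> + m * 180 + 10 \<and> A' = A \<and> keep {17, 18, 27, 28} e e' \<and>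
    (e' 28 = 0 \<longleftrightarrow> far_edges E (e 22) (e 23) (e 24) (e 25) (e 26) = {})) \<tau> (e(28 := 0)) A"
    (is "wp _ ?Q _ _ _")
proof -
  define near where "near u \<longleftrightarrow> E (e 22) u \<or> E (e 23) u \<or> E (e 24) u \<or> E (e 25) u \<or> E (e 26) u" for u
  define bad where "bad j \<longleftrightarrow> eu j \<in> V \<and> \<not> near (eu j) \<and> \<not> near (ev j)" for j
  define P where "P i e' A' \<longleftrightarrow> A' = A \<and> keep {17, 18, 27, 28} e e' \<and> (e' 28 = 0 \<longleftrightarrow> (\<forall>j<i. \<not> bad j))"
    for i :: nat and e' :: env and A' :: arrays
  have s: "static e A" "e 1 = m" "e 4 = r" "\<And>i. i < m \<Longrightarrow> A 0 (2 + 2 * i) = eu i \<and> A 0 (3 + 2 * i) = ev i"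
    "\<And>v. v < n \<Longrightarrow> A 2 v = Suc r \<longleftrightarrow> v \<in> V" using st unfolding static2_def by blast+
  have adj: "A (20 + v) w = of_bool (E v w)" if "v \<in> V" "w \<in> V" for v w
    using s(1) that unfolding static_def by blast
  show ?thesis
  proof (rule wp_FOR_const[where D = 160 and n = m and P = P])
    show "m < M" using small(1)[of m] Kn by simp
    show "P 0 (e(28 := 0, 27 := 0)) A" unfolding P_def by (simp add: keep_def)
  next
    fix k e' A' assume "P k e' A'"
    then show "xok e' A' (X 1) \<and> xval e' A' (X 1) = m"
      using keepD[of "{17, 18, 27, 28}" e e' 1] s(2) unfolding P_def by simp
  next
    fix i and \<tau>' :: nat and e' A' assume i: "i < m" and P: "P i e' A'" and ei: "e' 27 = i"
    have A': "A' = A" and k: "keep {17, 18, 27, 28} e e'" and f: "e' 28 = 0 \<longleftrightarrow> (\<forall>j<i. \<not> bad j)"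
      using P unfolding P_def by blast+
    have same: "e' j = e j" if "j \<notin> {17, 18, 27, 28}" for j by (rule keepD[OF k that])
    have en: "eu i < n" "ev i < n" "eu i < K" "ev i < K" using eun[OF i] Kn by simp_all
    have mark: "A 2 (eu i) = Suc r \<longleftrightarrow> eu i \<in> V" by (rule s(5)[OF en(1)])
    have rb: "Suc r < M" using V_less[OF root] small(1)[of "Suc r"] Kn by simp
    have idx: "3 + 2 * i < K" "2 + 2 * i < K" "2 * i < M" "2 + 2 * i < M" "3 + 2 * i < M"
      using i Kn small(1)[of "3 + 2 * i"] by simp_all
    let ?Q' = "\<lambda>\<tau>'' e'' A''. \<tau>'' \<le> \<tau>' + 160 \<and> e'' 27 = i \<and> P (Suc i) (e''(27 := Suc i)) A''"
    let ?e = "e'(17 := eu i, 18 := ev i)"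
    have res: "P (Suc i) (?e(27 := Suc i)) A" if "\<not> bad i"
      unfolding P_def using k f that by (auto simp add: keep_def less_Suc_eq)
    have res1: "P (Suc i) (?e(28 := 1, 27 := Suc i)) A" if "bad i"
      unfolding P_def using k f that by (auto simp add: keep_def less_Suc_eq)
    have nr: "xok (e''::env) A (NEAR (X x)) \<and> (xval e'' A (NEAR (X x)) = 0 \<longleftrightarrow> \<not> near (e'' x))"
      if e'': "e'' x \<in> V" "e'' 22 = e 22" "e'' 23 = e 23" "e'' 24 = e 24" "e'' 25 = e 25" "e'' 26 = e 26" for e'' x
      using e'' c bounds(1)[OF e''(1)] bounds(6)[OF c(1)] bounds(6)[OF c(2)] bounds(6)[OF c(3)]
        bounds(6)[OF c(4)] bounds(6)[OF c(5)] adj[OF c(1) e''(1)] adj[OF c(2) e''(1)] adj[OF c(3) e''(1)]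
        adj[OF c(4) e''(1)] adj[OF c(5) e''(1)] small_consts Kn Jn small
      unfolding NEAR_def near_def by (simp add: small)
    have cost: "xcost (NEAR (X x)) = 39" for x unfolding NEAR_def by simp
    have w: "wp (IF (Eq (NEAR (X 17)) (N 0)) (IF (Eq (NEAR (X 18)) (N 0)) (Asg 28 (N 1)) SKIP) SKIP) ?Q' \<tau>1 ?e A"
      if t1: "\<tau>1 \<le> \<tau>' + 50" and uV: "eu i \<in> V" for \<tau>1
    proof -
      have vV: "ev i \<in> V" using edges[OF uV, of "ev i"] i dom sym by blast
      have n17: "xok ?e A (NEAR (X 17))" "xval ?e A (NEAR (X 17)) = 0 \<longleftrightarrow> \<not> near (eu i)"
        and n18: "xok ?e A (NEAR (X 18))" "xval ?e A (NEAR (X 18)) = 0 \<longleftrightarrow> \<not> near (ev i)"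
        using nr[of ?e 17] nr[of ?e 18] uV vV same by simp_all
      consider "near (eu i)" | "\<not> near (eu i)" "near (ev i)" | "\<not> near (eu i)" "\<not> near (ev i)" by blast
      then show ?thesis
      proof cases
        case 1
        then have "\<not> bad i" unfolding bad_def by simp
        from res[OF this] show ?thesis using 1 n17 n18 t1 M cost ei by simp
      next
        case 2
        then have "\<not> bad i" unfolding bad_def by simp
        from res[OF this] show ?thesis using 2 n17 n18 t1 M cost ei by simp
      next
        case 3
        then have "bad i" unfolding bad_def using uV by simp
        from res1[OF this] show ?thesis using 3 n17 n18 t1 M cost ei by simp
      qed
    qed
    define C where "C = IF (Eq (NEAR (X 17)) (N 0)) (IF (Eq (NEAR (X 18)) (N 0)) (Asg 28 (N 1)) SKIP) SKIP"
    show "wp CHECK_EDGE ?Q' \<tau>' e' A'"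
    proof (cases "eu i \<in> V")
      case True
      then show ?thesis unfolding CHECK_EDGE_def C_def[symmetric]
        using w[folded C_def] A' s(4)[OF i] ei idx en mark rb same[of 4] s(3) Jn small_consts by (simp add: small)
    next
      case False
      then have "\<not> bad i" unfolding bad_def by simp
      from res[OF this] show ?thesis unfolding CHECK_EDGE_def
        using False A' s(4)[OF i] ei idx en mark rb same[of 4] s(3) Jn small_consts by (simp add: small)
    qed
  next
    fix \<tau>' e' A' assume t: "\<tau>' \<le> \<tau> + m * (160 + xcost (X 1) + 6) + xcost (X 1) + 4" and P: "P m e' A'"
    have "(\<exists>j<m. bad j) \<longleftrightarrow> far_edges E (e 22) (e 23) (e 24) (e 25) (e 26) \<noteq> {}"
    proof
      assume "\<exists>j<m. bad j"
      then obtain j where j: "j < m" "eu j \<in> V" "\<not> near (eu j)" "\<not> near (ev j)" unfolding bad_def by blast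
      then have "E (eu j) (ev j)" using edges[OF j(2)] by blast
      then have "(eu j, ev j) \<in> far_edges E (e 22) (e 23) (e 24) (e 25) (e 26)"
        using j unfolding far_edges_def near_def by blast
      then show "far_edges E (e 22) (e 23) (e 24) (e 25) (e 26) \<noteq> {}" by blast
    next
      assume "far_edges E (e 22) (e 23) (e 24) (e 25) (e 26) \<noteq> {}"
      then obtain u v where uv: "E u v" "\<not> near u" "\<not> near v" unfolding far_edges_def near_def by blast
      have V: "u \<in> V" "v \<in> V" using dom[OF uv(1)] dom[OF sym[OF uv(1)]] .
      obtain j where "j < m" "eu j = u \<and> ev j = v \<or> eu j = v \<and> ev j = u" using edges[OF V(1)] uv(1) by blast
      then show "\<exists>j<m. bad j" unfolding bad_def using uv V by blast
    qed
    then show "?Q \<tau>' e' A'" using P t unfolding P_def by simp blast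
  qed
qed

definition tuple :: "nat \<Rightarrow> nat \<Rightarrow> nat" where
  "tuple t k = vc (t div nc ^ k mod nc)"

lemma tuple_V: "tuple t k \<in> V"
  using vc nc_pos unfolding tuple_def by auto

lemma div_nc: "t div nc ^ k div nc = t div nc ^ Suc k"
  by (simp only: div_mult2_eq power_Suc2)

lemma wp_TEST_CYCLE:
  assumes st: "static2 e A" and t: "e 21 = t" "t < M" and f: "e 29 = 0"
  shows "wp TEST_CYCLE (\<lambda>\<tau>' e' A'. \<tau>' \<le> \<tau> + m * 180 + 400 \<and> A' = A \<and>
    keep ({17..19} \<union> {22..29}) e e' \<and>
    (if good_cycle E V (tuple t 0) (tuple t 1) (tuple t 2) (tuple t 3) (tuple t 4)
     then e' 29 = 1 \<and> e' 22 = tuple t 0 \<and> e' 23 = tuple t 1 \<and> e' 24 = tuple t 2 \<and> e' 25 = tuple t 3 \<and> e' 26 = tuple t 4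
     else e' 29 = 0)) \<tau> e A"
    (is "wp _ ?Q _ _ _")
proof -
  let ?c = "tuple t"
  have s: "static e A" "e 1 = m" using st unfolding static2_def by blast+
  have adj: "A (20 + v) w = of_bool (E v w)" if "v \<in> V" "w \<in> V" for v w
    using s(1) that unfolding static_def by blast
  let ?e = "e(22 := ?c 0, 23 := ?c 1, 24 := ?c 2, 25 := ?c 3, 26 := ?c 4, 19 := t div nc ^ 5)"
  have ke: "keep ({17..19} \<union> {22..29}) e ?e" by (simp add: keep_def)
  have st': "static2 (e(28 := x)) A" if "static2 e A" for e x
    using that unfolding static2_def static_def by simp
  have ste: "static2 ?e A" using st unfolding static2_def static_def by simp
  have check: "wp (FOR 27 (X 1) CHECK_EDGE ;; IF (Eq (X 28) (N 0)) (Asg 29 (N 1)) SKIP) ?Q \<tau>1 (?e(28 := 0)) A"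
    if t1: "\<tau>1 \<le> \<tau> + 250" and cy: "c5 (?c 0) (?c 1) (?c 2) (?c 3) (?c 4)" for \<tau>1
  proof (rule wp_seqI)
    show "wp (FOR 27 (X 1) CHECK_EDGE) (\<lambda>\<tau>' e' A'. \<tau>' \<le> \<tau>1 + m * 180 + 10 \<and> A' = A \<and> keep {17, 18, 27, 28} ?e e' \<and>
      (e' 28 = 0 \<longleftrightarrow> far_edges E (?c 0) (?c 1) (?c 2) (?c 3) (?c 4) = {})) \<tau>1 (?e(28 := 0)) A"
      using wp_CHECK[OF ste, of \<tau>1] by (simp add: tuple_V)
  next
    fix \<tau>2 e2 A2
    assume 2: "\<tau>2 \<le> \<tau>1 + m * 180 + 10 \<and> A2 = A \<and> keep {17, 18, 27, 28} ?e e2 \<and>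
      (e2 28 = 0 \<longleftrightarrow> far_edges E (?c 0) (?c 1) (?c 2) (?c 3) (?c 4) = {})"
    have k2: "keep {17, 18, 27, 28} ?e e2" using 2 by blast
    have v2: "e2 22 = ?c 0" "e2 23 = ?c 1" "e2 24 = ?c 2" "e2 25 = ?c 3" "e2 26 = ?c 4" "e2 29 = 0"
      using keepD[OF k2] f by simp_all
    have g: "good_cycle E V (?c 0) (?c 1) (?c 2) (?c 3) (?c 4) \<longleftrightarrow> e2 28 = 0" using 2 cy unfolding good_iff by blast
    have k3: "keep ({17..19} \<union> {22..29}) e e2" by (rule keep_trans'[OF ke k2]) simp
    have k4: "keep ({17..19} \<union> {22..29}) e (e2(29 := 1))" using k3 unfolding keep_def by simp
    show "wp (IF (Eq (X 28) (N 0)) (Asg 29 (N 1)) SKIP) ?Q \<tau>2 e2 A2"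
    proof (cases "e2 28 = 0")
      case True
      then show ?thesis using 2 t1 g v2 k4 M by simp
    next
      case False
      then show ?thesis using 2 t1 g v2 k3 M by simp
    qed
  qed
  have edge5: "A (20 + ?c 0) (?c 1) + A (20 + ?c 1) (?c 2) + A (20 + ?c 2) (?c 3) + A (20 + ?c 3) (?c 4) +
      A (20 + ?c 4) (?c 0) = 5 \<longleftrightarrow> c5 (?c 0) (?c 1) (?c 2) (?c 3) (?c 4)"
    unfolding c5_def adj[OF tuple_V tuple_V] by (simp add: of_bool_def)
  have le5: "A (20 + ?c i) (?c j) \<le> 1" for i j unfolding adj[OF tuple_V tuple_V] by simp
  have b5: "20 + ?c i < J" "?c i < K" "20 + ?c i < M" for i
    using bounds(6)[OF tuple_V] bounds(1)[OF tuple_V] small(2)[of "20 + ?c i"] by (simp_all add: less_imp_le)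
  have sums: "A (20 + ?c 0) (?c 1) + A (20 + ?c 1) (?c 2) < M"
    "A (20 + ?c 0) (?c 1) + A (20 + ?c 1) (?c 2) + A (20 + ?c 2) (?c 3) < M"
    "A (20 + ?c 0) (?c 1) + A (20 + ?c 1) (?c 2) + A (20 + ?c 2) (?c 3) + A (20 + ?c 3) (?c 4) < M"
    "A (20 + ?c 0) (?c 1) + A (20 + ?c 1) (?c 2) + A (20 + ?c 2) (?c 3) + A (20 + ?c 3) (?c 4) +
      A (20 + ?c 4) (?c 0) < M"
    using le5[of 0 1] le5[of 1 2] le5[of 2 3] le5[of 3 4] le5[of 4 0] small_consts(1) by linarith+
  let ?s = "Rd (N 20 \<oplus> X 22) (X 23) \<oplus> Rd (N 20 \<oplus> X 23) (X 24) \<oplus> Rd (N 20 \<oplus> X 24) (X 25) \<oplus>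
         Rd (N 20 \<oplus> X 25) (X 26) \<oplus> Rd (N 20 \<oplus> X 26) (X 22)"
  have xs: "xok ?e A ?s" "xval ?e A ?s = A (20 + ?c 0) (?c 1) + A (20 + ?c 1) (?c 2) + A (20 + ?c 2) (?c 3) +
      A (20 + ?c 3) (?c 4) + A (20 + ?c 4) (?c 0)" "xcost ?s = 39"
    using b5 sums small_consts by simp_all
  have body: "wp (IF (Eq ?s (N 5)) (Asg 28 (N 0) ;; FOR 27 (X 1) CHECK_EDGE ;; IF (Eq (X 28) (N 0)) (Asg 29 (N 1)) SKIP)
      SKIP) ?Q \<tau>1 ?e A" if t1: "\<tau>1 \<le> \<tau> + 200" for \<tau>1
  proof (cases "c5 (?c 0) (?c 1) (?c 2) (?c 3) (?c 4)")
    case True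
    have "wp (FOR 27 (X 1) CHECK_EDGE ;; IF (Eq (X 28) (N 0)) (Asg 29 (N 1)) SKIP) ?Q (\<tau>1 + 41 + 2) (?e(28 := 0)) A"
      by (rule check[OF _ True]) (use t1 in simp)
    moreover have "bval ?e A (Eq ?s (N 5))" using True edge5 xs(2) by simp
    moreover have "bok ?e A (Eq ?s (N 5))" using xs(1) small_consts by simp
    moreover have "bcost (Eq ?s (N 5)) = 41" using xs(3) by simp
    moreover have "xok ?e A (N 0)" "xcost (N 0) + 1 = 2" "xval ?e A (N 0) = 0" using M by simp_all
    ultimately show ?thesis unfolding wp.simps(5) wp.simps(4) wp.simps(2) by simp
  next
    case False
    then have ng: "\<not> good_cycle E V (?c 0) (?c 1) (?c 2) (?c 3) (?c 4)" unfolding good_iff by blast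
    have Q1: "?Q (\<tau>1 + 41 + 1) ?e A"
      unfolding if_not_P[OF ng] using t1 f ke by (simp del: One_nat_def)
    have nb: "\<not> bval ?e A (Eq ?s (N 5))" using False edge5 xs(2) by simp
    have ok: "bok ?e A (Eq ?s (N 5))" using xs(1) small_consts by simp
    have co: "bcost (Eq ?s (N 5)) = 41" using xs(3) by simp
    show ?thesis by (rule wp_IF_F[OF ok nb wp_SKIP], unfold co, rule Q1)
  qed
  have le: "t div nc ^ k < M" for k using t(2) div_le_dividend le_less_trans by blast
  have d: "t div nc ^ k mod nc = t div nc ^ k mod nc" for k ..
  have q: "t div nc = t div nc ^ 1" "t div nc ^ 1 div nc = t div nc ^ 2" "t div nc ^ 2 div nc = t div nc ^ 3"
    "t div nc ^ 3 div nc = t div nc ^ 4" "t div nc ^ 4 div nc = t div nc ^ 5"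
    using div_nc[of t 1] div_nc[of t 2] div_nc[of t 3] div_nc[of t 4] by (simp_all add: eval_nat_numeral)
  let ?ez = "e(19 := t)" let ?e1 = "e(19 := t div nc ^ 1, 22 := ?c 0)"
  let ?e2 = "e(19 := t div nc ^ 2, 22 := ?c 0, 23 := ?c 1)"
  let ?e3 = "e(19 := t div nc ^ 3, 22 := ?c 0, 23 := ?c 1, 24 := ?c 2)"
  let ?e4 = "e(19 := t div nc ^ 4, 22 := ?c 0, 23 := ?c 1, 24 := ?c 2, 25 := ?c 3)"
  have sts: "static ?ez A" "static ?e1 A" "static ?e2 A" "static ?e3 A" "static ?e4 A"
    using s(1) unfolding static_def by simp_all
  let ?I = "IF (Eq ?s (N 5)) (Asg 28 (N 0) ;; FOR 27 (X 1) CHECK_EDGE ;; IF (Eq (X 28) (N 0)) (Asg 29 (N 1)) SKIP) SKIP"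
  have "wp (DIGIT 22 ;; DIGIT 23 ;; DIGIT 24 ;; DIGIT 25 ;; DIGIT 26 ;; ?I) ?Q (\<tau> + 2) ?ez A"
  proof (rule wp_DIGIT[OF sts(1), of t])
    fix \<tau>1 assume t1: "\<tau>1 \<le> \<tau> + 2 + 30"
    have "wp (DIGIT 23 ;; DIGIT 24 ;; DIGIT 25 ;; DIGIT 26 ;; ?I) ?Q \<tau>1 ?e1 A"
    proof (rule wp_DIGIT[OF sts(2), of "t div nc ^ 1"])
      fix \<tau>2 assume t2: "\<tau>2 \<le> \<tau>1 + 30"
      have "wp (DIGIT 24 ;; DIGIT 25 ;; DIGIT 26 ;; ?I) ?Q \<tau>2 ?e2 A"
      proof (rule wp_DIGIT[OF sts(3), of "t div nc ^ 2"])
        fix \<tau>3 assume t3: "\<tau>3 \<le> \<tau>2 + 30"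
        have "wp (DIGIT 25 ;; DIGIT 26 ;; ?I) ?Q \<tau>3 ?e3 A"
        proof (rule wp_DIGIT[OF sts(4), of "t div nc ^ 3"])
          fix \<tau>4 assume t4: "\<tau>4 \<le> \<tau>3 + 30"
          have "wp (DIGIT 26 ;; ?I) ?Q \<tau>4 ?e4 A"
          proof (rule wp_DIGIT[OF sts(5), of "t div nc ^ 4"])
            fix \<tau>5 assume t5: "\<tau>5 \<le> \<tau>4 + 30"
            have "wp ?I ?Q \<tau>5 ?e A" by (rule body) (use t1 t2 t3 t4 t5 in simp)
            moreover have "?e4(26 := vc (t div nc ^ 4 mod nc), 19 := t div nc ^ 4 div nc) = ?e"
              unfolding q(5) tuple_def by (rule ext) simp
            ultimately show "wp ?I ?Q \<tau>5 (?e4(26 := vc (t div nc ^ 4 mod nc), 19 := t div nc ^ 4 div nc)) A" by (simp only:)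
          qed (use le in simp_all)
          moreover have "?e3(25 := vc (t div nc ^ 3 mod nc), 19 := t div nc ^ 3 div nc) = ?e4"
            unfolding q(4) tuple_def by (rule ext) simp
          ultimately show "wp (DIGIT 26 ;; ?I) ?Q \<tau>4 (?e3(25 := vc (t div nc ^ 3 mod nc), 19 := t div nc ^ 3 div nc)) A" by (simp only:)
        qed (use le in simp_all)
        moreover have "?e2(24 := vc (t div nc ^ 2 mod nc), 19 := t div nc ^ 2 div nc) = ?e3"
          unfolding q(3) tuple_def by (rule ext) simp
        ultimately show "wp (DIGIT 25 ;; DIGIT 26 ;; ?I) ?Q \<tau>3 (?e2(24 := vc (t div nc ^ 2 mod nc), 19 := t div nc ^ 2 div nc)) A" by (simp only:)
      qed (use le in simp_all)
      moreover have "?e1(23 := vc (t div nc ^ 1 mod nc), 19 := t div nc ^ 1 div nc) = ?e2"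
        unfolding q(2) tuple_def by (rule ext) simp
      ultimately show "wp (DIGIT 24 ;; DIGIT 25 ;; DIGIT 26 ;; ?I) ?Q \<tau>2 (?e1(23 := vc (t div nc ^ 1 mod nc), 19 := t div nc ^ 1 div nc)) A" by (simp only:)
    qed (use le[of 1] in simp_all)
    moreover have "?ez(22 := vc (t mod nc), 19 := t div nc) = ?e1"
      unfolding q(1) tuple_def by (rule ext) simp
    ultimately show "wp (DIGIT 23 ;; DIGIT 24 ;; DIGIT 25 ;; DIGIT 26 ;; ?I) ?Q \<tau>1 (?ez(22 := vc (t mod nc), 19 := t div nc)) A" by (simp only:)
  qed (use t in simp_all)
  then show ?thesis unfolding TEST_CYCLE_def wp.simps(4)[of "Asg 19 (X 21)"] wp.simps(2) using t(1) by simp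
qed

text \<open>
  Part two treats the digits above the fourth as a number of its own: it encodes the rotation of the
  cycle and a colour.
\<close>

lemma tuple_surj:
  assumes "x0 \<in> V" "x1 \<in> V" "x2 \<in> V" "x3 \<in> V" "x4 \<in> V" and p: "p < b"
  shows "\<exists>t<nc ^ 5. tuple t 0 = x0 \<and> tuple t 1 = x1 \<and> tuple t 2 = x2 \<and> tuple t 3 = x3 \<and> tuple t 4 = x4"
    and "\<exists>t<nc ^ 4 * b. tuple t 0 = x0 \<and> tuple t 1 = x1 \<and> tuple t 2 = x2 \<and> tuple t 3 = x3 \<and> t div nc ^ 4 = p"
proof -
  obtain i0 i1 i2 i3 i4 where i: "i0 < nc" "x0 = vc i0" "i1 < nc" "x1 = vc i1" "i2 < nc" "x2 = vc i2"
    "i3 < nc" "x3 = vc i3" "i4 < nc" "x4 = vc i4" using vc_ex assms by metis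
  have P: "t div nc ^ Suc k = t div nc div nc ^ k" for t k by (simp add: div_mult2_eq)
  have n: "nc ^ 5 = nc * (nc * (nc * (nc * nc)))" "nc ^ 4 * b = nc * (nc * (nc * (nc * b)))"
    by (simp_all add: eval_nat_numeral)
  let ?t = "i0 + nc * (i1 + nc * (i2 + nc * (i3 + nc * i4)))"
  let ?s = "i0 + nc * (i1 + nc * (i2 + nc * (i3 + nc * p)))"
  have "?t < nc ^ 5" unfolding n by (intro mixed_radix(3) i)
  moreover have "tuple ?t 0 = x0 \<and> tuple ?t 1 = x1 \<and> tuple ?t 2 = x2 \<and> tuple ?t 3 = x3 \<and> tuple ?t 4 = x4"
    unfolding tuple_def using i by (simp add: numeral_eq_Suc P mixed_radix(1,2) del: power_Suc)
  ultimately show "\<exists>t<nc ^ 5. tuple t 0 = x0 \<and> tuple t 1 = x1 \<and> tuple t 2 = x2 \<and> tuple t 3 = x3 \<and> tuple t 4 = x4" by blast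
  have "?s < nc ^ 4 * b" unfolding n by (intro mixed_radix(3) i p)
  moreover have "tuple ?s 0 = x0 \<and> tuple ?s 1 = x1 \<and> tuple ?s 2 = x2 \<and> tuple ?s 3 = x3 \<and> ?s div nc ^ 4 = p"
    unfolding tuple_def using i by (simp add: numeral_eq_Suc P mixed_radix(1,2) del: power_Suc)
  ultimately show "\<exists>t<nc ^ 4 * b. tuple t 0 = x0 \<and> tuple t 1 = x1 \<and> tuple t 2 = x2 \<and> tuple t 3 = x3 \<and> t div nc ^ 4 = p" by blast
qed

lemma wp_SEARCH:
  assumes st: "static2 e A"
  shows "wp SEARCH (\<lambda>\<tau>' e' A'. \<tau>' \<le> \<tau> + nc ^ 5 * (150 * K) + 40 \<and> A' = A \<and>
    keep ({17..29}) e e' \<and>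
    (if e' 29 = 1 then good_cycle E V (e' 22) (e' 23) (e' 24) (e' 25) (e' 26)
     else \<forall>a b c d f. \<not> good_cycle E V a b c d f)) \<tau> e A"
    (is "wp _ ?Q _ _ _")
proof -
  define good where "good t \<longleftrightarrow> good_cycle E V (tuple t 0) (tuple t 1) (tuple t 2) (tuple t 3) (tuple t 4)" for t
  define P where "P i e' A' \<longleftrightarrow> A' = A \<and> keep {17..29} e e' \<and> e' 20 = nc ^ 5 \<and> (e' 29 = 0 \<or> e' 29 = 1) \<and>
    (e' 29 = 0 \<longrightarrow> (\<forall>t<i. \<not> good t)) \<and> (e' 29 = 1 \<longrightarrow> good_cycle E V (e' 22) (e' 23) (e' 24) (e' 25) (e' 26))"
    for i :: nat and e' :: env and A' :: arrays
  have e2: "e 2 = nc" using st unfolding static2_def static_def by blast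
  have "wp (FOR 21 (X 20) (IF (Eq (X 29) (N 0)) TEST_CYCLE SKIP)) ?Q \<tau>0 (e(29 := 0, 20 := nc ^ 5)) A"
    if t0: "\<tau>0 \<le> \<tau> + 20" for \<tau>0
  proof (rule wp_FOR_const[where D = "m * 180 + 410" and n = "nc ^ 5" and P = P])
    show "nc ^ 5 < M" using big by simp
    show "P 0 (e(29 := 0, 20 := nc ^ 5, 21 := 0)) A" unfolding P_def by (simp add: keep_def)
  next
    fix k e' A' assume "P k e' A'"
    then show "xok e' A' (X 20) \<and> xval e' A' (X 20) = nc ^ 5" unfolding P_def by simp
  next
    fix i and \<tau>' :: nat and e' A' assume i: "i < nc ^ 5" and P: "P i e' A'" and ei: "e' 21 = i"
    have A': "A' = A" and k: "keep {17..29} e e'" and f: "e' 20 = nc ^ 5" "e' 29 = 0 \<or> e' 29 = 1"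
      "e' 29 = 0 \<longrightarrow> (\<forall>t<i. \<not> good t)" "e' 29 = 1 \<longrightarrow> good_cycle E V (e' 22) (e' 23) (e' 24) (e' 25) (e' 26)"
      using P unfolding P_def by blast+
    let ?Q' = "\<lambda>\<tau>'' e'' A''. \<tau>'' \<le> \<tau>' + (m * 180 + 410) \<and> e'' 21 = i \<and> P (Suc i) (e''(21 := Suc i)) A''"
    show "wp (IF (Eq (X 29) (N 0)) TEST_CYCLE SKIP) ?Q' \<tau>' e' A'"
    proof (cases "e' 29 = 0")
      case False
      have "P (Suc i) (e'(21 := Suc i)) A'" unfolding P_def using A' k f False by (simp add: keep_def)
      then show ?thesis using False ei M f(2) by simp
    next
      case True
      have st': "static2 e' A'" unfolding A'
        by (rule static2_keep[OF st k, of "{}"]) (simp_all add: keep_refl)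
      have iM: "i < M" using i big by simp
      have "wp TEST_CYCLE ?Q' (\<tau>' + 3) e' A'"
      proof (rule wp_mono[OF wp_TEST_CYCLE[OF st' ei iM True]], elim conjE)
        fix \<tau>2 e2 A2
        assume 2: "\<tau>2 \<le> \<tau>' + 3 + m * 180 + 400" "A2 = A'" "keep ({17..19} \<union> {22..29}) e' e2"
          "if good_cycle E V (tuple i 0) (tuple i 1) (tuple i 2) (tuple i 3) (tuple i 4)
           then e2 29 = 1 \<and> e2 22 = tuple i 0 \<and> e2 23 = tuple i 1 \<and> e2 24 = tuple i 2 \<and> e2 25 = tuple i 3 \<and> e2 26 = tuple i 4
           else e2 29 = 0"
        have k2: "keep {17..29} e e2" by (rule keep_trans'[OF k 2(3)]) simp
        then have k3: "keep {17..29} e (e2(21 := Suc i))" unfolding keep_def by simp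
        have r: "e2 20 = nc ^ 5" "e2 21 = i" using keepD[OF 2(3)] f(1) ei by simp_all
        have "P (Suc i) (e2(21 := Suc i)) A2"
        proof (cases "good i")
          case g: True
          then show ?thesis unfolding P_def using 2(2,4) A' k3 r unfolding good_def by simp
        next
          case g: False
          have "e2 29 = 0" using 2(4) g unfolding good_def by simp
          moreover have "\<forall>t<Suc i. \<not> good t" using f(3) True g by (simp add: less_Suc_eq)
          ultimately show ?thesis unfolding P_def using 2(2) A' k3 r by simp
        qed
        then show "?Q' \<tau>2 e2 A2" using 2(1) r by simp
      qed
      then show ?thesis using True M by (simp add: numeral_3_eq_3)
    qed
  next
    fix \<tau>' e' A' assume t: "\<tau>' \<le> \<tau>0 + nc ^ 5 * (m * 180 + 410 + xcost (X 20) + 6) + xcost (X 20) + 4"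
      and P: "P (nc ^ 5) e' A'"
    have "m * 180 + 410 + xcost (X 20) + 6 \<le> 150 * K" using Kn by simp
    then have "nc ^ 5 * (m * 180 + 410 + xcost (X 20) + 6) \<le> nc ^ 5 * (150 * K)" by (rule mult_le_mono2)
    then have "\<tau>' \<le> \<tau> + nc ^ 5 * (150 * K) + 40" using t t0 unfolding xcost.simps by linarith
    moreover have "\<forall>a b c d f. \<not> good_cycle E V a b c d f" if "e' 29 = 0"
    proof (intro allI notI)
      fix a b c d f assume g: "good_cycle E V a b c d f"
      then have "c5 a b c d f" unfolding good_iff by blast
      then have "a \<in> V" "b \<in> V" "c \<in> V" "d \<in> V" "f \<in> V" unfolding c5_def using dom by blast+
      from tuple_surj(1)[OF this, of 0 1] obtain t where "t < nc ^ 5" "tuple t 0 = a" "tuple t 1 = b" "tuple t 2 = c"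
        "tuple t 3 = d" "tuple t 4 = f" by auto
      then show False using P that g unfolding P_def good_def by auto
    qed
    ultimately show "?Q \<tau>' e' A'" using P unfolding P_def by auto
  qed
  moreover have "nc * nc * nc * nc * nc = nc ^ 5" by (simp add: eval_nat_numeral)
  moreover have "nc ^ k < M" if "k \<le> 5" for k
    using power_increasing[OF that, of nc] nc_pos big by simp
  from this[of 2] this[of 3] this[of 4] this[of 5]
  have "nc * nc < M" "nc * nc * nc < M" "nc * nc * nc * nc < M" "nc * nc * nc * nc * nc < M"
    by (simp_all add: eval_nat_numeral mult.assoc)
  ultimately show ?thesis unfolding SEARCH_def using e2 M by simp
qed

end

section \<open>Colouring one component\<close>

definition LOAD_GUESS :: cmd where
  "LOAD_GUESS =
     Asg 35 (N 1 \<oplus> X 19 \<oslash> N 5) ;; Asg 43 (X 19 \<ominus> X 19 \<oslash> N 5 \<otimes> N 5) ;;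
     Asg 36 (Rd (N 6) (X 43)) ;; Asg 37 (Rd (N 6) (X 43 \<oplus> N 1)) ;; Asg 38 (Rd (N 6) (X 43 \<oplus> N 2)) ;;
     Asg 39 (Rd (N 6) (X 43 \<oplus> N 3)) ;; Asg 40 (Rd (N 6) (X 43 \<oplus> N 4))"

definition TRY_GUESS :: cmd where
  "TRY_GUESS =
     Asg 19 (X 42) ;; DIGIT 31 ;; DIGIT 32 ;; DIGIT 33 ;; DIGIT 34 ;; LOAD_GUESS ;;
     EVAL ;; IF (Eq (X 7) (N 0)) (Asg 41 (N 1)) SKIP"

definition GUESS :: cmd where
  "GUESS = Asg 41 (N 0) ;; Asg 30 (X 2 \<otimes> X 2 \<otimes> X 2 \<otimes> X 2 \<otimes> N 10) ;;
     FOR 42 (X 30) (IF (Eq (X 41) (N 0)) TRY_GUESS SKIP)"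

definition STORE_CYCLE :: cmd where
  "STORE_CYCLE =
     Wr (N 6) (N 0) (X 22) ;; Wr (N 6) (N 1) (X 23) ;; Wr (N 6) (N 2) (X 24) ;; Wr (N 6) (N 3) (X 25) ;;
     Wr (N 6) (N 4) (X 26) ;; Wr (N 6) (N 5) (X 22) ;; Wr (N 6) (N 6) (X 23) ;; Wr (N 6) (N 7) (X 24) ;;
     Wr (N 6) (N 8) (X 25)"

text \<open>
  The cycle is stored twice up to its last vertex, so that rotating it is an offset. A failing search
  means that the component has no five-cycle at all.
\<close>

definition SOLVE_COMP :: cmd where
  "SOLVE_COMP = SEARCH ;;
     IF (Eq (X 29) (N 1)) (STORE_CYCLE ;; GUESS)
       (BIP ;; IF (Eq (X 7) (N 0)) (Asg 41 (N 1)) (Asg 41 (N 0)))"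

context comp_search begin

text \<open>
  The guess \<open>t\<close> consists of four vertices, the rotation \<open>k\<close>, and one bit for the colour of the second
  vertex.
\<close>

definition right_guess :: "(nat \<Rightarrow> nat) \<Rightarrow> nat \<Rightarrow> bool" where
  "right_guess cy t \<longleftrightarrow> (let k = t div nc ^ 4 mod 5 in
    \<exists>f. proper f \<and> f (cy k) = 0 \<and> f (cy (k + 1)) = 1 \<and> f (cy (k + 2)) = 2 \<and> f (cy (k + 3)) = 1 \<and> f (cy (k + 4)) = 2 \<and>
      f (tuple t 0) = 0 \<and> f (tuple t 1) = 1 + t div nc ^ 4 div 5 \<and> f (tuple t 2) = 1 \<and> f (tuple t 3) = 2 \<and>
      (\<forall>L. seeded f L {cy k, cy (k + 1), cy (k + 2), cy (k + 3), cy (k + 4), tuple t 0, tuple t 1, tuple t 2, tuple t 3} \<longrightarrow>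
        closed_lists L \<longrightarrow> (\<exists>g. proper g \<and> (\<forall>v\<in>V. g v \<in> trim L v))))"

lemma wp_LOAD_GUESS:
  assumes q: "e 19 = q" "q < 10" and cy: "\<And>i. i < 9 \<Longrightarrow> A 6 i = cy i"
    and Q: "\<And>\<tau>'. \<tau>' \<le> \<tau> + 80 \<Longrightarrow> wp d Q \<tau>' (e(35 := 1 + q div 5, 43 := q mod 5, 36 := cy (q mod 5),
      37 := cy (q mod 5 + 1), 38 := cy (q mod 5 + 2), 39 := cy (q mod 5 + 3), 40 := cy (q mod 5 + 4))) A"
  shows "wp (LOAD_GUESS ;; d) Q \<tau> e A"
proof -
  have md: "q - q div 5 * 5 = q mod 5" by (simp add: minus_div_mult_eq_mod)
  have k: "q mod 5 < 5" by simp
  have a: "A 6 (q mod 5 + i) = cy (q mod 5 + i)" if "i < 5" for i using cy[of "q mod 5 + i"] k that by linarith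
  have b: "q mod 5 + i < K" "q mod 5 + i < M" if "i < 5" for i
    using k that Kn small(1)[of "q mod 5 + i"] by linarith+
  have qd: "q div 5 * 5 \<le> q" by simp
  have d5: "q div 5 < M" "Suc (q div 5) < M" "q div 5 * 5 < M" "q - q div 5 * 5 < M"
    using q(2) small_consts(1) qd by linarith+
  define k where "k = q mod 5"
  let ?R = "Asg 36 (Rd (N 6) (X 43)) ;; Asg 37 (Rd (N 6) (X 43 \<oplus> N 1)) ;; Asg 38 (Rd (N 6) (X 43 \<oplus> N 2)) ;;
     Asg 39 (Rd (N 6) (X 43 \<oplus> N 3)) ;; Asg 40 (Rd (N 6) (X 43 \<oplus> N 4))"
  have rest: "wp (?R ;; d) Q \<tau>1 (e(35 := 1 + q div 5, 43 := k)) A" if "\<tau>1 \<le> \<tau> + 20" for \<tau>1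
    using a[of 0] a[of 1] a[of 2] a[of 3] a[of 4] b[of 0] b[of 1] b[of 2] b[of 3] b[of 4] Jn small_consts that
      Q[unfolded k_def[symmetric]]
    unfolding k_def[symmetric]
    by (simp add: small)
  have assoc: "wp (LOAD_GUESS ;; d) Q \<tau> e A = wp (Asg 35 (N 1 \<oplus> X 19 \<oslash> N 5) ;;
      Asg 43 (X 19 \<ominus> X 19 \<oslash> N 5 \<otimes> N 5) ;; ?R ;; d) Q \<tau> e A"
    unfolding LOAD_GUESS_def wp.simps(4) ..
  show ?thesis
    unfolding assoc
  proof (rule wp_Asg_seq)
    show "wp (Asg 43 (X 19 \<ominus> X 19 \<oslash> N 5 \<otimes> N 5) ;; ?R ;; d) Q (\<tau> + 6) (e(35 := 1 + q div 5)) A"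
    proof (rule wp_Asg_seq)
      show "wp (?R ;; d) Q (\<tau> + 6 + 8) (e(35 := 1 + q div 5, 43 := k)) A" by (rule rest) simp
      show "xval (e(35 := 1 + q div 5)) A (X 19 \<ominus> X 19 \<oslash> N 5 \<otimes> N 5) = k" unfolding k_def using md q(1) by simp
    qed (use q(1) d5 small_consts in simp_all)
  qed (use q(1) d5 small_consts in simp_all)
qed

lemma wp_TRY_GUESS:
  assumes st: "static2 e A" and t: "e 42 = t" "t < nc ^ 4 * 10" "t < M" and f: "e 41 = 0"
    and cy: "\<And>i. i < 9 \<Longrightarrow> A 6 i = cy i" "\<And>i. i < 9 \<Longrightarrow> cy i \<in> V"
  shows "wp TRY_GUESS (\<lambda>\<tau>' e' A'. \<tau>' \<le> \<tau> + nc * (600 * K) + 700 * K + 300 \<and>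
    keep ({5..19} \<union> {31..41} \<union> {43}) e e' \<and> keep ({5} \<union> {10..15}) A A' \<and>
    (e' 41 = 0 \<or> e' 41 = 1 \<and> solved A') \<and> (right_guess cy t \<longrightarrow> e' 41 = 1)) \<tau> e A"
    (is "wp _ ?Q _ _ _")
proof -
  let ?c = "tuple t"
  let ?q = "t div nc ^ 4"
  have s: "static e A" using st unfolding static2_def by blast
  have q10: "?q < 10" using t(2) by (simp add: less_mult_imp_div_less mult.commute)
  have k: "?q mod 5 < 5" by simp
  let ?e = "e(31 := ?c 0, 32 := ?c 1, 33 := ?c 2, 34 := ?c 3, 19 := ?q)"
  let ?f = "?e(35 := 1 + ?q div 5, 43 := ?q mod 5, 36 := cy (?q mod 5),
      37 := cy (?q mod 5 + 1), 38 := cy (?q mod 5 + 2), 39 := cy (?q mod 5 + 3), 40 := cy (?q mod 5 + 4))"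
  have stf: "static ?f A" using s unfolding static_def by simp
  have kf: "keep ({5..19} \<union> {31..41} \<union> {43}) e ?f" by (simp add: keep_def)
  have eval: "wp (EVAL ;; IF (Eq (X 7) (N 0)) (Asg 41 (N 1)) SKIP) ?Q \<tau>1 ?f A" if t1: "\<tau>1 \<le> \<tau> + 250" for \<tau>1
  proof (rule wp_seqI[OF wp_EVAL[OF stf]])
    fix i :: nat assume "i \<in> {31, 32, 33, 34, 36, 37, 38, 39, 40}"
    then show "?f i \<in> V"
      by (elim insertE) (use k cy(2) in \<open>simp_all add: tuple_V\<close>)
  next
    show "?f 35 < 3" using q10 by simp
  next
    fix \<tau>2 :: nat and e2 :: env and A2 :: arrays
    let ?C = "\<forall>f. proper f \<and> f (?f 36) = 0 \<and> f (?f 37) = 1 \<and> f (?f 38) = 2 \<and> f (?f 39) = 1 \<and> f (?f 40) = 2 \<and>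
      f (?f 31) = 0 \<and> f (?f 32) = ?f 35 \<and> f (?f 33) = 1 \<and> f (?f 34) = 2 \<and>
      (\<forall>L. seeded f L {?f 36, ?f 37, ?f 38, ?f 39, ?f 40, ?f 31, ?f 32, ?f 33, ?f 34} \<longrightarrow> closed_lists L \<longrightarrow>
        (\<exists>g. proper g \<and> (\<forall>v\<in>V. g v \<in> trim L v))) \<longrightarrow> e2 7 = 0"
    assume 2: "\<tau>2 \<le> \<tau>1 + nc * (600 * K) + 700 * K \<and> (e2 7 = 0 \<longrightarrow> solved A2) \<and> ?C \<and>
      keep {5..19} ?f e2 \<and> keep ({5} \<union> {10..15}) A A2"
    have C: ?C using 2 by blast
    have k2: "keep {5..19} ?f e2" and a2: "keep ({5} \<union> {10..15}) A A2" using 2 by blast+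
    have r: "e2 7 = 0" if g: "right_guess cy t"
    proof -
      from g obtain f where f: "proper f" "f (cy (?q mod 5)) = 0" "f (cy (?q mod 5 + 1)) = 1" "f (cy (?q mod 5 + 2)) = 2"
        "f (cy (?q mod 5 + 3)) = 1" "f (cy (?q mod 5 + 4)) = 2"
        "f (tuple t 0) = 0" "f (tuple t 1) = 1 + ?q div 5" "f (tuple t 2) = 1" "f (tuple t 3) = 2"
        "\<forall>L. seeded f L {cy (?q mod 5), cy (?q mod 5 + 1), cy (?q mod 5 + 2), cy (?q mod 5 + 3), cy (?q mod 5 + 4),
          tuple t 0, tuple t 1, tuple t 2, tuple t 3} \<longrightarrow>
        closed_lists L \<longrightarrow> (\<exists>g. proper g \<and> (\<forall>v\<in>V. g v \<in> trim L v))"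
        unfolding right_guess_def Let_def by (elim exE conjE) (rule that)
      show ?thesis by (rule C[rule_format, of f]) (use f in simp)
    qed
    have e41: "e2 41 = 0" using keepD[OF k2, of 41] f by simp
    have ke: "keep ({5..19} \<union> {31..41} \<union> {43}) e e2" by (rule keep_trans'[OF kf k2]) auto
    then have ke1: "keep ({5..19} \<union> {31..41} \<union> {43}) e (e2(41 := 1))" unfolding keep_def by simp
    show "wp (IF (Eq (X 7) (N 0)) (Asg 41 (N 1)) SKIP) ?Q \<tau>2 e2 A2"
    proof (cases "e2 7 = 0")
      case True
      then show ?thesis using 2 t1 ke1 a2 M by simp
    next
      case False
      have nr: "\<not> right_guess cy t"
      proof
        assume "right_guess cy t"
        from r[OF this] \<open>e2 7 \<noteq> 0\<close> show False by simp
      qed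
      have tl: "\<tau>2 \<le> \<tau>1 + nc * (600 * K) + 700 * K" using 2 by blast
      have "?Q (\<tau>2 + bcost (Eq (X 7) (N 0)) + 1) e2 A2" using tl t1 nr ke a2 e41 by simp
      then show ?thesis by (intro wp_IF_F wp_SKIP) (use False M in simp_all)
    qed
  qed
  let ?I = "LOAD_GUESS ;; EVAL ;; IF (Eq (X 7) (N 0)) (Asg 41 (N 1)) SKIP"
  have body: "wp ?I ?Q \<tau>1 ?e A" if t1: "\<tau>1 \<le> \<tau> + 150" for \<tau>1
  proof (rule wp_LOAD_GUESS[of ?e ?q A cy])
    show "wp (EVAL ;; IF (Eq (X 7) (N 0)) (Asg 41 (N 1)) SKIP) ?Q \<tau>' ?f A" if "\<tau>' \<le> \<tau>1 + 80" for \<tau>'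
      by (rule eval) (use that t1 in simp)
  qed (use q10 cy(1) in simp_all)
  have le: "t div nc ^ k < M" for k using t(3) div_le_dividend le_less_trans by blast
  have q: "t div nc = t div nc ^ 1" "t div nc ^ 1 div nc = t div nc ^ 2" "t div nc ^ 2 div nc = t div nc ^ 3"
    "t div nc ^ 3 div nc = t div nc ^ 4"
    using div_nc[of t 1] div_nc[of t 2] div_nc[of t 3] by (simp_all add: eval_nat_numeral)
  let ?ez = "e(19 := t)" let ?e1 = "e(19 := t div nc ^ 1, 31 := ?c 0)"
  let ?e2 = "e(19 := t div nc ^ 2, 31 := ?c 0, 32 := ?c 1)"
  let ?e3 = "e(19 := t div nc ^ 3, 31 := ?c 0, 32 := ?c 1, 33 := ?c 2)"
  have sts: "static ?ez A" "static ?e1 A" "static ?e2 A" "static ?e3 A"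
    using s unfolding static_def by simp_all
  have "wp (DIGIT 31 ;; DIGIT 32 ;; DIGIT 33 ;; DIGIT 34 ;; ?I) ?Q (\<tau> + 2) ?ez A"
  proof (rule wp_DIGIT[OF sts(1), of t])
    fix \<tau>1 assume t1: "\<tau>1 \<le> \<tau> + 2 + 30"
    have "wp (DIGIT 32 ;; DIGIT 33 ;; DIGIT 34 ;; ?I) ?Q \<tau>1 ?e1 A"
    proof (rule wp_DIGIT[OF sts(2), of "t div nc ^ 1"])
      fix \<tau>2 assume t2: "\<tau>2 \<le> \<tau>1 + 30"
      have "wp (DIGIT 33 ;; DIGIT 34 ;; ?I) ?Q \<tau>2 ?e2 A"
      proof (rule wp_DIGIT[OF sts(3), of "t div nc ^ 2"])
        fix \<tau>3 assume t3: "\<tau>3 \<le> \<tau>2 + 30"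
        have "wp (DIGIT 34 ;; ?I) ?Q \<tau>3 ?e3 A"
        proof (rule wp_DIGIT[OF sts(4), of "t div nc ^ 3"])
          fix \<tau>4 assume t4: "\<tau>4 \<le> \<tau>3 + 30"
          have "wp ?I ?Q \<tau>4 ?e A" by (rule body) (use t1 t2 t3 t4 in simp)
          moreover have "?e3(34 := vc (t div nc ^ 3 mod nc), 19 := t div nc ^ 3 div nc) = ?e"
            unfolding q(4) tuple_def by (rule ext) simp
          ultimately show "wp ?I ?Q \<tau>4 (?e3(34 := vc (t div nc ^ 3 mod nc), 19 := t div nc ^ 3 div nc)) A" by (simp only:)
        qed (use le in simp_all)
        moreover have "?e2(33 := vc (t div nc ^ 2 mod nc), 19 := t div nc ^ 2 div nc) = ?e3"
          unfolding q(3) tuple_def by (rule ext) simp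
        ultimately show "wp (DIGIT 34 ;; ?I) ?Q \<tau>3 (?e2(33 := vc (t div nc ^ 2 mod nc), 19 := t div nc ^ 2 div nc)) A" by (simp only:)
      qed (use le in simp_all)
      moreover have "?e1(32 := vc (t div nc ^ 1 mod nc), 19 := t div nc ^ 1 div nc) = ?e2"
        unfolding q(2) tuple_def by (rule ext) simp
      ultimately show "wp (DIGIT 33 ;; DIGIT 34 ;; ?I) ?Q \<tau>2 (?e1(32 := vc (t div nc ^ 1 mod nc), 19 := t div nc ^ 1 div nc)) A" by (simp only:)
    qed (use le[of 1] in simp_all)
    moreover have "?ez(31 := vc (t mod nc), 19 := t div nc) = ?e1"
      unfolding q(1) tuple_def by (rule ext) simp
    ultimately show "wp (DIGIT 32 ;; DIGIT 33 ;; DIGIT 34 ;; ?I) ?Q \<tau>1 (?ez(31 := vc (t mod nc), 19 := t div nc)) A" by (simp only:)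
  qed (use t in simp_all)
  then show ?thesis unfolding TRY_GUESS_def wp.simps(4)[of "Asg 19 (X 42)"] wp.simps(2) using t(1) by simp
qed

lemma wp_GUESS:
  assumes st: "static2 e A" and good: "good_cycle E V (cy 0) (cy 1) (cy 2) (cy 3) (cy 4)"
    and cy5: "cy 5 = cy 0" "cy 6 = cy 1" "cy 7 = cy 2" "cy 8 = cy 3"
    and cyA: "\<And>i. i < 9 \<Longrightarrow> A 6 i = cy i"
  shows "wp GUESS (\<lambda>\<tau>' e' A'. \<tau>' \<le> \<tau> + nc ^ 5 * (14000 * K) + 40 \<and>
    keep ({5..19} \<union> {30..43}) e e' \<and> keep ({5} \<union> {10..15}) A A' \<and>
    (if e' 41 = 1 then solved A' else e' 41 = 0 \<and> (\<forall>f. \<not> proper f))) \<tau> e A"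
    (is "wp _ ?Q _ _ _")
proof -
  define P where "P i e' A' \<longleftrightarrow> keep ({5..19} \<union> {30..43}) e e' \<and> keep ({5} \<union> {10..15}) A A' \<and> e' 30 = nc ^ 4 * 10 \<and>
    (e' 41 = 0 \<or> e' 41 = 1 \<and> solved A') \<and> (e' 41 = 0 \<longrightarrow> (\<forall>t<i. \<not> right_guess cy t))"
    for i :: nat and e' :: env and A' :: arrays
  have e2: "e 2 = nc" using st unfolding static2_def static_def by blast
  have n5: "nc ^ 4 * 10 \<le> 10 * nc ^ 5" using power_increasing[of 4 5 nc] nc_pos by simp
  have nM: "nc ^ 4 * 10 < M" using n5 big by linarith
  interpret G: good_cycle E V "cy 0" "cy 1" "cy 2" "cy 3" "cy 4" by (rule good)
  have cyV: "cy i \<in> V" if "i < 9" for i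
  proof -
    have "i = 0 \<or> i = 1 \<or> i = 2 \<or> i = 3 \<or> i = 4 \<or> i = 5 \<or> i = 6 \<or> i = 7 \<or> i = 8" using that by auto
    then show ?thesis using G.cyc[THEN dom] cy5 by (elim disjE) simp_all
  qed
  have "wp (FOR 42 (X 30) (IF (Eq (X 41) (N 0)) TRY_GUESS SKIP)) ?Q \<tau>0 (e(41 := 0, 30 := nc ^ 4 * 10)) A"
    if t0: "\<tau>0 \<le> \<tau> + 20" for \<tau>0
  proof (rule wp_FOR_const[where D = "nc * (600 * K) + 700 * K + 310" and n = "nc ^ 4 * 10" and P = P])
    show "nc ^ 4 * 10 < M" by (rule nM)
    show "P 0 (e(41 := 0, 30 := nc ^ 4 * 10, 42 := 0)) A" unfolding P_def by (simp add: keep_def)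
  next
    fix k e' A' assume "P k e' A'"
    then show "xok e' A' (X 30) \<and> xval e' A' (X 30) = nc ^ 4 * 10" unfolding P_def by simp
  next
    fix i and \<tau>' :: nat and e' A' assume i: "i < nc ^ 4 * 10" and P: "P i e' A'" and ei: "e' 42 = i"
    have k: "keep ({5..19} \<union> {30..43}) e e'" "keep ({5} \<union> {10..15}) A A'" and f: "e' 30 = nc ^ 4 * 10"
      "e' 41 = 0 \<or> e' 41 = 1 \<and> solved A'" "e' 41 = 0 \<longrightarrow> (\<forall>t<i. \<not> right_guess cy t)"
      using P unfolding P_def by blast+
    let ?Q' = "\<lambda>\<tau>'' e'' A''. \<tau>'' \<le> \<tau>' + (nc * (600 * K) + 700 * K + 310) \<and> e'' 42 = i \<and> P (Suc i) (e''(42 := Suc i)) A''"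
    show "wp (IF (Eq (X 41) (N 0)) TRY_GUESS SKIP) ?Q' \<tau>' e' A'"
    proof (cases "e' 41 = 0")
      case False
      have "P (Suc i) (e'(42 := Suc i)) A'" unfolding P_def using k f False by (simp add: keep_def)
      then show ?thesis using False ei M f(2) by simp
    next
      case True
      have st': "static2 e' A'"
        by (rule static2_keep[OF st k]) auto
      have cyA': "A' 6 j = cy j" if "j < 9" for j using keepD[OF k(2), of 6] cyA[OF that] by simp
      have iM: "i < M" using i nM by simp
      have "wp TRY_GUESS ?Q' (\<tau>' + 3) e' A'"
      proof (rule wp_mono[OF wp_TRY_GUESS[where cy = cy, OF st' ei i iM True cyA' cyV]], assumption, assumption, elim conjE)
        fix \<tau>2 e2 A2
        assume 2: "\<tau>2 \<le> \<tau>' + 3 + nc * (600 * K) + 700 * K + 300" "keep ({5..19} \<union> {31..41} \<union> {43}) e' e2"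
          "keep ({5} \<union> {10..15}) A' A2" "e2 41 = 0 \<or> e2 41 = 1 \<and> solved A2" "right_guess cy i \<longrightarrow> e2 41 = 1"
        have k2: "keep ({5..19} \<union> {30..43}) e e2" by (rule keep_trans'[OF k(1) 2(2)]) auto
        then have k3: "keep ({5..19} \<union> {30..43}) e (e2(42 := Suc i))" unfolding keep_def by simp
        have a3: "keep ({5} \<union> {10..15}) A A2" by (rule keep_trans[OF k(2) 2(3)])
        have r: "e2 30 = nc ^ 4 * 10" "e2 42 = i" using keepD[OF 2(2)] f(1) ei by simp_all
        have "\<forall>t<Suc i. \<not> right_guess cy t" if "e2 41 = 0"
          using f(3) True 2(5) that by (auto simp: less_Suc_eq)
        then have "P (Suc i) (e2(42 := Suc i)) A2" unfolding P_def using k3 a3 r 2(4) by simp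
        then show "?Q' \<tau>2 e2 A2" using 2(1) r by simp
      qed
      then show ?thesis using True M by (simp add: numeral_3_eq_3)
    qed
  next
    fix \<tau>' e' A'
    assume t: "\<tau>' \<le> \<tau>0 + nc ^ 4 * 10 * (nc * (600 * K) + 700 * K + 310 + xcost (X 30) + 6) + xcost (X 30) + 4"
      and P: "P (nc ^ 4 * 10) e' A'"
    have "nc * (600 * K) + 700 * K + 310 + xcost (X 30) + 6 \<le> nc * (1400 * K)"
    proof -
      have "1 * K \<le> nc * K" using nc_pos by (intro mult_le_mono1) simp
      moreover have "nc * (800 * K) = 800 * (nc * K)" by simp
      moreover have "nc * (1400 * K) = nc * (600 * K) + nc * (800 * K)" by (simp add: algebra_simps)
      ultimately show ?thesis using Kn unfolding xcost.simps by linarith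
    qed
    then have "nc ^ 4 * 10 * (nc * (600 * K) + 700 * K + 310 + xcost (X 30) + 6) \<le> nc ^ 4 * 10 * (nc * (1400 * K))"
      by (rule mult_le_mono2)
    moreover have "nc ^ 5 = nc ^ 4 * nc" by (simp add: eval_nat_numeral)
    then have "nc ^ 4 * 10 * (nc * (1400 * K)) = nc ^ 5 * (14000 * K)" by simp
    ultimately have "\<tau>' \<le> \<tau> + nc ^ 5 * (14000 * K) + 40" using t t0 unfolding xcost.simps by linarith
    moreover have "\<forall>f. \<not> proper f" if z: "e' 41 = 0"
    proof (intro allI notI)
      fix f0 assume "proper f0"
      from good_guess[of cy, OF good cy5 this] obtain k f x0 a0 y0 u0 where g: "k < 5" "proper f" "f (cy k) = 0"
        "f (cy (k + 1)) = 1" "f (cy (k + 2)) = 2" "f (cy (k + 3)) = 1" "f (cy (k + 4)) = 2"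
        "x0 \<in> V" "a0 \<in> V" "y0 \<in> V" "u0 \<in> V" "f x0 = 0" "f a0 \<in> {1, 2}" "f y0 = 1" "f u0 = 2"
        "\<forall>L. seeded f L {cy k, cy (k + 1), cy (k + 2), cy (k + 3), cy (k + 4), x0, a0, y0, u0} \<longrightarrow>
          closed_lists L \<longrightarrow> (\<exists>g. proper g \<and> (\<forall>v\<in>V. g v \<in> trim L v))"
        by (elim exE conjE bexE) (rule that)
      \<comment> \<open>The top digit has base ten: five rotations times two colours.\<close>
      let ?p = "5 * (f a0 - 1) + k"
      have p: "?p < 10" "?p div 5 = f a0 - 1" "?p mod 5 = k" "1 + (f a0 - 1) = f a0" using g(1,13) by auto
      from tuple_surj(2)[OF g(8-11) root p(1)] obtain t where tt: "t < nc ^ 4 * 10" "tuple t 0 = x0" "tuple t 1 = a0"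
        "tuple t 2 = y0" "tuple t 3 = u0" "t div nc ^ 4 = ?p" by blast
      have "right_guess cy t"
        unfolding right_guess_def Let_def tt(2-6) p(2-4)
        by (intro exI[of _ f] conjI) (use g in simp_all)
      then show False using P z tt(1) unfolding P_def by blast
    qed
    ultimately show "?Q \<tau>' e' A'" using P unfolding P_def by auto
  qed
  moreover have "nc * nc * nc * nc * 10 = nc ^ 4 * 10" by (simp add: eval_nat_numeral)
  moreover have "nc ^ k < M" if "k \<le> 5" for k
    using power_increasing[OF that, of nc] nc_pos big by simp
  from this[of 2] this[of 3] this[of 4]
  have "nc * nc < M" "nc * nc * nc < M" "nc * nc * nc * nc < M"
    by (simp_all add: eval_nat_numeral mult.assoc)
  ultimately show ?thesis unfolding GUESS_def using e2 M nM small_consts by simp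
qed

text \<open>
  If no guess succeeds, \<open>good_guess\<close> refutes every colouring, as it turns any of them into a right
  guess.
\<close>

lemma wp_SOLVE_COMP:
  assumes st: "static2 e A"
  shows "wp SOLVE_COMP (\<lambda>\<tau>' e' A'. \<tau>' \<le> \<tau> + nc ^ 5 * (16000 * K) \<and>
    keep {5..43} e e' \<and> keep ({5, 6} \<union> {10..15}) A A' \<and>
    (if e' 41 = 1 then solved A' else \<forall>f. \<not> proper f)) \<tau> e A"
    (is "wp _ ?Q _ _ _")
  unfolding SOLVE_COMP_def
proof (rule wp_seqI[OF wp_SEARCH[OF st]], elim conjE)
  fix \<tau>1 e1 A1
  assume 1: "\<tau>1 \<le> \<tau> + nc ^ 5 * (150 * K) + 40" "A1 = A" "keep {17..29} e e1"
    "if e1 29 = 1 then good_cycle E V (e1 22) (e1 23) (e1 24) (e1 25) (e1 26)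
     else \<forall>a b c d f. \<not> good_cycle E V a b c d f"
  have pos: "10 * 1 \<le> nc ^ 5 * K" using nc_pos Kn by (intro order_trans[OF _ mult_le_mono[of 1 "nc ^ 5" 10 K]]) simp_all
  have st1: "static2 e1 A1" unfolding 1(2)
    by (rule static2_keep[OF st 1(3), of "{}"]) (simp_all add: keep_refl)
  show "wp (IF (Eq (X 29) (N 1)) (STORE_CYCLE ;; GUESS)
       (BIP ;; IF (Eq (X 7) (N 0)) (Asg 41 (N 1)) (Asg 41 (N 0)))) ?Q \<tau>1 e1 A1"
  proof (cases "e1 29 = 1")
    case True
    define cy where "cy i = (if i = 0 \<or> i = 5 then e1 22 else if i = 1 \<or> i = 6 then e1 23 else
      if i = 2 \<or> i = 7 then e1 24 else if i = 3 \<or> i = 8 then e1 25 else e1 26)" for i :: nat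
    have good: "good_cycle E V (cy 0) (cy 1) (cy 2) (cy 3) (cy 4)" using 1(4) True unfolding cy_def by simp
    let ?A = "A1(6 := (A1 6)(0 := e1 22, 1 := e1 23, 2 := e1 24, 3 := e1 25, 4 := e1 26, 5 := e1 22, 6 := e1 23,
      7 := e1 24, 8 := e1 25))"
    have kA: "keep {6} A1 ?A" by (simp add: keep_def)
    have st2: "static2 e1 ?A" by (rule static2_keep[OF st1 keep_refl[of "{}"] kA]) simp_all
    have cyA: "?A 6 i = cy i" if "i < 9" for i
    proof -
      have "i = 0 \<or> i = 1 \<or> i = 2 \<or> i = 3 \<or> i = 4 \<or> i = 5 \<or> i = 6 \<or> i = 7 \<or> i = 8" using that by auto
      then show ?thesis unfolding cy_def by (elim disjE) simp_all
    qed
    have w: "wp GUESS ?Q \<tau>2 e1 ?A" if t2: "\<tau>2 \<le> \<tau>1 + 80" for \<tau>2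
    proof (rule wp_mono[OF wp_GUESS[where cy = cy, OF st2 good _ _ _ _ cyA]])
      fix \<tau>3 e3 A3
      assume 3: "\<tau>3 \<le> \<tau>2 + nc ^ 5 * (14000 * K) + 40 \<and> keep ({5..19} \<union> {30..43}) e1 e3 \<and>
        keep ({5} \<union> {10..15}) ?A A3 \<and> (if e3 41 = 1 then solved A3 else e3 41 = 0 \<and> (\<forall>f. \<not> proper f))"
      have "keep {5..43} e e3" by (rule keep_trans'[OF keep_mono[OF 1(3)]]) (use 3 in auto)
      moreover have "keep ({5, 6} \<union> {10..15}) A A3"
        by (rule keep_trans'[OF keep_mono[OF kA[unfolded 1(2)]]]) (use 3 1(2) in auto)
      moreover have "\<tau>3 \<le> \<tau> + nc ^ 5 * (16000 * K)"
      proof -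
        have "\<tau>3 \<le> \<tau> + nc ^ 5 * (150 * K) + nc ^ 5 * (14000 * K) + 160" using 3 t2 1(1) by linarith
        moreover have "nc ^ 5 * (16000 * K) = nc ^ 5 * (150 * K) + nc ^ 5 * (14000 * K) + 1850 * (nc ^ 5 * K)" by simp
        ultimately show ?thesis using pos by linarith
      qed
      ultimately show "?Q \<tau>3 e3 A3" using 3 by auto
    qed (simp_all add: cy_def)
    show ?thesis unfolding STORE_CYCLE_def
      using True w Jn Kn small_consts M by (simp add: small)
  next
    case False
    then have ng: "\<not> good_cycle E V a b c d f" for a b c d f using 1(4) by simp
    have n5: "\<not> five_cycle E V a b c d f" for a b c d f using ex_good_cycle ng by blast
    have s1: "static e1 A1" "e1 4 = r" using st1 unfolding static2_def by blast+
    have w: "wp (BIP ;; IF (Eq (X 7) (N 0)) (Asg 41 (N 1)) (Asg 41 (N 0))) ?Q (\<tau>1 + 3) e1 A1"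
    proof (rule wp_seqI[OF wp_BIP[OF s1 root]], elim conjE)
      fix \<tau>2 e2 A2
      assume 2: "\<tau>2 \<le> \<tau>1 + 3 + nc * (600 * K) + 700 * K" "e2 7 = 0 \<longrightarrow> solved A2"
        "(\<exists>f. proper f \<and> (\<forall>v\<in>V. f v \<in> (if E r v then {2} else {0, 1}))) \<longrightarrow> e2 7 = 0"
        "keep {5..19} e1 e2" "keep ({5} \<union> {10..15}) A1 A2"
      have z: "e2 7 = 0" using 2(3) no_five_cycle_colouring[OF n5] by blast
      have ke: "keep {5..43} e e2" by (rule keep_trans'[OF keep_mono[OF 1(3)] 2(4)]) auto
      then have "keep {5..43} e (e2(41 := 1))" unfolding keep_def by simp
      moreover have "keep ({5, 6} \<union> {10..15}) A A2" using keep_mono[OF 2(5)] unfolding 1(2) by auto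
      moreover have "\<tau>2 + 10 \<le> \<tau> + nc ^ 5 * (16000 * K)"
      proof -
        have "nc ^ 1 \<le> nc ^ 5" using nc_pos by (intro power_increasing) simp_all
        then have "nc * K \<le> nc ^ 5 * K" by (intro mult_le_mono1) simp
        moreover have "1 * K \<le> nc * K" using nc_pos by (intro mult_le_mono1) simp
        moreover have "nc ^ 5 * (16000 * K) = 16000 * (nc ^ 5 * K)" "nc ^ 5 * (150 * K) = 150 * (nc ^ 5 * K)"
          "nc * (600 * K) = 600 * (nc * K)" by simp_all
        ultimately show ?thesis using 2(1) 1(1) pos by linarith
      qed
      ultimately show "wp (IF (Eq (X 7) (N 0)) (Asg 41 (N 1)) (Asg 41 (N 0))) ?Q \<tau>2 e2 A2"
        using z 2(2) M by simp
    qed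
    then show ?thesis using False M by (simp add: numeral_3_eq_3)
  qed
qed

end

section \<open>Adjacency structure and breadth first search\<close>

definition ADD :: "nat \<Rightarrow> nat \<Rightarrow> cmd" where
  "ADD a b = Wr (N 20 \<oplus> X 0 \<oplus> X a) (Rd (N 1) (X a)) (X b) ;;
     Wr (N 1) (X a) (Rd (N 1) (X a) \<oplus> N 1) ;; Wr (N 20 \<oplus> X a) (X b) (N 1)"

definition BUILD :: cmd where
  "BUILD = FOR 46 (X 1)
     (Asg 44 (Rd (N 0) (N 2 \<oplus> N 2 \<otimes> X 46)) ;; Asg 45 (Rd (N 0) (N 3 \<oplus> N 2 \<otimes> X 46)) ;; ADD 44 45 ;; ADD 45 44)"

text \<open>
  The list of component vertices doubles as the queue of the search; marked vertices are not added
  again.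
\<close>

definition ENQUEUE :: cmd where
  "ENQUEUE = IF (Eq (Rd (N 2) (X 48)) (N 0))
     (Wr (N 2) (X 48) (X 4 \<oplus> N 1) ;; Wr (N 4) (X 2) (X 48) ;; Asg 2 (X 2 \<oplus> N 1)) SKIP"

definition SCAN :: cmd where
  "SCAN = Asg 47 (Rd (N 4) (X 44)) ;;
     FOR 45 (Rd (N 1) (X 47)) (Asg 48 (Rd (N 20 \<oplus> X 0 \<oplus> X 47) (X 45)) ;; ENQUEUE) ;;
     Asg 44 (X 44 \<oplus> N 1)"

definition BFS :: cmd where
  "BFS = Asg 2 (N 0) ;; Asg 44 (N 0) ;; Asg 48 (X 4) ;; ENQUEUE ;; WHILE (Lt (X 44) (X 2)) SCAN"

definition row :: "(nat \<times> nat) list \<Rightarrow> nat \<Rightarrow> nat list" where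
  "row ps u = map snd (filter (\<lambda>p. fst p = u) ps)"

lemma row_snoc: "row (ps @ [(u, v)]) w = (if w = u then row ps u @ [v] else row ps w)"
  unfolding row_def by simp

lemma set_row: "set (row ps u) = {w. (u, w) \<in> set ps}"
  unfolding row_def by force

lemma length_row: "length (row ps u) \<le> length ps"
  unfolding row_def by simp

lemma sum_row: "(\<Sum>u<n. length (row ps u)) \<le> length ps"
proof (induction ps rule: rev_induct)
  case Nil
  show ?case by (simp add: row_def)
next
  case (snoc p ps)
  obtain a b where p: "p = (a, b)" by (cases p)
  have "length (row (ps @ [p]) u) = length (row ps u) + (if u = a then 1 else 0)" for u
    unfolding p row_snoc by simp
  then have "(\<Sum>u<n. length (row (ps @ [p]) u)) = (\<Sum>u<n. length (row ps u)) + (\<Sum>u<n. if u = a then 1 else 0)"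
    by (simp only: sum.distrib)
  moreover have "(\<Sum>u<n. if u = a then 1 else 0 :: nat) \<le> 1" by (simp add: sum.delta')
  ultimately show ?case using snoc by simp
qed

locale input_graph = machine M K J + p7_graph E "{..<n}"
  for M K J :: nat and E :: "nat \<Rightarrow> nat \<Rightarrow> bool" and n :: nat +
  fixes m :: nat and eu ev :: "nat \<Rightarrow> nat"
  assumes E_iff: "E u v \<longleftrightarrow> (\<exists>i<m. eu i = u \<and> ev i = v \<or> eu i = v \<and> ev i = u)"
    and eun: "i < m \<Longrightarrow> eu i < n \<and> ev i < n"
    and Kn: "n + 2 * m + 10 \<le> K" and Jn: "20 + 2 * n < J" and big: "10 * n ^ 5 + 10 < M"
begin

lemma small: "x \<le> 2 * K \<Longrightarrow> x < M" "x \<le> J \<Longrightarrow> x < M"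
proof -
  have "2 * K < K * 21" "K * 21 \<le> K * J" using Kn Jn by simp_all
  then show "x \<le> 2 * K \<Longrightarrow> x < M" using KJ by linarith
  have "J < 10 * J" "10 * J \<le> K * J" using Kn Jn by simp_all
  then show "x \<le> J \<Longrightarrow> x < M" using KJ by linarith
qed

lemma small_consts: "10 < M" "5 < M" "20 < M" using small(1)[of 10] small(1)[of 20] small(1)[of 5] Kn by simp_all

lemma off_diag: "w < n \<Longrightarrow> w \<noteq> n + x" "w < n \<Longrightarrow> n + x \<noteq> w" by simp_all

definition arcs :: "nat \<Rightarrow> (nat \<times> nat) list" where
  "arcs i = concat (map (\<lambda>i. [(eu i, ev i), (ev i, eu i)]) [0..<i])"

lemma arcs_Suc: "arcs (Suc i) = (arcs i @ [(eu i, ev i)]) @ [(ev i, eu i)]" unfolding arcs_def by simp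
lemma arcs_0: "arcs 0 = []" unfolding arcs_def by simp
lemma length_arcs: "length (arcs i) = 2 * i" by (induction i) (simp_all add: arcs_Suc arcs_0)

lemma arcs_E: "(u, v) \<in> set (arcs m) \<longleftrightarrow> E u v"
  unfolding E_iff arcs_def by auto

definition built :: "(nat \<times> nat) list \<Rightarrow> arrays \<Rightarrow> bool" where
  "built ps A \<longleftrightarrow> (\<forall>u<n. A 1 u = length (row ps u) \<and> (\<forall>i<length (row ps u). A (20 + n + u) i = row ps u ! i) \<and>
     (\<forall>w<n. A (20 + u) w = of_bool ((u, w) \<in> set ps)))"

lemma built_keep: "built ps A \<Longrightarrow> keep S A A' \<Longrightarrow> S \<subseteq> {2..19} \<Longrightarrow> built ps A'"
proof -
  assume b: "built ps A" and k: "keep S A A'" and S: "S \<subseteq> {2..19}"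
  have "A' 1 = A 1" "\<And>v. A' (20 + v) = A (20 + v)" "\<And>v. A' (20 + n + v) = A (20 + n + v)"
    using S by (intro keepD[OF k]; force)+
  then show "built ps A'" using b unfolding built_def by simp
qed

lemma wp_ADD:
  assumes b: "built ps A" and l: "length ps < 2 * m" and e: "e 0 = n" "e a = u" "e b = v" and uv: "u < n" "v < n"
    and Q: "\<And>\<tau>' A'. \<tau>' \<le> \<tau> + 40 \<Longrightarrow> built (ps @ [(u, v)]) A' \<Longrightarrow> keep ({1} \<union> {20..}) A A' \<Longrightarrow> Q \<tau>' e A'"
  shows "wp (ADD a b) Q \<tau> e A"
proof -
  let ?A = "A(20 + n + u := (A (20 + n + u))(A 1 u := v), 1 := (A 1)(u := A 1 u + 1), 20 + u := (A (20 + u))(v := 1))"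
  have d: "A 1 u = length (row ps u)" using b uv unfolding built_def by blast
  have dl: "A 1 u < 2 * m" using d length_row[of ps u] l by simp
  have B: "built (ps @ [(u, v)]) ?A"
    unfolding built_def
  proof (intro allI impI conjI)
    fix w assume w: "w < n"
    have bw: "A 1 w = length (row ps w)" "\<forall>i<length (row ps w). A (20 + n + w) i = row ps w ! i"
      "\<forall>x<n. A (20 + w) x = of_bool ((w, x) \<in> set ps)" using b w unfolding built_def by blast+
    show "?A 1 w = length (row (ps @ [(u, v)]) w)" using bw(1) d unfolding row_snoc by simp
    show "?A (20 + n + w) i = row (ps @ [(u, v)]) w ! i" if i: "i < length (row (ps @ [(u, v)]) w)" for i
    proof (cases "w = u")
      case True
      then show ?thesis using bw(1,2) i uv unfolding row_snoc by (auto simp: nth_append off_diag)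
    next
      case False
      then show ?thesis using bw(2) i uv unfolding row_snoc by (simp add: off_diag)
    qed
    show "?A (20 + w) x = of_bool ((w, x) \<in> set (ps @ [(u, v)]))" if x: "x < n" for x
      using bw(3) x w uv by (cases "w = u") (simp_all add: off_diag)
  qed
  have k: "keep ({1} \<union> {20..}) A ?A" unfolding keep_def by auto
  have bd: "20 + n + u < J" "20 + u < J" "20 + n < M" "20 + n + u < M" "20 + u < M" "A 1 u < K" "u < K" "v < K"
    "A 1 u + 1 < M"
    using Jn Kn uv dl small(2)[of "20 + n + u"] small(2)[of "20 + n"] small(2)[of "20 + u"] small(1)[of "A 1 u + 1"]
    by linarith+
  have "Q (\<tau> + 14 + 12 + 8) e ?A" by (rule Q[OF _ B k]) simp
  then show ?thesis unfolding ADD_def using e bd M Jn small_consts uv by simp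
qed

definition inputs :: "arrays \<Rightarrow> bool" where
  "inputs A \<longleftrightarrow> (\<forall>i<m. A 0 (2 + 2 * i) = eu i \<and> A 0 (3 + 2 * i) = ev i)"

lemma inputs_keep: "inputs A \<Longrightarrow> keep S A A' \<Longrightarrow> 0 \<notin> S \<Longrightarrow> inputs A'"
  using keepD[of S A A' 0] unfolding inputs_def by simp

lemma wp_BUILD:
  assumes e: "e 0 = n" "e 1 = m" and A: "inputs A" "\<And>j i. 1 \<le> j \<Longrightarrow> i < K \<Longrightarrow> A j i = 0"
  shows "wp BUILD (\<lambda>\<tau>' e' A'. \<tau>' \<le> \<tau> + 130 * m + 10 \<and> keep {44, 45, 46} e e' \<and> built (arcs m) A' \<and>
    keep ({1} \<union> {20..}) A A') \<tau> e A"
    (is "wp _ ?Q _ _ _")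
proof -
  define P where "P i e' A' \<longleftrightarrow> keep {44, 45, 46} e e' \<and> built (arcs i) A' \<and> keep ({1} \<union> {20..}) A A'"
    for i :: nat and e' :: env and A' :: arrays
  have mM: "m < M" using small(1)[of m] Kn by simp
  show ?thesis
    unfolding BUILD_def
  proof (rule wp_FOR_const[where P = P and n = m and D = "120"])
    show "P 0 (e(46 := 0)) A"
      using A(2) Kn unfolding P_def built_def arcs_0 row_def by (simp add: keep_def)
  next
    fix k e' A' assume "P k e' A'"
    then have "keep {44, 45, 46} e e'" unfolding P_def by blast
    from keepD[OF this, of 1] show "xok e' A' (X 1) \<and> xval e' A' (X 1) = m" using e by simp
  next
    fix k and \<tau>1 :: nat and e' A' assume k: "k < m" and P: "P k e' A'" and ek: "e' 46 = k"
    have ke: "keep {44, 45, 46} e e'" and b: "built (arcs k) A'" and ka: "keep ({1} \<union> {20..}) A A'"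
      using P unfolding P_def by blast+
    have e0: "e' 0 = n" using keepD[OF ke, of 0] e by simp
    have in': "inputs A'" by (rule inputs_keep[OF A(1) ka]) simp
    have i: "A' 0 (2 + 2 * k) = eu k" "A' 0 (3 + 2 * k) = ev k" using in' k unfolding inputs_def by blast+
    have n: "eu k < n" "ev k < n" using eun[OF k] by blast+
    let ?e = "e'(44 := eu k, 45 := ev k)"
    let ?R = "\<lambda>\<tau>' e'' A''. \<tau>' \<le> \<tau>1 + 120 \<and> e'' 46 = k \<and> P (Suc k) (e''(46 := Suc k)) A''"
    have "wp (ADD 44 45 ;; ADD 45 44) ?R \<tau>2 ?e A'" if t2: "\<tau>2 \<le> \<tau>1 + 30" for \<tau>2
      unfolding wp.simps(4)
    proof (rule wp_ADD[OF b])
      fix \<tau>3 A3 assume 3: "\<tau>3 \<le> \<tau>2 + 40" "built (arcs k @ [(eu k, ev k)]) A3" "keep ({1} \<union> {20..}) A' A3"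
      show "wp (ADD 45 44) ?R \<tau>3 ?e A3"
      proof (rule wp_ADD[OF 3(2)])
        fix \<tau>4 A4 assume 4: "\<tau>4 \<le> \<tau>3 + 40" "built ((arcs k @ [(eu k, ev k)]) @ [(ev k, eu k)]) A4"
          "keep ({1} \<union> {20..}) A3 A4"
        have "keep {44, 45, 46} e (?e(46 := Suc k))" using ke unfolding keep_def by simp
        moreover have "keep ({1} \<union> {20..}) A A4" by (rule keep_trans[OF ka keep_trans[OF 3(3) 4(3)]])
        ultimately have "P (Suc k) (?e(46 := Suc k)) A4" using 4(2) unfolding P_def arcs_Suc by blast
        then show "?R \<tau>4 ?e A4" using 4(1) 3(1) t2 ek by simp
      qed (use e0 n k length_arcs[of k] in simp_all)
    qed (use e0 n k length_arcs[of k] in simp_all)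
    moreover have "3 + 2 * k < K" "2 + 2 * k < K" "3 + 2 * k < M" "2 + 2 * k < M" "2 * k < M" using k Kn small(1)[of "3 + 2 * k"] by linarith+
    ultimately show "wp (Asg 44 (Rd (N 0) (N 2 \<oplus> N 2 \<otimes> X 46)) ;; Asg 45 (Rd (N 0) (N 3 \<oplus> N 2 \<otimes> X 46)) ;;
      ADD 44 45 ;; ADD 45 44) ?R \<tau>1 e' A'"
      unfolding wp.simps(4)[of "Asg _ _"] wp.simps(2) using i ek Jn small_consts by simp
  next
    fix \<tau>' e' A' assume "\<tau>' \<le> \<tau> + m * (120 + xcost (X 1) + 6) + xcost (X 1) + 4" "P m e' A'"
    then show "?Q \<tau>' e' A'" unfolding P_def by simp
  qed (rule mM)
qed

text \<open>
  The search from \<open>r\<close> has met the vertices \<open>xs\<close>. The function \<open>mk\<close> holds the marks at its beginning, so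
  \<open>xs\<close> consists of vertices that no earlier search has met; the last clause says that \<open>xs\<close> can be
  reached from \<open>r\<close>.
\<close>

definition found :: "nat \<Rightarrow> (nat \<Rightarrow> nat) \<Rightarrow> nat list \<Rightarrow> env \<Rightarrow> arrays \<Rightarrow> bool" where
  "found r mk xs e A \<longleftrightarrow> e 0 = n \<and> e 4 = r \<and> e 2 = length xs \<and> distinct xs \<and> (\<forall>i<length xs. A 4 i = xs ! i) \<and>
     (\<forall>v<n. A 2 v = (if v \<in> set xs then Suc r else mk v)) \<and> set xs \<subseteq> {v. v < n \<and> mk v = 0} \<and> built (arcs m) A \<and>
     (\<forall>Y. r \<in> Y \<longrightarrow> (\<forall>u v. u \<in> Y \<longrightarrow> E u v \<longrightarrow> v \<in> Y) \<longrightarrow> set xs \<subseteq> Y)"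

lemma foundD:
  assumes "found r mk xs e A"
  shows "e 0 = n" "e 4 = r" "e 2 = length xs" "distinct xs" "i < length xs \<Longrightarrow> A 4 i = xs ! i"
    "v < n \<Longrightarrow> A 2 v = (if v \<in> set xs then Suc r else mk v)" "set xs \<subseteq> {v. v < n \<and> mk v = 0}" "built (arcs m) A"
    "r \<in> Y \<Longrightarrow> \<forall>u v. u \<in> Y \<longrightarrow> E u v \<longrightarrow> v \<in> Y \<Longrightarrow> set xs \<subseteq> Y"
proof -
  note f = assms[unfolded found_def]
  show "e 0 = n" "e 4 = r" "e 2 = length xs" "distinct xs" using f by blast+
  show "i < length xs \<Longrightarrow> A 4 i = xs ! i" "v < n \<Longrightarrow> A 2 v = (if v \<in> set xs then Suc r else mk v)" using f by blast+
  show "set xs \<subseteq> {v. v < n \<and> mk v = 0}" "built (arcs m) A" using f by blast+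
  show "r \<in> Y \<Longrightarrow> \<forall>u v. u \<in> Y \<longrightarrow> E u v \<longrightarrow> v \<in> Y \<Longrightarrow> set xs \<subseteq> Y" using f by blast
qed

lemma found_length: "found r mk xs e A \<Longrightarrow> length xs \<le> n"
proof -
  assume f: "found r mk xs e A"
  have "card (set xs) \<le> card {..<n}" by (rule card_mono) (use foundD(7)[OF f] in auto)
  then show ?thesis using distinct_card[OF foundD(4)[OF f]] by simp
qed

lemma found_env: "found r mk xs e A \<Longrightarrow> keep {44..48} e e' \<Longrightarrow> found r mk xs e' A"
  using keepD[of "{44..48}" e e' 0] keepD[of "{44..48}" e e' 2] keepD[of "{44..48}" e e' 4] unfolding found_def by simp

lemma wp_ENQUEUE:
  assumes f: "found r mk xs e A" and w: "e 48 = w" "w < n" and r: "r < n"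
    and reach: "\<And>Y. r \<in> Y \<Longrightarrow> \<forall>u v. u \<in> Y \<longrightarrow> E u v \<longrightarrow> v \<in> Y \<Longrightarrow> w \<in> Y"
    and Q: "\<And>\<tau>' ys e' A'. \<tau>' \<le> \<tau> + 40 \<Longrightarrow> found r mk (xs @ ys) e' A' \<Longrightarrow> keep {2} e e' \<Longrightarrow> keep {2, 4} A A' \<Longrightarrow>
      (mk w = 0 \<Longrightarrow> w \<in> set (xs @ ys)) \<Longrightarrow> Q \<tau>' e' A'"
  shows "wp ENQUEUE Q \<tau> e A"
proof (cases "A 2 w = 0")
  case False
  have "w \<in> set xs" if "mk w = 0"
    using foundD(6)[OF f w(2)] that False by (simp split: if_splits)
  then have "Q (\<tau> + 7 + 1) e A" using Q[of "\<tau> + 7 + 1" "[]" e A] f by (simp add: keep_refl)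
  then show ?thesis unfolding ENQUEUE_def using False w M Kn Jn small_consts by simp
next
  case True
  have nin: "w \<notin> set xs" "mk w = 0" using foundD(6)[OF f w(2)] True by (simp_all split: if_splits)
  let ?A = "A(2 := (A 2)(w := Suc r), 4 := (A 4)(length xs := w))"
  let ?e = "e(2 := Suc (length xs))"
  have ka: "keep {2, 4} A ?A" by (simp add: keep_def)
  have "found r mk (xs @ [w]) ?e ?A"
    unfolding found_def
  proof (intro conjI allI impI)
    show "?e 0 = n" "?e 4 = r" "?e 2 = length (xs @ [w])" "distinct (xs @ [w])"
      using foundD(1-4)[OF f] nin(1) by simp_all
    show "?A 4 i = (xs @ [w]) ! i" if "i < length (xs @ [w])" for i
      using that foundD(5)[OF f, of i] by (auto simp: nth_append less_Suc_eq)
    show "?A 2 v = (if v \<in> set (xs @ [w]) then Suc r else mk v)" if "v < n" for v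
      using foundD(6)[OF f that] by simp
    show "set (xs @ [w]) \<subseteq> {v. v < n \<and> mk v = 0}" using foundD(7)[OF f] nin w by simp
    show "built (arcs m) ?A" by (rule built_keep[OF foundD(8)[OF f] ka]) simp
    show "set (xs @ [w]) \<subseteq> Y" if "r \<in> Y" "\<forall>u v. u \<in> Y \<longrightarrow> E u v \<longrightarrow> v \<in> Y" for Y
      using foundD(9)[OF f that] reach[OF that] by simp
  qed
  then have "Q (\<tau> + 7 + (3 + 5) + 6 + 4) ?e ?A"
    by (intro Q[of _ "[w]"]) (simp_all add: ka keep_def)
  moreover have "Suc r < M" "length xs < K" "Suc (length xs) < M" "w < K"
    using small(1)[of "Suc r"] small(1)[of "Suc (length xs)"] r Kn found_length[OF f] w by simp_all
  ultimately show ?thesis unfolding ENQUEUE_def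
    using True w M Kn Jn foundD(2,3)[OF f] small(2)[of 4] by (simp add: eval_nat_numeral)
qed

lemma row_arcs: "u < n \<Longrightarrow> built (arcs m) A \<Longrightarrow> A 1 u = length (row (arcs m) u)"
    "u < n \<Longrightarrow> built (arcs m) A \<Longrightarrow> i < length (row (arcs m) u) \<Longrightarrow> A (20 + n + u) i = row (arcs m) u ! i"
  unfolding built_def by blast+

lemma row_E: "set (row (arcs m) u) = {w. E u w}" unfolding set_row arcs_E ..

lemma row_less: "length (row (arcs m) u) \<le> 2 * m" using length_row[of "arcs m" u] length_arcs[of m] by simp

lemma wp_SCAN:
  assumes f: "found r mk xs e A" and i: "e 44 = i" "i < length xs" and r: "r < n"
    and mk: "\<And>u v. mk u \<noteq> 0 \<Longrightarrow> E u v \<Longrightarrow> mk v \<noteq> 0"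
  shows "wp SCAN (\<lambda>\<tau>' e' A'. \<tau>' \<le> \<tau> + 100 * K \<and> e' 44 = Suc i \<and> keep ({2} \<union> {44..48}) e e' \<and> keep {2, 4} A A' \<and>
    (\<exists>ys. found r mk (xs @ ys) e' A' \<and> (\<forall>w. E (xs ! i) w \<longrightarrow> w \<in> set (xs @ ys)))) \<tau> e A"
    (is "wp _ ?Q _ _ _")
proof -
  let ?u = "xs ! i" and ?l = "row (arcs m) (xs ! i)"
  have u: "?u \<in> set xs" "?u < n" "mk ?u = 0" using nth_mem[OF i(2)] foundD(7)[OF f] by auto
  define P where "P k e' A' \<longleftrightarrow> keep ({2} \<union> {45..48}) e e' \<and> e' 47 = ?u \<and> keep {2, 4} A A' \<and>
    (\<exists>ys. found r mk (xs @ ys) e' A' \<and> (\<forall>j<k. ?l ! j \<in> set (xs @ ys)))" for k :: nat and e' :: env and A' :: arrays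
  have nbn: "w < n" if "E ?u w" for w using dom[OF sym[OF that]] by simp
  have "wp (FOR 45 (Rd (N 1) (X 47)) (Asg 48 (Rd (N 20 \<oplus> X 0 \<oplus> X 47) (X 45)) ;; ENQUEUE) ;; Asg 44 (X 44 \<oplus> N 1))
      ?Q \<tau>0 (e(47 := ?u)) A" if t0: "\<tau>0 \<le> \<tau> + 10" for \<tau>0
    unfolding wp.simps(4)[of "FOR _ _ _"]
  proof (rule wp_FOR_const[where P = P and n = "length ?l" and D = 60])
    show "length ?l < M" using row_less[of ?u] small(1)[of "length ?l"] Kn by simp
    have "found r mk xs (e(47 := ?u, 45 := 0)) A" by (rule found_env[OF f]) (simp add: keep_def)
    then show "P 0 (e(47 := ?u, 45 := 0)) A"
      unfolding P_def by (intro conjI exI[of _ "[]"]) (simp_all add: keep_def)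
  next
    fix k e' A' assume P: "P k e' A'"
    from P obtain ys where f': "found r mk (xs @ ys) e' A'" and 47: "e' 47 = ?u" unfolding P_def by blast
    show "xok e' A' (Rd (N 1) (X 47)) \<and> xval e' A' (Rd (N 1) (X 47)) = length ?l"
      using 47 u Kn Jn M row_arcs(1)[OF u(2) foundD(8)[OF f']] by simp
  next
    fix k and \<tau>1 :: nat and e' A' assume k: "k < length ?l" and P: "P k e' A'" and ek: "e' 45 = k"
    from P obtain ys where f': "found r mk (xs @ ys) e' A'" and 47: "e' 47 = ?u" and ys: "\<forall>j<k. ?l ! j \<in> set (xs @ ys)"
      and ke: "keep ({2} \<union> {45..48}) e e'" and ka: "keep {2, 4} A A'" unfolding P_def by blast
    let ?w = "?l ! k"
    have w: "E ?u ?w" using nth_mem[OF k] unfolding row_E by simp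
    let ?e = "e'(48 := ?w)"
    let ?R = "\<lambda>\<tau>' e'' A''. \<tau>' \<le> \<tau>1 + 60 \<and> e'' 45 = k \<and> P (Suc k) (e''(45 := Suc k)) A''"
    have fe: "found r mk (xs @ ys) ?e A'" by (rule found_env[OF f']) (simp add: keep_def)
    have "wp ENQUEUE ?R \<tau>2 ?e A'" if t2: "\<tau>2 \<le> \<tau>1 + 20" for \<tau>2
    proof (rule wp_ENQUEUE[OF fe _ nbn[OF w] r])
      fix Y assume Y: "r \<in> Y" "\<forall>u v. u \<in> Y \<longrightarrow> E u v \<longrightarrow> v \<in> Y"
      have "?u \<in> Y" using foundD(9)[OF f Y] u(1) by blast
      then show "?w \<in> Y" using Y(2) w by blast
    next
      fix \<tau>3 zs e3 A3
      assume 3: "\<tau>3 \<le> \<tau>2 + 40" "found r mk ((xs @ ys) @ zs) e3 A3" "keep {2} ?e e3" "keep {2, 4} A' A3"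
        "mk ?w = 0 \<Longrightarrow> ?w \<in> set ((xs @ ys) @ zs)"
      have "mk ?w = 0" using mk[OF _ sym[OF w]] u(3) by blast
      then have wi: "?w \<in> set ((xs @ ys) @ zs)" by (rule 3(5))
      have k1: "keep ({2} \<union> {45..48}) e ?e" using ke unfolding keep_def by simp
      have k3: "keep ({2} \<union> {45..48}) e e3" by (rule keep_trans'[OF k1 3(3)]) simp
      then have k4: "keep ({2} \<union> {45..48}) e (e3(45 := Suc k))" unfolding keep_def by simp
      have a3: "keep {2, 4} A A3" by (rule keep_trans[OF ka 3(4)])
      have "found r mk (xs @ (ys @ zs)) (e3(45 := Suc k)) A3"
        by (rule found_env[of _ _ _ e3]) (use 3(2) in \<open>simp_all add: keep_def\<close>)
      moreover have "\<forall>j<Suc k. ?l ! j \<in> set (xs @ (ys @ zs))" using ys wi by (auto simp: less_Suc_eq)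
      ultimately have "P (Suc k) (e3(45 := Suc k)) A3"
        unfolding P_def using k4 a3 keepD[OF 3(3), of 47] 47 by (intro conjI exI[of _ "ys @ zs"]) simp_all
      then show "?R \<tau>3 e3 A3" using 3(1) t2 keepD[OF 3(3), of 45] ek by simp
    qed simp
    moreover have "A' (20 + n + ?u) k = ?w" by (rule row_arcs(2)[OF u(2) foundD(8)[OF f'] k])
    moreover have "k < K" using k row_less[of ?u] Kn by simp
    moreover have "20 + n + ?u < J" "20 + n + ?u < M" "20 + n < M"
      using u(2) Jn small(2)[of "20 + n + ?u"] small(2)[of "20 + n"] by simp_all
    ultimately show "wp (Asg 48 (Rd (N 20 \<oplus> X 0 \<oplus> X 47) (X 45)) ;; ENQUEUE) ?R \<tau>1 e' A'"
      unfolding wp.simps(4) wp.simps(2) using 47 ek foundD(1)[OF f'] M small_consts by simp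
  next
    fix \<tau>' e' A'
    assume t: "\<tau>' \<le> \<tau>0 + length ?l * (60 + xcost (Rd (N 1) (X 47)) + 6) + xcost (Rd (N 1) (X 47)) + 4"
      and P: "P (length ?l) e' A'"
    from P obtain ys where f': "found r mk (xs @ ys) e' A'" and ys: "\<forall>j<length ?l. ?l ! j \<in> set (xs @ ys)"
      and ke: "keep ({2} \<union> {45..48}) e e'" and ka: "keep {2, 4} A A'" unfolding P_def by blast
    have e44: "e' 44 = i" using keepD[OF ke, of 44] i(1) by simp
    have t1: "\<tau>' + 4 \<le> \<tau> + 100 * K" using t t0 row_less[of ?u] Kn by simp
    have "w \<in> set (xs @ ys)" if "E ?u w" for w
    proof -
      have "w \<in> set ?l" using that unfolding row_E by simp
      then show ?thesis using ys unfolding in_set_conv_nth by blast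
    qed
    moreover have "found r mk (xs @ ys) (e'(44 := Suc i)) A'" by (rule found_env[OF f']) (simp add: keep_def)
    moreover have "keep ({2} \<union> {44..48}) e (e'(44 := Suc i))" using ke unfolding keep_def by simp
    ultimately have "?Q (\<tau>' + 4) (e'(44 := Suc i)) A'" using t1 ka by auto
    moreover have "Suc i < M" using small(1)[of "Suc i"] i found_length[OF f] Kn by simp
    ultimately show "wp (Asg 44 (X 44 \<oplus> N 1)) ?Q \<tau>' e' A'"
      using e44 M by (simp del: set_append add: numeral_eq_Suc)
  qed
  moreover have "i < K" using i(2) found_length[OF f] Kn by simp
  ultimately show ?thesis unfolding SCAN_def wp.simps(4)[of "Asg _ _"] wp.simps(2)
    using i foundD(5)[OF f i(2)] Jn small(2)[of 4] by simp
qed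

text \<open>
  The set found is closed under adjacency because all its members have been scanned.
\<close>

lemma wp_BFS:
  assumes e: "e 0 = n" "e 4 = r" and r: "r < n" "mk r = 0" and A: "\<And>v. v < n \<Longrightarrow> A 2 v = mk v" "built (arcs m) A"
    and mk: "\<And>u v. mk u \<noteq> 0 \<Longrightarrow> E u v \<Longrightarrow> mk v \<noteq> 0"
  shows "wp BFS (\<lambda>\<tau>' e' A'. \<exists>xs. found r mk xs e' A' \<and> r \<in> set xs \<and> (\<forall>u v. u \<in> set xs \<longrightarrow> E u v \<longrightarrow> v \<in> set xs) \<and>
    \<tau>' \<le> \<tau> + 60 + length xs * (110 * K) \<and> keep ({2} \<union> {44..48}) e e' \<and> keep {2, 4} A A') \<tau> e A"
    (is "wp _ ?Q _ _ _")
proof -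
  let ?e = "e(2 := 0, 44 := 0, 48 := r)"
  have f0: "found r mk [] ?e A" unfolding found_def using e A by simp
  have "wp (ENQUEUE ;; WHILE (Lt (X 44) (X 2)) SCAN) ?Q \<tau>0 ?e A" if t0: "\<tau>0 \<le> \<tau> + 10" for \<tau>0
    unfolding wp.simps(4)
  proof (rule wp_ENQUEUE[OF f0 _ r(1) r(1)])
    fix \<tau>1 zs e1 A1
    assume 1: "\<tau>1 \<le> \<tau>0 + 40" "found r mk ([] @ zs) e1 A1" "keep {2} ?e e1" "keep {2, 4} A A1"
      "mk r = 0 \<Longrightarrow> r \<in> set ([] @ zs)"
    have rz: "r \<in> set zs" using 1(5) r(2) by simp
    have k1: "keep ({2} \<union> {44..48}) e e1" by (rule keep_trans'[OF _ 1(3)]) (simp_all add: keep_def)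
    define I where "I \<tau>' e' A' \<longleftrightarrow> (\<exists>xs. found r mk xs e' A' \<and> r \<in> set xs \<and> e' 44 \<le> length xs \<and>
      (\<forall>i<e' 44. \<forall>w. E (xs ! i) w \<longrightarrow> w \<in> set xs) \<and> \<tau>' \<le> \<tau> + 50 + e' 44 * (110 * K) \<and>
      keep ({2} \<union> {44..48}) e e' \<and> keep {2, 4} A A')" for \<tau>' :: nat and e' :: env and A' :: arrays
    have e44: "e1 44 = 0" using keepD[OF 1(3), of 44] by simp
    have I1: "I \<tau>1 e1 A1" unfolding I_def
      by (rule exI[of _ zs]) (use 1 t0 rz k1 e44 in simp)
    have step: "\<tau>' \<le> \<tau> + 50 + n * (110 * K) \<and> bok e' A' (Lt (X 44) (X 2)) \<and>
      (if bval e' A' (Lt (X 44) (X 2)) then wp SCAN I (\<tau>' + bcost (Lt (X 44) (X 2))) e' A'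
       else ?Q (\<tau>' + bcost (Lt (X 44) (X 2))) e' A')" if I: "I \<tau>' e' A'" for \<tau>' e' A'
    proof -
      from I obtain xs where f: "found r mk xs e' A'" and rx: "r \<in> set xs" and le: "e' 44 \<le> length xs"
        and cl: "\<forall>i<e' 44. \<forall>w. E (xs ! i) w \<longrightarrow> w \<in> set xs" and t: "\<tau>' \<le> \<tau> + 50 + e' 44 * (110 * K)"
        and k: "keep ({2} \<union> {44..48}) e e'" "keep {2, 4} A A'" unfolding I_def by blast
      have "e' 44 * (110 * K) \<le> n * (110 * K)" by (rule mult_le_mono1) (use le found_length[OF f] in simp)
      then have b: "\<tau>' \<le> \<tau> + 50 + n * (110 * K)" using t by linarith
      show ?thesis
      proof (cases "e' 44 < length xs")
        case True
        have "wp SCAN I (\<tau>' + 3) e' A'"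
        proof (rule wp_mono[OF wp_SCAN[OF f refl True r(1) mk]], assumption, assumption, elim conjE exE)
          fix \<tau>2 e2 A2 ys
          assume 2: "\<tau>2 \<le> \<tau>' + 3 + 100 * K" "e2 44 = Suc (e' 44)" "keep ({2} \<union> {44..48}) e' e2" "keep {2, 4} A' A2"
            "found r mk (xs @ ys) e2 A2" "\<forall>w. E (xs ! e' 44) w \<longrightarrow> w \<in> set (xs @ ys)"
          have "\<forall>i<Suc (e' 44). \<forall>w. E ((xs @ ys) ! i) w \<longrightarrow> w \<in> set (xs @ ys)"
          proof (intro allI impI)
            fix i w assume i: "i < Suc (e' 44)" and w: "E ((xs @ ys) ! i) w"
            have "(xs @ ys) ! i = xs ! i" using i True by (simp add: nth_append)
            then show "w \<in> set (xs @ ys)" using i w cl[rule_format, of i w] 2(6)[rule_format, of w] by (cases "i = e' 44") simp_all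
          qed
          moreover have "\<tau>2 \<le> \<tau> + 50 + Suc (e' 44) * (110 * K)" using 2(1) t Kn by simp
          moreover have "Suc (e' 44) \<le> length (xs @ ys)" "r \<in> set (xs @ ys)" using True rx by simp_all
          ultimately show "I \<tau>2 e2 A2" unfolding I_def
            using 2(5) keep_trans[OF k(1) 2(3)] keep_trans[OF k(2) 2(4)] unfolding 2(2) by blast
        qed
        then show ?thesis using b True foundD(3)[OF f] by (simp add: numeral_3_eq_3)
      next
        case False
        then have eq: "e' 44 = length xs" using le by simp
        have "v \<in> set xs" if "u \<in> set xs" "E u v" for u v
        proof -
          from that(1) obtain i where "i < length xs" "xs ! i = u" unfolding in_set_conv_nth by blast
          then show ?thesis using cl[rule_format, of i v] that(2) eq by simp
        qed
        moreover have "\<tau>' + 3 \<le> \<tau> + 60 + length xs * (110 * K)" using t eq by simp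
        ultimately have "?Q (\<tau>' + 3) e' A'" using f rx k by blast
        then show ?thesis using b False foundD(3)[OF f] by simp
      qed
    qed
    show "wp (WHILE (Lt (X 44) (X 2)) SCAN) ?Q \<tau>1 e1 A1"
      unfolding wp.simps(6) using I1 step by (intro exI[of _ I] exI[of _ "\<tau> + 50 + n * (110 * K)"]) blast
  qed (simp_all)
  then show ?thesis unfolding BFS_def wp.simps(4)[of "Asg _ _"] wp.simps(2)
    using e M by simp
qed

end

section \<open>All components\<close>

definition COMMIT :: cmd where
  "COMMIT = FOR 44 (X 2) (Asg 45 (Rd (N 4) (X 44)) ;;
     Wr (N 3) (X 45) (N 1 \<oplus> Rd (N 11) (X 45) \<oplus> N 2 \<otimes> Rd (N 12) (X 45)))"

definition COMPONENT :: cmd where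
  "COMPONENT = BFS ;; SOLVE_COMP ;; IF (Eq (X 41) (N 1)) COMMIT (Asg 3 (N 0))"

definition MAIN :: cmd where
  "MAIN = Asg 3 (N 1) ;; FOR 4 (X 0) (IF (Eq (Rd (N 2) (X 4)) (N 0)) COMPONENT SKIP)"

definition OUTPUT :: cmd where
  "OUTPUT = IF (Eq (X 3) (N 1))
     (FOR 44 (X 0) (Wr (N 0) (X 44 \<oplus> N 1) (Rd (N 3) (X 44))) ;; Wr (N 0) (N 0) (N 1)) (Wr (N 0) (N 0) (N 0))"

context input_graph begin

text \<open>
  A component is an induced subgraph, so it inherits what is forbidden.
\<close>

lemma comp_search_component:
  assumes f: "found r mk xs e A" and r: "r \<in> set xs" and cl: "\<And>u v. u \<in> set xs \<Longrightarrow> E u v \<Longrightarrow> v \<in> set xs"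
  shows "comp_search M K J (\<lambda>u v. E u v \<and> u \<in> set xs) (set xs) n m (length xs) (\<lambda>i. xs ! i)
    (\<lambda>u. length (row (arcs m) u)) (\<lambda>u i. row (arcs m) u ! i) r eu ev"
proof unfold_locales
  have sub: "set xs \<subseteq> {..<n}" using foundD(7)[OF f] by auto
  show "finite (set xs)" by simp
  show "u \<in> set xs" if "E u v \<and> u \<in> set xs" for u v using that by blast
  show "E v u \<and> v \<in> set xs" if "E u v \<and> u \<in> set xs" for u v using that cl sym by blast
  show False if "E u v \<and> u \<in> set xs" "E v w \<and> v \<in> set xs" "E u w \<and> u \<in> set xs" for u v w
    using that tri by blast
  show False if "E a b \<and> a \<in> set xs" "E b c \<and> b \<in> set xs" "E c d \<and> c \<in> set xs" "E d e \<and> d \<in> set xs"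
    "E e f \<and> e \<in> set xs" "E f g \<and> f \<in> set xs" "\<not> (E a c \<and> a \<in> set xs)" "\<not> (E a d \<and> a \<in> set xs)"
    "\<not> (E a e \<and> a \<in> set xs)" "\<not> (E a f \<and> a \<in> set xs)" "\<not> (E a g \<and> a \<in> set xs)"
    "\<not> (E b d \<and> b \<in> set xs)" "\<not> (E b e \<and> b \<in> set xs)" "\<not> (E b f \<and> b \<in> set xs)" "\<not> (E b g \<and> b \<in> set xs)"
    "\<not> (E c e \<and> c \<in> set xs)" "\<not> (E c f \<and> c \<in> set xs)" "\<not> (E c g \<and> c \<in> set xs)"
    "\<not> (E d f \<and> d \<in> set xs)" "\<not> (E d g \<and> d \<in> set xs)" "\<not> (E e g \<and> e \<in> set xs)" for a b c d e f g
    using that by (intro p7[of a b c d e f g]) simp_all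
  show "set xs \<subseteq> {..<n}" by (rule sub)
  show "(\<lambda>i. xs ! i) ` {..<length xs} = set xs" unfolding set_conv_nth by blast
  show "length xs = card (set xs)" using distinct_card[OF foundD(4)[OF f]] by simp
  show "(\<lambda>i. row (arcs m) v ! i) ` {..<length (row (arcs m) v)} = {w. E v w \<and> v \<in> set xs}" if "v \<in> set xs" for v
  proof -
    have "(\<lambda>i. row (arcs m) v ! i) ` {..<length (row (arcs m) v)} = set (row (arcs m) v)"
      unfolding set_conv_nth by blast
    then show ?thesis using that unfolding row_E by simp
  qed
  have "(\<Sum>u\<in>set xs. length (row (arcs m) u)) \<le> (\<Sum>u<n. length (row (arcs m) u))"
    by (rule sum_mono2) (use sub in simp_all)
  then show "(\<Sum>u\<in>set xs. length (row (arcs m) u)) \<le> 2 * m" using sum_row[where ps = "arcs m"] unfolding length_arcs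
    by (rule order_trans)
  show "n + 2 * m + 10 \<le> K" "20 + 2 * n < J" by (rule Kn, rule Jn)
  show "r \<in> set xs" by (rule r)
  show "set xs \<subseteq> S" if S: "r \<in> S" "\<And>u v. u \<in> S \<Longrightarrow> E u v \<and> u \<in> set xs \<Longrightarrow> v \<in> S" for S
  proof -
    have "set xs \<subseteq> S \<inter> set xs"
      by (rule foundD(9)[OF f]) (use S r cl in blast)+
    then show ?thesis by blast
  qed
  show "E u v \<and> u \<in> set xs \<longleftrightarrow> (\<exists>i<m. eu i = u \<and> ev i = v \<or> eu i = v \<and> ev i = u)" if "u \<in> set xs" for u v
    using that unfolding E_iff by blast
  have "length xs ^ 5 \<le> n ^ 5" by (rule power_mono[OF found_length[OF f]]) simp
  then show "10 * length xs ^ 5 + 10 < M" using big by linarith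
  show "eu i < n \<and> ev i < n" if "i < m" for i using eun[OF that] .
qed

definition good_on :: "nat set \<Rightarrow> (nat \<Rightarrow> nat) \<Rightarrow> bool" where
  "good_on Z c \<longleftrightarrow> (\<forall>v\<in>Z. c v \<in> {1, 2, 3}) \<and> (\<forall>u\<in>Z. \<forall>v. E u v \<longrightarrow> c u \<noteq> c v)"

definition colourless :: bool where
  "colourless \<longleftrightarrow> (\<forall>f. \<not> proper f)"

lemma wp_COMMIT:
  assumes e: "e 2 = length xs" and A: "\<And>i. i < length xs \<Longrightarrow> A 4 i = xs ! i" and xs: "set xs \<subseteq> {..<n}" "length xs \<le> n"
    and f: "\<And>v c. v \<in> set xs \<Longrightarrow> c < 3 \<Longrightarrow> A (10 + c) v = of_bool (c = f v)" "\<And>v. v \<in> set xs \<Longrightarrow> f v < 3"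
  shows "wp COMMIT (\<lambda>\<tau>' e' A'. \<tau>' \<le> \<tau> + 60 * length xs + 10 \<and> keep {44, 45} e e' \<and> keep {3} A A' \<and>
    (\<forall>v. A' 3 v = (if v \<in> set xs then f v + 1 else A 3 v))) \<tau> e A"
    (is "wp _ ?Q _ _ _")
proof -
  define P where "P k e' A' \<longleftrightarrow> keep {44, 45} e e' \<and> keep {3} A A' \<and>
    (\<forall>v. A' 3 v = (if v \<in> set (take k xs) then f v + 1 else A 3 v))" for k :: nat and e' :: env and A' :: arrays
  show ?thesis
    unfolding COMMIT_def
  proof (rule wp_FOR_const[where P = P and n = "length xs" and D = 50])
    show "length xs < M" using xs(2) small(1)[of "length xs"] Kn by simp
    show "P 0 (e(44 := 0)) A" unfolding P_def by (simp add: keep_def)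
  next
    fix k e' A' assume "P k e' A'"
    then have "keep {44, 45} e e'" unfolding P_def by blast
    from keepD[OF this, of 2] show "xok e' A' (X 2) \<and> xval e' A' (X 2) = length xs" using e by simp
  next
    fix k and \<tau>1 :: nat and e' A' assume k: "k < length xs" and P: "P k e' A'" and ek: "e' 44 = k"
    have ke: "keep {44, 45} e e'" and ka: "keep {3} A A'" and c: "\<And>v. A' 3 v = (if v \<in> set (take k xs) then f v + 1 else A 3 v)"
      using P unfolding P_def by blast+
    let ?v = "xs ! k"
    have v: "?v \<in> set xs" "?v < n" using nth_mem[OF k] xs(1) by auto
    have v4: "A' 4 k = ?v" using A[OF k] keepD[OF ka, of 4] by simp
    have v11: "A' 11 ?v = of_bool (1 = f ?v)" "A' 12 ?v = of_bool (2 = f ?v)"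
      using f(1)[OF v(1), of 1] f(1)[OF v(1), of 2] keepD[OF ka, of 11] keepD[OF ka, of 12] by simp_all
    have val: "1 + A' 11 ?v + 2 * A' 12 ?v = f ?v + 1"
    proof -
      have "f ?v = 0 \<or> f ?v = 1 \<or> f ?v = 2" using f(2)[OF v(1)] by linarith
      then show ?thesis unfolding v11 by (elim disjE) simp_all
    qed
    have le: "A' 11 ?v \<le> 1" "A' 12 ?v \<le> 1" unfolding v11 by simp_all
    let ?e = "e'(45 := ?v)" let ?A = "A'(3 := (A' 3)(?v := f ?v + 1))"
    have "P (Suc k) (?e(44 := Suc k)) ?A"
      unfolding P_def
    proof (intro conjI allI)
      show "keep {44, 45} e (?e(44 := Suc k))" using ke unfolding keep_def by simp
      show "keep {3} A ?A" using ka unfolding keep_def by simp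
      show "?A 3 w = (if w \<in> set (take (Suc k) xs) then f w + 1 else A 3 w)" for w
        using c[of w] k by (simp add: take_Suc_conv_app_nth)
    qed
    then have q: "\<tau>1 + 5 + 17 \<le> \<tau>1 + 50 \<and> ?e 44 = k \<and> P (Suc k) (?e(44 := Suc k)) ?A" using ek by simp
    let ?R = "\<lambda>\<tau>' e'' A''. \<tau>' \<le> \<tau>1 + 50 \<and> e'' 44 = k \<and> P (Suc k) (e''(44 := Suc k)) A''"
    let ?x = "N 1 \<oplus> Rd (N 11) (X 45) \<oplus> N 2 \<otimes> Rd (N 12) (X 45)"
    have x: "xval ?e A' ?x = f ?v + 1" using val by simp
    have kK: "k < K" "?v < K" "12 < M" using k xs(2) v Kn small(1)[of 12] by linarith+
    have ok: "xok ?e A' ?x" using kK Jn small_consts le by simp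
    have "wp (Wr (N 3) (X 45) ?x) ?R \<tau>2 ?e A'" if t2: "\<tau>2 \<le> \<tau>1 + 10" for \<tau>2
      unfolding wp.simps(3) x using ok q t2 kK Jn small_consts by (simp del: One_nat_def)
    from this[of "\<tau>1 + 6"] show "wp (Asg 45 (Rd (N 4) (X 44)) ;; Wr (N 3) (X 45) ?x) ?R \<tau>1 e' A'"
      by (intro wp_Asg_seq[where y = ?v and k = 6]) (use v4 ek kK Jn small_consts in simp_all)
  next
    fix \<tau>' e' A'
    assume "\<tau>' \<le> \<tau> + length xs * (50 + xcost (X 2) + 6) + xcost (X 2) + 4" "P (length xs) e' A'"
    then show "?Q \<tau>' e' A'" unfolding P_def by simp
  qed
qed

text \<open>
  The roots below \<open>k\<close> have been treated. The marked vertices are a union of components; either they are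
  coloured, or some component has been shown to have no colouring.
\<close>

definition progress :: "nat \<Rightarrow> env \<Rightarrow> arrays \<Rightarrow> bool" where
  "progress k e A \<longleftrightarrow> e 0 = n \<and> e 1 = m \<and> inputs A \<and> built (arcs m) A \<and> (\<forall>v<n. A 2 v \<le> k) \<and>
     (\<forall>v<k. A 2 v \<noteq> 0) \<and> (\<forall>u<n. \<forall>v. A 2 u \<noteq> 0 \<longrightarrow> E u v \<longrightarrow> A 2 v \<noteq> 0) \<and>
     (e 3 = 1 \<and> good_on {v. v < n \<and> A 2 v \<noteq> 0} (A 3) \<or> e 3 = 0 \<and> colourless)"

definition marked :: "arrays \<Rightarrow> nat" where
  "marked A = card {v. v < n \<and> A 2 v \<noteq> 0}"

text \<open>
  The time is charged to the \<open>l\<close> vertices that become marked.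
\<close>

lemma wp_COMPONENT:
  assumes P: "progress r e A" and r: "e 4 = r" "r < n" "A 2 r = 0"
  shows "wp COMPONENT (\<lambda>\<tau>' e' A'. e' 4 = r \<and> progress (Suc r) e' A' \<and>
    (\<exists>l. marked A' = marked A + l \<and> \<tau>' \<le> \<tau> + l ^ 5 * (17000 * K))) \<tau> e A"
    (is "wp _ ?Q _ _ _")
proof -
  have e: "e 0 = n" "e 1 = m" and inp: "inputs A" and b: "built (arcs m) A" and stamp: "\<And>v. v < n \<Longrightarrow> A 2 v \<le> r"
    and low: "\<And>v. v < r \<Longrightarrow> A 2 v \<noteq> 0" and cl: "\<And>u v. u < n \<Longrightarrow> A 2 u \<noteq> 0 \<Longrightarrow> E u v \<Longrightarrow> A 2 v \<noteq> 0"
    and st: "e 3 = 1 \<and> good_on {v. v < n \<and> A 2 v \<noteq> 0} (A 3) \<or> e 3 = 0 \<and> colourless"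
    using P unfolding progress_def by blast+
  have En: "u < n" "v < n" if "E u v" for u v using dom[OF that] dom[OF sym[OF that]] by simp_all
  show ?thesis
    unfolding COMPONENT_def
  proof (rule wp_seqI[OF wp_BFS[OF e(1) r(1,2) r(3) refl b]], use cl En in blast, elim exE conjE)
    fix \<tau>1 e1 A1 xs
    assume f: "found r (A 2) xs e1 A1" and rx: "r \<in> set xs" and clx: "\<forall>u v. u \<in> set xs \<longrightarrow> E u v \<longrightarrow> v \<in> set xs"
      and t1: "\<tau>1 \<le> \<tau> + 60 + length xs * (110 * K)" and k1: "keep ({2} \<union> {44..48}) e e1" and a1: "keep {2, 4} A A1"
    interpret C: comp_search M K J "\<lambda>u v. E u v \<and> u \<in> set xs" "set xs" n m "length xs" "\<lambda>i. xs ! i"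
      "\<lambda>u. length (row (arcs m) u)" "\<lambda>u i. row (arcs m) u ! i" r eu ev
      by (rule comp_search_component[OF f rx]) (use clx in blast)
    have xn: "v < n" "A 2 v = 0" if "v \<in> set xs" for v using foundD(7)[OF f] that by auto
    have e1: "e1 0 = n" "e1 1 = m" "e1 2 = length xs" "e1 4 = r" "e1 3 = e 3"
      using foundD(1-3)[OF f] keepD[OF k1, of 1] keepD[OF k1, of 3] e by simp_all
    have inp1: "inputs A1" by (rule inputs_keep[OF inp a1]) simp
    have static: "C.static2 e1 A1"
      unfolding C.static2_def C.static_def
    proof (intro conjI ballI allI impI)
      fix v assume v: "v \<in> set xs"
      show "A1 1 v = length (row (arcs m) v)" using foundD(8)[OF f] xn[OF v] unfolding built_def by blast
      show "A1 (20 + n + v) i = row (arcs m) v ! i" if "i < length (row (arcs m) v)" for i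
        using foundD(8)[OF f] xn[OF v] that unfolding built_def by blast
      show "A1 (20 + v) w = of_bool (E v w \<and> v \<in> set xs)" if "w \<in> set xs" for w
        using foundD(8)[OF f] xn(1)[OF v] xn(1)[OF that] v unfolding built_def arcs_E by simp
    next
      fix v assume v: "v < n"
      have "A 2 v \<noteq> Suc r" using stamp[OF v] by simp
      then show "A1 2 v = Suc r \<longleftrightarrow> v \<in> set xs" using foundD(6)[OF f v] by simp
    next
      fix i assume i: "i < m"
      show "A1 0 (2 + 2 * i) = eu i" "A1 0 (3 + 2 * i) = ev i" using inp1 i unfolding inputs_def by blast+
    qed (use e1 foundD(5)[OF f] in simp_all)
    let ?Z = "{v. v < n \<and> A 2 v \<noteq> 0}"
    show "wp (SOLVE_COMP ;; IF (Eq (X 41) (N 1)) COMMIT (Asg 3 (N 0))) ?Q \<tau>1 e1 A1"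
    proof (rule wp_seqI[OF C.wp_SOLVE_COMP[OF static]], elim conjE)
      fix \<tau>2 e2 A2
      assume t2: "\<tau>2 \<le> \<tau>1 + length xs ^ 5 * (16000 * K)" and k2: "keep {5..43} e1 e2"
        and a2: "keep ({5, 6} \<union> {10..15}) A1 A2" and res: "if e2 41 = 1 then C.solved A2 else \<forall>f. \<not> C.proper f"
      have e2: "e2 0 = n" "e2 1 = m" "e2 2 = length xs" "e2 4 = r" "e2 3 = e 3"
        using e1 keepD[OF k2, of 0] keepD[OF k2, of 1] keepD[OF k2, of 2] keepD[OF k2, of 4] keepD[OF k2, of 3] by simp_all
      have inp2: "inputs A2" by (rule inputs_keep[OF inp1 a2]) simp
      have b2: "built (arcs m) A2" by (rule built_keep[OF foundD(8)[OF f] a2]) auto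
      have A2: "A2 2 = A1 2" "A2 3 = A 3" "A2 4 = A1 4"
        using keepD[OF a2, of 2] keepD[OF a2, of 3] keepD[OF a2, of 4] keepD[OF a1, of 3] by simp_all
      have A2m: "A2 2 v = (if v \<in> set xs then Suc r else A 2 v)" if "v < n" for v
        using foundD(6)[OF f that] unfolding A2 .
      have Z: "{v. v < n \<and> A2 2 v \<noteq> 0} = set xs \<union> ?Z"
      proof (rule set_eqI)
        fix v
        show "v \<in> {v. v < n \<and> A2 2 v \<noteq> 0} \<longleftrightarrow> v \<in> set xs \<union> ?Z"
        proof (cases "v < n")
          case True
          then show ?thesis using A2m[OF True] by simp
        next
          case False
          then have "v \<notin> set xs" using xn(1)[of v] by blast
          then show ?thesis using False by simp
        qed
      qed
      have disj: "set xs \<inter> ?Z = {}"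
      proof (rule Int_emptyI)
        fix v assume "v \<in> set xs" "v \<in> ?Z"
        then show False using xn(2)[of v] by simp
      qed
      have cnt: "marked A2 = marked A + length xs"
        unfolding marked_def Z using card_Un_disjoint[OF _ _ disj] distinct_card[OF foundD(4)[OF f]] by simp
      have time: "60 + length xs * (110 * K) + length xs ^ 5 * (16000 * K) + (60 * length xs + 40) \<le> length xs ^ 5 * (17000 * K)"
      proof -
        have l: "1 \<le> length xs" using C.nc_pos by linarith
        have "length xs ^ 1 \<le> length xs ^ 5" using l by (rule power_increasing[rotated]) simp
        then have 1: "length xs * K \<le> length xs ^ 5 * K" by (intro mult_le_mono1) simp
        have 2: "length xs * 1 \<le> length xs * K" using K by (intro mult_le_mono2) simp
        have 3: "1 * K \<le> length xs * K" using l by (rule mult_le_mono1)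
        have "length xs ^ 5 * (17000 * K) = 17000 * (length xs ^ 5 * K)" "length xs ^ 5 * (16000 * K) = 16000 * (length xs ^ 5 * K)"
          "length xs * (110 * K) = 110 * (length xs * K)" by simp_all
        then show ?thesis using 1 2 3 Kn by linarith
      qed
      have prog: "progress (Suc r) e3 A3" if e3: "e3 0 = n" "e3 1 = m" and A3: "inputs A3" "built (arcs m) A3" "A3 2 = A2 2"
        and s3: "e3 3 = 1 \<and> good_on (set xs \<union> ?Z) (A3 3) \<or> e3 3 = 0 \<and> colourless" for e3 A3
        unfolding progress_def A3(3) Z
      proof (intro conjI allI impI)
        show "A2 2 v \<le> Suc r" if "v < n" for v using A2m[OF that] stamp[OF that] by simp
        show "A2 2 v \<noteq> 0" if "v < Suc r" for v
        proof (cases "v = r")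
          case True
          then show ?thesis using A2m[OF r(2)] rx by simp
        next
          case False
          then have "v < r" using that by simp
          then show ?thesis using A2m[of v] low[of v] r(2) by simp
        qed
        show "A2 2 v \<noteq> 0" if "u < n" "A2 2 u \<noteq> 0" "E u v" for u v
        proof (cases "u \<in> set xs")
          case True
          then have "v \<in> set xs" using clx that(3) by blast
          then show ?thesis using A2m[OF En(2)[OF that(3)]] by simp
        next
          case False
          then have "A 2 u \<noteq> 0" using A2m[OF that(1)] that(2) by simp
          then have "A 2 v \<noteq> 0" using cl[OF that(1) _ that(3)] by blast
          then show ?thesis using A2m[OF En(2)[OF that(3)]] by simp
        qed
        show "e3 3 = 1 \<and> good_on (set xs \<union> ?Z) (A3 3) \<or> e3 3 = 0 \<and> colourless" by (rule s3)
      qed (use e3 A3 in simp_all)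
      have c3: "bcost (Eq (X 41) (N 1)) = 3" by simp
      show "wp (IF (Eq (X 41) (N 1)) COMMIT (Asg 3 (N 0))) ?Q \<tau>2 e2 A2"
      proof (cases "e2 41 = 1")
        case True
        then obtain g where g: "C.proper g" "\<forall>v\<in>set xs. \<forall>c<3. A2 (10 + c) v = of_bool (c = g v)"
          using res unfolding C.solved_def by auto
        have g3: "g v < 3" if "v \<in> set xs" for v using g(1) that unfolding C.proper_def by blast
        have gE: "g u \<noteq> g v" if "E u v" "u \<in> set xs" for u v using g(1) that unfolding C.proper_def by blast
        have "wp COMMIT ?Q (\<tau>2 + 3) e2 A2"
        proof (rule wp_mono[OF wp_COMMIT[where f = g and xs = xs]])
          show "e2 2 = length xs" by (rule e2(3))
          show "A2 4 i = xs ! i" if "i < length xs" for i using foundD(5)[OF f that] unfolding A2 .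
          show "set xs \<subseteq> {..<n}" using xn(1) by blast
          show "length xs \<le> n" by (rule found_length[OF f])
          show "A2 (10 + c) v = of_bool (c = g v)" if "v \<in> set xs" "c < 3" for v c using g(2) that by blast
          show "g v < 3" if "v \<in> set xs" for v by (rule g3[OF that])
        next
          fix \<tau>3 e3 A3
          assume 3: "\<tau>3 \<le> \<tau>2 + 3 + 60 * length xs + 10 \<and> keep {44, 45} e2 e3 \<and> keep {3} A2 A3 \<and>
            (\<forall>v. A3 3 v = (if v \<in> set xs then g v + 1 else A2 3 v))"
          have k3: "keep {44, 45} e2 e3" and a3: "keep {3} A2 A3" and
            c3: "\<And>v. A3 3 v = (if v \<in> set xs then g v + 1 else A 3 v)" using 3 unfolding A2 by blast+
          have e3: "e3 0 = n" "e3 1 = m" "e3 4 = r" "e3 3 = e 3"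
            using e2 keepD[OF k3, of 0] keepD[OF k3, of 1] keepD[OF k3, of 4] keepD[OF k3, of 3] by simp_all
          have m3: "A3 2 = A2 2" using keepD[OF a3, of 2] by simp
          have "good_on (set xs \<union> ?Z) (A3 3)" if g: "good_on ?Z (A 3)"
            unfolding good_on_def
          proof (intro conjI ballI allI impI)
            fix v assume v: "v \<in> set xs \<union> ?Z"
            show "A3 3 v \<in> {1, 2, 3}"
            proof (cases "v \<in> set xs")
              case True
              have "g v = 0 \<or> g v = 1 \<or> g v = 2" using g3[OF True] by linarith
              then show ?thesis using c3[of v] True by (elim disjE) simp_all
            next
              case False
              then have "A 3 v \<in> {1, 2, 3}" using g v unfolding good_on_def by blast
              then show ?thesis using c3[of v] False by simp
            qed
          next
            fix u v assume u: "u \<in> set xs \<union> ?Z" and uv: "E u v"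
            show "A3 3 u \<noteq> A3 3 v"
            proof (cases "u \<in> set xs")
              case True
              then have "v \<in> set xs" using clx uv by blast
              then show ?thesis using c3[of u] c3[of v] gE[OF uv True] True by simp
            next
              case False
              then have z: "u \<in> ?Z" using u by blast
              have "v \<notin> set xs" using clx sym[OF uv] False by blast
              moreover have "A 3 u \<noteq> A 3 v" using g z uv unfolding good_on_def by blast
              ultimately show ?thesis using c3[of u] c3[of v] False by simp
            qed
          qed
          then have s3: "e3 3 = 1 \<and> good_on (set xs \<union> ?Z) (A3 3) \<or> e3 3 = 0 \<and> colourless"
            using st unfolding e3(4) by blast
          have "progress (Suc r) e3 A3"
            by (rule prog[OF e3(1,2) inputs_keep[OF inp2 a3] built_keep[OF b2 a3] m3 s3]) simp_all
          moreover have "marked A3 = marked A + length xs" using cnt unfolding marked_def m3 .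
          moreover have "\<tau>3 \<le> \<tau> + length xs ^ 5 * (17000 * K)" using 3 t2 t1 time by linarith
          ultimately show "?Q \<tau>3 e3 A3" using e3(3) by blast
        qed
        then show ?thesis unfolding c3[symmetric] by (intro wp_IF_T) (use True M in simp_all)
      next
        case False
        let ?e3 = "e2(3 := 0)"
        have np: "\<not> C.proper h" for h using res False by simp
        have "colourless"
          unfolding colourless_def
        proof (intro allI notI)
          fix h assume h: "proper h"
          have "C.proper h" unfolding C.proper_def using h xn(1) unfolding proper_def by blast
          then show False using np by blast
        qed
        then have "progress (Suc r) ?e3 A2" by (intro prog) (use e2 inp2 b2 in simp_all)
        moreover have "\<tau>2 + 3 + 2 \<le> \<tau> + length xs ^ 5 * (17000 * K)" using t2 t1 time by linarith
        ultimately have q: "?Q (\<tau>2 + 3 + 2) ?e3 A2" using e2(4) cnt by auto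
        have "wp (Asg 3 (N 0)) ?Q (\<tau>2 + 3) e2 A2"
          unfolding wp.simps(2) xval.simps xcost.simps one_add_one using q M by (intro conjI) simp_all
        then show ?thesis unfolding c3[symmetric] by (intro wp_IF_F) (use False M in simp_all)
      qed
    qed
  qed
qed

text \<open>
  This lets the time bounds of the components add up to the bound for the graph.
\<close>

lemma pow5_add: "(a::nat) ^ 5 + b ^ 5 \<le> (a + b) ^ 5"
  by (simp add: eval_nat_numeral algebra_simps)

lemma wp_MAIN:
  assumes e: "e 0 = n" "e 1 = m" and A: "inputs A" "built (arcs m) A" "\<And>v. v < n \<Longrightarrow> A 2 v = 0"
  shows "wp MAIN (\<lambda>\<tau>' e' A'. \<tau>' \<le> \<tau> + 30 * n + 20 + n ^ 5 * (17000 * K) \<and> e' 0 = n \<and>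
    (e' 3 = 1 \<and> good_on {..<n} (A' 3) \<or> e' 3 = 0 \<and> colourless)) \<tau> e A"
    (is "wp _ ?Q _ _ _")
proof -
  define I where "I k \<tau>' e' A' \<longleftrightarrow> k \<le> n \<and> e' 4 = k \<and> progress k e' A' \<and>
    \<tau>' \<le> \<tau> + 10 + 30 * k + marked A' ^ 5 * (17000 * K)" for k \<tau>' :: nat and e' :: env and A' :: arrays
  have mk: "marked A' \<le> n" for A' unfolding marked_def using card_mono[of "{..<n}" "{v. v < n \<and> A' 2 v \<noteq> 0}"] by auto
  have tm: "\<tau> + 10 + 30 * k + marked A' ^ 5 * (17000 * K) \<le> \<tau> + 10 + 30 * n + n ^ 5 * (17000 * K)" if "k \<le> n" for k A'
  proof -
    have "marked A' ^ 5 * (17000 * K) \<le> n ^ 5 * (17000 * K)" by (intro mult_le_mono1 power_mono mk) simp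
    then show ?thesis using that by linarith
  qed
  have "wp (FOR 4 (X 0) (IF (Eq (Rd (N 2) (X 4)) (N 0)) COMPONENT SKIP)) ?Q (\<tau> + 2) (e(3 := 1)) A"
  proof (rule wp_FOR[where I = I and n = n and B = "\<tau> + 10 + 30 * n + n ^ 5 * (17000 * K)"])
    show "n < M" using small(1)[of n] Kn by simp
    show "I 0 (\<tau> + 2 + 2) (e(3 := 1, 4 := 0)) A"
      unfolding I_def progress_def good_on_def using e A by auto
  next
    fix k \<tau>1 e1 A1 assume I: "I k \<tau>1 e1 A1"
    have "e1 0 = n" using I unfolding I_def progress_def by blast
    then show "k \<le> n \<and> e1 4 = k \<and> xok e1 A1 (X 0) \<and> xval e1 A1 (X 0) = n \<and>
        \<tau>1 \<le> \<tau> + 10 + 30 * n + n ^ 5 * (17000 * K)"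
      using I tm[of k A1] unfolding I_def by (simp add: order_trans)
  next
    fix k \<tau>1 e1 A1 assume I: "I k \<tau>1 e1 A1" and k: "k < n"
    let ?R = "\<lambda>\<tau>' e' A'. e' 4 = k \<and> I (Suc k) (\<tau>' + 4) (e'(4 := Suc k)) A'"
    have P: "progress k e1 A1" and e4: "e1 4 = k" and t: "\<tau>1 \<le> \<tau> + 10 + 30 * k + marked A1 ^ 5 * (17000 * K)"
      using I unfolding I_def by blast+
    have Pe: "progress j (e'(4 := x)) A'" if "progress j e' A'" for j e' A' x
      using that unfolding progress_def by simp
    have ok: "bok e1 A1 (Eq (Rd (N 2) (X 4)) (N 0))" using e4 k Kn Jn small_consts by simp
    show "wp (IF (Eq (Rd (N 2) (X 4)) (N 0)) COMPONENT SKIP) ?R (\<tau>1 + (xcost (X 0) + 2)) e1 A1"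
    proof (cases "A1 2 k = 0")
      case True
      have "wp COMPONENT ?R (\<tau>1 + 10) e1 A1"
      proof (rule wp_mono[OF wp_COMPONENT[OF P e4 k True]], elim exE conjE)
        fix \<tau>2 e2 A2 l
        assume 2: "e2 4 = k" "progress (Suc k) e2 A2" "marked A2 = marked A1 + l" "\<tau>2 \<le> \<tau>1 + 10 + l ^ 5 * (17000 * K)"
        have d: "marked A1 ^ 5 * (17000 * K) + l ^ 5 * (17000 * K) \<le> marked A2 ^ 5 * (17000 * K)"
          using mult_le_mono1[OF pow5_add] by (simp only: 2(3) add_mult_distrib[symmetric])
        have key: "\<And>a b c. a + b \<le> c \<Longrightarrow> \<tau>2 \<le> \<tau>1 + 10 + b \<Longrightarrow> \<tau>1 \<le> \<tau> + 10 + 30 * k + a \<Longrightarrow>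
          \<tau>2 + 4 \<le> \<tau> + 10 + 30 * Suc k + c" by simp
        have "\<tau>2 + 4 \<le> \<tau> + 10 + 30 * Suc k + marked A2 ^ 5 * (17000 * K)" by (rule key[OF d 2(4) t])
        then show "?R \<tau>2 e2 A2" unfolding I_def using k 2(1) Pe[OF 2(2)] by simp
      qed
      then show ?thesis by (intro wp_IF_T[OF ok]) (use True e4 in \<open>simp_all add: eval_nat_numeral\<close>)
    next
      case False
      have "progress (Suc k) e1 A1"
        using P False k unfolding progress_def by (auto simp: less_Suc_eq intro: le_SucI)
      then have "I (Suc k) (\<tau>1 + (xcost (X 0) + 2) + bcost (Eq (Rd (N 2) (X 4)) (N 0)) + 1 + 4) (e1(4 := Suc k)) A1"
        unfolding I_def using t k Pe by simp
      then show ?thesis by (intro wp_IF_F[OF ok] wp_SKIP) (use False e4 in simp_all)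
    qed
  next
    fix \<tau>1 e1 A1 assume I: "I n \<tau>1 e1 A1"
    have P: "progress n e1 A1" using I unfolding I_def by blast
    have "{v. v < n \<and> A1 2 v \<noteq> 0} = {..<n}" using P unfolding progress_def by blast
    then have "e1 0 = n \<and> (e1 3 = 1 \<and> good_on {..<n} (A1 3) \<or> e1 3 = 0 \<and> colourless)"
      using P unfolding progress_def by simp
    moreover have "\<tau>1 \<le> \<tau> + 10 + 30 * n + n ^ 5 * (17000 * K)" using I tm[of n A1] unfolding I_def by linarith
    ultimately show "?Q (\<tau>1 + (xcost (X 0) + 2)) e1 A1" by simp
  qed
  then show ?thesis unfolding MAIN_def using M by simp
qed

lemma wp_OUTPUT:
  assumes e: "e 0 = n" "e 3 = 1 \<and> good_on {..<n} (A 3) \<or> e 3 = 0 \<and> colourless"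
  shows "wp OUTPUT (\<lambda>\<tau>' e' A'. \<tau>' \<le> \<tau> + 40 * n + 30 \<and>
    (A' 0 0 = 1 \<and> good_on {..<n} (\<lambda>v. A' 0 (Suc v)) \<or> A' 0 0 = 0 \<and> colourless)) \<tau> e A"
    (is "wp _ ?Q _ _ _")
proof (cases "e 3 = 1")
  case False
  then show ?thesis using e M K Jn unfolding OUTPUT_def by simp
next
  case True
  then have g: "good_on {..<n} (A 3)" using e(2) by auto
  define P where "P k e' A' \<longleftrightarrow> e' 0 = n \<and> A' 3 = A 3 \<and> (\<forall>v<k. A' 0 (Suc v) = A 3 v)"
    for k :: nat and e' :: env and A' :: arrays
  have "wp (FOR 44 (X 0) (Wr (N 0) (X 44 \<oplus> N 1) (Rd (N 3) (X 44))) ;; Wr (N 0) (N 0) (N 1)) ?Q (\<tau> + 3) e A"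
    unfolding wp.simps(4)
  proof (rule wp_FOR_const[where P = P and n = n and D = 20])
    show "n < M" using small(1)[of n] Kn by simp
    show "P 0 (e(44 := 0)) A" unfolding P_def using e by simp
    show "xok e' A' (X 0) \<and> xval e' A' (X 0) = n" if "P k e' A'" for k e' A' using that unfolding P_def by simp
  next
    fix k and \<tau>1 :: nat and e' A' assume k: "k < n" and P: "P k e' A'" and ek: "e' 44 = k"
    have "P (Suc k) (e'(44 := Suc k)) (A'(0 := (A' 0)(Suc k := A 3 k)))"
      using P unfolding P_def by (simp add: less_Suc_eq)
    moreover have "A' 3 = A 3" using P unfolding P_def by blast
    moreover have "Suc k < M" "Suc k < K" "k < K" using k Kn small(1)[of "Suc k"] by simp_all
    ultimately show "wp (Wr (N 0) (X 44 \<oplus> N 1) (Rd (N 3) (X 44)))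
        (\<lambda>\<tau>' e'' A''. \<tau>' \<le> \<tau>1 + 20 \<and> e'' 44 = k \<and> P (Suc k) (e''(44 := Suc k)) A'') \<tau>1 e' A'"
      using ek M Jn small_consts by simp
  next
    fix \<tau>' e' A'
    assume t: "\<tau>' \<le> \<tau> + 3 + n * (20 + xcost (X 0) + 6) + xcost (X 0) + 4" and P: "P n e' A'"
    have "good_on {..<n} (\<lambda>v. A' 0 (Suc v))"
      unfolding good_on_def
    proof (intro conjI ballI allI impI)
      have c: "A' 0 (Suc v) = A 3 v" if "v < n" for v using P that unfolding P_def by blast
      show "A' 0 (Suc v) \<in> {1, 2, 3}" if "v \<in> {..<n}" for v using g that c[of v] unfolding good_on_def by simp
      show "A' 0 (Suc u) \<noteq> A' 0 (Suc v)" if "u \<in> {..<n}" "E u v" for u v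
        using g that c[of v] c[of u] dom[OF sym[OF that(2)]] unfolding good_on_def by simp
    qed
    then show "wp (Wr (N 0) (N 0) (N 1)) ?Q \<tau>' e' A'" using t M K Jn unfolding good_on_def by simp
  qed
  then show ?thesis using True M unfolding OUTPUT_def by (simp add: numeral_3_eq_3)
qed

theorem wp_program:
  assumes e: "e 0 = n" "e 1 = m" and A: "inputs A" "\<And>j i. 1 \<le> j \<Longrightarrow> i < K \<Longrightarrow> A j i = 0"
  shows "wp (BUILD ;; MAIN ;; OUTPUT) (\<lambda>\<tau>' e' A'. \<tau>' \<le> \<tau> + 200 * K + n ^ 5 * (17000 * K) \<and>
    (A' 0 0 = 1 \<and> good_on {..<n} (\<lambda>v. A' 0 (Suc v)) \<or> A' 0 0 = 0 \<and> colourless)) \<tau> e A"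
    (is "wp _ ?Q _ _ _")
proof (rule wp_seqI[OF wp_BUILD[OF e A]], assumption, assumption, elim conjE)
  fix \<tau>1 e1 A1
  assume 1: "\<tau>1 \<le> \<tau> + 130 * m + 10" "keep {44, 45, 46} e e1" "built (arcs m) A1" "keep ({1} \<union> {20..}) A A1"
  have e1: "e1 0 = n" "e1 1 = m" using keepD[OF 1(2), of 0] keepD[OF 1(2), of 1] e by simp_all
  have inp: "inputs A1" by (rule inputs_keep[OF A(1) 1(4)]) simp
  have z: "A1 2 v = 0" if "v < n" for v using keepD[OF 1(4), of 2] A(2)[of 2 v] that Kn by simp
  show "wp (MAIN ;; OUTPUT) ?Q \<tau>1 e1 A1"
  proof (rule wp_seqI[OF wp_MAIN[OF e1 inp 1(3) z]], assumption)
    fix \<tau>2 :: nat and e2 :: env and A2 :: arrays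
    assume 2: "\<tau>2 \<le> \<tau>1 + 30 * n + 20 + n ^ 5 * (17000 * K) \<and> e2 0 = n \<and>
      (e2 3 = 1 \<and> good_on {..<n} (A2 3) \<or> e2 3 = 0 \<and> colourless)"
    have 21: "\<tau>2 \<le> \<tau>1 + 30 * n + 20 + n ^ 5 * (17000 * K)" and 22: "e2 0 = n" and
      23: "e2 3 = 1 \<and> good_on {..<n} (A2 3) \<or> e2 3 = 0 \<and> colourless" using 2 by blast+
    show "wp OUTPUT ?Q \<tau>2 e2 A2"
    proof (rule wp_mono[OF wp_OUTPUT[of e2 A2, OF 22 23]])
      fix \<tau>3 :: nat and e3 :: env and A3 :: arrays
      assume 3: "\<tau>3 \<le> \<tau>2 + 40 * n + 30 \<and>
        (A3 0 0 = 1 \<and> good_on {..<n} (\<lambda>v. A3 0 (Suc v)) \<or> A3 0 0 = 0 \<and> colourless)"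
      have "\<tau>3 \<le> \<tau> + 200 * K + n ^ 5 * (17000 * K)" using 3 21 1(1) Kn by linarith
      then show "?Q \<tau>3 e3 A3" using 3 by blast
    qed
  qed
qed

end

section \<open>From the input word to the answer\<close>

text \<open>
  Compiled programs expect the array length \<open>n + 2 m + 10\<close> in register 1. Array 0 then starts at address
  0 and contains the whole input.
\<close>

definition PRELUDE :: program where
  "PRELUDE = Seq (Load 0 (Const 0)) (Seq (Load 2 (Const 1)) (Seq (Arith 1 Plus (Reg 2) (Reg 2))
     (Seq (Arith 1 Plus (Reg 1) (Reg 0)) (Arith 1 Plus (Reg 1) (Const 10)))))"

definition SOLVER :: program where
  "SOLVER = Seq PRELUDE (cc (BUILD ;; MAIN ;; OUTPUT))"

lemma concat_pairs:
  "i < length es \<Longrightarrow> concat (map (\<lambda>(u, v). [u, v]) es) ! (2 * i) = fst (es ! i) \<and>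
     concat (map (\<lambda>(u, v). [u, v]) es) ! Suc (2 * i) = snd (es ! i)"
proof (induction es arbitrary: i)
  case (Cons p es)
  obtain u v where p: "p = (u, v)" by (cases p)
  show ?case using Cons.IH[of "i - 1"] Cons.prems unfolding p by (cases i) simp_all
qed simp

lemma set_concat_pairs: "set (concat (map (\<lambda>(u, v). [u, v]) es)) = fst ` set es \<union> snd ` set es"
  by (induction es) auto

lemma length_concat_pairs: "length (concat (map (\<lambda>(u, v). [u, v]) es)) = 2 * length es"
  by (induction es) auto

text \<open>
  A map from the cycle on three vertices onto a triangle is an isomorphism.
\<close>

lemma triangle_free_edges:
  assumes s: "simple_graph G" and h: "H_free {path_graph 7, cycle_graph 3} G"
    and e: "{u, v} \<in> edges G" "{v, w} \<in> edges G" "{u, w} \<in> edges G"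
  shows False
proof -
  have d: "a \<in> verts G" "b \<in> verts G" "a \<noteq> b" if "{a, b} \<in> edges G" for a b
    using s that unfolding simple_graph_def by (auto dest!: bspec[of _ _ "{a, b}"] split: if_splits)
  have ne: "u \<noteq> v" "v \<noteq> w" "u \<noteq> w" using e d(3) by blast+
  have V: "{u, v, w} \<subseteq> verts G" using e d(1,2) by blast
  have no_loop: "{a} \<notin> edges G" for a using d(3)[of a a] by auto
  define f where "f i = (if i = 0 then u else if i = 1 then v else w)" for i :: nat
  have three: "{..<3} = {0, 1, 2::nat}" by auto
  have "isomorphic (cycle_graph 3) (induced_subgraph G {u, v, w})"
    unfolding isomorphic_def
  proof (intro exI[of _ f] conjI ballI)
    show "bij_betw f (verts (cycle_graph 3)) (verts (induced_subgraph G {u, v, w}))"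
      using ne unfolding bij_betw_def inj_on_def f_def cycle_graph_def induced_subgraph_def by (auto simp: three)
  next
    fix i j assume "i \<in> verts (cycle_graph 3)" "j \<in> verts (cycle_graph 3)"
    then have ij: "i = 0 \<or> i = 1 \<or> i = 2" "j = 0 \<or> j = 1 \<or> j = 2"
      unfolding cycle_graph_def by auto
    have mod3: "Suc 0 mod 3 = 1" "Suc 1 mod 3 = 2" "Suc 2 mod 3 = 0" by simp_all
    have E: "edges (cycle_graph 3) = {{0, 1}, {1, 2}, {2, 0}}"
    proof -
      have "edges (cycle_graph 3) = (\<lambda>i. {i, Suc i mod 3}) ` {..<3}" unfolding cycle_graph_def by auto
      then show ?thesis
        unfolding three image_insert image_empty using mod3 by (simp only:)
    qed
    have "{i, j} \<in> edges (cycle_graph 3) \<longleftrightarrow> i \<noteq> j"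
      unfolding E using ij by (elim disjE) (simp_all add: doubleton_eq_iff)
    moreover have "{f i, f j} \<in> edges (induced_subgraph G {u, v, w}) \<longleftrightarrow> i \<noteq> j"
      using ij e no_loop unfolding induced_subgraph_def f_def
      by (elim disjE) (simp_all add: insert_commute)
    ultimately show "{i, j} \<in> edges (cycle_graph 3) \<longleftrightarrow> {f i, f j} \<in> edges (induced_subgraph G {u, v, w})" by simp
  qed
  then show False using h V unfolding H_free_def by blast
qed

text \<open>
  The vertices of the list are distinct because two vertices of a path on seven vertices never have
  the same neighbours.
\<close>

lemma path7_free_edges:
  assumes s: "simple_graph G" and h: "H_free {path_graph 7, cycle_graph 3} G"
    and p: "length p = 7" and pe: "\<And>i j. i < 7 \<Longrightarrow> j < 7 \<Longrightarrow> {p ! i, p ! j} \<in> edges G \<longleftrightarrow> i = Suc j \<or> j = Suc i"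
  shows False
proof -
  have "p ! i \<noteq> p ! j" if "i < j" "j < 7" for i j
  proof
    assume eq: "p ! i = p ! j"
    have "k = Suc i \<or> i = Suc k \<longleftrightarrow> k = Suc j \<or> j = Suc k" if "k < 7" for k
      using pe[of i k] pe[of j k] that \<open>i < j\<close> \<open>j < 7\<close> eq by auto
    from this[of "Suc j"] this[of 5] this[of 3] that show False
      by (cases "j < 6"; cases "i = 4") auto
  qed
  then have inj: "inj_on ((!) p) {..<7}" unfolding inj_on_def by (metis lessThan_iff linorder_neqE_nat)
  have V: "set p \<subseteq> verts G"
  proof
    fix x assume "x \<in> set p"
    then obtain i where i: "i < 7" "p ! i = x" using p unfolding in_set_conv_nth by metis
    have "{p ! i, p ! (if i = 0 then 1 else i - 1)} \<in> edges G"
      using pe[of i "if i = 0 then 1 else i - 1"] i(1) by auto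
    then show "x \<in> verts G" using s i(2) unfolding simple_graph_def by blast
  qed
  have E: "{i, j} \<in> edges (path_graph 7) \<longleftrightarrow> i = Suc j \<or> j = Suc i" if "i < 7" "j < 7" for i j
    using that unfolding path_graph_def by (auto simp: doubleton_eq_iff)
  have "isomorphic (path_graph 7) (induced_subgraph G (set p))"
    unfolding isomorphic_def
  proof (intro exI[of _ "(!) p"] conjI ballI)
    have "(!) p ` {..<7} = set p" using p unfolding set_conv_nth by auto
    then show "bij_betw ((!) p) (verts (path_graph 7)) (verts (induced_subgraph G (set p)))"
      using inj unfolding bij_betw_def path_graph_def induced_subgraph_def by simp
  next
    fix i j assume "i \<in> verts (path_graph 7)" "j \<in> verts (path_graph 7)"
    then have ij: "i < 7" "j < 7" unfolding path_graph_def by simp_all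
    then have "{p ! i, p ! j} \<subseteq> set p" using p by simp
    then show "{i, j} \<in> edges (path_graph 7) \<longleftrightarrow> {p ! i, p ! j} \<in> edges (induced_subgraph G (set p))"
      unfolding E[OF ij] induced_subgraph_def using pe[OF ij] by simp
  qed
  then show False using h V unfolding H_free_def by blast
qed

lemma (in p7_graph) proper_iff_three_coloring:
  assumes "\<And>u v. E u v \<longleftrightarrow> {u, v} \<in> edges G" "V = verts G"
  shows "proper f \<Longrightarrow> three_coloring G (\<lambda>v. f v + 1)"
    and "three_coloring G g \<Longrightarrow> \<exists>f. proper f"
proof -
  have E: "E u v \<longleftrightarrow> u \<in> verts G \<and> v \<in> verts G \<and> {u, v} \<in> edges G" for u v
    using assms dom sym by blast
  show "three_coloring G (\<lambda>v. f v + 1)" if f: "proper f"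
  proof -
    have f3: "f v < 3" if "v \<in> verts G" for v using f[unfolded proper_def] that unfolding assms(2)[symmetric] by blast
    have fE: "f u \<noteq> f v" if "E u v" for u v using f that unfolding proper_def by blast
    have "f v + 1 \<in> {1, 2, 3}" if "v \<in> verts G" for v
    proof -
      have "f v = 0 \<or> f v = 1 \<or> f v = 2" using f3[OF that] by linarith
      then show ?thesis by (elim disjE) simp_all
    qed
    moreover have "f v + 1 \<noteq> f w + 1" if "v \<in> verts G" "w \<in> verts G" "{v, w} \<in> edges G" for v w
      using fE[of v w] that assms(1)[of v w] by simp
    ultimately show ?thesis unfolding three_coloring_def coloring_def by (simp add: image_subset_iff)
  qed
  show "\<exists>f. proper f" if g: "three_coloring G g"
  proof
    show "proper (\<lambda>v. g v - 1)"
      unfolding proper_def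
    proof (intro conjI ballI allI impI)
      have g3: "g v = 1 \<or> g v = 2 \<or> g v = 3" if "v \<in> V" for v
        using g that unfolding three_coloring_def assms(2) by blast
      show "g v - 1 < 3" if "v \<in> V" for v using g3[OF that] by auto
      show "g u - 1 \<noteq> g v - 1" if "E u v" for u v
      proof -
        have "g u \<noteq> g v" using g that E unfolding three_coloring_def coloring_def by blast
        then show ?thesis using g3[OF dom[OF that]] g3[OF dom[OF sym[OF that]]] by auto
      qed
    qed
  qed
qed

text \<open>
  Constant factors are absorbed by powers of \<open>n + 2\<close>, which is at least two.
\<close>

lemma wordsize:
  fixes n m :: nat
  assumes m: "m \<le> n * n"
  shows "(n + 2 * m + 10) * (21 + 2 * n) \<le> (n + 2) ^ 12" "10 * n ^ 5 + 10 < (n + 2) ^ 12" "n < (n + 2) ^ 12" "m < (n + 2) ^ 12"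
    "n + 2 * m + 10 < (n + 2) ^ 12"
proof -
  let ?a = "n + 2"
  have 2: "2 \<le> ?a" by simp
  have p: "2 ^ k * ?a ^ j \<le> ?a ^ (k + j)" for k j
    unfolding power_add by (intro mult_le_mono1 power_mono 2) simp
  have nn: "n * n \<le> ?a ^ 2" "n \<le> ?a ^ 2" "1 \<le> ?a ^ 2" by (simp_all add: power2_eq_square)
  have "n + 2 * m + 10 \<le> 2 ^ 4 * ?a ^ 2"
  proof -
    have "4 \<le> ?a ^ 2" by (simp add: power2_eq_square)
    then show ?thesis using m nn by (simp add: power2_eq_square)
  qed
  also have "\<dots> \<le> ?a ^ 6" using p[of 4 2] by simp
  finally have K: "n + 2 * m + 10 \<le> ?a ^ 6" .
  have "21 + 2 * n \<le> 2 ^ 4 * ?a ^ 1" by simp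
  also have "\<dots> \<le> ?a ^ 5" using p[of 4 1] by simp
  finally have J: "21 + 2 * n \<le> ?a ^ 5" .
  have lt: "?a ^ 11 < ?a ^ 12" by (rule power_strict_increasing) simp_all
  have "(n + 2 * m + 10) * (21 + 2 * n) \<le> ?a ^ 6 * ?a ^ 5" by (rule mult_le_mono[OF K J])
  also have "\<dots> = ?a ^ 11" by (simp flip: power_add)
  finally have le: "(n + 2 * m + 10) * (21 + 2 * n) \<le> ?a ^ 11" .
  then show "(n + 2 * m + 10) * (21 + 2 * n) \<le> ?a ^ 12" using lt by linarith
  have "(n + 2 * m + 10) * 1 \<le> (n + 2 * m + 10) * (21 + 2 * n)" by (rule mult_le_mono2) simp
  then have "n + 2 * m + 10 \<le> ?a ^ 11" using le unfolding mult_1_right by (rule order_trans)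
  then have "n + 2 * m + 10 < ?a ^ 12" using lt by (rule le_less_trans)
  then show "n + 2 * m + 10 < ?a ^ 12" "n < ?a ^ 12" "m < ?a ^ 12" by linarith+
  have "n ^ 5 \<le> ?a ^ 5" by (rule power_mono) simp_all
  moreover have "1 \<le> ?a ^ 5" by simp
  moreover have "10 * x + 10 \<le> 2 ^ 5 * y" if "x \<le> y" "1 \<le> y" for x y :: nat using that by simp
  ultimately have "10 * n ^ 5 + 10 \<le> 2 ^ 5 * ?a ^ 5" by blast
  also have "\<dots> \<le> ?a ^ 10" using p[of 5 5] by simp
  also have "\<dots> < ?a ^ 12" by (rule power_strict_increasing) simp_all
  finally show "10 * n ^ 5 + 10 < ?a ^ 12" .
qed

lemma exec_PRELUDE:
  assumes "s = initial_state xs" "mem s 0 = n" "mem s 1 = m" and M: "1 < M" "n + 2 * m + 10 < M"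
  shows "\<exists>s'. exec M PRELUDE s 5 s' \<and> mem s' = mem s \<and> reg s' = (\<lambda>_. 0)(0 := n, 2 := m, 1 := n + 2 * m + 10)"
proof -
  let ?s1 = "s\<lparr>reg := (reg s)(0 := n)\<rparr>" let ?s2 = "?s1\<lparr>reg := (reg ?s1)(2 := m)\<rparr>"
  let ?s3 = "?s2\<lparr>reg := (reg ?s2)(1 := m + m)\<rparr>" let ?s4 = "?s3\<lparr>reg := (reg ?s3)(1 := m + m + n)\<rparr>"
  let ?s5 = "?s4\<lparr>reg := (reg ?s4)(1 := m + m + n + 10)\<rparr>"
  have 1: "exec M (Load 0 (Const 0)) s 1 ?s1" using exec.Load[of s "Const 0" M 0] assms by simp
  have 2: "exec M (Load 2 (Const 1)) ?s1 1 ?s2" using exec.Load[of ?s1 "Const 1" M 2] assms by simp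
  have 3: "exec M (Arith 1 Plus (Reg 2) (Reg 2)) ?s2 1 ?s3"
    using exec.Arith[of Plus ?s2 "Reg 2" "Reg 2" M 1] M by simp
  have 4: "exec M (Arith 1 Plus (Reg 1) (Reg 0)) ?s3 1 ?s4"
    using exec.Arith[of Plus ?s3 "Reg 1" "Reg 0" M 1] M by simp
  have 5: "exec M (Arith 1 Plus (Reg 1) (Const 10)) ?s4 1 ?s5"
    using exec.Arith[of Plus ?s4 "Reg 1" "Const 10" M 1] M by simp
  have "exec M PRELUDE s (1 + (1 + (1 + (1 + 1)))) ?s5"
    unfolding PRELUDE_def by (intro exec.Seq[OF 1] exec.Seq[OF 2] exec.Seq[OF 3] exec.Seq[OF 4] 5)
  moreover have "reg ?s5 = (\<lambda>_. 0)(0 := n, 2 := m, 1 := n + 2 * m + 10)"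
    using assms(1) unfolding initial_state_def by (auto simp: fun_eq_iff)
  ultimately show ?thesis by (intro exI[of _ ?s5]) (simp add: eval_nat_numeral)
qed

lemma solver_time:
  fixes n m :: nat
  assumes "K = n + 2 * m + 10" "m \<le> n * n"
  shows "5 + (200 * K + n ^ 5 * (17000 * K)) \<le> 300000 * (n ^ 5 * (n + m) + 1)"
proof (cases "n = 0")
  case True
  then show ?thesis using assms by simp
next
  case False
  then have 1: "1 * (n + m) \<le> n ^ 5 * (n + m)" by (intro mult_le_mono1) simp
  have 2: "n ^ 5 * 1 \<le> n ^ 5 * (n + m)" using False by (intro mult_le_mono2) simp
  have 3: "n ^ 5 * m \<le> n ^ 5 * (n + m)" by (rule mult_le_mono2) simp
  have 4: "n ^ 5 * (17000 * K) = 17000 * (n ^ 5 * (n + m)) + 17000 * (n ^ 5 * m) + 170000 * n ^ 5"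
    unfolding assms(1) by (simp add: algebra_simps)
  have key: "5 + (200 * (n + 2 * m + 10) + (17000 * P + 17000 * Q + 170000 * R)) \<le> 300000 * (P + 1)"
    if "1 * (n + m) \<le> P" "R * 1 \<le> P" "Q \<le> P" for P Q R using that by simp
  show ?thesis unfolding 4 unfolding assms(1) by (rule key[OF 1 2 3])
qed

text \<open>
  At most \<open>n^2\<close> edges fit, so the memory of \<open>K * J\<close> cells is polynomial in \<open>n\<close>.
\<close>

theorem solver_correct:
  assumes s: "simple_graph G" and h: "H_free {path_graph 7, cycle_graph 3} G" and x: "encodes xs G"
    and n: "n = card (verts G)" and m: "m = card (edges G)"
  shows "\<exists>t s. exec ((n + 2) ^ 12) SOLVER (initial_state xs) t s \<and> t \<le> 300000 * (n ^ 5 * (n + m) + 1) \<and>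
    mem s 0 = (if \<exists>f. three_coloring G f then 1 else 0) \<and>
    ((\<exists>f. three_coloring G f) \<longrightarrow> three_coloring G (\<lambda>v. mem s (Suc v)))"
proof -
  obtain n' es where V': "verts G = {..<n'}" and es: "edges G = set (map (\<lambda>(u, v). {u, v}) es)"
    "distinct (map (\<lambda>(u, v). {u, v}) es)" and xs': "xs = n' # length es # concat (map (\<lambda>(u, v). [u, v]) es)"
    using x unfolding encodes_def by blast
  have n': "n' = n" using n V' by simp
  have m': "length es = m" unfolding m es(1) distinct_card[OF es(2)] by simp
  note V = V'[unfolded n'] and xs = xs'[unfolded n' m']
  have len: "length xs = 2 * m + 2" unfolding xs using length_concat_pairs[of es] m' by simp
  define eu ev where "eu i = fst (es ! i)" and "ev i = snd (es ! i)" for i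
  define E where "E u v \<longleftrightarrow> {u, v} \<in> edges G" for u v
  have dd: "a \<in> verts G" "b \<in> verts G" "a \<noteq> b" if "{a, b} \<in> edges G" for a b
    using s that unfolding simple_graph_def by (auto dest!: bspec[of _ _ "{a, b}"] split: if_splits)
  have ed: "{eu i, ev i} \<in> edges G" if "i < m" for i
  proof -
    have "es ! i \<in> set es" using that m' by simp
    then show ?thesis unfolding es(1) eu_def ev_def by (force simp: case_prod_beta)
  qed
  have E_iff: "E u v \<longleftrightarrow> (\<exists>i<m. eu i = u \<and> ev i = v \<or> eu i = v \<and> ev i = u)" for u v
  proof
    assume "E u v"
    then obtain p where p: "p \<in> set es" "{u, v} = {fst p, snd p}" unfolding E_def es(1) by (auto simp: case_prod_beta)
    then obtain i where "i < m" "es ! i = p" unfolding in_set_conv_nth m' by blast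
    then show "\<exists>i<m. eu i = u \<and> ev i = v \<or> eu i = v \<and> ev i = u"
      using p(2) unfolding eu_def ev_def doubleton_eq_iff by (intro exI[of _ i]) auto
  next
    assume "\<exists>i<m. eu i = u \<and> ev i = v \<or> eu i = v \<and> ev i = u"
    then obtain i where "i < m" "eu i = u \<and> ev i = v \<or> eu i = v \<and> ev i = u" by blast
    then show "E u v" using ed[of i] unfolding E_def by (auto simp: insert_commute)
  qed
  have eun: "eu i < n \<and> ev i < n" if "i < m" for i using dd(1,2)[OF ed[OF that]] V by simp
  have mn: "m \<le> n * n"
  proof -
    have "distinct es" using es(2) by (simp add: distinct_map)
    moreover have "set es \<subseteq> {..<n} \<times> {..<n}"
    proof
      fix p assume "p \<in> set es"
      then obtain i where "i < m" "es ! i = p" unfolding in_set_conv_nth m' by blast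
      then show "p \<in> {..<n} \<times> {..<n}" using eun[of i] unfolding eu_def ev_def by (cases p) simp
    qed
    ultimately show ?thesis
      using card_mono[of "{..<n} \<times> {..<n}" "set es"] distinct_card[of es] m' by simp
  qed
  define M K J where "M = (n + 2) ^ 12" and "K = n + 2 * m + 10" and "J = 21 + 2 * n"
  note w = wordsize[OF mn, folded M_def, folded K_def, folded J_def]
  interpret input_graph M K J E n m eu ev
  proof unfold_locales
    show "0 < K" "n + 2 * m + 10 \<le> K" "20 + 2 * n < J" unfolding K_def J_def by simp_all
    then show "1 < M" using w(5) by linarith
    show "K * J \<le> M" "10 * n ^ 5 + 10 < M" by (rule w)+
    show "finite {..<n}" by simp
    show "u \<in> {..<n}" if "E u v" for u v using dd(1) that V unfolding E_def by blast
    show "E v u" if "E u v" for u v using that unfolding E_def by (simp add: insert_commute)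
    show False if "E u v" "E v w" "E u w" for u v w
      using triangle_free_edges[OF s h] that unfolding E_def by blast
    show "E u v \<longleftrightarrow> (\<exists>i<m. eu i = u \<and> ev i = v \<or> eu i = v \<and> ev i = u)" for u v by (rule E_iff)
    show "eu i < n \<and> ev i < n" if "i < m" for i by (rule eun[OF that])
    have irr: "\<not> E a a" for a using dd(3)[of a a] unfolding E_def by blast
    have sy: "E a b \<longleftrightarrow> E b a" for a b unfolding E_def by (simp add: insert_commute)
    show False if p: "E a b" "E b c" "E c d" "E d e" "E e f" "E f g" "\<not> E a c" "\<not> E a d" "\<not> E a e" "\<not> E a f" "\<not> E a g"
      "\<not> E b d" "\<not> E b e" "\<not> E b f" "\<not> E b g" "\<not> E c e" "\<not> E c f" "\<not> E c g" "\<not> E d f" "\<not> E d g" "\<not> E e g"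
      for a b c d e f g
    proof (rule path7_free_edges[OF s h, of "[a, b, c, d, e, f, g]"])
      have q: "E b a" "E c b" "E d c" "E e d" "E f e" "E g f" "\<not> E c a" "\<not> E d a" "\<not> E e a" "\<not> E f a" "\<not> E g a"
        "\<not> E d b" "\<not> E e b" "\<not> E f b" "\<not> E g b" "\<not> E e c" "\<not> E f c" "\<not> E g c" "\<not> E f d" "\<not> E g d" "\<not> E g e"
        using p sy by blast+
      fix i j :: nat assume ij: "i < 7" "j < 7"
      have seven: "k = 0 \<or> k = 1 \<or> k = 2 \<or> k = 3 \<or> k = 4 \<or> k = 5 \<or> k = 6" if "k < 7" for k :: nat using that by linarith
      show "{[a, b, c, d, e, f, g] ! i, [a, b, c, d, e, f, g] ! j} \<in> edges G \<longleftrightarrow> i = Suc j \<or> j = Suc i"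
        unfolding E_def[symmetric]
        using seven[OF ij(1)] by (elim disjE; insert seven[OF ij(2)]; elim disjE) (simp_all add: p q irr)
    qed simp
  qed
  let ?s = "initial_state xs"
  have mem0: "mem ?s i = (if i < 2 * m + 2 then xs ! i else 0)" for i unfolding initial_state_def len by simp
  have small_mem: "mem ?s i < M" for i
  proof (cases "i < 2 * m + 2")
    case True
    then have "xs ! i \<in> set xs" using len by simp
    moreover have "\<forall>z\<in>set xs. z < M"
    proof -
      have "z < n" if "z \<in> fst ` set es \<union> snd ` set es" for z
      proof -
        from that obtain p where "p \<in> set es" "z = fst p \<or> z = snd p" by blast
        then obtain i where "i < m" "z = eu i \<or> z = ev i" unfolding in_set_conv_nth m' eu_def ev_def by blast
        then show ?thesis using eun[of i] by auto
      qed
      then have "z < M" if "z \<in> fst ` set es \<union> snd ` set es" for z using w(3) that by (meson less_trans)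
      then show ?thesis unfolding xs using w(3,4) set_concat_pairs[of es] by simp
    qed
    ultimately show ?thesis unfolding mem0 using True by simp
  next
    case False
    then show ?thesis unfolding mem0 using w(3) by simp
  qed
  have m01: "mem ?s 0 = n" "mem ?s 1 = m" unfolding mem0 unfolding xs by simp_all
  from exec_PRELUDE[OF refl m01 M] w(5)[folded K_def] obtain s1 where
    1: "exec M PRELUDE ?s 5 s1" "mem s1 = mem ?s" "reg s1 = (\<lambda>_. 0)(0 := n, 2 := m, 1 := K)"
    unfolding K_def by blast
  let ?e = "\<lambda>v. reg s1 (2 * v)" let ?A = "\<lambda>j i. mem s1 (K * j + i)"
  have rep: "rep s1 ?e ?A"
    unfolding rep_def using 1(3) w(3-5)[folded K_def] small_mem 1(2) M by (auto simp: K_def)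
  have e01: "?e 0 = n" "?e 1 = m" using 1(3) by simp_all
  have inp: "inputs ?A"
    unfolding inputs_def
  proof (intro allI impI)
    fix i assume i: "i < m"
    have "xs ! (2 + 2 * i) = eu i" "xs ! (3 + 2 * i) = ev i"
      unfolding xs eu_def ev_def using concat_pairs[of i es] i m' by (simp_all add: numeral_3_eq_3)
    then show "?A 0 (2 + 2 * i) = eu i \<and> ?A 0 (3 + 2 * i) = ev i" unfolding 1(2) using i by (simp add: mem0)
  qed
  have zero: "?A j i = 0" if "1 \<le> j" "i < K" for j i
  proof -
    have "K * 1 \<le> K * j" using that(1) by (rule mult_le_mono2)
    moreover have "2 * m + 2 \<le> K" unfolding K_def by simp
    ultimately have "\<not> K * j + i < 2 * m + 2" by linarith
    then show ?thesis unfolding 1(2) mem0 by simp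
  qed
  from wp_sound[OF wp_program[OF e01 inp zero, of 0] rep] obtain t s2 e2 A2 where
    2: "exec M (cc (BUILD ;; MAIN ;; OUTPUT)) s1 t s2" "rep s2 e2 A2" "0 + t \<le> 0 + 200 * K + n ^ 5 * (17000 * K)"
      "A2 0 0 = 1 \<and> good_on {..<n} (\<lambda>v. A2 0 (Suc v)) \<or> A2 0 0 = 0 \<and> colourless" by blast
  have mem2: "mem s2 i = A2 0 i" if "i < K" for i
  proof -
    have "mem s2 (K * 0 + i) = A2 0 i" using 2(2) that unfolding rep_def by blast
    then show ?thesis by simp
  qed
  have out: "if \<exists>f. three_coloring G f then mem s2 0 = 1 \<and> three_coloring G (\<lambda>v. mem s2 (Suc v)) else mem s2 0 = 0"
  proof (cases "A2 0 0 = 1")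
    case True
    then have g: "good_on {..<n} (\<lambda>v. A2 0 (Suc v))" using 2(4) by auto
    have c: "mem s2 (Suc v) = A2 0 (Suc v)" if "v < n" for v by (rule mem2) (use that in \<open>simp add: K_def\<close>)
    have "mem s2 (Suc v) \<in> {1, 2, 3}" if "v < n" for v using g that c[OF that] unfolding good_on_def by simp
    moreover have "mem s2 (Suc v) \<noteq> mem s2 (Suc u)" if "v < n" "u < n" "{v, u} \<in> edges G" for u v
      using g that c[OF that(1)] c[OF that(2)] unfolding good_on_def E_def by simp
    ultimately have "three_coloring G (\<lambda>v. mem s2 (Suc v))"
      unfolding three_coloring_def coloring_def V by fastforce
    then show ?thesis using True mem2[of 0] K by auto
  next
    case False
    then have "A2 0 0 = 0" "colourless" using 2(4) by auto
    moreover have "\<not> three_coloring G f" for f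
      using proper_iff_three_coloring(2)[of G f] V \<open>colourless\<close> unfolding E_def colourless_def by auto
    ultimately show ?thesis using mem2[of 0] K by simp
  qed
  have "exec M SOLVER ?s (5 + t) s2" unfolding SOLVER_def by (rule exec.Seq[OF 1(1) 2(1)])
  moreover have "5 + t \<le> 300000 * (n ^ 5 * (n + m) + 1)"
    using solver_time[OF K_def mn] 2(3) by linarith
  ultimately show ?thesis using out unfolding M_def by (intro exI[of _ "5 + t"] exI[of _ s2]) (simp split: if_splits)
qed

theorem theorem1p3:
  "\<exists>(p :: program) (k :: nat) (C :: nat). \<forall>(G :: nat graph) (xs :: nat list).
     simple_graph G \<longrightarrow> H_free {path_graph 7, cycle_graph 3} G \<longrightarrow> encodes xs G \<longrightarrow>
     (let n = card (verts G); m = card (edges G) in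
      \<exists>t s. exec ((n + 2) ^ k) p (initial_state xs) t s \<and>
            t \<le> C * (n ^ 5 * (n + m) + 1) \<and>
            mem s 0 = (if \<exists>f. three_coloring G f then 1 else 0) \<and>
            ((\<exists>f. three_coloring G f) \<longrightarrow> three_coloring G (\<lambda>v. mem s (Suc v))))"
proof (rule exI[of _ SOLVER], rule exI[of _ 12], rule exI[of _ 300000], intro allI impI)
  fix G :: "nat graph" and xs :: "nat list"
  assume "simple_graph G" "H_free {path_graph 7, cycle_graph 3} G" "encodes xs G"
  from solver_correct[OF this refl refl]
  show "let n = card (verts G); m = card (edges G) in
      \<exists>t s. exec ((n + 2) ^ 12) SOLVER (initial_state xs) t s \<and>
            t \<le> 300000 * (n ^ 5 * (n + m) + 1) \<and>
            mem s 0 = (if \<exists>f. three_coloring G f then 1 else 0) \<and>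
            ((\<exists>f. three_coloring G f) \<longrightarrow> three_coloring G (\<lambda>v. mem s (Suc v)))"
    unfolding Let_def .
qed

end
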